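(* Let $m\ge 1$ be an integer, let $\Gamma_b$ and $\Gamma_i$ be of class $C^{m+2}$, and let $\{\mathcal T_h\}_{h\le h_0}$ be a quasi-uniform family of interface-fitted curved meshes as described in the context, with $h_0$ sufficiently small. Then there exists a constant $C$, independent of $h$, such that for every integer $0\le k\le m+1$, $$|\Pi_h u-u|_{k,\mathcal T_h}\le C\,h^{m+1-k}\,\|u\|_{m+1,\Omega},\qquad u\in H^{m+1}(\Omega),$$ where $|w|_{k,\mathcal T_h}^2:=\sum_{K\in\mathcal T_h}|w|_{k,K}^2$.
   Context: Geometry. $\Omega\subset\mathbb R^2$ is a bounded domain with smooth boundary $\Gamma_b$; $\Gamma_i\subset\Omega$ is a smooth curve separating $\Omega$ into disjoint open subdomains $\Omega^\pm$, $\Omega=\Omega^-\cup\Gamma_i\cup\Omega^+$. Each $\Gamma\in\{\Gamma_b,\Gamma_i\}$ has a regular parameterization $\mathbf g:[\xi_s,\xi_e]\to\mathbb R^2$ (depending on $\Gamma$) of class at least $C^2$. Put $\boldsymbol\tau=\mathbf g'/\|\mathbf g'\|$, $\mathbf n=Q\boldsymbol\tau$ with $Q=\begin{bmatrix}0&1\\-1&0\end{bmatrix}$, $\kappa=(\mathbf g')^TQ\mathbf g''/\|\mathbf g'\|^3$. The Frenet transformation is $P_\Gamma(\eta,\xi)=\mathbf g(\xi)+\eta\,\mathbf n(\xi)$, and $N_\Gamma(\epsilon)=P_\Gamma([-\epsilon,\epsilon]\times[\xi_s,\xi_e])$. Let $\epsilon_0>0$ be such that for $0<\epsilon\le\epsilon_0$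 and both curves: $P_\Gamma$ is a bijection onto $N_\Gamma(\epsilon)$ with inverse $R_\Gamma(x,y)=(\eta(x,y),\xi(x,y))$ (for a closed curve, modulo identification of $\xi_s$ and $\xi_e$, $\xi$ being taken as a continuous branch on each element); $\tfrac12\le1+\eta\kappa(\xi)\le2$; $|\det DP_\Gamma|,|\det DR_\Gamma|$ lie between positive constants and $\|DP_\Gamma\|,\|DR_\Gamma\|$ are bounded; and $N_{\Gamma_b}(\epsilon)\cap N_{\Gamma_i}(\epsilon)=\emptyset$. Meshes. Start from shape-regular straight-sided triangulations $\overline{\mathcal T}_h$ associated with $\Omega$. An edge fits a curve if both its endpoints lie on the curve. The mesh is interface-fitted: no element is cut by $\Gamma_i$ without having an edge fitted to $\Gamma_i$. Elements with a designated edge fitted to $\Gamma_b$ or $\Gamma_i$ are replaced by curved triangles $K$ in which that straight edge is replaced by the corresponding arc of the curve; these curved triangles form $\mathcal T_h^c$. The remaining straight triangles form $\mathcal T_h^r$, and $\mathcal T_h=\mathcal T_h^c\cup\mathcal T_h^r$. With $h_K=\operatorname{diam}K$, $h=\max_Kh_K$, and $\rho_K$ the supremum of radii of balls contained in $K$, we assume $h_K/\rho_K\le C_{\mathrm{sh}}$ uniformly. Quasi-uniform means $h\le C h_K$ for all $K\in\mathcal T_h$ uniformly. The curve $\Gamma$ associated with $K\in\mathcal T_h^c$ is the one to which its curved edge belongs; for some fixed $\epsilon\in(0,\epsilon_0]$ and all $h\le h_0$, each $K\in\mathcal T_h^c$ lies in $N_\Gamma(\epsilon)$ of its associated curve. Fictitious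 elements. For $K\in\mathcal T_h^c$ let $\xi_m(K),\xi_M(K)$ be the minimum and maximum of $\xi$ on $K$, $\widehat K_F=[-h_K,h_K]\times[\xi_m(K),\xi_M(K)]$, $K_F=P_\Gamma(\widehat K_F)\supset K$. The line $\eta=0$ divides $\widehat K_F$ into two half-rectangles $\widehat K_F^\pm$, with $K_F^\pm=P_\Gamma(\widehat K_F^\pm)$. Let $\Omega_K$ be the physical subdomain containing $K$ ($\Omega^-$ or $\Omega^+$ for an interface-fitted element; the domain on the interior side of $\Gamma_b$ for a boundary element), and let $s_K\in\{+,-\}$ be such that $K\subset K_F^{s_K}\subset\Omega_K$ (up to closure). Projection. $\mathbb P_m$ denotes polynomials of total degree at most $m$. For $K\in\mathcal T_h^c$, let $\widehat\Pi_{\widehat K_F^{s_K}}$ be the $L^2(\widehat K_F^{s_K})$-orthogonal projection onto $\mathbb P_m(\widehat K_F^{s_K})$ (polynomials in $(\eta,\xi)$), and $\Pi_Ku:=\big[\big(\widehat\Pi_{\widehat K_F^{s_K}}(u\circ P_\Gamma)\big)\circ R_\Gamma\big]\big|_K$. For $K\in\mathcal T_h^r$, $\Pi_K$ is the $L^2(K)$ projection onto $\mathbb P_m(K)$. $\Pi_h$ is defined by $(\Pi_hu)|_K=\Pi_Ku$. $\|\cdot\|_{k,D}$ and $|\cdot|_{k,D}$ are the $H^k(D)$ norm and seminorm. *)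

theory Defs
  imports "HOL-Analysis.Analysis"
begin

type_synonym plane = "real^2"

section \<open>Sobolev spaces on open subsets of the plane\<close>

definition partial_deriv :: "2 \<Rightarrow> (plane \<Rightarrow> real) \<Rightarrow> plane \<Rightarrow> real" where
  "partial_deriv i f x = frechet_derivative f (at x) (axis i 1)"

definition multi_deriv :: "nat \<Rightarrow> nat \<Rightarrow> (plane \<Rightarrow> real) \<Rightarrow> plane \<Rightarrow> real" where
  "multi_deriv i j f = (partial_deriv 1 ^^ i) ((partial_deriv 2 ^^ j) f)"

primrec of_class :: "nat \<Rightarrow> (plane \<Rightarrow> real) \<Rightarrow> bool" where
  "of_class 0 f \<longleftrightarrow> continuous_on UNIV f"
| "of_class (Suc k) f \<longleftrightarrow> f differentiable_on UNIV \<and> (\<forall>i. of_class k (partial_deriv i f))"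

definition test_function :: "plane set \<Rightarrow> (plane \<Rightarrow> real) \<Rightarrow> bool" where
  "test_function U \<phi> \<longleftrightarrow> (\<forall>k. of_class k \<phi>) \<and>
     compact (closure {x. \<phi> x \<noteq> 0}) \<and> closure {x. \<phi> x \<noteq> 0} \<subseteq> U"

definition locally_integrable :: "plane set \<Rightarrow> (plane \<Rightarrow> real) \<Rightarrow> bool" where
  "locally_integrable U u \<longleftrightarrow> (\<forall>S. compact S \<and> S \<subseteq> U \<longrightarrow> integrable (lebesgue_on S) u)"

definition has_weak_deriv ::
    "plane set \<Rightarrow> nat \<Rightarrow> nat \<Rightarrow> (plane \<Rightarrow> real) \<Rightarrow> (plane \<Rightarrow> real) \<Rightarrow> bool" where
  "has_weak_deriv U i j u v \<longleftrightarrow> locally_integrable U u \<and> locally_integrable U v \<and>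
     (\<forall>\<phi>. test_function U \<phi> \<longrightarrow>
        (LINT x|lebesgue_on U. u x * multi_deriv i j \<phi> x)
          = (-1) ^ (i + j) * (LINT x|lebesgue_on U. v x * \<phi> x))"

definition weak_deriv :: "plane set \<Rightarrow> nat \<Rightarrow> nat \<Rightarrow> (plane \<Rightarrow> real) \<Rightarrow> plane \<Rightarrow> real" where
  "weak_deriv U i j u = (SOME v. has_weak_deriv U i j u v)"

definition in_L2 :: "plane set \<Rightarrow> (plane \<Rightarrow> real) \<Rightarrow> bool" where
  "in_L2 U u \<longleftrightarrow> u \<in> borel_measurable (lebesgue_on U) \<and>
     integrable (lebesgue_on U) (\<lambda>x. (u x)\<^sup>2)"

definition in_sobolev :: "nat \<Rightarrow> plane set \<Rightarrow> (plane \<Rightarrow> real) \<Rightarrow> bool" where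
  "in_sobolev k U u \<longleftrightarrow> in_L2 U u \<and>
     (\<forall>i j. i + j \<le> k \<longrightarrow> (\<exists>v. has_weak_deriv U i j u v \<and> in_L2 U v))"

text \<open>The weak derivatives are unique almost everywhere, so the seminorm does not depend on
  the choice made in \<^const>\<open>weak_deriv\<close>. It is meaningful for members of the Sobolev
  space of order \<open>k\<close> only.\<close>

definition sobolev_seminorm :: "nat \<Rightarrow> plane set \<Rightarrow> (plane \<Rightarrow> real) \<Rightarrow> real" where
  "sobolev_seminorm k U u =
     sqrt (\<Sum>i\<le>k. LINT x|lebesgue_on U. (weak_deriv U i (k - i) u x)\<^sup>2)"

definition sobolev_norm :: "nat \<Rightarrow> plane set \<Rightarrow> (plane \<Rightarrow> real) \<Rightarrow> real" where
  "sobolev_norm k U u = sqrt (\<Sum>j\<le>k. (sobolev_seminorm j U u)\<^sup>2)"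

section \<open>Polynomials and the orthogonal projection\<close>

definition polys :: "nat \<Rightarrow> (plane \<Rightarrow> real) set" where
  "polys m = {p. \<exists>c. p = (\<lambda>z. \<Sum>i\<le>m. \<Sum>j\<le>m - i. c i j * (z$1) ^ i * (z$2) ^ j)}"

definition L2_projection :: "nat \<Rightarrow> plane set \<Rightarrow> (plane \<Rightarrow> real) \<Rightarrow> plane \<Rightarrow> real" where
  "L2_projection m D f = (THE q. q \<in> polys m \<and>
     (\<forall>p\<in>polys m. (LINT z|lebesgue_on D. (f z - q z) * p z) = 0))"

section \<open>Closed curves and the Frenet transformation\<close>

text \<open>A closed curve is given by a parameterization on the interval from \<open>xi_s\<close> to
  \<open>xi_e\<close>, extended periodically to the real line. This expresses the identification of
  the end points, and it lets an element lie across the junction.\<close>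

record curve =
  par :: "real \<Rightarrow> plane"
  xi_s :: real
  xi_e :: real

definition vderiv :: "(real \<Rightarrow> plane) \<Rightarrow> real \<Rightarrow> plane" where
  "vderiv g t = vector_derivative g (at t)"

definition curve_class :: "nat \<Rightarrow> curve \<Rightarrow> bool" where
  "curve_class k \<Gamma> \<longleftrightarrow> (\<forall>j<k. \<forall>t. (vderiv ^^ j) (par \<Gamma>) differentiable (at t)) \<and>
     continuous_on UNIV ((vderiv ^^ k) (par \<Gamma>))"

definition regular_closed_curve :: "curve \<Rightarrow> bool" where
  "regular_closed_curve \<Gamma> \<longleftrightarrow> xi_s \<Gamma> < xi_e \<Gamma> \<and>
     (\<forall>t. par \<Gamma> (t + (xi_e \<Gamma> - xi_s \<Gamma>)) = par \<Gamma> t) \<and>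
     curve_class 2 \<Gamma> \<and> (\<forall>t. vderiv (par \<Gamma>) t \<noteq> 0)"

definition trace_of :: "curve \<Rightarrow> plane set" where
  "trace_of \<Gamma> = par \<Gamma> ` {xi_s \<Gamma>..xi_e \<Gamma>}"

definition Q :: "real^2^2" where
  "Q = vector [vector [0, 1], vector [-1, 0]]"

definition tangent :: "curve \<Rightarrow> real \<Rightarrow> plane" where
  "tangent \<Gamma> t = vderiv (par \<Gamma>) t /\<^sub>R norm (vderiv (par \<Gamma>) t)"

definition normal_vec :: "curve \<Rightarrow> real \<Rightarrow> plane" where
  "normal_vec \<Gamma> t = Q *v tangent \<Gamma> t"

definition curvature :: "curve \<Rightarrow> real \<Rightarrow> real" where
  "curvature \<Gamma> t =
     (vderiv (par \<Gamma>) t \<bullet> (Q *v vderiv (vderiv (par \<Gamma>)) t)) / norm (vderiv (par \<Gamma>) t) ^ 3"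

text \<open>Frenet coordinates \<open>(\<eta>, \<xi>)\<close> are the components 1 and 2 of the argument.\<close>

definition frenet :: "curve \<Rightarrow> plane \<Rightarrow> plane" where
  "frenet \<Gamma> z = par \<Gamma> (z$2) + (z$1) *\<^sub>R normal_vec \<Gamma> (z$2)"

definition tube :: "curve \<Rightarrow> real \<Rightarrow> plane set" where
  "tube \<Gamma> \<epsilon> = frenet \<Gamma> ` {z. \<bar>z$1\<bar> \<le> \<epsilon> \<and> z$2 \<in> {xi_s \<Gamma>..xi_e \<Gamma>}}"

text \<open>A continuous branch of the inverse Frenet transformation on a set \<open>S\<close>.\<close>

definition frenet_branch :: "curve \<Rightarrow> real \<Rightarrow> plane set \<Rightarrow> (plane \<Rightarrow> plane) \<Rightarrow> bool" where
  "frenet_branch \<Gamma> \<epsilon> S R \<longleftrightarrow> continuous_on S R \<and>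
     (\<forall>x\<in>S. \<bar>R x $ 1\<bar> \<le> \<epsilon> \<and> frenet \<Gamma> (R x) = x)"

definition bounded_diffeo_at :: "real \<Rightarrow> real \<Rightarrow> (plane \<Rightarrow> plane) \<Rightarrow> plane \<Rightarrow> bool" where
  "bounded_diffeo_at c C f x \<longleftrightarrow> f differentiable (at x) \<and>
     c \<le> \<bar>det (matrix (frechet_derivative f (at x)))\<bar> \<and>
     \<bar>det (matrix (frechet_derivative f (at x)))\<bar> \<le> C \<and>
     onorm (frechet_derivative f (at x)) \<le> C"

definition frenet_regular :: "curve \<Rightarrow> real \<Rightarrow> bool" where
  "frenet_regular \<Gamma> \<epsilon> \<longleftrightarrow>
     bij_betw (frenet \<Gamma>) {z. \<bar>z$1\<bar> \<le> \<epsilon> \<and> z$2 \<in> {xi_s \<Gamma>..<xi_e \<Gamma>}} (tube \<Gamma> \<epsilon>) \<and>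
     (\<forall>\<eta> \<xi>. \<bar>\<eta>\<bar> \<le> \<epsilon> \<longrightarrow> 1/2 \<le> 1 + \<eta> * curvature \<Gamma> \<xi> \<and> 1 + \<eta> * curvature \<Gamma> \<xi> \<le> 2) \<and>
     (\<exists>c>0. \<exists>C.
        (\<forall>z. \<bar>z$1\<bar> \<le> \<epsilon> \<longrightarrow> bounded_diffeo_at c C (frenet \<Gamma>) z) \<and>
        (\<forall>U R. open U \<and> frenet_branch \<Gamma> \<epsilon> U R \<longrightarrow> (\<forall>x\<in>U. bounded_diffeo_at c C R x)))"

section \<open>The geometry\<close>

record geometry =
  Omega :: "plane set"
  Omega_minus :: "plane set"
  Omega_plus :: "plane set"
  bdry :: curve
  iface :: curve
  eps0 :: real

definition admissible_geometry :: "geometry \<Rightarrow> bool" where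
  "admissible_geometry G \<longleftrightarrow>
     open (Omega G) \<and> connected (Omega G) \<and> bounded (Omega G) \<and> Omega G \<noteq> {} \<and>
     frontier (Omega G) = trace_of (bdry G) \<and>
     open (Omega_minus G) \<and> connected (Omega_minus G) \<and> Omega_minus G \<noteq> {} \<and>
     open (Omega_plus G) \<and> connected (Omega_plus G) \<and> Omega_plus G \<noteq> {} \<and>
     Omega_minus G \<inter> Omega_plus G = {} \<and>
     Omega_minus G \<inter> trace_of (iface G) = {} \<and> Omega_plus G \<inter> trace_of (iface G) = {} \<and>
     Omega G = Omega_minus G \<union> trace_of (iface G) \<union> Omega_plus G \<and>
     regular_closed_curve (bdry G) \<and> regular_closed_curve (iface G) \<and>
     0 < eps0 G \<and>
     (\<forall>\<epsilon>. 0 < \<epsilon> \<and> \<epsilon> \<le> eps0 G \<longrightarrow>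
        frenet_regular (bdry G) \<epsilon> \<and> frenet_regular (iface G) \<epsilon> \<and>
        tube (bdry G) \<epsilon> \<inter> tube (iface G) \<epsilon> = {})"

section \<open>Interface-fitted curved meshes\<close>

text \<open>A mesh consists of the straight-sided triangulation \<open>tris\<close>, its designated edges
  \<open>des\<close> and the curved triangles \<open>curved\<close>. For a curved triangle \<open>K\<close>, the
  straight triangle that it replaces is \<open>base_tri K\<close>, the curve that carries its curved
  edge is \<open>assoc K\<close>, a continuous branch of the inverse Frenet transformation on \<open>K\<close> is
  \<open>branch K\<close>, and \<open>side K\<close> is the sign \<open>s_K\<close>, equal to 1 or -1.\<close>

record mesh =
  tris :: "plane set set"
  des :: "plane set set"
  curved :: "plane set set"
  base_tri :: "plane set \<Rightarrow> plane set"
  assoc :: "plane set \<Rightarrow> curve"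
  branch :: "plane set \<Rightarrow> plane \<Rightarrow> plane"
  side :: "plane set \<Rightarrow> real"

definition straight :: "mesh \<Rightarrow> plane set set" where
  "straight M = {T \<in> tris M. \<not> (\<exists>E\<in>des M. E edge_of T)}"

definition elements :: "mesh \<Rightarrow> plane set set" where
  "elements M = curved M \<union> straight M"

definition fits :: "plane set \<Rightarrow> curve \<Rightarrow> bool" where
  "fits E \<Gamma> \<longleftrightarrow> {x. x extreme_point_of E} \<subseteq> trace_of \<Gamma>"

text \<open>The edge \<open>E\<close> of the triangle \<open>T\<close> is replaced by an arc of the curve with the same
  end points. Of the two arcs of a closed curve with these end points, only the short one can
  be an edge of an element of small diameter, so the arc need not be specified further.\<close>

definition curved_triangle :: "curve \<Rightarrow> plane set \<Rightarrow> plane set \<Rightarrow> plane set \<Rightarrow> bool" where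
  "curved_triangle \<Gamma> T E K \<longleftrightarrow> (\<exists>a b c \<alpha> \<beta> A S.
     \<not> collinear {a, b, c} \<and> T = convex hull {a, b, c} \<and> E = closed_segment a b \<and>
     \<alpha> < \<beta> \<and> \<beta> < \<alpha> + (xi_e \<Gamma> - xi_s \<Gamma>) \<and> par \<Gamma> \<alpha> = a \<and> par \<Gamma> \<beta> = b \<and>
     A = par \<Gamma> ` {\<alpha>..\<beta>} \<and>
     A \<inter> (closed_segment b c \<union> closed_segment c a) = {a, b} \<and>
     S = A \<union> closed_segment b c \<union> closed_segment c a \<and>
     K = S \<union> inside S)"

definition xi_min :: "mesh \<Rightarrow> plane set \<Rightarrow> real" where
  "xi_min M K = (INF x\<in>K. branch M K x $ 2)"

definition xi_max :: "mesh \<Rightarrow> plane set \<Rightarrow> real" where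
  "xi_max M K = (SUP x\<in>K. branch M K x $ 2)"

definition half_rect :: "mesh \<Rightarrow> plane set \<Rightarrow> plane set" where
  "half_rect M K = {z. \<bar>z$1\<bar> \<le> diameter K \<and> z$2 \<in> {xi_min M K..xi_max M K} \<and> 0 \<le> side M K * z$1}"

definition half_fict :: "mesh \<Rightarrow> plane set \<Rightarrow> plane set" where
  "half_fict M K = frenet (assoc M K) ` half_rect M K"

definition fitted_mesh :: "geometry \<Rightarrow> real \<Rightarrow> mesh \<Rightarrow> bool" where
  "fitted_mesh G \<epsilon> M \<longleftrightarrow>
     triangulation (tris M) \<and> (\<forall>T\<in>tris M. 2 simplex T) \<and>
     (\<forall>E\<in>des M. (\<exists>T\<in>tris M. E edge_of T) \<and> (fits E (bdry G) \<or> fits E (iface G))) \<and>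
     (\<forall>T\<in>tris M. \<forall>E\<in>des M. \<forall>E'\<in>des M. E edge_of T \<and> E' edge_of T \<longrightarrow> E = E') \<and>
     (\<forall>E. (\<exists>!T. T \<in> tris M \<and> E edge_of T) \<longrightarrow> E \<in> des M \<and> fits E (bdry G)) \<and>
     (\<forall>T\<in>tris M. interior T \<inter> trace_of (iface G) \<noteq> {} \<longrightarrow>
        (\<exists>E\<in>des M. E edge_of T \<and> fits E (iface G))) \<and>
     bij_betw (base_tri M) (curved M) (tris M - straight M) \<and>
     (\<forall>K\<in>curved M. assoc M K \<in> {bdry G, iface G} \<and>
        (\<exists>E\<in>des M. curved_triangle (assoc M K) (base_tri M K) E K) \<and>
        K \<subseteq> tube (assoc M K) \<epsilon> \<and>
        frenet_branch (assoc M K) \<epsilon> K (branch M K) \<and>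
        side M K \<in> {1, -1} \<and> K \<subseteq> half_fict M K \<and>
        (\<exists>D\<in>{Omega_minus G, Omega_plus G}. half_fict M K \<subseteq> closure D)) \<and>
     \<Union>(elements M) = closure (Omega G) \<and>
     (\<forall>K\<in>elements M. \<forall>K'\<in>elements M. K \<noteq> K' \<longrightarrow> interior K \<inter> interior K' = {})"

definition inradius :: "plane set \<Rightarrow> real" where
  "inradius K = Sup {r. 0 < r \<and> (\<exists>x. ball x r \<subseteq> K)}"

definition mesh_size :: "mesh \<Rightarrow> real" where
  "mesh_size M = Max (diameter ` elements M)"

definition quasi_uniform_family ::
    "geometry \<Rightarrow> real \<Rightarrow> real \<Rightarrow> real \<Rightarrow> real \<Rightarrow> real set \<Rightarrow> (real \<Rightarrow> mesh) \<Rightarrow> bool" where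
  "quasi_uniform_family G \<epsilon> Csh Cqu h0 H T \<longleftrightarrow> H \<subseteq> {0<..h0} \<and>
     (\<forall>h\<in>H. fitted_mesh G \<epsilon> (T h) \<and> mesh_size (T h) = h \<and>
        (\<forall>K\<in>tris (T h) \<union> elements (T h). diameter K \<le> Csh * inradius K) \<and>
        (\<forall>K\<in>elements (T h). h \<le> Cqu * diameter K))"

section \<open>The projection operator\<close>

definition Pi_elem :: "nat \<Rightarrow> mesh \<Rightarrow> plane set \<Rightarrow> (plane \<Rightarrow> real) \<Rightarrow> plane \<Rightarrow> real" where
  "Pi_elem m M K u =
     (if K \<in> curved M
      then L2_projection m (half_rect M K) (u \<circ> frenet (assoc M K)) \<circ> branch M K
      else L2_projection m K u)"

text \<open>Distinct elements have disjoint interiors. On the null set of points on element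
  boundaries the value is immaterial.\<close>

definition Pi_h :: "nat \<Rightarrow> mesh \<Rightarrow> (plane \<Rightarrow> real) \<Rightarrow> plane \<Rightarrow> real" where
  "Pi_h m M u x =
     (if \<exists>K\<in>elements M. x \<in> interior K
      then Pi_elem m M (THE K. K \<in> elements M \<and> x \<in> interior K) u x else 0)"

definition broken_seminorm :: "nat \<Rightarrow> mesh \<Rightarrow> (plane \<Rightarrow> real) \<Rightarrow> real" where
  "broken_seminorm k M w = sqrt (\<Sum>K\<in>elements M. (sobolev_seminorm k (interior K) w)\<^sup>2)"

end

theory Submission
  imports Defs "HOL-Computational_Algebra.Polynomial"
begin

text \<open>
  On a convex set that contains a ball of radius comparable to its diameter, the Poincare inequality
  yields the Bramble-Hilbert lemma, and an inverse inequality for polynomials turns it into the bound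
  for the orthogonal projection, with a constant that depends on the chunkiness only. This settles
  straight elements.

  For a curved element \<open>K\<close> the projection lives on a rectangle \<open>H\<close> in Frenet coordinates. The
  Frenet transformation \<open>P\<close> is locally bi-Lipschitz, and since \<open>K\<close> is connected the inverse branch on
  \<open>K\<close> does not jump by a period; so the \<open>\<xi>\<close>-extent of \<open>K\<close> is bounded above and below by
  multiples of \<open>h\<close>, and \<open>H\<close> is shape-regular. The bound for \<open>u \<circ> P\<close> on \<open>H\<close> is transported to
  \<open>K\<close> by \<open>P\<close> and its inverse, whose derivatives are bounded uniformly in \<open>K\<close>.

  The local bounds involve \<open>u\<close> on \<open>P(H)\<close>, which is larger than \<open>K\<close>. These sets lie in the domain, have
  diameter of order \<open>h\<close>, and belong to elements with disjoint balls of radius of order \<open>h\<close>; counting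
  areas, every point lies in a bounded number of them, so the squared bounds may be summed.
\<close>

text \<open>Weak derivatives are tested against smooth functions, but the Frenet map is only of
  class C^(m+1), so pulling a test function back by it leaves the class. Mollification therefore
  first turns weak gradients into local L2 limits of C1 gradients, for which the product and chain
  rules are pointwise computations; integration by parts turns them back at the end. The bound in
  \<open>HN\<close> covers all derivatives at once, so that constants can be fixed before the domain
  and hence serve every element. The normal costs one derivative of the curve: class m+2 gives
  Jacobian entries with m bounded derivatives, exactly what the transport of m+1 derivatives of
  \<open>u\<close> consumes. The inverse map needs no regularity theory of its own, because its
  Jacobian is a function of the inverse itself. The mesh only guarantees that the half rectangles
  are mapped into the closure of a subdomain, whereas \<open>u\<close> is Sobolev on the open
  domain. So it has to be shown that the interior of the closure of the domain is the domain again.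
  This excludes a boundary curve with the domain on both sides and uses the tubular neighbourhood of
  that curve.\<close>

section \<open>Gradients in coordinates\<close>

abbreviation has_grad :: "(plane \<Rightarrow> real) \<Rightarrow> (2 \<Rightarrow> real) \<Rightarrow> plane \<Rightarrow> bool" where
  "has_grad f a x \<equiv> (f has_derivative (\<lambda>h. \<Sum>i\<in>UNIV. a i * h $ i)) (at x)"

lemma frechet_derivative_expansion:
  fixes L :: "real^'n \<Rightarrow> real"
  assumes "linear L"
  shows "L h = (\<Sum>i\<in>UNIV. L (axis i 1) * h $ i)"
proof -
  have "L h = L (\<Sum>i\<in>UNIV. h $ i *\<^sub>R axis i 1)"
    using basis_expansion[of h] by (simp add: scalar_mult_eq_scaleR)
  also have "\<dots> = (\<Sum>i\<in>UNIV. L (axis i 1) * h $ i)"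
    by (simp add: linear_sum[OF assms] linear_cmul[OF assms] mult.commute)
  finally show ?thesis .
qed

lemma has_grad_partial_deriv:
  assumes "f differentiable (at x)"
  shows "has_grad f (\<lambda>i. partial_deriv i f x) x"
proof -
  have *: "(f has_derivative frechet_derivative f (at x)) (at x)"
    using assms frechet_derivative_works by blast
  then have lin: "linear (frechet_derivative f (at x))"
    by (rule has_derivative_linear)
  from * show ?thesis
    unfolding partial_deriv_def
    by (rule has_derivative_eq_rhs) (rule ext, rule frechet_derivative_expansion[OF lin])
qed

lemma sum_mult_axis: "(\<Sum>i\<in>UNIV. a i * axis j 1 $ i) = (a j :: real)"
  by (simp add: axis_def if_distrib sum.delta cong: if_cong)

lemma partial_deriv_eq:
  assumes "has_grad f a x"
  shows "partial_deriv i f x = a i"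
  unfolding partial_deriv_def frechet_derivative_at[OF assms, symmetric]
  by (simp add: sum_mult_axis)

lemma has_grad_const [simp]: "has_grad (\<lambda>x. c) (\<lambda>i. 0) x"
  by simp

lemma has_grad_add:
  "has_grad f a x \<Longrightarrow> has_grad g b x \<Longrightarrow> has_grad (\<lambda>x. f x + g x) (\<lambda>i. a i + b i) x"
  by (drule (1) has_derivative_add) (simp add: algebra_simps sum.distrib)

lemma has_grad_mult:
  assumes "has_grad f a x" "has_grad g b x"
  shows "has_grad (\<lambda>x. f x * g x) (\<lambda>i. f x * b i + a i * g x) x"
  by (rule has_derivative_eq_rhs[OF has_derivative_mult[OF assms]])
     (simp add: fun_eq_iff sum_distrib_left sum_distrib_right sum.distrib algebra_simps)

lemma has_grad_coord: "has_grad (\<lambda>x. x $ j) (\<lambda>i. if i = j then 1 else 0) x"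
proof -
  have "((\<lambda>x::plane. x $ j) has_derivative (\<lambda>h. h $ j)) (at x)"
    by (rule bounded_linear_imp_has_derivative, rule bounded_linear_vec_nth)
  then show ?thesis
    by (rule has_derivative_eq_rhs) (simp add: fun_eq_iff if_distrib if_distribR cong: if_cong)
qed

lemma has_grad_compose_real:
  assumes "has_grad f a x" "(\<phi> has_real_derivative d) (at (f x))"
  shows "has_grad (\<lambda>x. \<phi> (f x)) (\<lambda>i. d * a i) x"
proof -
  have "(\<phi> has_derivative (*) d) (at (f x))"
    using assms(2) by (simp add: has_field_derivative_def)
  from diff_chain_at[OF assms(1) this] show ?thesis
    by (simp add: o_def sum_distrib_left algebra_simps)
qed

lemma has_grad_compose_vec:
  assumes "\<And>j. has_grad (\<lambda>x. \<Phi> x $ j) (\<lambda>i. A i j) x" "has_grad f a (\<Phi> x)"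
  shows "has_grad (\<lambda>x. f (\<Phi> x)) (\<lambda>i. \<Sum>j\<in>UNIV. a j * A i j) x"
proof -
  have "(\<Phi> has_derivative (\<lambda>h. \<chi> j. \<Sum>i\<in>UNIV. A i j * h $ i)) (at x)"
    by (subst has_derivative_componentwise_within)
       (auto simp: Basis_vec_def inner_axis assms(1))
  from diff_chain_at[OF this assms(2)] show ?thesis
    by (simp add: o_def sum_distrib_left sum_distrib_right algebra_simps UNIV_2)
qed

section \<open>Functions of class C-k\<close>

lemma of_class_gradI:
  assumes "\<And>x. has_grad f (\<lambda>i. f' i x) x" "\<And>i. of_class k (f' i)"
  shows "of_class (Suc k) f"
proof -
  have "partial_deriv i f = f' i" for i
    using partial_deriv_eq[OF assms(1)] by auto
  moreover have "f differentiable (at x)" for x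
    using assms(1) differentiable_def by blast
  ultimately show ?thesis
    using assms(2) by (auto simp: differentiable_on_def)
qed

lemma of_class_SucD:
  assumes "of_class (Suc k) f"
  shows "has_grad f (\<lambda>i. partial_deriv i f x) x" "of_class k (partial_deriv i f)"
  using assms by (auto simp: differentiable_on_def intro: has_grad_partial_deriv)

lemma of_class_continuous: "of_class k f \<Longrightarrow> continuous_on S f"
proof (cases k)
  case (Suc n)
  assume "of_class k f"
  then have "f differentiable_on UNIV" using Suc by simp
  then show ?thesis
    using differentiable_imp_continuous_on continuous_on_subset by blast
qed (auto intro: continuous_on_subset)

lemma of_class_Suc: "of_class (Suc k) f \<Longrightarrow> of_class k f"
proof (induction k arbitrary: f)
  case 0 then show ?case by (simp add: differentiable_imp_continuous_on)
next
  case (Suc k) then show ?case by (meson of_class.simps(2))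
qed

lemma of_class_const [simp]: "of_class k (\<lambda>x. c)"
  by (induction k arbitrary: c) (simp, rule of_class_gradI[of _ "\<lambda>i x. 0"], auto)

lemma of_class_add: "of_class k f \<Longrightarrow> of_class k g \<Longrightarrow> of_class k (\<lambda>x. f x + g x)"
proof (induction k arbitrary: f g)
  case 0 then show ?case by (simp add: continuous_on_add)
next
  case (Suc k)
  show ?case
    by (rule of_class_gradI[OF has_grad_add[OF of_class_SucD(1) of_class_SucD(1)], OF Suc.prems])
       (intro Suc.IH of_class_SucD(2) Suc.prems)
qed

lemma of_class_mult: "of_class k f \<Longrightarrow> of_class k g \<Longrightarrow> of_class k (\<lambda>x. f x * g x)"
proof (induction k arbitrary: f g)
  case 0 then show ?case by (simp add: continuous_on_mult)
next
  case (Suc k)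
  show ?case
    by (rule of_class_gradI[OF has_grad_mult[OF of_class_SucD(1) of_class_SucD(1)], OF Suc.prems])
       (intro of_class_add Suc.IH of_class_SucD(2) of_class_Suc[OF Suc.prems(1)] of_class_Suc[OF Suc.prems(2)] Suc.prems)
qed

lemma of_class_cmult: "of_class k f \<Longrightarrow> of_class k (\<lambda>x. c * f x)"
  by (rule of_class_mult) auto

lemma of_class_sum: "(\<And>i. i \<in> I \<Longrightarrow> of_class k (f i)) \<Longrightarrow> of_class k (\<lambda>x. \<Sum>i\<in>I. f i x)"
  by (induction I rule: infinite_finite_induct) (auto intro: of_class_add)

lemma of_class_coord: "of_class k (\<lambda>x. x $ j)"
proof (cases k)
  case 0
  have "continuous_on UNIV (\<lambda>x::plane. x $ j)"
    by (rule continuous_on_component, rule continuous_on_id)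
  with 0 show ?thesis by (simp only: of_class.simps)
next
  case (Suc n)
  show ?thesis unfolding Suc
    by (rule of_class_gradI[of _ "\<lambda>i x. if i = j then 1 else 0"])
       (rule has_grad_coord, rule of_class_const)
qed

lemma of_class_power: "of_class k f \<Longrightarrow> of_class k (\<lambda>x. f x ^ n)"
  by (induction n) (simp_all add: of_class_mult)

lemma has_grad_affine:
  assumes "has_grad f b (a + c *\<^sub>R x)"
  shows "has_grad (\<lambda>x. f (a + c *\<^sub>R x)) (\<lambda>i. c * b i) x"
proof -
  have "((\<lambda>x. a + c *\<^sub>R x) has_derivative (\<lambda>h. c *\<^sub>R h)) (at x)"
    by (auto intro!: derivative_eq_intros)
  from diff_chain_at[OF this assms] show ?thesis
    by (simp add: o_def sum_distrib_left algebra_simps)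
qed

lemma of_class_affine: "of_class k f \<Longrightarrow> of_class k (\<lambda>x. f (a + c *\<^sub>R x))"
proof (induction k arbitrary: f)
  case 0
  have "continuous_on UNIV (\<lambda>x::plane. a + c *\<^sub>R x)"
    by (intro continuous_intros)
  with 0 show ?case
    using continuous_on_compose2[of UNIV f UNIV "\<lambda>x. a + c *\<^sub>R x"] by simp
next
  case (Suc k)
  show ?case
    by (rule of_class_gradI[OF has_grad_affine[OF of_class_SucD(1)], OF Suc.prems])
       (intro of_class_cmult Suc.IH of_class_SucD(2) Suc.prems)
qed

lemma partial_deriv_affine:
  assumes "of_class (Suc 0) f"
  shows "partial_deriv i (\<lambda>x. f (a + c *\<^sub>R x)) = (\<lambda>x. c * partial_deriv i f (a + c *\<^sub>R x))"
  by (rule ext, rule partial_deriv_eq[OF has_grad_affine[OF of_class_SucD(1)], OF assms])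

text \<open>The induction on \<open>k\<close> passes from \<open>d n\<close> to
  \<open>d (Suc n)\<close>, so the whole chain of derivatives is carried along. It is used for the
  derivatives of \<open>flat_exp\<close>.\<close>

lemma of_class_derivative_chain:
  assumes "\<And>n t. (d n has_real_derivative d (Suc n) t) (at t)"
  shows "of_class k (\<lambda>x. d n (c * x $ i + b))"
proof (induction k arbitrary: n)
  case 0
  have "continuous_on UNIV (d n)"
    by (rule DERIV_continuous_on) (rule has_field_derivative_at_within[OF assms])
  then show ?case
    by (auto intro!: continuous_intros continuous_on_compose2[of UNIV "d n"])
next
  case (Suc k)
  have "has_grad (\<lambda>x. c * x $ i + b) (\<lambda>j. c * (if j = i then 1 else 0)) x" for x
    using has_grad_add[OF has_grad_mult[OF has_grad_const has_grad_coord] has_grad_const] by simp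
  from has_grad_compose_real[OF this assms]
  have "has_grad (\<lambda>x. d n (c * x $ i + b))
     (\<lambda>j. (c * (if j = i then 1 else 0)) * d (Suc n) (c * x $ i + b)) x" for x
    by (simp add: mult.commute)
  then show ?case
    by (rule of_class_gradI) (intro of_class_cmult Suc.IH)
qed

text \<open>Two applications of the mean value theorem: in direction \<open>i\<close> to the
  increment of \<open>f\<close> along direction \<open>j\<close>, then in direction \<open>j\<close>
  to the partial derivative so obtained.\<close>

lemma mixed_difference_quotient:
  assumes f: "of_class (Suc (Suc 0)) f" and t: "t > 0"
  obtains s s' where "0 < s" "s < t" "0 < s'" "s' < t"
    "f (x + t *\<^sub>R axis i 1 + t *\<^sub>R axis j 1) - f (x + t *\<^sub>R axis i 1) - f (x + t *\<^sub>R axis j 1) + f x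
      = t * t * partial_deriv j (partial_deriv i f) (x + s *\<^sub>R axis i 1 + s' *\<^sub>R axis j 1)"
proof -
  have line: "((\<lambda>s. g (y + s *\<^sub>R axis l 1)) has_real_derivative partial_deriv l g (y + s *\<^sub>R axis l 1)) (at s)"
    if "of_class (Suc 0) g" for g y s l
  proof -
    have "((\<lambda>s. y + s *\<^sub>R axis l 1) has_derivative (\<lambda>h. h *\<^sub>R axis l 1)) (at s)"
      by (auto intro!: derivative_eq_intros)
    from diff_chain_at[OF this of_class_SucD(1)[OF that]] show ?thesis
      by (simp add: has_field_derivative_def o_def axis_def if_distrib mult.commute[of _ "partial_deriv l g _"]
          mult_commute_abs cong: if_cong)
  qed
  note f1 = of_class_Suc[OF f]
  define g where "g = (\<lambda>s. f (x + t *\<^sub>R axis j 1 + s *\<^sub>R axis i 1) - f (x + s *\<^sub>R axis i 1))"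
  have "(g has_real_derivative partial_deriv i f (x + t *\<^sub>R axis j 1 + s *\<^sub>R axis i 1)
        - partial_deriv i f (x + s *\<^sub>R axis i 1)) (at s)" for s
    unfolding g_def by (intro DERIV_diff line f1)
  from MVT2[OF t this] obtain s where s: "0 < s" "s < t" 
    "g t - g 0 = (t - 0) * (partial_deriv i f (x + t *\<^sub>R axis j 1 + s *\<^sub>R axis i 1)
        - partial_deriv i f (x + s *\<^sub>R axis i 1))" by blast
  from MVT2[OF t line[OF of_class_SucD(2)[OF f], where y="x + s *\<^sub>R axis i 1" and l=j]] obtain s' where
    s': "0 < s'" "s' < t" 
    "partial_deriv i f (x + s *\<^sub>R axis i 1 + t *\<^sub>R axis j 1) - partial_deriv i f (x + s *\<^sub>R axis i 1)
      = t * partial_deriv j (partial_deriv i f) (x + s *\<^sub>R axis i 1 + s' *\<^sub>R axis j 1)"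
    by auto
  show ?thesis
    by (rule that[OF s(1,2) s'(1,2)]) (use s(3) s'(3) in \<open>simp add: g_def algebra_simps\<close>)
qed

text \<open>The second difference is symmetric in \<open>i\<close> and \<open>j\<close>, so both
  mixed derivatives take a common value at points arbitrarily close to \<open>x\<close>; continuity
  makes them equal at \<open>x\<close>.\<close>

lemma partial_deriv_commute:
  assumes f: "of_class (Suc (Suc 0)) f"
  shows "partial_deriv i (partial_deriv j f) = partial_deriv j (partial_deriv i f)"
proof
  fix x
  define a where "a = partial_deriv i (partial_deriv j f)"
  define b where "b = partial_deriv j (partial_deriv i f)"
  have cont: "continuous (at x) a" "continuous (at x) b"
    unfolding a_def b_def
    using of_class_SucD(2)[OF of_class_SucD(2)[OF f]] by (auto simp: continuous_on_eq_continuous_at)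
  show "a x = b x"
  proof (rule ccontr)
    assume "a x \<noteq> b x"
    then have e: "\<bar>a x - b x\<bar> / 2 > 0" by auto
    obtain d where d: "d > 0" "\<And>y. dist y x < d \<Longrightarrow> dist (a y) (a x) < \<bar>a x - b x\<bar> / 2"
      using cont(1) e unfolding continuous_at_eps_delta by metis
    obtain d' where d': "d' > 0" "\<And>y. dist y x < d' \<Longrightarrow> dist (b y) (b x) < \<bar>a x - b x\<bar> / 2"
      using cont(2) e unfolding continuous_at_eps_delta by metis
    \<comment> \<open>The intermediate points are displaced by less than \<open>t\<close> in each of
      two directions, hence by less than \<open>2 * t\<close>, which must not exceed
      \<open>d\<close> or \<open>d'\<close>.\<close>
    define t where "t = min d d' / 2"
    have t: "t > 0" "2 * t \<le> d" "2 * t \<le> d'" using d(1) d'(1) by (auto simp: t_def)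
    have near: "dist (x + s *\<^sub>R axis k 1 + s' *\<^sub>R axis l 1) x < 2 * t"
      if "0 < s" "s < t" "0 < s'" "s' < t" for s s' and k l :: 2
    proof -
      have "norm (s *\<^sub>R axis k 1 + s' *\<^sub>R axis l 1 :: plane) \<le> s + s'"
        using norm_triangle_ineq[of "s *\<^sub>R axis k 1 :: plane" "s' *\<^sub>R axis l 1"] that by (simp add: norm_axis_1)
      with that show ?thesis by (simp add: dist_norm add.assoc)
    qed
    obtain s s' where s: "0 < s" "s < t" "0 < s'" "s' < t" and e1:
      "f (x + t *\<^sub>R axis j 1 + t *\<^sub>R axis i 1) - f (x + t *\<^sub>R axis j 1) - f (x + t *\<^sub>R axis i 1) + f x
        = t * t * a (x + s *\<^sub>R axis j 1 + s' *\<^sub>R axis i 1)"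
      unfolding a_def by (rule mixed_difference_quotient[OF f t(1)])
    obtain r r' where r: "0 < r" "r < t" "0 < r'" "r' < t" and e2:
      "f (x + t *\<^sub>R axis i 1 + t *\<^sub>R axis j 1) - f (x + t *\<^sub>R axis i 1) - f (x + t *\<^sub>R axis j 1) + f x
        = t * t * b (x + r *\<^sub>R axis i 1 + r' *\<^sub>R axis j 1)"
      unfolding b_def by (rule mixed_difference_quotient[OF f t(1)])
    have "t * t * a (x + s *\<^sub>R axis j 1 + s' *\<^sub>R axis i 1) = t * t * b (x + r *\<^sub>R axis i 1 + r' *\<^sub>R axis j 1)"
      using e1 e2 by (simp add: algebra_simps)
    then have "a (x + s *\<^sub>R axis j 1 + s' *\<^sub>R axis i 1) = b (x + r *\<^sub>R axis i 1 + r' *\<^sub>R axis j 1)"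
      using t(1) by simp
    moreover have "dist (a (x + s *\<^sub>R axis j 1 + s' *\<^sub>R axis i 1)) (a x) < \<bar>a x - b x\<bar> / 2"
      using near[OF s, of j i] t by (intro d) linarith
    moreover have "dist (b (x + r *\<^sub>R axis i 1 + r' *\<^sub>R axis j 1)) (b x) < \<bar>a x - b x\<bar> / 2"
      using near[OF r, of i j] t by (intro d') linarith
    ultimately show False unfolding dist_real_def by (smt (verit) field_sum_of_halves)
  qed
qed

section \<open>Smooth functions\<close>

definition smooth :: "(plane \<Rightarrow> real) \<Rightarrow> bool" where
  "smooth f \<longleftrightarrow> (\<forall>k. of_class k f)"

lemma smooth_of_class: "smooth f \<Longrightarrow> of_class k f"
  by (simp add: smooth_def)

lemma smooth_partial_deriv: "smooth f \<Longrightarrow> smooth (partial_deriv i f)"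
  unfolding smooth_def using of_class_SucD(2) by blast

lemma smooth_has_grad: "smooth f \<Longrightarrow> has_grad f (\<lambda>i. partial_deriv i f x) x"
  by (rule of_class_SucD(1)[OF smooth_of_class])

lemma smooth_continuous_on: "smooth f \<Longrightarrow> continuous_on S f"
  using of_class_continuous smooth_of_class by blast

lemma smooth_add: "smooth f \<Longrightarrow> smooth g \<Longrightarrow> smooth (\<lambda>x. f x + g x)"
  and smooth_mult: "smooth f \<Longrightarrow> smooth g \<Longrightarrow> smooth (\<lambda>x. f x * g x)"
  and smooth_const [simp]: "smooth (\<lambda>x. c)"
  and smooth_coord: "smooth (\<lambda>x. x $ j)"
  and smooth_affine: "smooth f \<Longrightarrow> smooth (\<lambda>x. f (a + s *\<^sub>R x))"
  and smooth_power: "smooth f \<Longrightarrow> smooth (\<lambda>x. f x ^ n)"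
  by (simp_all add: smooth_def of_class_add of_class_mult of_class_coord of_class_affine of_class_power)

lemma smooth_sum: "(\<And>i. i \<in> I \<Longrightarrow> smooth (f i)) \<Longrightarrow> smooth (\<lambda>x. \<Sum>i\<in>I. f i x)"
  by (simp add: smooth_def of_class_sum)

lemma smooth_iterated: "smooth f \<Longrightarrow> smooth ((partial_deriv i ^^ n) f)"
  by (induction n) (auto intro: smooth_partial_deriv)

lemma smooth_multi_deriv: "smooth f \<Longrightarrow> smooth (multi_deriv i j f)"
  by (simp add: multi_deriv_def smooth_iterated)

lemma multi_deriv_0 [simp]: "multi_deriv 0 0 f = f"
  by (simp add: multi_deriv_def)

lemma partial_deriv_multi_deriv_1: "partial_deriv 1 (multi_deriv i j f) = multi_deriv (Suc i) j f"
  by (simp add: multi_deriv_def)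

lemma iterated_partial_deriv_commute:
  assumes "smooth f"
  shows "partial_deriv i ((partial_deriv j ^^ n) f) = (partial_deriv j ^^ n) (partial_deriv i f)"
  using assms
proof (induction n)
  case (Suc n)
  then show ?case
    using partial_deriv_commute[where f="(partial_deriv j ^^ n) f" and i=i and j=j, OF smooth_of_class[OF smooth_iterated]] by simp
qed simp

lemma partial_deriv_multi_deriv_2:
  assumes "smooth f"
  shows "partial_deriv 2 (multi_deriv i j f) = multi_deriv i (Suc j) f"
  using iterated_partial_deriv_commute[OF smooth_iterated[OF assms, where i=2 and n=j], where i=2 and j=1 and n=i] 
  by (simp add: multi_deriv_def)

lemma multi_deriv_partial_deriv_1:
  assumes "smooth f"
  shows "multi_deriv i j (partial_deriv 1 f) = multi_deriv (Suc i) j f"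
  using iterated_partial_deriv_commute[OF assms, where i=1 and j=2 and n=j]
  by (simp add: multi_deriv_def funpow_swap1)

lemma multi_deriv_partial_deriv_2: "multi_deriv i j (partial_deriv 2 f) = multi_deriv i (Suc j) f"
  by (simp add: multi_deriv_def funpow_swap1)

section \<open>Bump functions\<close>

text \<open>The functions p(1/t) exp(-1/t), extended by 0. The family is closed under
  differentiation: \<open>p\<close> becomes X^2 (p - p'), and \<open>[:0,0,1:]\<close> is
  X^2.\<close>

definition flat_family :: "real poly \<Rightarrow> real \<Rightarrow> real" where
  "flat_family p t = (if t > 0 then poly p (1/t) * exp (- (1/t)) else 0)"

lemma tendsto_poly_exp_0: "((\<lambda>x. poly p x * exp (- x)) \<longlongrightarrow> 0) at_top" for p :: "real poly"
proof -
  have "((\<lambda>x. \<Sum>i\<le>degree p. coeff p i * (x ^ i / exp x)) \<longlongrightarrow> (\<Sum>i\<le>degree p. coeff p i * 0)) at_top"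
    by (intro tendsto_intros tendsto_power_div_exp_0)
  then show ?thesis
    by (simp add: poly_altdef exp_minus field_simps sum_distrib_left sum_divide_distrib)
qed

lemma flat_family_derivative:
  "(flat_family p has_real_derivative flat_family ([:0,0,1:] * (p - pderiv p)) t) (at t)"
proof (cases "t = 0")
  case False
  show ?thesis
  proof (cases "t > 0")
    case True
    have "((\<lambda>t. poly p (1/t) * exp (- (1/t))) has_real_derivative
        flat_family ([:0,0,1:] * (p - pderiv p)) t) (at t)"
      using True by (auto intro!: derivative_eq_intros DERIV_chain2[where f="poly p"] poly_DERIV 
          simp: flat_family_def field_simps power2_eq_square)
    then show ?thesis
      by (rule has_field_derivative_transform_within_open[where S="{0<..}"])
         (use True in \<open>auto simp: flat_family_def\<close>)
  next
    case neg: False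
    have "((\<lambda>t. 0) has_real_derivative flat_family ([:0,0,1:] * (p - pderiv p)) t) (at t)"
      using neg by (simp add: flat_family_def)
    then show ?thesis
      by (rule has_field_derivative_transform_within_open[where S="{..<0}"])
         (use neg False in \<open>auto simp: flat_family_def\<close>)
  qed
next
  case True
  \<comment> \<open>With x = 1/h the difference quotient at 0 is x p(x) exp(-x), and x tends to
    infinity.\<close>
  have "((\<lambda>h. flat_family p h / h) \<longlongrightarrow> 0) (at_right 0)"
  proof -
    have "((\<lambda>h. poly ([:0,1:] * p) (inverse h) * exp (- inverse h)) \<longlongrightarrow> 0) (at_right 0)"
      using filterlim_compose[OF tendsto_poly_exp_0 filterlim_inverse_at_top_right] .
    then show ?thesis
      by (rule Lim_transform_eventually)
         (auto simp: eventually_at_filter flat_family_def field_simps)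
  qed
  moreover have "((\<lambda>h. flat_family p h / h) \<longlongrightarrow> 0) (at_left 0)"
    by (rule Lim_transform_eventually[OF tendsto_const])
       (auto simp: eventually_at_filter flat_family_def)
  ultimately have "((\<lambda>h. flat_family p h / h) \<longlongrightarrow> 0) (at 0)"
    using filterlim_split_at_real by blast
  then show ?thesis
    using True by (simp add: has_field_derivative_iff flat_family_def)
qed

definition flat_exp :: "real \<Rightarrow> real" where
  "flat_exp t = (if t > 0 then exp (- (1/t)) else 0)"

text \<open>\<open>flat_exp\<close> is the member of the flat family with polynomial 1, and
  iterating the polynomial operator gives its chain of derivatives.\<close>

lemma smooth_flat_exp: "smooth (\<lambda>x. flat_exp (c * x $ i + b))"
proof -
  define d where "d n = flat_family (((\<lambda>p. [:0,0,1:] * (p - pderiv p)) ^^ n) 1)" for n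
  have "flat_exp = d 0"
    by (auto simp: flat_exp_def d_def flat_family_def fun_eq_iff)
  moreover have *: "(d n has_real_derivative d (Suc n) t) (at t)" for n t
    using flat_family_derivative by (simp add: d_def)
  ultimately show ?thesis
    using of_class_derivative_chain[where d=d and n=0, OF *] by (simp only: smooth_def simp_thms)
qed

lemma flat_exp_nonneg [simp]: "flat_exp t \<ge> 0" and flat_exp_le_1 [simp]: "flat_exp t \<le> 1"
  and flat_exp_pos_iff: "flat_exp t > 0 \<longleftrightarrow> t > 0" and flat_exp_eq_0_iff: "flat_exp t = 0 \<longleftrightarrow> t \<le> 0"
  by (auto simp: flat_exp_def)

text \<open>As \<open>n\<close> tends to infinity, this increases to the indicator function of the open box.\<close>

definition box_bump :: "real \<Rightarrow> plane \<Rightarrow> plane \<Rightarrow> plane \<Rightarrow> real" where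
  "box_bump n a b x = flat_exp (n * (x$1 - a$1)) * flat_exp (n * (b$1 - x$1)) *
     (flat_exp (n * (x$2 - a$2)) * flat_exp (n * (b$2 - x$2)))"

lemma mem_box_2: "x \<in> box a b \<longleftrightarrow> a$1 < x$1 \<and> x$1 < b$1 \<and> a$2 < x$2 \<and> x$2 < b$2"
  and mem_cbox_2: "x \<in> cbox a b \<longleftrightarrow> a$1 \<le> x$1 \<and> x$1 \<le> b$1 \<and> a$2 \<le> x$2 \<and> x$2 \<le> b$2" for x a b :: plane
  by (auto simp: mem_box_cart forall_2)

lemma smooth_box_bump: "smooth (box_bump n a b)"
proof -
  have *: "box_bump n a b = (\<lambda>x. flat_exp (n * x$1 + - n * a$1) * flat_exp (- n * x$1 + n * b$1) *
     (flat_exp (n * x$2 + - n * a$2) * flat_exp (- n * x$2 + n * b$2)))"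
    by (simp add: box_bump_def fun_eq_iff algebra_simps)
  show ?thesis
    unfolding * by (intro smooth_mult smooth_flat_exp)
qed

lemma box_bump_nonneg [simp]: "box_bump n a b x \<ge> 0" and box_bump_le_1 [simp]: "box_bump n a b x \<le> 1"
  by (auto simp: box_bump_def intro!: mult_le_one)

lemma box_bump_eq_0_iff: "n > 0 \<Longrightarrow> box_bump n a b x = 0 \<longleftrightarrow> x \<notin> box a b"
  by (auto simp: box_bump_def mem_box_2 flat_exp_eq_0_iff mult_le_0_iff not_less)

lemma box_bump_tendsto: "(\<lambda>n. box_bump (real (Suc n)) a b x) \<longlonglongrightarrow> indicator (box a b) x"
proof -
  have *: "(\<lambda>n. flat_exp (real (Suc n) * t)) \<longlonglongrightarrow> (if t > 0 then 1 else 0)" for t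
  proof (cases "t > 0")
    case True
    have "(\<lambda>n. exp (- (inverse (real (Suc n)) * (1/t)))) \<longlonglongrightarrow> exp (- (0 * (1/t)))"
      by (intro tendsto_intros LIMSEQ_inverse_real_of_nat)
    moreover have "exp (- (inverse (real (Suc n)) * (1/t))) = flat_exp (real (Suc n) * t)" for n
      using True zero_less_mult_iff[of "real (Suc n)" t] unfolding flat_exp_def by (simp add: divide_simps)
    ultimately show ?thesis
      using True by simp
  next
    case False
    then show ?thesis by (auto simp: flat_exp_def zero_less_mult_iff)
  qed
  have "(\<lambda>n. box_bump (real (Suc n)) a b x) \<longlonglongrightarrow>
     (if x$1 - a$1 > 0 then 1 else 0) * (if b$1 - x$1 > 0 then 1 else 0) *
     ((if x$2 - a$2 > 0 then 1 else 0) * (if b$2 - x$2 > 0 then 1 else 0))"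
    unfolding box_bump_def by (intro tendsto_mult *)
  then show ?thesis
    by (rule back_subst[of "\<lambda>l. _ \<longlonglongrightarrow> l"]) (auto simp: mem_box_2 indicator_def)
qed

lemma test_function_iff:
  "test_function U \<phi> \<longleftrightarrow> smooth \<phi> \<and> compact (closure {x. \<phi> x \<noteq> 0}) \<and> closure {x. \<phi> x \<noteq> 0} \<subseteq> U"
  by (simp add: test_function_def smooth_def)

lemma test_functionI:
  assumes "smooth \<phi>" "compact S" "S \<subseteq> U" "\<And>x. x \<notin> S \<Longrightarrow> \<phi> x = 0"
  shows "test_function U \<phi>"
proof -
  have "closure {x. \<phi> x \<noteq> 0} \<subseteq> S"
  proof (rule closure_minimal)
    show "{x. \<phi> x \<noteq> 0} \<subseteq> S"
      using assms(4) by (metis (mono_tags) mem_Collect_eq subsetI)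
    show "closed S"
      by (rule compact_imp_closed[OF assms(2)])
  qed
  moreover from this have "compact (closure {x. \<phi> x \<noteq> 0})"
    using bounded_subset[OF compact_imp_bounded[OF assms(2)]] by (simp add: compact_eq_bounded_closed)
  ultimately show ?thesis
    unfolding test_function_iff using assms(1) subset_trans[OF _ assms(3)] by simp
qed

lemma test_functionE:
  assumes "test_function U \<phi>"
  obtains S where "smooth \<phi>" "compact S" "S \<subseteq> U" "\<And>x. x \<notin> S \<Longrightarrow> \<phi> x = 0"
    "\<And>x i. x \<notin> S \<Longrightarrow> partial_deriv i \<phi> x = 0"
proof -
  let ?S = "closure {x. \<phi> x \<noteq> 0}"
  have z: "\<phi> x = 0" if "x \<notin> ?S" for x
    using that closure_subset[of "{x. \<phi> x \<noteq> 0}"] by (metis (mono_tags) mem_Collect_eq subsetD)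
  have "partial_deriv i \<phi> x = 0" if "x \<notin> ?S" for x i
  proof -
    have "has_grad \<phi> (\<lambda>i. 0) x"
      by (rule has_derivative_transform_within_open[where f="\<lambda>x. 0" and s="- ?S"])
         (rule has_grad_const, rule open_Compl[OF closed_closure], simp only: Compl_iff that not_False_eq_True, rule z[symmetric], simp only: Compl_iff not_False_eq_True)
    from partial_deriv_eq[OF this] show ?thesis .
  qed
  then show ?thesis
    using that[of ?S, OF _ _ _ z] assms unfolding test_function_iff by simp
qed

lemma test_function_partial_deriv: "test_function U \<phi> \<Longrightarrow> test_function U (partial_deriv i \<phi>)"
  by (erule test_functionE, rule test_functionI) (rule smooth_partial_deriv)

lemma test_function_multi_deriv: "test_function U \<phi> \<Longrightarrow> test_function U (multi_deriv i j \<phi>)"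
proof -
  have "test_function U ((partial_deriv l ^^ n) \<psi>)" if "test_function U \<psi>" for \<psi> n l
    using that by (induction n) (auto intro: test_function_partial_deriv)
  then show "test_function U \<phi> \<Longrightarrow> test_function U (multi_deriv i j \<phi>)"
    by (simp add: multi_deriv_def)
qed

lemma test_function_box_bump: "n > 0 \<Longrightarrow> cbox a b \<subseteq> U \<Longrightarrow> test_function U (box_bump n a b)"
  by (rule test_functionI[OF smooth_box_bump, of "cbox a b"])
     (simp, assumption, metis box_bump_eq_0_iff box_subset_cbox subsetD)

section \<open>Square integrable functions\<close>

text \<open>The measure is arbitrary because both \<open>lborel\<close>, for convolutions and Fubini
  arguments, and restrictions of \<open>lebesgue\<close> occur.\<close>

definition sqint :: "'a measure \<Rightarrow> ('a \<Rightarrow> real) \<Rightarrow> bool" where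
  "sqint M f \<longleftrightarrow> f \<in> borel_measurable M \<and> integrable M (\<lambda>x. (f x)\<^sup>2)"

abbreviation sqint_on :: "'a::euclidean_space set \<Rightarrow> ('a \<Rightarrow> real) \<Rightarrow> bool" where
  "sqint_on S \<equiv> sqint (lebesgue_on S)"

abbreviation sqnorm :: "'a measure \<Rightarrow> ('a \<Rightarrow> real) \<Rightarrow> real" where
  "sqnorm M f \<equiv> LINT x|M. (f x)\<^sup>2"

abbreviation sqnorm_on :: "'a::euclidean_space set \<Rightarrow> ('a \<Rightarrow> real) \<Rightarrow> real" where
  "sqnorm_on S f \<equiv> sqnorm (lebesgue_on S) f"

lemma in_L2_iff_sqint: "in_L2 U f \<longleftrightarrow> sqint_on U f"
  by (simp add: in_L2_def sqint_def)

lemma sqint_measurable: "sqint M f \<Longrightarrow> f \<in> borel_measurable M"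
  and sqint_integrable: "sqint M f \<Longrightarrow> integrable M (\<lambda>x. (f x)\<^sup>2)"
  by (simp_all add: sqint_def)

lemma sqnorm_nonneg [simp]: "sqnorm M f \<ge> 0"
  by simp

lemma two_mult_le_squares: "2 * \<bar>a * b\<bar> \<le> a\<^sup>2 + (b::real)\<^sup>2"
  using zero_le_power2[of "\<bar>a\<bar> - \<bar>b\<bar>"] by (simp add: power2_diff abs_mult)

lemma square_add_le: "(a + b)\<^sup>2 \<le> 2 * a\<^sup>2 + 2 * (b::real)\<^sup>2"
  using zero_le_power2[of "a - b"] by (simp add: power2_diff power2_sum)

lemma sqint_mult_integrable:
  assumes "sqint M f" "sqint M g"
  shows "integrable M (\<lambda>x. f x * g x)"
proof (rule Bochner_Integration.integrable_bound)
  show "integrable M (\<lambda>x. (f x)\<^sup>2 + (g x)\<^sup>2)"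
    using assms by (auto simp: sqint_def)
  show "(\<lambda>x. f x * g x) \<in> borel_measurable M"
    using assms by (auto simp: sqint_def)
  have "\<bar>f x * g x\<bar> \<le> \<bar>(f x)\<^sup>2 + (g x)\<^sup>2\<bar>" for x
    using two_mult_le_squares[of "f x" "g x"] abs_ge_zero[of "f x * g x"] by linarith
  then show "AE x in M. norm (f x * g x) \<le> norm ((f x)\<^sup>2 + (g x)\<^sup>2)"
    by simp
qed

lemma sqint_cmult: "sqint M f \<Longrightarrow> sqint M (\<lambda>x. c * f x)"
  by (auto simp: sqint_def power_mult_distrib)

lemma sqnorm_cmult: "sqnorm M (\<lambda>x. c * f x) = c\<^sup>2 * sqnorm M f"
  by (simp add: power_mult_distrib)

lemma sqint_add: "sqint M f \<Longrightarrow> sqint M g \<Longrightarrow> sqint M (\<lambda>x. f x + g x)"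
  using sqint_mult_integrable[of M f g]
  by (auto simp: sqint_def power2_sum mult.assoc)

lemma sqint_diff: "sqint M f \<Longrightarrow> sqint M g \<Longrightarrow> sqint M (\<lambda>x. f x - g x)"
  using sqint_add[OF _ sqint_cmult[of M g "-1"]] by simp

lemma sqint_zero [simp]: "sqint M (\<lambda>x. 0)"
  by (simp add: sqint_def)

lemma sqint_sum: "(\<And>i. i \<in> I \<Longrightarrow> sqint M (f i)) \<Longrightarrow> sqint M (\<lambda>x. \<Sum>i\<in>I. f i x)"
  by (induction I rule: infinite_finite_induct) (auto intro: sqint_add)

lemma sqnorm_add_le:
  assumes "sqint M f" "sqint M g"
  shows "sqnorm M (\<lambda>x. f x + g x) \<le> 2 * sqnorm M f + 2 * sqnorm M g"
proof -
  have "sqnorm M (\<lambda>x. f x + g x) \<le> (LINT x|M. 2 * (f x)\<^sup>2 + 2 * (g x)\<^sup>2)"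
    by (rule integral_mono) (use assms sqint_add[OF assms] square_add_le in \<open>auto simp: sqint_def\<close>)
  also have "\<dots> = 2 * sqnorm M f + 2 * sqnorm M g"
    using assms by (simp add: sqint_def)
  finally show ?thesis .
qed

lemma sqnorm_diff_le:
  assumes "sqint M f" "sqint M g"
  shows "sqnorm M (\<lambda>x. f x - g x) \<le> 2 * sqnorm M f + 2 * sqnorm M g"
  using sqnorm_add_le[OF assms(1) sqint_cmult[OF assms(2), of "-1"]] by simp

lemma sqint_mult_bounded:
  assumes "sqint M f" "a \<in> borel_measurable M" "\<And>x. x \<in> space M \<Longrightarrow> \<bar>a x\<bar> \<le> B"
  shows "sqint M (\<lambda>x. a x * f x)" "sqnorm M (\<lambda>x. a x * f x) \<le> B\<^sup>2 * sqnorm M f"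
proof -
  have le: "(a x * f x)\<^sup>2 \<le> B\<^sup>2 * (f x)\<^sup>2" if "x \<in> space M" for x
    using assms(3)[OF that] by (simp add: power_mult_distrib mult_right_mono abs_le_square_iff power2_le_iff_abs_le
        order_trans[OF abs_ge_zero])
  have int: "integrable M (\<lambda>x. B\<^sup>2 * (f x)\<^sup>2)"
    using assms(1) by (simp add: sqint_def)
  have int2: "integrable M (\<lambda>x. (a x * f x)\<^sup>2)"
    by (rule Bochner_Integration.integrable_bound[OF int])
       (use assms le in \<open>auto simp: sqint_def\<close>)
  then show "sqint M (\<lambda>x. a x * f x)"
    using assms by (auto simp: sqint_def)
  show "sqnorm M (\<lambda>x. a x * f x) \<le> B\<^sup>2 * sqnorm M f"
    using integral_mono[OF int2 int le] by simp
qed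

text \<open>The quadratic form of \<open>s * f - t * g\<close> is nonnegative; its value at s = c, t
  = b is c (c a - b^2).\<close>

lemma sqint_Cauchy_Schwarz:
  assumes "sqint M f" "sqint M g"
  shows "(LINT x|M. f x * g x)\<^sup>2 \<le> sqnorm M f * sqnorm M g"
proof -
  define a b c where "a = sqnorm M f" and "b = (LINT x|M. f x * g x)" and "c = sqnorm M g"
  note i = sqint_integrable[OF assms(1)] sqint_integrable[OF assms(2)] sqint_mult_integrable[OF assms]
  have q: "0 \<le> s\<^sup>2 * a - 2 * s * t * b + t\<^sup>2 * c" for s t
  proof -
    have "(LINT x|M. (s * f x - t * g x)\<^sup>2) = (LINT x|M. s\<^sup>2 * (f x)\<^sup>2 - 2 * s * t * (f x * g x) + t\<^sup>2 * (g x)\<^sup>2)"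
      by (rule Bochner_Integration.integral_cong) (auto simp: power2_eq_square algebra_simps)
    also have "\<dots> = s\<^sup>2 * a - 2 * s * t * b + t\<^sup>2 * c"
      using i by (simp add: a_def b_def c_def)
    finally show ?thesis
      by (metis (no_types, lifting) integral_nonneg_AE AE_I2 zero_le_power2)
  qed
  have "c \<ge> 0" "a \<ge> 0" by (simp_all add: a_def c_def)
  show ?thesis
  proof (cases "c = 0")
    case True
    have "b = 0"
    proof (rule ccontr)
      assume "b \<noteq> 0"
      \<comment> \<open>When \<open>c = 0\<close> the form is affine in \<open>t\<close>, and this
        choice of \<open>t\<close> gives it the value -1.\<close>
      then have "0 \<le> a - 2 * ((a + 1) / (2 * b)) * b"
        using q[of 1 "(a + 1) / (2 * b)"] True by simp
      then show False using \<open>b \<noteq> 0\<close> by simp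
    qed
    then show ?thesis using True by (simp add: a_def b_def c_def)
  next
    case False
    with \<open>c \<ge> 0\<close> have "c > 0" by simp
    have "0 \<le> c\<^sup>2 * a - 2 * c * b * b + b\<^sup>2 * c" by (rule q)
    then have "0 \<le> c * (c * a - b\<^sup>2)" by (simp add: power2_eq_square algebra_simps)
    then have "0 \<le> c * a - b\<^sup>2" using \<open>c > 0\<close> by (simp add: zero_le_mult_iff)
    then show ?thesis by (simp add: a_def b_def c_def mult.commute)
  qed
qed

lemma integral_square_le:
  assumes "finite_measure M" "sqint M f"
  shows "integrable M f" "(LINT x|M. f x)\<^sup>2 \<le> measure M (space M) * sqnorm M f"
proof -
  interpret finite_measure M by fact
  have 1: "sqint M (\<lambda>x. 1)" by (simp add: sqint_def)
  from sqint_mult_integrable[OF 1 assms(2)] show "integrable M f" by simp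
  from sqint_Cauchy_Schwarz[OF 1 assms(2)]
  show "(LINT x|M. f x)\<^sup>2 \<le> measure M (space M) * sqnorm M f" by simp
qed

lemma sqint_AE_cong:
  assumes "AE x in M. f x = g x" "f \<in> borel_measurable M" "g \<in> borel_measurable M"
  shows "sqint M f \<longleftrightarrow> sqint M g" "sqnorm M f = sqnorm M g"
proof -
  have *: "AE x in M. (f x)\<^sup>2 = (g x)\<^sup>2" using assms(1) by eventually_elim simp
  show "sqint M f \<longleftrightarrow> sqint M g"
    unfolding sqint_def using assms * by (auto intro: integrable_cong_AE_imp)
  show "sqnorm M f = sqnorm M g"
    by (rule integral_cong_AE) (use assms * in auto)
qed

lemma sqint_cong:
  assumes "\<And>x. x \<in> space M \<Longrightarrow> f x = g x"
  shows "sqint M f \<longleftrightarrow> sqint M g" "sqnorm M f = sqnorm M g"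
proof -
  have "integrable M (\<lambda>x. (f x)\<^sup>2) \<longleftrightarrow> integrable M (\<lambda>x. (g x)\<^sup>2)"
    using assms by (intro Bochner_Integration.integrable_cong) auto
  then show "sqint M f \<longleftrightarrow> sqint M g"
    using measurable_cong[of M f g borel] assms by (simp add: sqint_def)
  show "sqnorm M f = sqnorm M g"
    using assms by (intro Bochner_Integration.integral_cong) auto
qed

lemma sqnorm_nn_integral:
  assumes "sqint M f"
  shows "(\<integral>\<^sup>+x. ennreal ((f x)\<^sup>2) \<partial>M) = ennreal (sqnorm M f)"
  using assms by (intro nn_integral_eq_integral) (auto simp: sqint_def)

lemma sqint_nn_integralI:
  assumes "f \<in> borel_measurable M" "(\<integral>\<^sup>+x. ennreal ((f x)\<^sup>2) \<partial>M) \<le> ennreal B" "B \<ge> 0"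
  shows "sqint M f" "sqnorm M f \<le> B"
proof -
  show *: "sqint M f" unfolding sqint_def
    using assms by (intro conjI integrableI_nonneg) (auto intro: le_less_trans)
  show "sqnorm M f \<le> B"
    using assms(2,3) unfolding sqnorm_nn_integral[OF *] by simp
qed

lemma sqint_lebesgue_on_iff:
  assumes "S \<in> sets lebesgue"
  shows "sqint_on S f \<longleftrightarrow> sqint lebesgue (\<lambda>x. if x \<in> S then f x else 0)"
    and "sqnorm_on S f = sqnorm lebesgue (\<lambda>x. if x \<in> S then f x else 0)"
proof -
  have *: "(\<lambda>x. (if x \<in> S then f x else 0)\<^sup>2) = (\<lambda>x. if x \<in> S then (f x)\<^sup>2 else 0)"
    by auto
  show "sqint_on S f \<longleftrightarrow> sqint lebesgue (\<lambda>x. if x \<in> S then f x else 0)"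
    unfolding sqint_def * using assms borel_measurable_if[OF assms, of f] Lebesgue_Measure.integrable_restrict_UNIV[OF assms, of "\<lambda>x. (f x)\<^sup>2"]
    by simp
  show "sqnorm_on S f = sqnorm lebesgue (\<lambda>x. if x \<in> S then f x else 0)"
    unfolding * using Lebesgue_Measure.integral_restrict_UNIV[OF assms, of "\<lambda>x. (f x)\<^sup>2"] by simp
qed

lemma integrable_lebesgue_on_mono:
  fixes f :: "'a::euclidean_space \<Rightarrow> real"
  assumes "integrable (lebesgue_on T) f" "S \<subseteq> T" "S \<in> sets lebesgue" "T \<in> sets lebesgue"
  shows "integrable (lebesgue_on S) f"
proof -
  have "integrable lebesgue (\<lambda>x. if x \<in> T then f x else 0)"
    by (rule Lebesgue_Measure.integrable_restrict_UNIV[OF assms(4), THEN iffD2]) (rule assms(1))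
  then have "integrable lebesgue (\<lambda>x. indicator S x *\<^sub>R (if x \<in> T then f x else 0))"
    using assms by (intro integrable_mult_indicator)
  then have "integrable lebesgue (\<lambda>x. if x \<in> S then f x else 0)"
    by (rule Bochner_Integration.integrable_cong[THEN iffD1, OF refl, rotated]) (use assms(2) in auto)
  then show ?thesis
    by (rule Lebesgue_Measure.integrable_restrict_UNIV[OF assms(3), THEN iffD1])
qed

lemma sqint_mono:
  fixes f :: "'a::euclidean_space \<Rightarrow> real"
  assumes "sqint_on T f" "S \<subseteq> T" "S \<in> sets lebesgue" "T \<in> sets lebesgue"
  shows "sqint_on S f" "sqnorm_on S f \<le> sqnorm_on T f"
proof -
  note i = integrable_lebesgue_on_mono[OF sqint_integrable[OF assms(1)] assms(2-4)]
  show "sqint_on S f"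
    using i measurable_restrict_mono[OF sqint_measurable[OF assms(1)] assms(2)] by (simp add: sqint_def)
  show "sqnorm_on S f \<le> sqnorm_on T f"
    by (rule integral_mono_lebesgue_on_AE) (use assms sqint_integrable in auto)
qed

lemma sqint_continuous_compact:
  fixes f :: "'a::euclidean_space \<Rightarrow> real"
  assumes "continuous_on S f" "compact S"
  shows "sqint_on S f"
proof -
  have S: "S \<in> sets lebesgue" using assms(2) by (simp add: lmeasurable_compact fmeasurableD)
  have "continuous_on S (\<lambda>x. (f x)\<^sup>2)" using assms(1) by (intro continuous_intros)
  then have *: "integrable lborel (\<lambda>x. indicator S x *\<^sub>R (f x)\<^sup>2)"
    by (rule borel_integrable_compact[OF assms(2)])
  then have "integrable lebesgue (\<lambda>x. indicator S x *\<^sub>R (f x)\<^sup>2)"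
    by (subst integrable_completion) auto
  then have "integrable (lebesgue_on S) (\<lambda>x. (f x)\<^sup>2)"
    by (subst Lebesgue_Measure.integrable_restrict_UNIV[OF S, symmetric])
       (auto elim!: Bochner_Integration.integrable_cong[THEN iffD1, rotated 2])
  moreover have "f \<in> borel_measurable (lebesgue_on S)"
    using continuous_imp_measurable_on_sets_lebesgue[OF assms(1) S] .
  ultimately show ?thesis by (simp add: sqint_def)
qed

section \<open>Translations and integration by parts\<close>

lemma nn_integral_lborel_affine:
  fixes t :: plane
  assumes [measurable]: "f \<in> borel_measurable borel" and "c \<noteq> 0"
  shows "(\<integral>\<^sup>+x. f x \<partial>lborel) = ennreal (c\<^sup>2) * (\<integral>\<^sup>+x. f (t + c *\<^sub>R x) \<partial>lborel)"
  by (subst lborel_affine[OF assms(2), of t])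
     (simp add: nn_integral_density nn_integral_distr nn_integral_cmult)

lemma nn_integral_lborel_translate:
  fixes t :: plane
  assumes "f \<in> borel_measurable borel"
  shows "(\<integral>\<^sup>+x. f (t + x) \<partial>lborel) = (\<integral>\<^sup>+x. f x \<partial>lborel)"
  using nn_integral_lborel_affine[OF assms, of 1 t] by simp

lemma nn_integral_lborel_reflect:
  fixes t :: plane
  assumes "f \<in> borel_measurable borel"
  shows "(\<integral>\<^sup>+x. f (t - x) \<partial>lborel) = (\<integral>\<^sup>+x. f x \<partial>lborel)"
  using nn_integral_lborel_affine[OF assms, of "-1" t] by simp

lemma integral_lborel_translate:
  fixes t :: plane and f :: "plane \<Rightarrow> real"
  assumes [measurable]: "f \<in> borel_measurable borel"
  shows "(LINT x|lborel. f (t + x)) = (LINT x|lborel. f x)"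
    and "integrable lborel (\<lambda>x. f (t + x)) \<longleftrightarrow> integrable lborel f"
proof -
  have d: "lborel = distr lborel borel (\<lambda>x. t + x)"
    using lborel_affine[of 1 t] by (simp add: density_1)
  show "(LINT x|lborel. f (t + x)) = (LINT x|lborel. f x)"
    by (subst (2) d) (simp add: integral_distr)
  show "integrable lborel (\<lambda>x. f (t + x)) \<longleftrightarrow> integrable lborel f"
    by (subst (2) d) (simp add: integrable_distr_eq)
qed

definition C1_on :: "plane set \<Rightarrow> (plane \<Rightarrow> real) \<Rightarrow> (2 \<Rightarrow> plane \<Rightarrow> real) \<Rightarrow> bool" where
  "C1_on U F F' \<longleftrightarrow> (\<forall>x\<in>U. has_grad F (\<lambda>i. F' i x) x) \<and> (\<forall>i. continuous_on U (F' i))"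

lemma C1_on_subset: "C1_on U F F' \<Longrightarrow> V \<subseteq> U \<Longrightarrow> C1_on V F F'"
  unfolding C1_on_def using continuous_on_subset by blast

lemma C1_on_continuous: "C1_on U F F' \<Longrightarrow> continuous_on U F"
  unfolding C1_on_def
  by (meson continuous_at_imp_continuous_on has_derivative_continuous)

lemma smooth_C1_on: "smooth f \<Longrightarrow> C1_on U f (\<lambda>i. partial_deriv i f)"
  by (simp add: C1_on_def smooth_has_grad smooth_continuous_on smooth_partial_deriv)

lemma C1_on_mult:
  assumes "C1_on U f f'" "C1_on U g g'"
  shows "C1_on U (\<lambda>x. f x * g x) (\<lambda>i x. f x * g' i x + f' i x * g x)"
  using assms C1_on_continuous[OF assms(1)] C1_on_continuous[OF assms(2)]
  unfolding C1_on_def by (auto intro!: has_grad_mult continuous_intros)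

lemma line_has_real_derivative:
  assumes "has_grad g a (y + s *\<^sub>R v)"
  shows "((\<lambda>s. g (y + s *\<^sub>R v)) has_real_derivative (\<Sum>i\<in>UNIV. a i * v $ i)) (at s)"
proof -
  have "((\<lambda>s. y + s *\<^sub>R v) has_derivative (\<lambda>h. h *\<^sub>R v)) (at s)"
    by (auto intro!: derivative_eq_intros)
  from diff_chain_at[OF this assms] show ?thesis
    unfolding has_field_derivative_def o_def
    by (rule has_derivative_eq_rhs) (simp add: fun_eq_iff sum_distrib_left algebra_simps)
qed

lemma integrable_lborel_compact_support:
  fixes f :: "'a::euclidean_space \<Rightarrow> real"
  assumes "continuous_on UNIV f" "compact S" "\<And>x. x \<notin> S \<Longrightarrow> f x = 0"
  shows "integrable lborel f"
proof -
  have "integrable lborel (\<lambda>x. indicator S x *\<^sub>R f x)"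
    by (rule borel_integrable_compact[OF assms(2)]) (use assms(1) continuous_on_subset in blast)
  also have "(\<lambda>x. indicator S x *\<^sub>R f x) = f"
    using assms(3) by (auto simp: indicator_def fun_eq_iff)
  finally show ?thesis .
qed

lemma continuous_compact_support_bounded:
  fixes f :: "'a::euclidean_space \<Rightarrow> real"
  assumes "continuous_on UNIV f" "compact S" "\<And>x. x \<notin> S \<Longrightarrow> f x = 0"
  obtains M where "M > 0" "\<And>x. \<bar>f x\<bar> \<le> M"
proof -
  have "bounded (f ` S)"
    by (rule compact_imp_bounded, rule compact_continuous_image[OF _ assms(2)])
       (use assms(1) continuous_on_subset in blast)
  then obtain M where M: "M > 0" "\<And>x. x \<in> S \<Longrightarrow> \<bar>f x\<bar> \<le> M"
    unfolding bounded_pos by auto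
  have "\<bar>f x\<bar> \<le> M" for x
    using M assms(3)[of x] by (cases "x \<in> S") auto
  with M show ?thesis using that by blast
qed

lemma continuous_on_UNIV_borel_measurable:
  "continuous_on UNIV f \<Longrightarrow> f \<in> borel_measurable borel" for f :: "'a::topological_space \<Rightarrow> real"
  by (rule borel_measurable_continuous_onI)

text \<open>The derivative is the limit of difference quotients, whose integrals vanish by
  translation invariance. The mean value theorem bounds the quotients, and the common compact
  support makes the bound integrable.\<close>

lemma integral_partial_zero:
  assumes C1: "C1_on UNIV \<psi> \<psi>'" and S: "compact S" "\<And>x. x \<notin> S \<Longrightarrow> \<psi> x = 0" "\<And>x. x \<notin> S \<Longrightarrow> \<psi>' i x = 0"
  shows "(LINT x|lborel. \<psi>' i x) = 0"
proof -
  have cont: "continuous_on UNIV \<psi>" "continuous_on UNIV (\<psi>' i)"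
    using C1 C1_on_continuous by (auto simp: C1_on_def)
  note [measurable] = cont[THEN continuous_on_UNIV_borel_measurable]
  obtain M where M: "M > 0" "\<And>x. \<bar>\<psi>' i x\<bar> \<le> M"
    using continuous_compact_support_bounded[OF cont(2) S(1,3)] by blast
  define e :: plane where "e = axis i 1"
  define h :: "nat \<Rightarrow> real" where "h n = inverse (real (Suc n))" for n
  have h: "h n > 0" "h n \<le> 1" "h \<longlonglongrightarrow> 0" for n
    using LIMSEQ_inverse_real_of_nat by (auto simp: h_def[abs_def] inverse_le_1_iff)
  have sum_e: "(\<Sum>j\<in>UNIV. a j * e $ j) = a i" for a :: "2 \<Rightarrow> real"
    by (simp add: e_def sum_mult_axis)
  have der: "((\<lambda>s. \<psi> (x + s *\<^sub>R e)) has_real_derivative \<psi>' i (x + s *\<^sub>R e)) (at s)" for x s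
    using line_has_real_derivative[of \<psi> "\<lambda>j. \<psi>' j (x + s *\<^sub>R e)" x s e] C1 
    unfolding C1_on_def sum_e by simp
  \<comment> \<open>\<open>T\<close> collects the translates of the support by at most one unit
    against \<open>e\<close>; as \<open>h n \<le> 1\<close>, all difference quotients vanish outside
    \<open>T\<close>.\<close>
  define T where "T = (\<lambda>(x, s). x - s *\<^sub>R e) ` (S \<times> {0..1})"
  have T: "compact T"
    unfolding T_def
    using S(1) by (auto intro!: compact_continuous_image continuous_intros compact_Times simp: split_beta)
  define q where "q n x = (\<psi> (h n *\<^sub>R e + x) - \<psi> x) / h n" for n x
  have q_bound: "\<bar>q n x\<bar> \<le> M * indicator T x" for n x
  proof -
    obtain s where s: "0 < s" "s < h n" "\<psi> (x + h n *\<^sub>R e) - \<psi> (x + 0 *\<^sub>R e) = (h n - 0) * \<psi>' i (x + s *\<^sub>R e)"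
      using MVT2[OF h(1) der] by blast
    then have q: "q n x = \<psi>' i (x + s *\<^sub>R e)"
      using h(1)[of n] by (simp add: q_def add.commute)
    show ?thesis
    proof (cases "x + s *\<^sub>R e \<in> S")
      case True
      then have "x \<in> T" using s h(2)[of n] unfolding T_def
        by (intro image_eqI[of _ _ "(x + s *\<^sub>R e, s)"]) auto
      then show ?thesis using M q by simp
    next
      case False then show ?thesis using q S(3) M by simp
    qed
  qed
  have "(\<lambda>n. LINT x|lborel. q n x) \<longlonglongrightarrow> (LINT x|lborel. \<psi>' i x)"
  proof (rule integral_dominated_convergence[where w="\<lambda>x. M * indicator T x"])
    show "integrable lborel (\<lambda>x. M * indicator T x)"
      using borel_integrable_compact[OF T, of "\<lambda>x. M"] by (simp add: mult.commute)
    show "AE x in lborel. (\<lambda>n. q n x) \<longlonglongrightarrow> \<psi>' i x"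
    proof (rule AE_I2)
      fix x
      have "((\<lambda>s. (\<psi> (x + s *\<^sub>R e) - \<psi> x) / s) \<longlongrightarrow> \<psi>' i x) (at 0)"
        using der[of x 0] by (simp add: has_field_derivative_iff)
      moreover have "filterlim h (at 0) sequentially"
        using h by (auto simp: filterlim_at intro!: always_eventually dest: less_imp_neq[symmetric])
      ultimately show "(\<lambda>n. q n x) \<longlonglongrightarrow> \<psi>' i x"
        unfolding q_def using filterlim_compose by (fastforce simp: add.commute)
    qed
  qed (use q_bound in \<open>auto simp: q_def\<close>)
  moreover have "(LINT x|lborel. q n x) = 0" for n
  proof -
    have int: "integrable lborel \<psi>"
      using integrable_lborel_compact_support[OF cont(1) S(1,2)] by blast
    then have "integrable lborel (\<lambda>x. \<psi> (h n *\<^sub>R e + x))"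
      by (subst integral_lborel_translate(2)) auto
    with int show ?thesis
      by (simp add: q_def integral_lborel_translate(1))
  qed
  ultimately show ?thesis
    by (simp add: LIMSEQ_const_iff)
qed

text \<open>The product of \<open>F\<close> and the test function, extended by 0, is C1 on the whole
  plane, since \<open>U\<close> and the complement of the support are open and cover it. The
  integral of its partial derivative vanishes.\<close>

lemma integration_by_parts:
  assumes O: "open U" and F: "C1_on U F F'" and \<phi>: "test_function U \<phi>"
  shows "(LINT x|lebesgue_on U. F x * partial_deriv i \<phi> x) = - (LINT x|lebesgue_on U. F' i x * \<phi> x)"
proof -
  obtain S where S: "smooth \<phi>" "compact S" "S \<subseteq> U" "\<And>x. x \<notin> S \<Longrightarrow> \<phi> x = 0"
    "\<And>x i. x \<notin> S \<Longrightarrow> partial_deriv i \<phi> x = 0"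
    using test_functionE[OF \<phi>] by blast
  have U: "U \<in> sets lebesgue" using O by (simp add: borel_open)
  have "open (- S)" using S(2) compact_imp_closed by auto
  \<comment> \<open>Gluing over the open cover by \<open>U\<close> and the complement of
    \<open>S\<close>: on the latter the function is 0, so nothing is asked of \<open>g\<close> at
    the boundary of \<open>U\<close>.\<close>
  have ext_cont: "continuous_on UNIV (\<lambda>x. if x \<in> U then g x * p x else 0)"
    if "continuous_on U g" "continuous_on UNIV p" "\<And>x. x \<notin> S \<Longrightarrow> p x = 0" for g p :: "plane \<Rightarrow> real"
  proof -
    have "continuous_on (U \<union> - S) (\<lambda>x. if x \<in> U then g x * p x else 0)"
    proof (rule continuous_on_open_Un[OF O \<open>open (- S)\<close>])
      show "continuous_on U (\<lambda>x. if x \<in> U then g x * p x else 0)"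
        by (rule continuous_on_eq[of _ "\<lambda>x. g x * p x"])
           (auto intro!: continuous_intros that continuous_on_subset[OF that(2) subset_UNIV])
      show "continuous_on (- S) (\<lambda>x. if x \<in> U then g x * p x else 0)"
        by (rule continuous_on_eq[of _ "\<lambda>x. 0"]) (use that in auto)
    qed
    moreover have "U \<union> - S = UNIV" using S(3) by auto
    ultimately show ?thesis by simp
  qed
  note cF = C1_on_continuous[OF F]
  have cF': "continuous_on U (F' i)" for i using F by (simp add: C1_on_def)
  note c\<phi> = smooth_continuous_on[OF S(1), of UNIV] smooth_continuous_on[OF smooth_partial_deriv[OF S(1)], of UNIV]
  define e1 e2 where "e1 = (\<lambda>i x. if x \<in> U then F x * partial_deriv i \<phi> x else 0)"
    and "e2 = (\<lambda>i x. if x \<in> U then F' i x * \<phi> x else 0)"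
  have c1: "continuous_on UNIV (e1 i)" and c2: "continuous_on UNIV (e2 i)" for i
    unfolding e1_def e2_def by (intro ext_cont cF cF' c\<phi> S; assumption)+
  have z: "x \<notin> S \<Longrightarrow> e1 i x = 0" "x \<notin> S \<Longrightarrow> e2 i x = 0" for i x
    using S by (auto simp: e1_def e2_def)
  define \<psi> where "\<psi> x = (if x \<in> U then F x * \<phi> x else 0)" for x
  have "has_grad \<psi> (\<lambda>i. e1 i x + e2 i x) x" for x
  proof (cases "x \<in> U")
    case True
    have "has_grad (\<lambda>x. F x * \<phi> x) (\<lambda>i. e1 i x + e2 i x) x"
      using has_grad_mult[OF _ smooth_has_grad[OF S(1)], of F "\<lambda>i. F' i x" x] F True
      by (simp add: C1_on_def e1_def e2_def)
    then show ?thesis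
      by (rule has_derivative_transform_within_open[OF _ O True]) (simp add: \<psi>_def)
  next
    case False
    with S have "x \<in> - S" by auto
    have "has_grad (\<lambda>x. 0) (\<lambda>i. e1 i x + e2 i x) x"
      using False by (simp add: e1_def e2_def)
    then show ?thesis
      by (rule has_derivative_transform_within_open[OF _ \<open>open (- S)\<close> \<open>x \<in> - S\<close>]) (use S in \<open>auto simp: \<psi>_def\<close>)
  qed
  then have "C1_on UNIV \<psi> (\<lambda>i x. e1 i x + e2 i x)"
    unfolding C1_on_def using c1 c2 by (auto intro!: continuous_intros)
  from integral_partial_zero[OF this S(2), of i]
  have "(LINT x|lborel. e1 i x + e2 i x) = 0"
    using z S by (auto simp: \<psi>_def)
  moreover have "integrable lborel (e1 i)" "integrable lborel (e2 i)"
    using integrable_lborel_compact_support[OF c1 S(2)] integrable_lborel_compact_support[OF c2 S(2)] z by auto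
  ultimately have "(LINT x|lborel. e1 i x) = - (LINT x|lborel. e2 i x)" by simp
  moreover have "(LINT x|lborel. e1 i x) = (LINT x|lebesgue. e1 i x)"
    "(LINT x|lborel. e2 i x) = (LINT x|lebesgue. e2 i x)"
    using c1 c2 by (auto intro!: integral_completion[symmetric] continuous_on_UNIV_borel_measurable simp: measurable_lborel1)
  ultimately show ?thesis
    by (simp add: e1_def e2_def Lebesgue_Measure.integral_restrict_UNIV[OF U])
qed

section \<open>The fundamental lemma of the calculus of variations\<close>

text \<open>The positive and negative parts of \<open>D\<close> are densities of two measures that
  agree on boxes. Boxes form an intersection-stable generator of the Borel sets, so the measures and
  hence the densities agree.\<close>

lemma AE_eq_zero_if_box_integrals:
  fixes D :: "plane \<Rightarrow> real"
  assumes int: "integrable lborel D" and box: "\<And>a b. (LINT x|lborel. indicator (box a b) x * D x) = 0"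
  shows "AE x in lborel. D x = 0"
proof -
  note [measurable] = borel_measurable_integrable[OF int, simplified]
  define P N where "P x = max (D x) 0" and "N x = max (- D x) 0" for x
  have [measurable]: "P \<in> borel_measurable borel" "N \<in> borel_measurable borel"
    unfolding P_def N_def by measurable
  have intP: "integrable lborel P" and intN: "integrable lborel N"
    unfolding P_def N_def using int by auto
  have em: "emeasure (density lborel (\<lambda>x. ennreal (P x))) (box a b) = emeasure (density lborel (\<lambda>x. ennreal (N x))) (box a b)"
    for a b
  proof -
    have i: "integrable lborel (\<lambda>x. indicator (box a b) x * P x)" "integrable lborel (\<lambda>x. indicator (box a b) x * N x)"
      using integrable_mult_indicator[OF _ intP, of "box a b"] integrable_mult_indicator[OF _ intN, of "box a b"] by simp_all
    have "(LINT x|lborel. indicator (box a b) x * P x) - (LINT x|lborel. indicator (box a b) x * N x)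
       = (LINT x|lborel. indicator (box a b) x * P x - indicator (box a b) x * N x)"
      using i by simp
    also have "\<dots> = (LINT x|lborel. indicator (box a b) x * D x)"
      by (rule Bochner_Integration.integral_cong) (auto simp: P_def N_def indicator_def)
    finally have eq: "(LINT x|lborel. indicator (box a b) x * P x) = (LINT x|lborel. indicator (box a b) x * N x)"
      using box by simp
    have "emeasure (density lborel (\<lambda>x. ennreal (F x))) (box a b) = ennreal (LINT x|lborel. indicator (box a b) x * F x)"
      if "integrable lborel (\<lambda>x. indicator (box a b) x * F x)" "\<And>x. F x \<ge> 0" "F \<in> borel_measurable borel" for F
    proof -
      have "emeasure (density lborel (\<lambda>x. ennreal (F x))) (box a b) = (\<integral>\<^sup>+x. ennreal (indicator (box a b) x * F x) \<partial>lborel)"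
        using that by (subst emeasure_density) (auto intro!: nn_integral_cong simp: indicator_def)
      also have "\<dots> = ennreal (LINT x|lborel. indicator (box a b) x * F x)"
        using that by (intro nn_integral_eq_integral) auto
      finally show ?thesis .
    qed
    from this[OF i(1)] this[OF i(2)] eq show ?thesis by (simp add: P_def N_def)
  qed
  have "density lborel (\<lambda>x. ennreal (P x)) = density lborel (\<lambda>x. ennreal (N x))"
  proof (rule measure_eqI_generator_eq)
    let ?E = "range (\<lambda>(a, b). box a b::plane set)"
    show "Int_stable ?E" by (auto simp: Int_stable_def box_Int_box)
    show "?E \<subseteq> Pow UNIV" "sets (density lborel (\<lambda>x. ennreal (P x))) = sigma_sets UNIV ?E"
      "sets (density lborel (\<lambda>x. ennreal (N x))) = sigma_sets UNIV ?E"
      by (simp_all add: borel_eq_box)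
    let ?A = "\<lambda>n::nat. box (- (real n *\<^sub>R One)) (real n *\<^sub>R One) :: plane set"
    show "range ?A \<subseteq> ?E" "(\<Union>i. ?A i) = UNIV"
      unfolding UN_box_eq_UNIV by auto
    show "emeasure (density lborel (\<lambda>x. ennreal (P x))) (?A i) \<noteq> \<infinity>" for i
    proof -
      have "emeasure (density lborel (\<lambda>x. ennreal (P x))) (?A i) \<le> (\<integral>\<^sup>+x. ennreal (P x) \<partial>lborel)"
        by (subst emeasure_density) (auto intro!: nn_integral_mono simp: indicator_def)
      also have "\<dots> = ennreal (LINT x|lborel. P x)"
        by (rule nn_integral_eq_integral[OF intP]) (simp add: P_def)
      also have "\<dots> < \<infinity>" by simp
      finally show ?thesis by simp
    qed
    show "emeasure (density lborel (\<lambda>x. ennreal (P x))) X = emeasure (density lborel (\<lambda>x. ennreal (N x))) X"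
      if "X \<in> ?E" for X using that em by auto
  qed
  then have "AE x in lborel. ennreal (P x) = ennreal (N x)"
    by (intro sigma_finite_measure.density_unique[OF lborel.sigma_finite_measure_axioms]) auto
  then show ?thesis
    by eventually_elim (auto simp: P_def N_def max_def split: if_splits)
qed

lemma indicator_box_measurable:
  fixes f :: "plane \<Rightarrow> real"
  shows "f \<in> borel_measurable lebesgue \<Longrightarrow> (\<lambda>x. indicator (box a b) x * f x) \<in> borel_measurable lebesgue"
  by (intro borel_measurable_times borel_measurable_indicator) auto

text \<open>Box bumps are test functions and converge to indicators of boxes, so \<open>d\<close>
  has integral 0 over every box whose closure lies in \<open>U\<close>. The box lemma applies
  locally, and countably many closed boxes exhaust \<open>U\<close>.\<close>

lemma fundamental_lemma:
  assumes U: "open U" and d: "locally_integrable U d"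
    and zero: "\<And>\<phi>. test_function U \<phi> \<Longrightarrow> (LINT x|lebesgue_on U. d x * \<phi> x) = 0"
  shows "AE x in lebesgue_on U. d x = 0"
proof -
  have Us: "U \<in> sets lebesgue" using U by (simp add: borel_open)
  have box0: "integrable lebesgue (\<lambda>x. indicator (box a b) x * d x)" 
      "(LINT x|lebesgue. indicator (box a b) x * d x) = 0" if ab: "cbox a b \<subseteq> U" for a b
  proof -
    have "integrable (lebesgue_on (cbox a b)) d"
      using d[unfolded locally_integrable_def, rule_format, of "cbox a b"] ab by simp
    then have "integrable lebesgue (\<lambda>x. if x \<in> cbox a b then d x else 0)"
      by (rule Lebesgue_Measure.integrable_restrict_UNIV[THEN iffD2, rotated]) simp
    moreover define E where "E x = (if x \<in> cbox a b then d x else 0)" for x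
    ultimately have iE: "integrable lebesgue E" by (simp add: E_def[abs_def])
    have [measurable]: "E \<in> borel_measurable lebesgue" using iE by blast
    have eqE: "(\<lambda>x. indicator (box a b) x * d x) = (\<lambda>x. indicator (box a b) x * E x)"
      using box_subset_cbox[of a b] by (auto simp: E_def indicator_def fun_eq_iff)
    show "integrable lebesgue (\<lambda>x. indicator (box a b) x * d x)"
      unfolding eqE using integrable_mult_indicator[OF _ iE, of "box a b"] by simp
    define \<phi> where "\<phi> n = box_bump (real (Suc n)) a b" for n
    have [measurable]: "\<phi> n \<in> borel_measurable borel" for n
      unfolding \<phi>_def by (intro continuous_on_UNIV_borel_measurable smooth_continuous_on smooth_box_bump)
    have [measurable]: "\<phi> n \<in> borel_measurable lebesgue" for n
      by (rule measurable_completion) simp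
    have "(LINT x|lebesgue. \<phi> n x * E x) = 0" for n
    proof -
      have "(LINT x|lebesgue. \<phi> n x * E x) = (LINT x|lebesgue. (if x \<in> U then d x * \<phi> n x else 0))"
        using ab box_subset_cbox[of a b] box_bump_eq_0_iff[of "real (Suc n)" a b]
        by (intro Bochner_Integration.integral_cong) (auto simp: E_def \<phi>_def)
      also have "\<dots> = (LINT x|lebesgue_on U. d x * \<phi> n x)"
        by (rule Lebesgue_Measure.integral_restrict_UNIV[OF Us])
      also have "\<dots> = 0"
        unfolding \<phi>_def by (intro zero test_function_box_bump ab) simp
      finally show ?thesis .
    qed
    moreover have "(\<lambda>n. LINT x|lebesgue. \<phi> n x * E x) \<longlonglongrightarrow> (LINT x|lebesgue. indicator (box a b) x * E x)"
    proof (rule integral_dominated_convergence[where w="\<lambda>x. \<bar>E x\<bar>"])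
      show "integrable lebesgue (\<lambda>x. \<bar>E x\<bar>)" using iE by simp
      show "AE x in lebesgue. (\<lambda>n. \<phi> n x * E x) \<longlonglongrightarrow> indicator (box a b) x * E x"
        unfolding \<phi>_def by (intro AE_I2 tendsto_mult box_bump_tendsto tendsto_const)
      show "AE x in lebesgue. norm (\<phi> n x * E x) \<le> \<bar>E x\<bar>" for n
        by (rule AE_I2) (auto simp: abs_mult \<phi>_def intro!: mult_left_le_one_le)
      show "(\<lambda>x. indicator (box a b) x * E x) \<in> borel_measurable lebesgue"
        using borel_measurable_integrable[OF integrable_mult_indicator[OF _ iE, of "box a b"]] by simp
    qed auto
    ultimately show "(LINT x|lebesgue. indicator (box a b) x * d x) = 0"
      unfolding eqE by (simp add: LIMSEQ_const_iff)
  qed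
  have ae_box: "AE x in lebesgue. x \<in> box p q \<longrightarrow> d x = 0" if pq: "cbox p q \<subseteq> U" for p q
  proof -
    note iD = box0(1)[OF pq]
    \<comment> \<open>The box lemma is about Borel functions, so the Lebesgue measurable integrand
      is replaced by a Borel function equal to it almost everywhere.\<close>
    from completion_ex_borel_measurable_real[OF borel_measurable_integrable[OF iD]]
    obtain D0 where [measurable]: "D0 \<in> borel_measurable lborel" and D0: "AE x in lborel. indicator (box p q) x * d x = D0 x"
      by auto
    note D0' = AE_completion[OF D0]
    have mD0: "D0 \<in> borel_measurable lebesgue" by (rule measurable_completion) simp
    have "integrable lebesgue D0"
      using integrable_cong_AE_imp[OF iD mD0] D0' by (simp add: eq_commute)
    then have "integrable lborel D0"
      by (subst (asm) integrable_completion) auto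
    moreover have "(LINT x|lborel. indicator (box a b) x * D0 x) = 0" for a b
    proof -
      have "(LINT x|lborel. indicator (box a b) x * D0 x) = (LINT x|lebesgue. indicator (box a b) x * D0 x)"
        by (rule integral_completion[symmetric]) measurable
      also have "\<dots> = (LINT x|lebesgue. indicator (box a b) x * (indicator (box p q) x * d x))"
        using D0' mD0 borel_measurable_integrable[OF iD] by (intro integral_cong_AE indicator_box_measurable[where a=a and b=b]) auto
      also have "\<dots> = (LINT x|lebesgue. indicator (box a b \<inter> box p q) x * d x)"
        by (simp add: indicator_inter_arith mult.assoc)
      also have "\<dots> = 0"
      \<comment> \<open>Only a nonempty intersection determines its closed box as a closure, and
        hence places that closed box inside \<open>U\<close>. An empty box has corners that say
        nothing about \<open>cbox a' b'\<close>.\<close>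
      proof (cases "box a b \<inter> box p q = {}")
        case False
        obtain a' b' where ab': "box a b \<inter> box p q = box a' b'" by (simp add: box_Int_box)
        have "cbox a' b' = closure (box a' b')" using False ab' by simp
        also have "\<dots> \<subseteq> cbox p q"
          using ab' box_subset_cbox[of p q] by (intro closure_minimal) auto
        finally show ?thesis using box0(2)[of a' b'] pq ab' by auto
      qed simp
      finally show ?thesis .
    qed
    ultimately have "AE x in lborel. D0 x = 0" by (rule AE_eq_zero_if_box_integrals)
    with D0 have "AE x in lborel. x \<in> box p q \<longrightarrow> d x = 0"
      by eventually_elim (auto simp: indicator_def)
    then show ?thesis by (rule AE_completion)
  qed
  have ae_cbox: "AE x in lebesgue. x \<in> cbox p q \<longrightarrow> d x = 0" if pq: "cbox p q \<subseteq> U" for p q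
  proof -
    have "AE x in lebesgue. x \<notin> cbox p q - box p q"
      by (rule AE_not_in) (use negligible_frontier_interval negligible_iff_null_sets in blast)
    with ae_box[OF pq] show ?thesis by eventually_elim auto
  qed
  obtain \<D> where \<D>: "countable \<D>" "\<D> \<subseteq> Pow U" "\<And>X. X \<in> \<D> \<Longrightarrow> \<exists>a b. X = cbox a b" "\<Union>\<D> = U"
    using open_countable_Union_open_cbox[OF U] by metis
  have "AE x in lebesgue. \<forall>X\<in>\<D>. x \<in> X \<longrightarrow> d x = 0"
  proof (subst AE_ball_countable[OF \<D>(1)], rule ballI)
    fix X assume "X \<in> \<D>"
    then obtain p q where "X = cbox p q" "cbox p q \<subseteq> U" using \<D> by blast
    then show "AE x in lebesgue. x \<in> X \<longrightarrow> d x = 0" using ae_cbox by simp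
  qed
  then have "AE x in lebesgue. x \<in> U \<longrightarrow> d x = 0"
    by eventually_elim (use \<D>(4) in auto)
  then show ?thesis
    using Us by (simp add: AE_restrict_space_iff)
qed

lemma sqint_locally_integrable:
  assumes "open U" "sqint_on U f"
  shows "locally_integrable U f"
  unfolding locally_integrable_def
proof (intro allI impI, elim conjE)
  fix S assume S: "compact S" "S \<subseteq> U"
  then have "S \<in> lmeasurable" by (simp add: lmeasurable_compact)
  then have "finite_measure (lebesgue_on S)" "S \<in> sets lebesgue"
    by (auto simp: finite_measure_lebesgue_on fmeasurableD)
  moreover have "sqint_on S f"
    using sqint_mono(1)[OF assms(2) S(2)] \<open>S \<in> sets lebesgue\<close> assms(1) by (simp add: borel_open)
  ultimately show "integrable (lebesgue_on S) f"
    using integral_square_le(1) by blast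
qed

section \<open>Mollification\<close>

lemma smoothing_kernel:
  assumes "\<delta> > 0"
  obtains \<rho> where "smooth \<rho>" "\<And>x. \<rho> x \<ge> 0" "\<And>x. norm x > \<delta> \<Longrightarrow> \<rho> x = 0" "(LINT x|lborel. \<rho> x) = 1"
proof -
  \<comment> \<open>Two coordinates of modulus at most \<delta>/2 keep the norm at most
    \<delta>.\<close>
  define a :: plane where "a = (\<chi> i. - (\<delta>/2))"
  define b :: plane where "b = (\<chi> i. \<delta>/2)"
  define \<beta> where "\<beta> = box_bump 1 a b"
  have sm: "smooth \<beta>" by (simp add: \<beta>_def smooth_box_bump)
  note cont = smooth_continuous_on[OF sm, of UNIV]
  have nz: "\<beta> x > 0 \<longleftrightarrow> x \<in> box a b" for x
    using box_bump_eq_0_iff[of 1 a b x] box_bump_nonneg[of 1 a b x] by (auto simp: \<beta>_def less_le)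
  have out: "\<beta> x = 0" if "norm x > \<delta>" for x
  proof -
    have "x \<notin> box a b"
    proof
      assume "x \<in> box a b"
      then have "\<bar>x$1\<bar> \<le> \<delta>/2" "\<bar>x$2\<bar> \<le> \<delta>/2" by (auto simp: mem_box_2 a_def b_def abs_if)
      then have "norm x \<le> \<delta>" using norm_le_l1_cart[of x] by (simp add: sum_2)
      with that show False by simp
    qed
    then show ?thesis using box_bump_eq_0_iff[of 1 a b x] by (simp add: \<beta>_def)
  qed
  have int: "integrable lborel \<beta>"
    by (rule integrable_lborel_compact_support[OF cont compact_cball[of 0 \<delta>]]) (use out in auto)
  have "(LINT x|lborel. \<beta> x) \<noteq> 0"
  proof
    assume "(LINT x|lborel. \<beta> x) = 0"
    then have "AE x in lborel. \<beta> x = 0"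
      using integral_nonneg_eq_0_iff_AE[OF int] by (simp add: \<beta>_def)
    then have "AE x in lborel. x \<notin> box a b" by eventually_elim (use nz in force)
    then have "negligible (box a b)"
      by (simp add: negligible_iff_null_sets AE_iff_null_sets AE_completion)
    moreover have "0 \<in> box a b" using assms by (simp add: mem_box_2 a_def b_def)
    ultimately show False using open_not_negligible[OF open_box] by blast
  qed
  moreover have "(LINT x|lborel. \<beta> x) \<ge> 0" by (simp add: \<beta>_def)
  ultimately have I: "(LINT x|lborel. \<beta> x) > 0" by linarith
  show ?thesis
  proof (rule that[of "\<lambda>x. (1 / (LINT x|lborel. \<beta> x)) * \<beta> x"])
    show "smooth (\<lambda>x. (1 / (LINT x|lborel. \<beta> x)) * \<beta> x)"
      by (intro smooth_mult smooth_const sm)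
  qed (use I out in \<open>auto simp: \<beta>_def\<close>)
qed

text \<open>The kernel is evaluated at \<open>y - x\<close> and not at \<open>x - y\<close>: as a
  function of \<open>y\<close> it is a translate of the kernel, and the minus sign from
  differentiating in \<open>x\<close> cancels the one in the definition of the weak
  gradient.\<close>

definition convol :: "(plane \<Rightarrow> real) \<Rightarrow> (plane \<Rightarrow> real) \<Rightarrow> plane \<Rightarrow> real" where
  "convol g \<rho> x = (LINT y|lborel. g y * \<rho> (y - x))"

lemma sqint_compact_support:
  fixes x :: plane
  assumes "continuous_on UNIV \<rho>" "\<And>x. norm x > \<delta> \<Longrightarrow> \<rho> x = 0"
  shows "sqint lborel (\<lambda>y. \<rho> (y - x) :: real)"
proof -
  have c: "continuous_on UNIV (\<lambda>y. \<rho> (y - x))"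
    by (rule continuous_on_compose2[OF assms(1)]) (auto intro!: continuous_intros)
  have "integrable lborel (\<lambda>y. (\<rho> (y - x))\<^sup>2)"
    by (rule integrable_lborel_compact_support[OF _ compact_cball[of x \<delta>]])
       (use assms(2) c in \<open>auto intro!: continuous_intros simp: dist_norm norm_minus_commute\<close>)
  then show ?thesis
    using continuous_on_UNIV_borel_measurable[OF c] by (simp add: sqint_def)
qed

lemma convol_integrable:
  fixes \<rho> :: "plane \<Rightarrow> real"
  assumes "sqint lborel g" "continuous_on UNIV \<rho>" "\<And>x. norm x > \<delta> \<Longrightarrow> \<rho> x = 0"
  shows "integrable lborel (\<lambda>y. g y * \<rho> (y - x))"
  by (rule sqint_mult_integrable[OF assms(1) sqint_compact_support[OF assms(2,3)]])

lemma smooth_compact_support_Lipschitz: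
  assumes "smooth \<rho>" "\<And>x. norm x > \<delta> \<Longrightarrow> \<rho> x = 0"
  obtains L where "L > 0" "\<And>x y. \<bar>\<rho> x - \<rho> y\<bar> \<le> L * norm (x - y)"
proof -
  have "test_function UNIV \<rho>"
    by (rule test_functionI[OF assms(1) compact_cball[of 0 \<delta>]]) (use assms in auto)
  then obtain S where S: "compact S" "\<And>x i. x \<notin> S \<Longrightarrow> partial_deriv i \<rho> x = 0"
    by (elim test_functionE) metis
  have "\<exists>M. M > 0 \<and> (\<forall>x. \<bar>partial_deriv i \<rho> x\<bar> \<le> M)" for i
    using continuous_compact_support_bounded[OF smooth_continuous_on[OF smooth_partial_deriv[OF assms(1)]] S] by metis
  then obtain M where M: "\<And>i. M i > 0" "\<And>i x. \<bar>partial_deriv i \<rho> x\<bar> \<le> M i" by metis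
  have "norm (\<rho> x - \<rho> y) \<le> (M 1 + M 2) * norm (x - y)" for x y
  proof (rule differentiable_bound[of UNIV \<rho> "\<lambda>x h. \<Sum>i\<in>UNIV. partial_deriv i \<rho> x * h $ i"])
    show "(\<rho> has_derivative (\<lambda>h. \<Sum>i\<in>UNIV. partial_deriv i \<rho> x * h $ i)) (at x within UNIV)" for x
      using smooth_has_grad[OF assms(1)] by simp
    show "onorm (\<lambda>h. \<Sum>i\<in>UNIV. partial_deriv i \<rho> x * h $ i) \<le> M 1 + M 2" for x
    proof (rule onorm_le)
      fix h :: plane
      have "norm (\<Sum>i\<in>UNIV. partial_deriv i \<rho> x * h $ i) \<le> (\<Sum>i\<in>UNIV. M i * norm h)"
        using M component_le_norm_cart[of h] 
        by (intro sum_norm_le) (auto simp: abs_mult intro!: mult_mono intro: less_imp_le)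
      then show "norm (\<Sum>i\<in>UNIV. partial_deriv i \<rho> x * h $ i) \<le> (M 1 + M 2) * norm h"
        by (simp add: sum_2 algebra_simps)
    qed
  qed auto
  then show ?thesis using that[of "M 1 + M 2"] M by (simp add: add_pos_pos)
qed

text \<open>The first order Taylor remainder of the kernel is bounded by a multiple of the squared
  increment and supported near \<open>x\<close>, and \<open>g\<close> is integrable there. So the
  error of the linear approximation is quadratic.\<close>

lemma convol_has_grad:
  assumes g: "sqint lborel g" and \<rho>: "smooth \<rho>" "\<And>x. norm x > \<delta> \<Longrightarrow> \<rho> x = 0"
  shows "has_grad (convol g \<rho>) (\<lambda>i. - convol g (partial_deriv i \<rho>) x) x"
proof -
  have tf: "test_function UNIV \<rho>"
    by (rule test_functionI[OF \<rho>(1) compact_cball[of 0 \<delta>]]) (use \<rho> in auto)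
  have out: "partial_deriv i \<rho> x = 0" if "norm x > \<delta>" for i x
  proof -
    have "has_grad \<rho> (\<lambda>i. 0) x"
      by (rule has_derivative_transform_within_open[where f="\<lambda>x. 0" and s="- cball 0 \<delta>"])
         (use that \<rho>(2) in auto)
    from partial_deriv_eq[OF this] show ?thesis .
  qed
  have "\<exists>L>0. \<forall>x y. \<bar>partial_deriv i \<rho> x - partial_deriv i \<rho> y\<bar> \<le> L * norm (x - y)" for i
    using smooth_compact_support_Lipschitz[OF smooth_partial_deriv[OF \<rho>(1)] out] by metis
  then obtain L where L: "\<And>i. L i > 0" "\<And>i x y. \<bar>partial_deriv i \<rho> x - partial_deriv i \<rho> y\<bar> \<le> L i * norm (x - y)"
    by metis
  \<comment> \<open>The Taylor remainder of the kernel at \<open>z\<close> for the increment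
    \<open>- h\<close>; moving \<open>x\<close> by \<open>h\<close> moves the argument
    \<open>y - x\<close> by \<open>- h\<close>.\<close>
  define R where "R z h = \<rho> (z - h) - \<rho> z + (\<Sum>i\<in>UNIV. partial_deriv i \<rho> z * h $ i)" for z h
  have R_le: "\<bar>R z h\<bar> \<le> (L 1 + L 2) * (norm h)\<^sup>2" for z h
  proof -
    have der: "((\<lambda>s. \<rho> (z + s *\<^sub>R (-h)) + s * (\<Sum>i\<in>UNIV. partial_deriv i \<rho> z * h $ i)) has_real_derivative
        (\<Sum>i\<in>UNIV. partial_deriv i \<rho> (z + s *\<^sub>R (-h)) * (-h) $ i) + (\<Sum>i\<in>UNIV. partial_deriv i \<rho> z * h $ i)) (at s)" for s
      by (intro DERIV_add line_has_real_derivative smooth_has_grad[OF \<rho>(1)]) (auto intro!: derivative_eq_intros)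
    obtain s where s: "0 < s" "s < 1" and Req: "R z h = 
        (\<Sum>i\<in>UNIV. partial_deriv i \<rho> (z + s *\<^sub>R (-h)) * (-h) $ i) + (\<Sum>i\<in>UNIV. partial_deriv i \<rho> z * h $ i)"
      using MVT2[OF zero_less_one der] by (auto simp: R_def)
    have "R z h = (\<Sum>i\<in>UNIV. (partial_deriv i \<rho> z - partial_deriv i \<rho> (z + s *\<^sub>R (-h))) * h $ i)"
      unfolding Req by (simp add: sum_2 algebra_simps)
    also have "\<bar>\<dots>\<bar> \<le> (\<Sum>i\<in>UNIV. (L i * norm h) * norm h)"
    proof (rule order_trans[OF sum_abs sum_mono])
      fix i :: 2
      have "norm (z - (z + s *\<^sub>R (-h))) \<le> 1 * norm h"
        using s by (auto intro: mult_left_le_one_le)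
      then have "\<bar>partial_deriv i \<rho> z - partial_deriv i \<rho> (z + s *\<^sub>R (-h))\<bar> \<le> L i * norm h"
        using L(2)[of i z "z + s *\<^sub>R (-h)"] L(1)[of i] by (smt (verit) mult_left_mono mult_cancel_right1)
      then show "\<bar>(partial_deriv i \<rho> z - partial_deriv i \<rho> (z + s *\<^sub>R (-h))) * h $ i\<bar> \<le> (L i * norm h) * norm h"
        unfolding abs_mult using component_le_norm_cart[of h i] L(1)[of i]
        by (intro mult_mono) auto
    qed
    finally show ?thesis by (simp add: sum_2 power2_eq_square algebra_simps)
  qed
  have R_out: "R z h = 0" if "norm h \<le> 1" "norm z > \<delta> + 1" for z h
  proof -
    have "norm (z - h) > \<delta>" using norm_triangle_ineq2[of z h] that by linarith
    then show ?thesis using that out \<rho>(2) by (simp add: R_def)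
  qed
  note cont\<rho> = smooth_continuous_on[OF \<rho>(1), of UNIV]
  note cont\<rho>' = smooth_continuous_on[OF smooth_partial_deriv[OF \<rho>(1)], of UNIV]
  \<comment> \<open>The radius \<delta> + 1 covers the supports of all remainders with increment of
    norm at most 1.\<close>
  define K where "K = (LINT y|lborel. \<bar>indicator (cball x (\<delta> + 1)) y * g y\<bar>)"
  have intK: "integrable lborel (\<lambda>y. indicator (cball x (\<delta> + 1)) y * g y)"
  proof (rule sqint_mult_integrable[OF _ g])
    have "(\<lambda>y. (indicat_real (cball x (\<delta> + 1)) y)\<^sup>2) = indicator (cball x (\<delta> + 1))"
      by (auto simp: indicator_def fun_eq_iff)
    then show "sqint lborel (indicat_real (cball x (\<delta> + 1)))"
      using borel_integrable_compact[OF compact_cball continuous_on_const, of x "\<delta> + 1" "1::real"]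
      unfolding sqint_def real_scaleR_def mult_1_right by auto
  qed
  have err: "\<bar>convol g \<rho> y - convol g \<rho> x - (\<Sum>i\<in>UNIV. - convol g (partial_deriv i \<rho>) x * (y - x) $ i)\<bar>
      \<le> K * (L 1 + L 2) * (norm (y - x))\<^sup>2" if "norm (y - x) \<le> 1" for y
  proof -
    define h where "h = y - x"
    have i1: "integrable lborel (\<lambda>y. g y * \<rho> (y - (x + h)))" "integrable lborel (\<lambda>y. g y * \<rho> (y - x))"
      and i2: "integrable lborel (\<lambda>y. g y * partial_deriv i \<rho> (y - x))" for i
      by (rule convol_integrable[OF g cont\<rho> \<rho>(2)] convol_integrable[OF g cont\<rho>' out], assumption)+
    have e: "convol g \<rho> (x + h) - convol g \<rho> x - (\<Sum>i\<in>UNIV. - convol g (partial_deriv i \<rho>) x * h $ i)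
      = (LINT y|lborel. g y * R (y - x) h)"
    proof -
      have "(LINT y|lborel. g y * R (y - x) h) = (LINT y|lborel. g y * \<rho> (y - (x + h)) - g y * \<rho> (y - x)
         + (g y * partial_deriv 1 \<rho> (y - x) * h $ 1 + g y * partial_deriv 2 \<rho> (y - x) * h $ 2))"
        by (rule Bochner_Integration.integral_cong) (auto simp: R_def sum_2 algebra_simps)
      also have "\<dots> = convol g \<rho> (x + h) - convol g \<rho> x +
         (convol g (partial_deriv 1 \<rho>) x * h $ 1 + convol g (partial_deriv 2 \<rho>) x * h $ 2)"
        unfolding convol_def using i1 i2[of 1] i2[of 2] by simp
      finally show ?thesis by (simp add: sum_2)
    qed
    have [measurable]: "g \<in> borel_measurable borel" using g by (simp add: sqint_def)
    have bound: "\<bar>g z * R (z - x) h\<bar> \<le> \<bar>indicator (cball x (\<delta> + 1)) z * g z\<bar> * ((L 1 + L 2) * (norm h)\<^sup>2)" for z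
      using R_le[of "z - x" h] R_out[of h "z - x"] that
      by (auto simp: indicator_def abs_mult h_def dist_norm norm_minus_commute intro!: mult_left_mono)
    have iR: "integrable lborel (\<lambda>y. g y * R (y - x) h)"
    proof -
      have "(\<lambda>y. g y * R (y - x) h) = (\<lambda>y. g y * \<rho> (y - (x + h)) - g y * \<rho> (y - x)
         + (g y * partial_deriv 1 \<rho> (y - x) * h $ 1 + g y * partial_deriv 2 \<rho> (y - x) * h $ 2))"
        by (auto simp: R_def sum_2 algebra_simps)
      then show ?thesis using i1 i2 by simp
    qed
    have "\<bar>LINT y|lborel. g y * R (y - x) h\<bar> \<le> (LINT y|lborel. \<bar>g y * R (y - x) h\<bar>)"
      by (rule integral_abs_bound)
    also have "\<dots> \<le> (LINT y|lborel. \<bar>indicator (cball x (\<delta> + 1)) y * g y\<bar> * ((L 1 + L 2) * (norm h)\<^sup>2))"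
      by (rule integral_mono) (use iR intK bound in auto)
    also have "\<dots> = K * (L 1 + L 2) * (norm h)\<^sup>2"
      unfolding K_def by (simp add: mult.assoc)
    finally show ?thesis using e by (simp add: h_def)
  qed
  show ?thesis
  proof (rule has_derivativeI_sandwich[of 1 _ _ _ _ "\<lambda>y. K * (L 1 + L 2) * norm (y - x)"])
    show "bounded_linear (\<lambda>h. \<Sum>i\<in>UNIV. - convol g (partial_deriv i \<rho>) x * h $ i)"
      by (intro bounded_linear_sum bounded_linear_mult_right[THEN bounded_linear_compose] bounded_linear_vec_nth)
    show "((\<lambda>y. K * (L 1 + L 2) * norm (y - x)) \<longlongrightarrow> 0) (at x)"
    proof -
      have "((\<lambda>y. K * (L 1 + L 2) * norm (y - x)) \<longlongrightarrow> K * (L 1 + L 2) * norm (x - x)) (at x)"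
        by (intro tendsto_intros)
      then show ?thesis by simp
    qed
    show "norm (convol g \<rho> y - convol g \<rho> x - (\<Sum>i\<in>UNIV. - convol g (partial_deriv i \<rho>) x * (y - x) $ i)) / norm (y - x)
        \<le> K * (L 1 + L 2) * norm (y - x)" if "y \<noteq> x" "dist y x < 1" for y
      using err[of y] that by (simp add: dist_norm divide_le_eq power2_eq_square mult.assoc)
  qed simp
qed

lemma convol_continuous:
  assumes "sqint lborel g" "smooth \<rho>" "\<And>x. norm x > \<delta> \<Longrightarrow> \<rho> x = 0"
  shows "continuous_on S (convol g \<rho>)"
  by (intro continuous_at_imp_continuous_on ballI) (rule has_derivative_continuous[OF convol_has_grad[OF assms]])

text \<open>The kernel is a probability density, so the integral of (g - c)^2 against it, with
  \<open>c\<close> the mean, is nonnegative; this bounds the squared mean by the mean of the square.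
  Tonelli's theorem then gives the norm bound with constant 1.\<close>

lemma convol_Young:
  assumes g: "sqint lborel g" and \<rho>: "smooth \<rho>" "\<And>x. norm x > \<delta> \<Longrightarrow> \<rho> x = 0" "\<And>x. \<rho> x \<ge> 0" "(LINT x|lborel. \<rho> x) = 1"
  shows "sqint lborel (convol g \<rho>)" "sqnorm lborel (convol g \<rho>) \<le> sqnorm lborel g"
proof -
  have [measurable]: "g \<in> borel_measurable borel" using g by (simp add: sqint_def)
  note cont\<rho> = smooth_continuous_on[OF \<rho>(1), of UNIV]
  have [measurable]: "\<rho> \<in> borel_measurable borel" by (rule continuous_on_UNIV_borel_measurable[OF cont\<rho>])
  have int\<rho>: "integrable lborel \<rho>"
    by (rule integrable_lborel_compact_support[OF cont\<rho> compact_cball[of 0 \<delta>]]) (use \<rho> in auto)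
  obtain M where M: "M > 0" "\<And>x. \<bar>\<rho> x\<bar> \<le> M"
    using continuous_compact_support_bounded[OF cont\<rho> compact_cball[of 0 \<delta>]] \<rho>(2) by (metis dist_0_norm linorder_not_less mem_cball)
  have one: "(LINT y|lborel. \<rho> (y - x)) = 1" "integrable lborel (\<lambda>y. \<rho> (y - x))" for x
    using integral_lborel_translate[of \<rho> "- x"] int\<rho> \<rho>(4) by simp_all
  have i2: "integrable lborel (\<lambda>y. (g y)\<^sup>2 * \<rho> (y - x))" for x
  proof (rule Bochner_Integration.integrable_bound)
    show "integrable lborel (\<lambda>y. M * (g y)\<^sup>2)" using g by (simp add: sqint_def)
    show "AE y in lborel. norm ((g y)\<^sup>2 * \<rho> (y - x)) \<le> norm (M * (g y)\<^sup>2)"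
      using M by (auto simp: abs_mult mult.commute intro!: mult_right_mono)
  qed auto
  have pw: "(convol g \<rho> x)\<^sup>2 \<le> (LINT y|lborel. (g y)\<^sup>2 * \<rho> (y - x))" for x
  proof -
    define c where "c = convol g \<rho> x"
    have i1: "integrable lborel (\<lambda>y. g y * \<rho> (y - x))" by (rule convol_integrable[OF g cont\<rho> \<rho>(2)])
    have "0 \<le> (LINT y|lborel. (g y - c)\<^sup>2 * \<rho> (y - x))" using \<rho>(3) by simp
    also have "\<dots> = (LINT y|lborel. (g y)\<^sup>2 * \<rho> (y - x) - 2 * c * (g y * \<rho> (y - x)) + c\<^sup>2 * \<rho> (y - x))"
      by (rule Bochner_Integration.integral_cong) (auto simp: power2_eq_square algebra_simps)
    also have "\<dots> = (LINT y|lborel. (g y)\<^sup>2 * \<rho> (y - x)) - 2 * c * c + c\<^sup>2"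
      using i1 i2 one by (simp add: c_def convol_def)
    finally show ?thesis by (simp add: c_def power2_eq_square)
  qed
  have "(\<integral>\<^sup>+x. ennreal ((convol g \<rho> x)\<^sup>2) \<partial>lborel) \<le> (\<integral>\<^sup>+x. (\<integral>\<^sup>+y. ennreal ((g y)\<^sup>2 * \<rho> (y - x)) \<partial>lborel) \<partial>lborel)"
  proof (rule nn_integral_mono)
    fix x
    have "ennreal ((convol g \<rho> x)\<^sup>2) \<le> ennreal (LINT y|lborel. (g y)\<^sup>2 * \<rho> (y - x))"
      using pw by (rule ennreal_leI)
    also have "\<dots> = (\<integral>\<^sup>+y. ennreal ((g y)\<^sup>2 * \<rho> (y - x)) \<partial>lborel)"
      using i2 \<rho>(3) by (intro nn_integral_eq_integral[symmetric]) auto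
    finally show "ennreal ((convol g \<rho> x)\<^sup>2) \<le> (\<integral>\<^sup>+y. ennreal ((g y)\<^sup>2 * \<rho> (y - x)) \<partial>lborel)" .
  qed
  also have "\<dots> = (\<integral>\<^sup>+y. (\<integral>\<^sup>+x. ennreal ((g y)\<^sup>2 * \<rho> (y - x)) \<partial>lborel) \<partial>lborel)"
    by (rule lborel_pair.Fubini') measurable
  also have "\<dots> = (\<integral>\<^sup>+y. ennreal ((g y)\<^sup>2) * (\<integral>\<^sup>+x. ennreal (\<rho> (y - x)) \<partial>lborel) \<partial>lborel)"
    using \<rho>(3) by (simp add: ennreal_mult nn_integral_cmult)
  also have "\<dots> = (\<integral>\<^sup>+y. ennreal ((g y)\<^sup>2) * (\<integral>\<^sup>+x. ennreal (\<rho> x) \<partial>lborel) \<partial>lborel)"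
    using nn_integral_lborel_reflect[of "\<lambda>x. ennreal (\<rho> x)"] by simp
  also have "\<dots> = ennreal (sqnorm lborel g)"
    using int\<rho> \<rho> sqnorm_nn_integral[OF g] by (simp add: nn_integral_eq_integral)
  finally have le: "(\<integral>\<^sup>+x. ennreal ((convol g \<rho> x)\<^sup>2) \<partial>lborel) \<le> ennreal (sqnorm lborel g)" .
  have "convol g \<rho> \<in> borel_measurable lborel"
    using continuous_on_UNIV_borel_measurable[OF convol_continuous[OF g \<rho>(1,2)]] by simp
  from sqint_nn_integralI[OF this le] 
  show "sqint lborel (convol g \<rho>)" "sqnorm lborel (convol g \<rho>) \<le> sqnorm lborel g" by auto
qed

lemma sqint_lebesgue_lborel:
  assumes "f \<in> borel_measurable borel"
  shows "sqint lebesgue f \<longleftrightarrow> sqint lborel f" "sqnorm lebesgue f = sqnorm lborel f"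
proof -
  have [measurable]: "f \<in> borel_measurable lborel" using assms by simp
  have "f \<in> borel_measurable lebesgue" by (rule measurable_completion) simp
  then show "sqint lebesgue f \<longleftrightarrow> sqint lborel f"
    using assms by (simp add: sqint_def integrable_completion)
  show "sqnorm lebesgue f = sqnorm lborel f"
    by (rule integral_completion) measurable
qed

lemma sqint_truncation:
  fixes g :: "'a::euclidean_space \<Rightarrow> real"
  assumes g: "sqint lebesgue g" and e: "e > 0"
  obtains k :: nat where "sqnorm lebesgue (\<lambda>x. g x - (if norm x \<le> k \<and> \<bar>g x\<bar> \<le> k then g x else 0)) \<le> e"
    "sqint lebesgue (\<lambda>x. if norm x \<le> k \<and> \<bar>g x\<bar> \<le> k then g x else 0)"
proof -
  have [measurable]: "g \<in> borel_measurable lebesgue" using g by (simp add: sqint_def)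
  have [measurable]: "norm \<in> borel_measurable (lebesgue :: 'a measure)"
    by (rule measurable_completion) simp
  define t where "t = (\<lambda>(k::nat) x. if norm x \<le> k \<and> \<bar>g x\<bar> \<le> k then g x else 0)"
  have [measurable]: "t k \<in> borel_measurable lebesgue" for k
    unfolding t_def by measurable
  have tg: "(t k x)\<^sup>2 \<le> (g x)\<^sup>2" "(g x - t k x)\<^sup>2 \<le> (g x)\<^sup>2" for k x by (auto simp: t_def)
  have sq: "sqint lebesgue (t k)" for k
    unfolding sqint_def
    by (intro conjI Bochner_Integration.integrable_bound[OF sqint_integrable[OF g]]) (use tg in auto)
  have "(\<lambda>k. sqnorm lebesgue (\<lambda>x. g x - t k x)) \<longlonglongrightarrow> (LINT x|(lebesgue::'a measure). 0::real)"
  proof (rule integral_dominated_convergence[OF _ _ sqint_integrable[OF g]])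
    show "AE x in lebesgue. (\<lambda>k. (g x - t k x)\<^sup>2) \<longlonglongrightarrow> 0"
    proof (rule AE_I2)
      fix x
      obtain k0 :: nat where k0: "norm x \<le> k0" "\<bar>g x\<bar> \<le> k0"
        using real_arch_simple[of "max (norm x) \<bar>g x\<bar>"] by auto
      have "\<forall>\<^sub>F k in sequentially. (g x - t k x)\<^sup>2 = 0"
        using eventually_ge_at_top[of k0] by eventually_elim (use k0 in \<open>auto simp: t_def\<close>)
      then show "(\<lambda>k. (g x - t k x)\<^sup>2) \<longlonglongrightarrow> 0" by (rule tendsto_eventually)
    qed
  qed (use tg in auto)
  then have "\<forall>\<^sub>F k in sequentially. sqnorm lebesgue (\<lambda>x. g x - t k x) < e"
    by (intro order_tendstoD) (use e in auto)
  then obtain k where "sqnorm lebesgue (\<lambda>x. g x - t k x) < e"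
    by (auto simp: eventually_sequentially)
  with sq[of k] show ?thesis using that[of k] by (simp add: t_def less_imp_le)
qed

text \<open>The truncation is an almost everywhere limit of continuous functions. Clamping these to
  [-k, k] and multiplying by a continuous cutoff does not change the limit and gives an integrable
  dominating function.\<close>

lemma sqint_continuous_approx:
  fixes g :: "'a::euclidean_space \<Rightarrow> real"
  assumes g: "sqint lebesgue g" and e: "e > 0"
  obtains \<gamma> S where "continuous_on UNIV \<gamma>" "compact S" "\<And>x. x \<notin> S \<Longrightarrow> \<gamma> x = 0" "sqint lebesgue \<gamma>"
    "sqnorm lebesgue (\<lambda>x. g x - \<gamma> x) \<le> e"
proof -
  obtain k :: nat where k: "sqnorm lebesgue (\<lambda>x. g x - (if norm x \<le> k \<and> \<bar>g x\<bar> \<le> k then g x else 0)) \<le> e/4"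
    "sqint lebesgue (\<lambda>x. if norm x \<le> k \<and> \<bar>g x\<bar> \<le> k then g x else 0)"
    using sqint_truncation[OF g, of "e/4"] e by auto
  define h where "h x = (if norm x \<le> k \<and> \<bar>g x\<bar> \<le> k then g x else 0)" for x
  have h: "sqnorm lebesgue (\<lambda>x. g x - h x) \<le> e/4" "sqint lebesgue h"
    using k by (auto simp: h_def[abs_def])
  have hb: "\<bar>h x\<bar> \<le> k" "norm x > k \<Longrightarrow> h x = 0" for x by (auto simp: h_def)
  have "h measurable_on UNIV"
    using h(2) by (subst measurable_on_iff_borel_measurable) (auto simp: sqint_def lebesgue_on_UNIV_eq)
  then obtain N c where N: "negligible N" and c: "\<And>n. continuous_on UNIV (c n)"
    and lim: "\<And>x. x \<notin> N \<Longrightarrow> (\<lambda>n. c n x) \<longlonglongrightarrow> h x"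
    unfolding measurable_on_def by auto
  \<comment> \<open>A cutoff equal to 1 on the ball of radius \<open>k\<close>, where the truncation
    lives, and 0 beyond radius \<open>k + 1\<close>.\<close>
  define ct where "ct x = max 0 (min 1 (real k + 1 - norm x))" for x :: 'a
  define \<Gamma> where "\<Gamma> n x = ct x * max (- real k) (min (real k) (c n x))" for n x
  have ct: "0 \<le> ct x" "ct x \<le> 1" "norm x \<le> k \<Longrightarrow> ct x = 1" "norm x > real k + 1 \<Longrightarrow> ct x = 0" for x
    by (auto simp: ct_def)
  have cont: "continuous_on UNIV (\<Gamma> n)" for n
    unfolding \<Gamma>_def ct_def by (intro continuous_intros c)
  have supp: "x \<notin> cball 0 (real k + 1) \<Longrightarrow> \<Gamma> n x = 0" for n x
    using ct(4)[of x] by (simp add: \<Gamma>_def)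
  have b: "\<bar>\<Gamma> n x\<bar> \<le> k" for n x
  proof -
    have "\<bar>\<Gamma> n x\<bar> \<le> 1 * real k"
      unfolding \<Gamma>_def abs_mult using ct(1,2)[of x] by (intro mult_mono) auto
    then show ?thesis by simp
  qed
  have bm: "\<Gamma> n \<in> borel_measurable borel" for n by (rule continuous_on_UNIV_borel_measurable[OF cont])
  have sqG: "sqint lebesgue (\<Gamma> n)" for n
  proof -
    have "integrable lborel (\<lambda>x. (\<Gamma> n x)\<^sup>2)"
      by (rule integrable_lborel_compact_support[OF _ compact_cball[of 0 "real k + 1"]])
         (use cont supp in \<open>auto intro!: continuous_intros\<close>)
    then have "sqint lborel (\<Gamma> n)" using bm[of n] by (simp add: sqint_def)
    then show ?thesis unfolding sqint_lebesgue_lborel(1)[OF bm] .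
  qed
  have mh: "h \<in> borel_measurable lebesgue" and mG: "\<Gamma> n \<in> borel_measurable lebesgue" for n
    using h(2) sqG by (auto simp: sqint_def)
  have "(\<lambda>n. sqnorm lebesgue (\<lambda>x. h x - \<Gamma> n x)) \<longlonglongrightarrow> (LINT x|(lebesgue::'a measure). 0::real)"
  proof (rule integral_dominated_convergence[where w="\<lambda>x. (2 * real k)\<^sup>2 * indicator (cball 0 (real k + 1)) x"])
    have "integrable lborel (\<lambda>x. indicator (cball (0::'a) (real k + 1)) x *\<^sub>R (2 * real k)\<^sup>2)"
      by (rule borel_integrable_compact) auto
    then show "integrable lebesgue (\<lambda>x. (2 * real k)\<^sup>2 * indicator (cball (0::'a) (real k + 1)) x)"
      by (subst integrable_completion) (auto simp: mult.commute)
    show "AE x in lebesgue. (\<lambda>n. (h x - \<Gamma> n x)\<^sup>2) \<longlonglongrightarrow> 0"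
    proof -
      have "AE x in lebesgue. x \<notin> N" using N by (intro AE_not_in) (simp add: negligible_iff_null_sets)
      then show ?thesis
      proof eventually_elim
        case (elim x)
        have "(\<lambda>n. (h x - \<Gamma> n x)\<^sup>2) \<longlonglongrightarrow> (h x - ct x * max (- real k) (min (real k) (h x)))\<^sup>2"
          unfolding \<Gamma>_def by (intro tendsto_intros lim elim)
        moreover have "ct x * max (- real k) (min (real k) (h x)) = h x"
        proof (cases "norm x \<le> k")
          case True then show ?thesis using ct(3)[of x] hb(1)[of x] by (simp add: max_def min_def abs_le_iff)
        next
          case False then show ?thesis using hb(2)[of x] by simp
        qed
        ultimately show ?case by simp
      qed
    qed
    show "AE x in lebesgue. norm ((h x - \<Gamma> n x)\<^sup>2) \<le> (2 * real k)\<^sup>2 * indicator (cball 0 (real k + 1)) x" for n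
    proof (rule AE_I2)
      fix x :: 'a
      show "norm ((h x - \<Gamma> n x)\<^sup>2) \<le> (2 * real k)\<^sup>2 * indicator (cball 0 (real k + 1)) x"
      proof (cases "x \<in> cball 0 (real k + 1)")
        case True
        have "\<bar>h x - \<Gamma> n x\<bar> \<le> \<bar>2 * real k\<bar>" using b[of n x] hb(1)[of x] by linarith
        then show ?thesis using True by (simp only: abs_le_square_iff) simp
      next
        case False then show ?thesis using supp[OF False, of n] hb(2)[of x] by simp
      qed
    qed
    show "(\<lambda>x. (h x - \<Gamma> n x)\<^sup>2) \<in> borel_measurable lebesgue" for n
      using mh mG[of n] by auto
  qed simp
  then have "\<forall>\<^sub>F n in sequentially. sqnorm lebesgue (\<lambda>x. h x - \<Gamma> n x) < e/4"
    by (intro order_tendstoD) (use e in auto)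
  then obtain n where n: "sqnorm lebesgue (\<lambda>x. h x - \<Gamma> n x) < e/4"
    by (auto simp: eventually_sequentially)
  have "sqnorm lebesgue (\<lambda>x. (g x - h x) + (h x - \<Gamma> n x)) \<le> 
      2 * sqnorm lebesgue (\<lambda>x. g x - h x) + 2 * sqnorm lebesgue (\<lambda>x. h x - \<Gamma> n x)"
    by (intro sqnorm_add_le sqint_diff g h sqG)
  with n h(1) have "sqnorm lebesgue (\<lambda>x. g x - \<Gamma> n x) \<le> e" by simp
  then show ?thesis using that[OF cont compact_cball supp sqG] by blast
qed

lemma sqnorm_lebesgue_on_le:
  fixes f :: "'a::euclidean_space \<Rightarrow> real"
  assumes "sqint lebesgue f" "S \<in> sets lebesgue"
  shows "sqint_on S f" "sqnorm_on S f \<le> sqnorm lebesgue f"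
  using sqint_mono[of UNIV f S] assms by (auto simp: lebesgue_on_UNIV_eq)

text \<open>Split \<open>g\<close> into a continuous function of compact support, on which uniform
  continuity acts, and a small remainder, which convolution does not enlarge. The threshold is
  chosen before the kernel, so that one kernel can serve a function and both its
  derivatives.\<close>

lemma convol_approximates:
  assumes g: "sqint lborel g" and C: "compact C" and e: "e > 0"
  obtains \<delta>\<^sub>0 where "\<delta>\<^sub>0 > 0"
    "\<And>\<rho> \<delta>. \<lbrakk>smooth \<rho>; \<And>x. \<rho> x \<ge> 0; \<And>x. norm x > \<delta> \<Longrightarrow> \<rho> x = 0; (LINT x|lborel. \<rho> x) = 1; \<delta> \<le> \<delta>\<^sub>0\<rbrakk>
      \<Longrightarrow> sqnorm_on C (\<lambda>x. convol g \<rho> x - g x) \<le> e"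
proof -
  have mg: "g \<in> borel_measurable borel" using g by (simp add: sqint_def)
  have gl: "sqint lebesgue g" using g sqint_lebesgue_lborel[OF mg] by simp
  have Cm: "C \<in> lmeasurable" using C by (simp add: lmeasurable_compact)
  then have Cs: "C \<in> sets lebesgue" by (rule fmeasurableD)
  obtain \<gamma> S where \<gamma>: "continuous_on UNIV \<gamma>" "compact S" "\<And>x. x \<notin> S \<Longrightarrow> \<gamma> x = 0" "sqint lebesgue \<gamma>"
    and app: "sqnorm lebesgue (\<lambda>x. g x - \<gamma> x) \<le> e/12"
    using sqint_continuous_approx[OF gl, of "e/12"] e by auto
  have m\<gamma>: "\<gamma> \<in> borel_measurable borel" by (rule continuous_on_UNIV_borel_measurable[OF \<gamma>(1)])
  have \<gamma>b: "sqint lborel \<gamma>" using \<gamma>(4) sqint_lebesgue_lborel[OF m\<gamma>] by simp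
  define r where "r x = g x - \<gamma> x" for x
  have r: "sqint lborel r" unfolding r_def using g \<gamma>b by (rule sqint_diff)
  have mr: "r \<in> borel_measurable borel" using r by (simp add: sqint_def)
  have rl: "sqint lebesgue r" "sqnorm lebesgue r \<le> e/12" "sqnorm lborel r \<le> e/12"
    using r app sqint_lebesgue_lborel[OF mr] by (auto simp: r_def[abs_def])
  \<comment> \<open>Chosen so that a pointwise error \<open>\<eta>\<close> contributes at most e/6
    over \<open>C\<close>; the added 1 avoids division by 0. With e/12 for the two remainder terms,
    the doubling in each triangle inequality brings the total to \<open>e\<close>.\<close>
  define \<eta> where "\<eta> = sqrt (e / (6 * (measure lebesgue C + 1)))"
  have \<eta>: "\<eta> > 0" "\<eta>\<^sup>2 * measure lebesgue C \<le> e/6"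
  proof -
    show "\<eta> > 0" using e by (simp add: \<eta>_def add_nonneg_pos)
    have "\<eta>\<^sup>2 = e / (6 * (measure lebesgue C + 1))" unfolding \<eta>_def using e by simp
    moreover have "measure lebesgue C + 1 > 0" by (simp add: add_nonneg_pos)
    ultimately have "\<eta>\<^sup>2 * (measure lebesgue C + 1) = e/6" by (simp add: divide_simps) (simp add: algebra_simps)
    moreover have "\<eta>\<^sup>2 * measure lebesgue C \<le> \<eta>\<^sup>2 * (measure lebesgue C + 1)" by (intro mult_left_mono) auto
    ultimately show "\<eta>\<^sup>2 * measure lebesgue C \<le> e/6" by simp
  qed
  \<comment> \<open>The closed 1-neighbourhood of \<open>C\<close>, compact, so that the uniform
    continuity holds at all points the kernel can reach from \<open>C\<close>.\<close>
  define C' where "C' = {x + y | x y. x \<in> C \<and> y \<in> cball 0 (1::real)}"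
  have "compact C'" unfolding C'_def by (rule compact_sums[OF C compact_cball])
  then have "uniformly_continuous_on C' \<gamma>"
    using \<gamma>(1) by (meson compact_uniformly_continuous continuous_on_subset subset_UNIV)
  then obtain \<delta>\<^sub>1 where \<delta>\<^sub>1: "\<delta>\<^sub>1 > 0" "\<And>x y. x \<in> C' \<Longrightarrow> y \<in> C' \<Longrightarrow> dist y x < \<delta>\<^sub>1 \<Longrightarrow> dist (\<gamma> y) (\<gamma> x) < \<eta>"
    unfolding uniformly_continuous_on_def using \<eta>(1) by metis
  show ?thesis
  proof (rule that[of "min 1 (\<delta>\<^sub>1/2)"])
    show "min 1 (\<delta>\<^sub>1 / 2) > 0" using \<delta>\<^sub>1 by simp
    fix \<rho> \<delta> assume \<rho>: "smooth \<rho>" "\<And>x. \<rho> x \<ge> 0" "\<And>x. norm x > \<delta> \<Longrightarrow> \<rho> x = 0" "(LINT x|lborel. \<rho> x) = 1"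
      and \<delta>: "\<delta> \<le> min 1 (\<delta>\<^sub>1 / 2)"
    note cont\<rho> = smooth_continuous_on[OF \<rho>(1), of UNIV]
    have m\<rho>: "\<rho> \<in> borel_measurable borel" by (rule continuous_on_UNIV_borel_measurable[OF cont\<rho>])
    have int\<rho>: "integrable lborel \<rho>"
      by (rule integrable_lborel_compact_support[OF cont\<rho> compact_cball[of 0 \<delta>]]) (use \<rho> in auto)
    have one: "(LINT y|lborel. \<rho> (y - x)) = 1" "integrable lborel (\<lambda>y. \<rho> (y - x))" for x
      using integral_lborel_translate[OF m\<rho>, of "- x"] int\<rho> \<rho>(4) by simp_all
    have split: "convol g \<rho> x = convol r \<rho> x + convol \<gamma> \<rho> x" for x
    proof -
      have "convol r \<rho> x + convol \<gamma> \<rho> x = (LINT y|lborel. r y * \<rho> (y - x) + \<gamma> y * \<rho> (y - x))"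
        unfolding convol_def
        by (rule Bochner_Integration.integral_add[symmetric]) (rule convol_integrable[OF r cont\<rho> \<rho>(3)] convol_integrable[OF \<gamma>b cont\<rho> \<rho>(3)]; assumption)+
      then show ?thesis by (simp add: convol_def r_def algebra_simps)
    qed
    have Y: "sqint lborel (convol r \<rho>)" "sqnorm lborel (convol r \<rho>) \<le> sqnorm lborel r"
      using convol_Young[OF r \<rho>(1,3,2,4)] by auto
    have mY: "convol r \<rho> \<in> borel_measurable borel" using Y by (simp add: sqint_def)
    have Y': "sqint lebesgue (convol r \<rho>)" "sqnorm lebesgue (convol r \<rho>) \<le> e/12"
      using Y rl(3) sqint_lebesgue_lborel[OF mY] by auto
    have near: "\<bar>convol \<gamma> \<rho> x - \<gamma> x\<bar> \<le> \<eta>" if "x \<in> C" for x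
    proof -
      have i: "integrable lborel (\<lambda>y. \<gamma> y * \<rho> (y - x))" by (rule convol_integrable[OF \<gamma>b cont\<rho> \<rho>(3)])
      have "convol \<gamma> \<rho> x - \<gamma> x = (LINT y|lborel. \<gamma> y * \<rho> (y - x)) - (LINT y|lborel. \<gamma> x * \<rho> (y - x))"
        using one[of x] by (simp add: convol_def)
      also have "\<dots> = (LINT y|lborel. \<gamma> y * \<rho> (y - x) - \<gamma> x * \<rho> (y - x))"
        using i one[of x] by simp
      also have "\<bar>\<dots>\<bar> \<le> (LINT y|lborel. \<bar>\<gamma> y * \<rho> (y - x) - \<gamma> x * \<rho> (y - x)\<bar>)"
        by (rule integral_abs_bound)
      also have "\<dots> \<le> (LINT y|lborel. \<eta> * \<rho> (y - x))"
      proof (rule integral_mono)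
        show "integrable lborel (\<lambda>y. \<bar>\<gamma> y * \<rho> (y - x) - \<gamma> x * \<rho> (y - x)\<bar>)" using i one[of x] by auto
        show "integrable lborel (\<lambda>y. \<eta> * \<rho> (y - x))" using one[of x] by auto
        fix y
        show "\<bar>\<gamma> y * \<rho> (y - x) - \<gamma> x * \<rho> (y - x)\<bar> \<le> \<eta> * \<rho> (y - x)"
        proof (cases "norm (y - x) > \<delta>")
          case False
          have "x \<in> C'" unfolding C'_def mem_Collect_eq
            by (rule exI[of _ x], rule exI[of _ 0]) (use that in auto)
          moreover have "y \<in> C'" unfolding C'_def mem_Collect_eq
            by (rule exI[of _ x], rule exI[of _ "y - x"]) (use that False \<delta> in auto)
          ultimately
          have "\<bar>\<gamma> y - \<gamma> x\<bar> \<le> \<eta>"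
            using \<delta>\<^sub>1(2)[of x y] False \<delta> \<delta>\<^sub>1(1) by (simp add: dist_norm less_imp_le)
          then have "\<bar>\<gamma> y - \<gamma> x\<bar> * \<rho> (y - x) \<le> \<eta> * \<rho> (y - x)" using \<rho>(2) by (intro mult_right_mono) auto
          then show ?thesis using \<rho>(2)[of "y - x"] by (simp add: left_diff_distrib[symmetric] abs_mult)
        qed (use \<rho>(3) in simp)
      qed
      also have "\<dots> = \<eta>" using one[of x] by simp
      finally show ?thesis .
    qed
    have mc: "convol \<gamma> \<rho> \<in> borel_measurable borel"
      by (rule continuous_on_UNIV_borel_measurable[OF convol_continuous[OF \<gamma>b \<rho>(1,3)]])
    define d where "d x = convol \<gamma> \<rho> x - \<gamma> x" for x
    have cd: "continuous_on C d"
      unfolding d_def using \<gamma>(1) by (intro continuous_intros convol_continuous[OF \<gamma>b \<rho>(1,3)]) (auto intro: continuous_on_subset)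
    have sd: "sqint_on C d" by (rule sqint_continuous_compact[OF cd C])
    have "sqnorm_on C d \<le> (LINT x|lebesgue_on C. \<eta>\<^sup>2)"
    proof (rule integral_mono)
      show "integrable (lebesgue_on C) (\<lambda>x. (d x)\<^sup>2)" using sd by (simp add: sqint_def)
      show "integrable (lebesgue_on C) (\<lambda>x. \<eta>\<^sup>2)"
        using Cm finite_measure.integrable_const finite_measure_lebesgue_on by blast
      fix x assume "x \<in> space (lebesgue_on C)"
      then show "(d x)\<^sup>2 \<le> \<eta>\<^sup>2" using near[of x] \<eta>(1) by (simp add: d_def power2_le_iff_abs_le)
    qed
    also have "\<dots> = \<eta>\<^sup>2 * measure lebesgue C"
      using Cs by (simp add: measure_restrict_space)
    finally have sd_le: "sqnorm_on C d \<le> e/6" using \<eta> by linarith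
    have rC: "sqint_on C r" "sqnorm_on C r \<le> e/12"
      using sqnorm_lebesgue_on_le[OF rl(1) Cs] rl(2) by auto
    have YC: "sqint_on C (convol r \<rho>)" "sqnorm_on C (convol r \<rho>) \<le> e/12"
      using sqnorm_lebesgue_on_le[OF Y'(1) Cs] Y'(2) by auto
    have "sqnorm_on C (\<lambda>x. convol g \<rho> x - g x) = sqnorm_on C (\<lambda>x. (convol r \<rho> x - r x) + d x)"
      unfolding split by (simp add: d_def r_def algebra_simps)
    also have "\<dots> \<le> 2 * sqnorm_on C (\<lambda>x. convol r \<rho> x - r x) + 2 * sqnorm_on C d"
      by (intro sqnorm_add_le sqint_diff YC rC sd)
    also have "\<dots> \<le> 2 * (2 * sqnorm_on C (convol r \<rho>) + 2 * sqnorm_on C r) + 2 * (e/6)"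
      by (intro add_mono mult_left_mono sqnorm_diff_le YC rC sd_le) auto
    also have "\<dots> \<le> e" using YC rC by simp
    finally show "sqnorm_on C (\<lambda>x. convol g \<rho> x - g x) \<le> e" .
  qed
qed

section \<open>Strong and weak gradients\<close>

text \<open>The gradient in the sense of local approximation by differentiable functions. On open sets it agrees
  with the weak gradient, and the chain rule carries over to it directly.\<close>

definition strong_grad :: "plane set \<Rightarrow> (plane \<Rightarrow> real) \<Rightarrow> (2 \<Rightarrow> plane \<Rightarrow> real) \<Rightarrow> bool" where
  "strong_grad U f f' \<longleftrightarrow> (\<forall>C e. compact C \<and> C \<subseteq> U \<and> 0 < e \<longrightarrow>
     (\<exists>V F F'. open V \<and> C \<subseteq> V \<and> V \<subseteq> U \<and> C1_on V F F' \<and>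
        sqnorm_on C (\<lambda>x. F x - f x) \<le> e \<and>
        (\<forall>i. sqnorm_on C (\<lambda>x. F' i x - f' i x) \<le> e)))"

definition weak_grad :: "plane set \<Rightarrow> (plane \<Rightarrow> real) \<Rightarrow> (2 \<Rightarrow> plane \<Rightarrow> real) \<Rightarrow> bool" where
  "weak_grad U f f' \<longleftrightarrow> (\<forall>\<phi> i. test_function U \<phi> \<longrightarrow>
     (LINT x|lebesgue_on U. f x * partial_deriv i \<phi> x) = - (LINT x|lebesgue_on U. f' i x * \<phi> x))"

lemma strong_gradD:
  assumes "strong_grad U f f'" "compact C" "C \<subseteq> U" "0 < e"
  obtains V F F' where "open V" "C \<subseteq> V" "V \<subseteq> U" "C1_on V F F'"
    "sqnorm_on C (\<lambda>x. F x - f x) \<le> e" "\<And>i. sqnorm_on C (\<lambda>x. F' i x - f' i x) \<le> e"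
proof -
  have "compact C \<and> C \<subseteq> U \<and> 0 < e" using assms(2-4) by simp
  from assms(1)[unfolded strong_grad_def, rule_format, OF this] show ?thesis
    by (elim exE conjE) (rule that, assumption+, erule spec)
qed

lemma strong_grad_subset:
  assumes "strong_grad U f f'" "open V" "V \<subseteq> U"
  shows "strong_grad V f f'"
  unfolding strong_grad_def
proof (intro allI impI, elim conjE)
  fix C and e :: real
  assume C: "compact C" "C \<subseteq> V" "0 < e"
  obtain W F F' where W: "open W" "C \<subseteq> W" "W \<subseteq> U" "C1_on W F F'" 
    "sqnorm_on C (\<lambda>x. F x - f x) \<le> e" "\<And>i. sqnorm_on C (\<lambda>x. F' i x - f' i x) \<le> e"
    by (rule strong_gradD[OF assms(1) C(1) subset_trans[OF C(2) assms(3)] C(3)]) (rule that)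
  have "C1_on (W \<inter> V) F F'" by (rule C1_on_subset[OF W(4)]) simp
  then show "\<exists>V' F F'. open V' \<and> C \<subseteq> V' \<and> V' \<subseteq> V \<and> C1_on V' F F' \<and>
        sqnorm_on C (\<lambda>x. F x - f x) \<le> e \<and>
        (\<forall>i. sqnorm_on C (\<lambda>x. F' i x - f' i x) \<le> e)"
    using W C assms(2)
    by (intro exI[of _ "W \<inter> V"] exI[of _ F] exI[of _ F'] conjI allI) auto
qed

lemma C1_on_imp_strong_grad: "open U \<Longrightarrow> C1_on U f f' \<Longrightarrow> strong_grad U f f'"
  unfolding strong_grad_def by (intro allI impI exI[of _ U] exI[of _ f] exI[of _ f']) auto

text \<open>Convolution is an integral over the whole plane against \<open>lborel\<close>; this
  supplies the Borel representative, extended by 0, on which it acts.\<close>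

lemma borel_version:
  assumes U: "U \<in> sets lebesgue" and f: "sqint_on U f"
  obtains g where "sqint lborel g" "AE x in lebesgue. (if x \<in> U then f x else 0) = g x"
proof -
  have s: "sqint lebesgue (\<lambda>x. if x \<in> U then f x else 0)"
    using f sqint_lebesgue_on_iff(1)[OF U] by blast
  obtain g where g: "g \<in> borel_measurable lborel" "AE x in lborel. (if x \<in> U then f x else 0) = g x"
    using completion_ex_borel_measurable_real[OF sqint_measurable[OF s]] by blast
  have mg: "g \<in> borel_measurable lebesgue" by (rule measurable_completion[OF g(1)])
  have "sqint lebesgue g"
    using sqint_AE_cong(1)[OF AE_completion[OF g(2)] sqint_measurable[OF s] mg] s by blast
  then show ?thesis
    using that[of g] g AE_completion[OF g(2)] sqint_lebesgue_lborel(1)[of g] by simp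
qed

text \<open>The approximants are mollifications. Near \<open>C\<close> the translated kernel is a
  test function in \<open>U\<close>, so the classical gradient of the mollified function is the
  mollified weak gradient.\<close>

theorem weak_imp_strong_grad:
  assumes U: "open U" and f: "sqint_on U f" and f': "\<And>i. sqint_on U (f' i)"
    and weak: "weak_grad U f f'"
  shows "strong_grad U f f'"
  unfolding strong_grad_def
proof (intro allI impI, elim conjE)
  fix C and e :: real assume C: "compact C" "C \<subseteq> U" "0 < e"
  have Us: "U \<in> sets lebesgue" using U by (simp add: borel_open)
  have Cs: "C \<in> sets lebesgue" using C(1) by (simp add: lmeasurable_compact fmeasurableD)
  obtain g where g: "sqint lborel g" "AE x in lebesgue. (if x \<in> U then f x else 0) = g x"
    using borel_version[OF Us f] .
  have "\<forall>i. \<exists>g. sqint lborel g \<and> (AE x in lebesgue. (if x \<in> U then f' i x else 0) = g x)"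
  proof
    fix i
    show "\<exists>g. sqint lborel g \<and> (AE x in lebesgue. (if x \<in> U then f' i x else 0) = g x)"
      by (rule borel_version[OF Us f'[of i]]) blast
  qed
  then obtain g' where g': "\<And>i. sqint lborel (g' i)" "\<And>i. AE x in lebesgue. (if x \<in> U then f' i x else 0) = g' i x"
    by (drule_tac choice) blast
  obtain \<epsilon> where \<epsilon>: "\<epsilon> > 0" "(\<Union>x\<in>C. ball x \<epsilon>) \<subseteq> U"
    by (rule compact_subset_open_imp_ball_epsilon_subset[OF C(1) U C(2)])
  let ?good = "\<lambda>g \<delta>\<^sub>0. \<delta>\<^sub>0 > 0 \<and> (\<forall>\<rho> \<delta>. smooth \<rho> \<and> (\<forall>x. \<rho> x \<ge> 0) \<and> (\<forall>x. norm x > \<delta> \<longrightarrow> \<rho> x = 0) \<and> (LINT x|lborel. \<rho> x) = 1 \<and> \<delta> \<le> \<delta>\<^sub>0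
      \<longrightarrow> sqnorm_on C (\<lambda>x. convol g \<rho> x - g x) \<le> e)"
  have ex: "\<exists>\<delta>\<^sub>0. ?good g \<delta>\<^sub>0" if "sqint lborel g" for g
    by (rule convol_approximates[OF that C(1,3)]) blast
  obtain d0 where d0: "?good g d0" using ex[OF g(1)] by blast
  have "\<forall>i. \<exists>\<delta>\<^sub>0. ?good (g' i) \<delta>\<^sub>0" using ex[OF g'(1)] by (rule allI)
  from choice[OF this] obtain d where d: "\<And>i. ?good (g' i) (d i)" by (elim exE) (rule that, erule spec)
  \<comment> \<open>Below the thresholds of the function and of both derivatives. The bound
    \<epsilon>/3, together with the neighbourhood \<open>V\<close> of radius \<epsilon>/3, keeps the
    kernel supports centred in \<open>V\<close> inside \<open>U\<close>.\<close>
  define \<delta> where "\<delta> = min (\<epsilon>/3) (min d0 (min (d 1) (d 2)))"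
  have \<delta>: "\<delta> > 0" "\<delta> \<le> \<epsilon>/3" "\<delta> \<le> d0" "\<delta> \<le> d i" for i
    using \<epsilon>(1) d0 d exhaust_2[of i] by (auto simp: \<delta>_def)
  obtain \<rho> where \<rho>: "smooth \<rho>" "\<And>x. \<rho> x \<ge> 0" "\<And>x. norm x > \<delta> \<Longrightarrow> \<rho> x = 0" "(LINT x|lborel. \<rho> x) = 1"
    using smoothing_kernel[OF \<delta>(1)] by blast
  define V where "V = (\<Union>x\<in>C. ball x (\<epsilon>/3))"
  have V: "open V" "C \<subseteq> V" "V \<subseteq> U"
    unfolding V_def using \<epsilon> by (auto, force)
  \<comment> \<open>The definition of the weak gradient, tested with the kernel translated to
    \<open>x\<close>.\<close>
  have grad: "- convol g (partial_deriv i \<rho>) x = convol (g' i) \<rho> x" if "x \<in> V" for x i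
  proof -
    define \<phi> where "\<phi> y = \<rho> (- x + 1 *\<^sub>R y)" for y
    have sm: "smooth \<phi>" unfolding \<phi>_def by (rule smooth_affine[OF \<rho>(1)])
    have cb: "cball x \<delta> \<subseteq> U"
    proof
      fix y assume y: "y \<in> cball x \<delta>"
      obtain c where c: "c \<in> C" "dist c x < \<epsilon>/3" using \<open>x \<in> V\<close> by (auto simp: V_def)
      then have "dist c y < \<epsilon>" using dist_triangle[of c y x] y \<delta>(2) \<epsilon>(1) by simp
      then show "y \<in> U" by (intro subsetD[OF \<epsilon>(2)] UN_I[OF c(1)]) simp
    qed
    have tf: "test_function U \<phi>"
      by (rule test_functionI[OF sm compact_cball cb]) (use \<rho>(3) in \<open>auto simp: \<phi>_def dist_norm norm_minus_commute\<close>)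
    have pd: "partial_deriv i \<phi> = (\<lambda>y. partial_deriv i \<rho> (- x + 1 *\<^sub>R y))"
      using partial_deriv_affine[OF smooth_of_class[OF \<rho>(1)], of i "- x" 1] by (simp add: \<phi>_def[abs_def])
    have key: "(LINT y|lebesgue_on U. k y * \<psi> y) = (LINT y|lborel. b y * \<psi> y)"
      if "AE x in lebesgue. (if x \<in> U then k x else 0) = b x" "sqint lborel b" "sqint_on U k" "smooth \<psi>" for k b \<psi>
    proof -
      have mb: "b \<in> borel_measurable borel" using that(2) by (simp add: sqint_def)
      have mp: "\<psi> \<in> borel_measurable borel" 
        by (rule continuous_on_UNIV_borel_measurable[OF smooth_continuous_on[OF that(4)]])
      have mk: "(\<lambda>x. if x \<in> U then k x else 0) \<in> borel_measurable lebesgue"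
        using sqint_lebesgue_on_iff(1)[OF Us] that(3) sqint_measurable by blast
      have mp': "\<psi> \<in> borel_measurable lebesgue" and mb': "b \<in> borel_measurable lebesgue"
        by (rule measurable_completion; use mp mb in simp)+
      have "(LINT y|lebesgue_on U. k y * \<psi> y) = (LINT y|lebesgue. (if y \<in> U then k y * \<psi> y else 0))"
        by (rule Lebesgue_Measure.integral_restrict_UNIV[OF Us, symmetric])
      also have "\<dots> = (LINT y|lebesgue. (if y \<in> U then k y else 0) * \<psi> y)"
        by (rule Bochner_Integration.integral_cong) auto
      also have "\<dots> = (LINT y|lebesgue. b y * \<psi> y)"
        using that(1) by (intro integral_cong_AE borel_measurable_times mk mp' mb') (auto elim: eventually_mono)
      also have "\<dots> = (LINT y|lborel. b y * \<psi> y)"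
        using mb mp by (intro integral_completion) auto
      finally show ?thesis .
    qed
    have "(LINT y|lebesgue_on U. f y * partial_deriv i \<phi> y) = - (LINT y|lebesgue_on U. f' i y * \<phi> y)"
      using weak tf unfolding weak_grad_def by blast
    then have "(LINT y|lborel. g y * partial_deriv i \<phi> y) = - (LINT y|lborel. g' i y * \<phi> y)"
      unfolding key[OF g(2,1) f smooth_partial_deriv[OF sm]] key[OF g'(2,1) f' sm] .
    then show ?thesis unfolding pd convol_def by (simp add: \<phi>_def)
  qed
  have "has_grad (convol g \<rho>) (\<lambda>i. convol (g' i) \<rho> x) x" if "x \<in> V" for x
    using convol_has_grad[OF g(1) \<rho>(1,3), where x=x] unfolding grad[OF that] .
  then have "C1_on V (convol g \<rho>) (\<lambda>i. convol (g' i) \<rho>)"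
    unfolding C1_on_def using convol_continuous[OF g'(1) \<rho>(1,3)] by simp
  moreover have "sqnorm_on C (\<lambda>x. convol g \<rho> x - f x) \<le> e"
    and "\<forall>i. sqnorm_on C (\<lambda>x. convol (g' i) \<rho> x - f' i x) \<le> e"
  proof -
    have tr: "sqnorm_on C (\<lambda>x. convol b \<rho> x - k x) = sqnorm_on C (\<lambda>x. convol b \<rho> x - b x)"
      if "AE x in lebesgue. (if x \<in> U then k x else 0) = b x" "sqint lborel b" "sqint_on U k" for k b
    proof (rule sqint_AE_cong(2))
      have "AE x in lebesgue. x \<in> C \<longrightarrow> k x = b x"
        using that(1) by eventually_elim (use C(2) in auto)
      then have "AE x in lebesgue_on C. k x = b x"
        using Cs by (simp add: AE_restrict_space_iff)
      then show "AE x in lebesgue_on C. convol b \<rho> x - k x = convol b \<rho> x - b x" by eventually_elim simp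
      have mb: "b \<in> borel_measurable borel" using that(2) by (simp add: sqint_def)
      have mc: "convol b \<rho> \<in> borel_measurable (lebesgue_on C)"
        by (rule sqint_measurable[OF sqint_continuous_compact[OF convol_continuous[OF that(2) \<rho>(1,3)] C(1)]])
      have mb': "b \<in> borel_measurable (lebesgue_on C)"
        by (rule measurable_restrict_space1, rule measurable_completion) (use mb in simp)
      have mk: "k \<in> borel_measurable (lebesgue_on C)"
        by (rule sqint_measurable[OF sqint_mono(1)[OF that(3) C(2) Cs Us]])
      show "(\<lambda>x. convol b \<rho> x - k x) \<in> borel_measurable (lebesgue_on C)" "(\<lambda>x. convol b \<rho> x - b x) \<in> borel_measurable (lebesgue_on C)"
        using mc mb' mk by auto
    qed
    show "sqnorm_on C (\<lambda>x. convol g \<rho> x - f x) \<le> e"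
      unfolding tr[OF g(2,1) f] using d0 \<rho> \<delta>(3) by blast
    show "\<forall>i. sqnorm_on C (\<lambda>x. convol (g' i) \<rho> x - f' i x) \<le> e"
      unfolding tr[OF g'(2,1) f'] using d \<rho> \<delta>(4) by blast
  qed
  ultimately show "\<exists>V F F'. open V \<and> C \<subseteq> V \<and> V \<subseteq> U \<and> C1_on V F F' \<and>
        sqnorm_on C (\<lambda>x. F x - f x) \<le> e \<and>
        (\<forall>i. sqnorm_on C (\<lambda>x. F' i x - f' i x) \<le> e)"
    using V by blast
qed

lemma lebesgue_on_integral_support:
  fixes k :: "plane \<Rightarrow> real"
  assumes "U \<in> sets lebesgue" "S \<in> sets lebesgue" "S \<subseteq> U" "\<And>x. x \<notin> S \<Longrightarrow> k x = 0"
  shows "(LINT x|lebesgue_on U. k x) = (LINT x|lebesgue_on S. k x)"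
    and "integrable (lebesgue_on U) k \<longleftrightarrow> integrable (lebesgue_on S) k"
proof -
  have eq: "(\<lambda>x. if x \<in> U then k x else 0) = (\<lambda>x. if x \<in> S then k x else 0)"
    using assms(3,4) by (auto simp: fun_eq_iff)
  show "(LINT x|lebesgue_on U. k x) = (LINT x|lebesgue_on S. k x)"
    using Lebesgue_Measure.integral_restrict_UNIV[OF assms(1), of k]
      Lebesgue_Measure.integral_restrict_UNIV[OF assms(2), of k] eq by simp
  show "integrable (lebesgue_on U) k \<longleftrightarrow> integrable (lebesgue_on S) k"
    using Lebesgue_Measure.integrable_restrict_UNIV[OF assms(1), of k]
      Lebesgue_Measure.integrable_restrict_UNIV[OF assms(2), of k] eq by simp
qed

lemma compact_sets_lebesgue: "compact S \<Longrightarrow> S \<in> sets lebesgue" for S :: "'a::euclidean_space set"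
  by (simp add: lmeasurable_compact fmeasurableD)

lemma open_sets_lebesgue: "open S \<Longrightarrow> S \<in> sets lebesgue" for S :: "'a::euclidean_space set"
  by (simp add: borel_open)

lemma nonneg_le_all_mult_imp_zero:
  assumes "\<And>e::real. e > 0 \<Longrightarrow> a \<le> e * K" "a \<ge> 0" "K \<ge> 0"
  shows "a = (0::real)"
proof (rule ccontr)
  assume "a \<noteq> 0"
  then have "a > 0" using assms(2) by simp
  have "a \<le> (a / (2 * (K + 1))) * K"
    by (rule assms(1)) (use \<open>a > 0\<close> assms(3) in simp)
  also have "\<dots> \<le> a / 2" using \<open>a > 0\<close> assms(3) by (simp add: field_simps)
  finally show False using \<open>a > 0\<close> by simp
qed

text \<open>Integrate by parts for an approximant on the support of the test function. The defect of
  the identity is then bounded through Cauchy-Schwarz by the approximation error, which is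
  arbitrary.\<close>

theorem strong_imp_weak_grad:
  assumes U: "open U" and f: "sqint_on U f" and f': "\<And>i. sqint_on U (f' i)"
    and strong: "strong_grad U f f'"
  shows "weak_grad U f f'"
  unfolding weak_grad_def
proof (intro allI impI)
  fix \<phi> i assume \<phi>: "test_function U \<phi>"
  obtain S where S: "smooth \<phi>" "compact S" "S \<subseteq> U" "\<And>x. x \<notin> S \<Longrightarrow> \<phi> x = 0"
    "\<And>x i. x \<notin> S \<Longrightarrow> partial_deriv i \<phi> x = 0"
    by (rule test_functionE[OF \<phi>]) (rule that)
  have Us: "U \<in> sets lebesgue" and Ss: "S \<in> sets lebesgue"
    using U S by (auto intro: open_sets_lebesgue compact_sets_lebesgue)
  have fS: "sqint_on S f" "sqint_on S (f' j)" for j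
    using sqint_mono(1)[OF f S(3) Ss Us] sqint_mono(1)[OF f' S(3) Ss Us] by auto
  have pS: "sqint_on S \<phi>" "sqint_on S (partial_deriv i \<phi>)"
    by (intro sqint_continuous_compact smooth_continuous_on smooth_partial_deriv S)+
  define X where "X = (LINT x|lebesgue_on U. f x * partial_deriv i \<phi> x) + (LINT x|lebesgue_on U. f' i x * \<phi> x)"
  have XS: "X = (LINT x|lebesgue_on S. f x * partial_deriv i \<phi> x) + (LINT x|lebesgue_on S. f' i x * \<phi> x)"
    unfolding X_def using lebesgue_on_integral_support(1)[OF Us Ss S(3)] S(4,5) by simp
  \<comment> \<open>It depends on the test function alone, so that X^2 \<le> e K for every
    \<open>e\<close> forces X = 0.\<close>
  define K where "K = 2 * sqnorm_on S (partial_deriv i \<phi>) + 2 * sqnorm_on S \<phi>"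
  have "X\<^sup>2 \<le> e * K" if e: "e > 0" for e
  proof -
    obtain V F F' where V: "open V" "S \<subseteq> V" "V \<subseteq> U" "C1_on V F F'"
      and err: "sqnorm_on S (\<lambda>x. F x - f x) \<le> e" "\<And>i. sqnorm_on S (\<lambda>x. F' i x - f' i x) \<le> e"
      by (rule strong_gradD[OF strong S(2,3) e]) (rule that)
    have Vs: "V \<in> sets lebesgue" using V(1) by (rule open_sets_lebesgue)
    have tV: "test_function V \<phi>" by (rule test_functionI[OF S(1,2) V(2) S(4)])
    have FS: "sqint_on S F" "sqint_on S (F' i)"
      using V(2,4) C1_on_continuous[OF V(4)]
      by (auto intro!: sqint_continuous_compact[OF _ S(2)] simp: C1_on_def intro: continuous_on_subset)
    have "(LINT x|lebesgue_on S. F x * partial_deriv i \<phi> x) = - (LINT x|lebesgue_on S. F' i x * \<phi> x)"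
      using integration_by_parts[OF V(1,4) tV, of i]
        lebesgue_on_integral_support(1)[OF Vs Ss V(2)] S(4,5) by simp
    moreover have "(LINT x|lebesgue_on S. (F x - f x) * partial_deriv i \<phi> x)
        = (LINT x|lebesgue_on S. F x * partial_deriv i \<phi> x) - (LINT x|lebesgue_on S. f x * partial_deriv i \<phi> x)"
      using sqint_mult_integrable[OF fS(1) pS(2)] sqint_mult_integrable[OF FS(1) pS(2)]
      by (simp add: left_diff_distrib)
    moreover have "(LINT x|lebesgue_on S. (F' i x - f' i x) * \<phi> x)
        = (LINT x|lebesgue_on S. F' i x * \<phi> x) - (LINT x|lebesgue_on S. f' i x * \<phi> x)"
      using sqint_mult_integrable[OF fS(2) pS(1)] sqint_mult_integrable[OF FS(2) pS(1)]
      by (simp add: left_diff_distrib)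
    ultimately have Xe: "X = - (LINT x|lebesgue_on S. (F x - f x) * partial_deriv i \<phi> x)
        - (LINT x|lebesgue_on S. (F' i x - f' i x) * \<phi> x)"
      unfolding XS by simp
    have "(LINT x|lebesgue_on S. (F x - f x) * partial_deriv i \<phi> x)\<^sup>2 \<le> 
        sqnorm_on S (\<lambda>x. F x - f x) * sqnorm_on S (partial_deriv i \<phi>)"
      by (rule sqint_Cauchy_Schwarz[OF sqint_diff[OF FS(1) fS(1)] pS(2)])
    also have "\<dots> \<le> e * sqnorm_on S (partial_deriv i \<phi>)"
      by (rule mult_right_mono[OF err(1)]) simp
    finally have 1: "(LINT x|lebesgue_on S. (F x - f x) * partial_deriv i \<phi> x)\<^sup>2 \<le> e * sqnorm_on S (partial_deriv i \<phi>)" .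
    have "(LINT x|lebesgue_on S. (F' i x - f' i x) * \<phi> x)\<^sup>2 \<le> 
        sqnorm_on S (\<lambda>x. F' i x - f' i x) * sqnorm_on S \<phi>"
      by (rule sqint_Cauchy_Schwarz[OF sqint_diff[OF FS(2) fS(2)] pS(1)])
    also have "\<dots> \<le> e * sqnorm_on S \<phi>"
      by (rule mult_right_mono[OF err(2)]) simp
    finally have 2: "(LINT x|lebesgue_on S. (F' i x - f' i x) * \<phi> x)\<^sup>2 \<le> e * sqnorm_on S \<phi>" .
    have "X\<^sup>2 \<le> 2 * (LINT x|lebesgue_on S. (F x - f x) * partial_deriv i \<phi> x)\<^sup>2 + 2 * (LINT x|lebesgue_on S. (F' i x - f' i x) * \<phi> x)\<^sup>2"
      unfolding Xe using square_add_le[of "- (LINT x|lebesgue_on S. (F x - f x) * partial_deriv i \<phi> x)" "- (LINT x|lebesgue_on S. (F' i x - f' i x) * \<phi> x)"]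
      by simp
    with 1 2 show ?thesis unfolding K_def by (simp add: algebra_simps)
  qed
  moreover have "K \<ge> 0" unfolding K_def by simp
  ultimately have "X\<^sup>2 = 0" by (intro nonneg_le_all_mult_imp_zero[of "X\<^sup>2" K]) auto
  then show "(LINT x|lebesgue_on U. f x * partial_deriv i \<phi> x) = - (LINT x|lebesgue_on U. f' i x * \<phi> x)"
    unfolding X_def by simp
qed

section \<open>Calculus of strong gradients\<close>

lemma C1_on_sqint_compact:
  assumes "C1_on V F F'" "compact C" "C \<subseteq> V"
  shows "sqint_on C F" "sqint_on C (F' i)"
  using assms C1_on_continuous[OF assms(1)]
  by (auto intro!: sqint_continuous_compact[OF _ assms(2)] simp: C1_on_def intro: continuous_on_subset)

text \<open>Sums of approximants on the intersection of their domains; the tolerance e/4 for each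
  pays for the factor 2 in the squared triangle inequality.\<close>

lemma strong_grad_add:
  assumes U: "open U"
    and f: "sqint_on U f" "\<And>i. sqint_on U (f' i)" "strong_grad U f f'"
    and g: "sqint_on U g" "\<And>i. sqint_on U (g' i)" "strong_grad U g g'"
  shows "strong_grad U (\<lambda>x. f x + g x) (\<lambda>i x. f' i x + g' i x)"
  unfolding strong_grad_def
proof (intro allI impI, elim conjE)
  fix C and e :: real assume C: "compact C" "C \<subseteq> U" "0 < e"
  have Us: "U \<in> sets lebesgue" and Cs: "C \<in> sets lebesgue" using U C by (auto intro: open_sets_lebesgue compact_sets_lebesgue)
  note m = sqint_mono(1)[OF _ C(2) Cs Us]
  have e4: "e/4 > 0" using C by simp
  obtain V F F' where V: "open V" "C \<subseteq> V" "V \<subseteq> U" "C1_on V F F'"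
    "sqnorm_on C (\<lambda>x. F x - f x) \<le> e/4" "\<And>i. sqnorm_on C (\<lambda>x. F' i x - f' i x) \<le> e/4"
    by (rule strong_gradD[OF f(3) C(1,2) e4]) (rule that)
  obtain W G G' where W: "open W" "C \<subseteq> W" "W \<subseteq> U" "C1_on W G G'"
    "sqnorm_on C (\<lambda>x. G x - g x) \<le> e/4" "\<And>i. sqnorm_on C (\<lambda>x. G' i x - g' i x) \<le> e/4"
    by (rule strong_gradD[OF g(3) C(1,2) e4]) (rule that)
  have le: "sqnorm_on C (\<lambda>x. (A x + B x) - (a x + b x)) \<le> e"
    if "sqint_on C A" "sqint_on C B" "sqint_on C a" "sqint_on C b"
      "sqnorm_on C (\<lambda>x. A x - a x) \<le> e/4" "sqnorm_on C (\<lambda>x. B x - b x) \<le> e/4" for A B a b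
  proof -
    have "sqnorm_on C (\<lambda>x. (A x + B x) - (a x + b x)) = sqnorm_on C (\<lambda>x. (A x - a x) + (B x - b x))"
      by (simp add: algebra_simps)
    also have "\<dots> \<le> 2 * sqnorm_on C (\<lambda>x. A x - a x) + 2 * sqnorm_on C (\<lambda>x. B x - b x)"
      by (intro sqnorm_add_le sqint_diff that)
    finally show ?thesis using that by simp
  qed
  have C1: "C1_on (V \<inter> W) (\<lambda>x. F x + G x) (\<lambda>i x. F' i x + G' i x)"
    using V(4) W(4) unfolding C1_on_def
    by (auto intro!: has_grad_add continuous_on_add intro: continuous_on_subset)
  show "\<exists>V F F'. open V \<and> C \<subseteq> V \<and> V \<subseteq> U \<and> C1_on V F F' \<and>
        sqnorm_on C (\<lambda>x. F x - (f x + g x)) \<le> e \<and>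
        (\<forall>i. sqnorm_on C (\<lambda>x. F' i x - (f' i x + g' i x)) \<le> e)"
    by (rule exI[of _ "V \<inter> W"], rule exI[of _ "\<lambda>x. F x + G x"], rule exI[of _ "\<lambda>i x. F' i x + G' i x"])
       (intro conjI allI open_Int C1 le m f g V W C1_on_sqint_compact[OF V(4) C(1) V(2)] C1_on_sqint_compact[OF W(4) C(1) W(2)],
        use V W in auto)
qed

lemma continuous_on_compact_abs_bound:
  fixes a :: "'a::topological_space \<Rightarrow> real"
  assumes "continuous_on C a" "compact C"
  obtains M where "M > 0" "\<And>x. x \<in> C \<Longrightarrow> \<bar>a x\<bar> \<le> M"
  using compact_imp_bounded[OF compact_continuous_image[OF assms]] unfolding bounded_pos by (metis image_eqI real_norm_def)

text \<open>Only \<open>f\<close> is approximated; the C1 factor \<open>a\<close> and its gradient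
  are bounded on the compact set, which is all that the error needs.\<close>

lemma strong_grad_mult:
  assumes U: "open U" and a: "C1_on U a a'"
    and f: "sqint_on U f" "\<And>i. sqint_on U (f' i)" "strong_grad U f f'"
  shows "strong_grad U (\<lambda>x. a x * f x) (\<lambda>i x. a x * f' i x + a' i x * f x)"
  unfolding strong_grad_def
proof (intro allI impI, elim conjE)
  fix C and e :: real assume C: "compact C" "C \<subseteq> U" "0 < e"
  have Us: "U \<in> sets lebesgue" and Cs: "C \<in> sets lebesgue" using U C by (auto intro: open_sets_lebesgue compact_sets_lebesgue)
  note m = sqint_mono(1)[OF _ C(2) Cs Us]
  have ca: "continuous_on C a" "continuous_on C (a' i)" for i
    using C1_on_continuous[OF a] a C(2) by (auto simp: C1_on_def intro: continuous_on_subset)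
  have ma: "a \<in> borel_measurable (lebesgue_on C)" "a' i \<in> borel_measurable (lebesgue_on C)" for i
    by (intro continuous_imp_measurable_on_sets_lebesgue[OF _ Cs] ca)+
  obtain M0 where M0: "M0 > 0" "\<And>x. x \<in> C \<Longrightarrow> \<bar>a x\<bar> \<le> M0"
    by (rule continuous_on_compact_abs_bound[OF ca(1) C(1)]) (rule that)
  obtain M1 where M1: "M1 > 0" "\<And>x. x \<in> C \<Longrightarrow> \<bar>a' 1 x\<bar> \<le> M1"
    by (rule continuous_on_compact_abs_bound[OF ca(2) C(1)]) (rule that)
  obtain M2 where M2: "M2 > 0" "\<And>x. x \<in> C \<Longrightarrow> \<bar>a' 2 x\<bar> \<le> M2"
    by (rule continuous_on_compact_abs_bound[OF ca(2) C(1)]) (rule that)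
  define M where "M = M0 + M1 + M2"
  have M: "M > 0" "\<And>x. x \<in> C \<Longrightarrow> \<bar>a x\<bar> \<le> M" "\<And>x i. x \<in> C \<Longrightarrow> \<bar>a' i x\<bar> \<le> M"
  proof -
    show "M > 0" using M0(1) M1(1) M2(1) by (simp add: M_def)
    show "\<bar>a x\<bar> \<le> M" if "x \<in> C" for x
      using M0(2)[OF that] M1(1) M2(1) by (simp add: M_def)
    show "\<bar>a' i x\<bar> \<le> M" if "x \<in> C" for x i
      using M1(2)[OF that] M2(2)[OF that] M0(1) M1(1) M2(1) exhaust_2[of i] by (auto simp: M_def)
  qed
  \<comment> \<open>Multiplication by a function bounded by \<open>M\<close> turns this into e/4,
    and each gradient component is a sum of two such terms.\<close>
  define e' where "e' = e / (4 * M\<^sup>2)"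
  have e': "e' > 0" using C(3) M(1) by (simp add: e'_def)
  obtain V F F' where V: "open V" "C \<subseteq> V" "V \<subseteq> U" "C1_on V F F'"
    and err: "sqnorm_on C (\<lambda>x. F x - f x) \<le> e'" "\<And>i. sqnorm_on C (\<lambda>x. F' i x - f' i x) \<le> e'"
    by (rule strong_gradD[OF f(3) C(1,2) e']) (rule that)
  note sF = C1_on_sqint_compact[OF V(4) C(1) V(2)]
  have bd: "sqint_on C (\<lambda>x. b x * (H x - h x))" "sqnorm_on C (\<lambda>x. b x * (H x - h x)) \<le> e / 4"
    if "b \<in> borel_measurable (lebesgue_on C)" "\<And>x. x \<in> C \<Longrightarrow> \<bar>b x\<bar> \<le> M" 
      "sqint_on C H" "sqint_on C h" "sqnorm_on C (\<lambda>x. H x - h x) \<le> e'" for b H h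
  proof -
    note * = sqint_mult_bounded[OF sqint_diff[OF that(3,4)] that(1), of M]
    show "sqint_on C (\<lambda>x. b x * (H x - h x))" by (rule *(1)) (simp add: that(2))
    have "sqnorm_on C (\<lambda>x. b x * (H x - h x)) \<le> M\<^sup>2 * sqnorm_on C (\<lambda>x. H x - h x)"
      by (rule *(2)) (simp add: that(2))
    also have "\<dots> \<le> M\<^sup>2 * e'" by (rule mult_left_mono[OF that(5)]) simp
    also have "\<dots> = e / 4" using M(1) by (simp add: e'_def)
    finally show "sqnorm_on C (\<lambda>x. b x * (H x - h x)) \<le> e / 4" .
  qed
  have err1: "sqnorm_on C (\<lambda>x. a x * F x - a x * f x) \<le> e"
    using bd(2)[OF ma(1) M(2) sF(1) m[OF f(1)] err(1)] C(3) by (simp add: right_diff_distrib)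
  have err2: "sqnorm_on C (\<lambda>x. (a x * F' i x + a' i x * F x) - (a x * f' i x + a' i x * f x)) \<le> e" for i
  proof -
    have "sqnorm_on C (\<lambda>x. (a x * F' i x + a' i x * F x) - (a x * f' i x + a' i x * f x))
      = sqnorm_on C (\<lambda>x. a x * (F' i x - f' i x) + a' i x * (F x - f x))"
      by (simp add: algebra_simps)
    also have "\<dots> \<le> 2 * sqnorm_on C (\<lambda>x. a x * (F' i x - f' i x)) + 2 * sqnorm_on C (\<lambda>x. a' i x * (F x - f x))"
      by (intro sqnorm_add_le bd(1)[OF ma(1) M(2) sF(2) m[OF f(2)] err(2)] bd(1)[OF ma(2) M(3) sF(1) m[OF f(1)] err(1)])
    also have "\<dots> \<le> 2 * (e/4) + 2 * (e/4)"
      by (intro add_mono mult_left_mono bd(2)[OF ma(1) M(2) sF(2) m[OF f(2)] err(2)] bd(2)[OF ma(2) M(3) sF(1) m[OF f(1)] err(1)]) auto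
    finally show ?thesis by simp
  qed
  have C1: "C1_on V (\<lambda>x. a x * F x) (\<lambda>i x. a x * F' i x + a' i x * F x)"
    by (rule C1_on_mult[OF C1_on_subset[OF a V(3)] V(4)])
  show "\<exists>V F F'. open V \<and> C \<subseteq> V \<and> V \<subseteq> U \<and> C1_on V F F' \<and>
        sqnorm_on C (\<lambda>x. F x - a x * f x) \<le> e \<and>
        (\<forall>i. sqnorm_on C (\<lambda>x. F' i x - (a x * f' i x + a' i x * f x)) \<le> e)"
    by (rule exI[of _ V], rule exI[of _ "\<lambda>x. a x * F x"], rule exI[of _ "\<lambda>i x. a x * F' i x + a' i x * F x"])
       (intro conjI allI V C1 err1 err2)
qed

section \<open>Change of variables\<close>

definition jac :: "(2 \<Rightarrow> 2 \<Rightarrow> plane \<Rightarrow> real) \<Rightarrow> plane \<Rightarrow> real" where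
  "jac A x = A 1 1 x * A 2 2 x - A 1 2 x * A 2 1 x"

text \<open>Note the order of the indices: \<open>A\<close> is the transpose of the usual Jacobian matrix.\<close>

definition has_jacobian :: "plane set \<Rightarrow> (plane \<Rightarrow> plane) \<Rightarrow> (2 \<Rightarrow> 2 \<Rightarrow> plane \<Rightarrow> real) \<Rightarrow> bool" where
  "has_jacobian U \<Phi> A \<longleftrightarrow> (\<forall>x\<in>U. \<forall>j. has_grad (\<lambda>x. \<Phi> x $ j) (\<lambda>i. A i j x) x) \<and>
     (\<forall>i j. continuous_on U (A i j))"

lemma has_jacobian_continuous_entry:
  assumes "has_jacobian U \<Phi> A" "S \<subseteq> U"
  shows "continuous_on S (A i j)"
  by (rule continuous_on_subset[OF _ assms(2)]) (use assms(1) in \<open>simp add: has_jacobian_def\<close>)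

lemma has_jacobian_has_derivative:
  assumes "has_jacobian U \<Phi> A" "x \<in> U"
  shows "(\<Phi> has_derivative (\<lambda>h. \<chi> j. \<Sum>i\<in>UNIV. A i j x * h $ i)) (at x)"
  by (subst has_derivative_componentwise_within)
     (use assms in \<open>auto simp: Basis_vec_def inner_axis has_jacobian_def\<close>)

lemma det_jacobian: "det (matrix (\<lambda>h::plane. \<chi> j. \<Sum>i\<in>UNIV. A i j x * h $ i)) = jac A x"
proof -
  have "matrix (\<lambda>h::plane. \<chi> j. \<Sum>i\<in>UNIV. A i j x * h $ i) = (\<chi> j i. A i j x)"
    by (simp add: matrix_def vec_eq_iff sum_2 axis_def forall_2)
  then show ?thesis by (simp add: det_2 jac_def mult.commute)
qed

lemma change_of_variables_real:
  fixes f :: "plane \<Rightarrow> real"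
  assumes S: "S \<in> sets lebesgue" "\<Phi> ` S \<in> sets lebesgue" and J: "has_jacobian U \<Phi> A" "S \<subseteq> U" and inj: "inj_on \<Phi> S"
    and f: "integrable (lebesgue_on (\<Phi> ` S)) f"
  shows "integrable (lebesgue_on S) (\<lambda>x. \<bar>jac A x\<bar> * f (\<Phi> x))"
    and "(LINT x|lebesgue_on S. \<bar>jac A x\<bar> * f (\<Phi> x)) = (LINT x|lebesgue_on (\<Phi> ` S). f x)"
proof -
  \<comment> \<open>The change of variables theorem used is stated for vector-valued integrands;
    \<open>real^1\<close> carries the scalar ones.\<close>
  let ?f = "\<lambda>x. vec (f x) :: real^1"
  let ?D = "\<lambda>x h. \<chi> j. \<Sum>i\<in>UNIV. A i j x * h $ i"
  have der: "(\<Phi> has_derivative ?D x) (at x within S)" if "x \<in> S" for x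
    using has_jacobian_has_derivative[OF J(1)] that J(2) by (meson has_derivative_at_withinI subsetD)
  have abs_iff: "h absolutely_integrable_on T \<longleftrightarrow> integrable (lebesgue_on T) h" if "T \<in> sets lebesgue" for T and h :: "plane \<Rightarrow> real"
    using that unfolding set_integrable_def by (simp add: integrable_restrict_space)
  have "?f absolutely_integrable_on (\<Phi> ` S)"
    unfolding absolutely_integrable_on_1_iff using f abs_iff[OF S(2)] by simp
  then have "?f absolutely_integrable_on (\<Phi> ` S) \<and> integral (\<Phi> ` S) ?f = integral (\<Phi> ` S) ?f" by simp
  then have *: "(\<lambda>x. \<bar>det (matrix (?D x))\<bar> *\<^sub>R ?f (\<Phi> x)) absolutely_integrable_on S"
     "integral S (\<lambda>x. \<bar>det (matrix (?D x))\<bar> *\<^sub>R ?f (\<Phi> x)) = integral (\<Phi> ` S) ?f"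
    using has_absolute_integral_change_of_variables[OF S(1) der inj, of ?f "integral (\<Phi> ` S) ?f"] by blast+
  from *(1) have "(\<lambda>x. \<bar>jac A x\<bar> * f (\<Phi> x)) absolutely_integrable_on S"
    unfolding absolutely_integrable_on_1_iff det_jacobian by simp
  then show i: "integrable (lebesgue_on S) (\<lambda>x. \<bar>jac A x\<bar> * f (\<Phi> x))"
    using abs_iff[OF S(1)] by blast
  have "integral S (\<lambda>x. \<bar>jac A x\<bar> * f (\<Phi> x)) = integral (\<Phi> ` S) f"
    using *(2) unfolding integral_on_1_eq det_jacobian by (simp add: vec_eq_iff)
  then show "(LINT x|lebesgue_on S. \<bar>jac A x\<bar> * f (\<Phi> x)) = (LINT x|lebesgue_on (\<Phi> ` S). f x)"
    by (simp add: lebesgue_integral_eq_integral[OF i S(1)] lebesgue_integral_eq_integral[OF f S(2)])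
qed

text \<open>A Lebesgue measurable function composed with a continuous map need not be measurable.
  Measurability comes from the change of variables: the integrand with the Jacobian factor is
  measurable, and dividing by the factor and taking the root recovers the composition, because
  \<open>k\<close> is nonnegative.\<close>

lemma sqint_compose_nonneg:
  fixes k :: "plane \<Rightarrow> real"
  assumes S: "S \<in> sets lebesgue" "\<Phi> ` S \<in> sets lebesgue" and J: "has_jacobian U \<Phi> A" "S \<subseteq> U" and inj: "inj_on \<Phi> S"
    and c: "c > 0" "\<forall>x\<in>S. c \<le> \<bar>jac A x\<bar>"
    and k: "sqint_on (\<Phi> ` S) k" "\<And>x. k x \<ge> 0"
  shows "(\<lambda>x. k (\<Phi> x)) \<in> borel_measurable (lebesgue_on S)"
proof -
  note i = change_of_variables_real(1)[OF S J inj sqint_integrable[OF k(1)]]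
  have "continuous_on S (jac A)"
    unfolding jac_def by (intro continuous_intros has_jacobian_continuous_entry[OF J])
  then have mJ: "jac A \<in> borel_measurable (lebesgue_on S)"
    by (rule continuous_imp_measurable_on_sets_lebesgue[OF _ S(1)])
  have "(\<lambda>x. sqrt (\<bar>jac A x\<bar> * (k (\<Phi> x))\<^sup>2 / \<bar>jac A x\<bar>)) \<in> borel_measurable (lebesgue_on S)"
  proof -
    note [measurable] = borel_measurable_integrable[OF i] mJ
    show ?thesis by measurable
  qed
  moreover have "sqrt (\<bar>jac A x\<bar> * (k (\<Phi> x))\<^sup>2 / \<bar>jac A x\<bar>) = k (\<Phi> x)" if "x \<in> S" for x
    using c(1) bspec[OF c(2) that] k(2)[of "\<Phi> x"] by (auto simp: abs_if)
  ultimately show ?thesis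
    by (subst measurable_cong[of _ _ "\<lambda>x. sqrt (\<bar>jac A x\<bar> * (k (\<Phi> x))\<^sup>2 / \<bar>jac A x\<bar>)"]) auto
qed

text \<open>Measurability holds for the positive and the negative part separately; the norm bound is
  the change of variables with the Jacobian factor bounded below by \<open>c\<close>.\<close>

lemma sqint_compose:
  fixes k :: "plane \<Rightarrow> real"
  assumes S: "S \<in> sets lebesgue" "\<Phi> ` S \<in> sets lebesgue" and J: "has_jacobian U \<Phi> A" "S \<subseteq> U" and inj: "inj_on \<Phi> S"
    and c: "c > 0" "\<forall>x\<in>S. c \<le> \<bar>jac A x\<bar>"
    and k: "sqint_on (\<Phi> ` S) k"
  shows "sqint_on S (\<lambda>x. k (\<Phi> x))"
    and "sqnorm_on S (\<lambda>x. k (\<Phi> x)) \<le> (1 / c) * sqnorm_on (\<Phi> ` S) k"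
proof -
  define p n where "p x = max (k x) 0" and "n x = max (- k x) 0" for x
  have mk: "k \<in> borel_measurable (lebesgue_on (\<Phi> ` S))" using k by (simp add: sqint_def)
  have pn: "sqint_on (\<Phi> ` S) p" "sqint_on (\<Phi> ` S) n"
    unfolding sqint_def p_def n_def using mk
    by (auto intro!: Bochner_Integration.integrable_bound[OF sqint_integrable[OF k]] simp: max_def)
  have "(\<lambda>x. p (\<Phi> x)) \<in> borel_measurable (lebesgue_on S)" "(\<lambda>x. n (\<Phi> x)) \<in> borel_measurable (lebesgue_on S)"
    by (rule sqint_compose_nonneg[OF S J inj c pn(1)] sqint_compose_nonneg[OF S J inj c pn(2)]; simp add: p_def n_def)+
  then have "(\<lambda>x. p (\<Phi> x) - n (\<Phi> x)) \<in> borel_measurable (lebesgue_on S)" by auto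
  moreover have "p (\<Phi> x) - n (\<Phi> x) = k (\<Phi> x)" for x by (simp add: p_def n_def)
  ultimately have m: "(\<lambda>x. k (\<Phi> x)) \<in> borel_measurable (lebesgue_on S)" by simp
  note i = change_of_variables_real[OF S J inj sqint_integrable[OF k]]
  have le: "(k (\<Phi> x))\<^sup>2 \<le> (1 / c) * (\<bar>jac A x\<bar> * (k (\<Phi> x))\<^sup>2)" if "x \<in> S" for x
  proof -
    have "c * (k (\<Phi> x))\<^sup>2 \<le> \<bar>jac A x\<bar> * (k (\<Phi> x))\<^sup>2" by (rule mult_right_mono[OF bspec[OF c(2) that]]) simp
    then show ?thesis using c(1) by (simp add: field_simps)
  qed
  have i2: "integrable (lebesgue_on S) (\<lambda>x. (1 / c) * (\<bar>jac A x\<bar> * (k (\<Phi> x))\<^sup>2))"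
    by (rule integrable_mult_right) (rule i(1))
  have "AE x in lebesgue_on S. norm ((k (\<Phi> x))\<^sup>2) \<le> norm ((1 / c) * (\<bar>jac A x\<bar> * (k (\<Phi> x))\<^sup>2))"
    by (rule AE_I2) (use le c(1) in auto)
  then have i3: "integrable (lebesgue_on S) (\<lambda>x. (k (\<Phi> x))\<^sup>2)"
    by (rule Bochner_Integration.integrable_bound[OF i2, rotated]) (use m in auto)
  then show "sqint_on S (\<lambda>x. k (\<Phi> x))" using m by (simp add: sqint_def)
  have "sqnorm_on S (\<lambda>x. k (\<Phi> x)) \<le> (LINT x|lebesgue_on S. (1 / c) * (\<bar>jac A x\<bar> * (k (\<Phi> x))\<^sup>2))"
    by (rule integral_mono[OF i3 i2]) (use le in auto)
  also have "\<dots> = (1 / c) * sqnorm_on (\<Phi> ` S) k"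
    using i(2) by simp
  finally show "sqnorm_on S (\<lambda>x. k (\<Phi> x)) \<le> (1 / c) * sqnorm_on (\<Phi> ` S) k" .
qed

lemma has_jacobian_image_sets:
  assumes "has_jacobian U \<Phi> A" "S \<subseteq> U" "S \<in> sets lebesgue"
  shows "\<Phi> ` S \<in> sets lebesgue"
proof (rule differentiable_image_in_sets_lebesgue[OF assms(3)])
  show "\<Phi> differentiable_on S"
    using has_jacobian_has_derivative[OF assms(1)] assms(2)
    unfolding differentiable_on_def differentiable_def by (meson has_derivative_at_withinI subsetD)
qed simp

lemma has_jacobian_continuous: "has_jacobian U \<Phi> A \<Longrightarrow> continuous_on U \<Phi>"
  by (intro continuous_at_imp_continuous_on ballI) (rule has_derivative_continuous[OF has_jacobian_has_derivative])

text \<open>Approximants of \<open>f\<close> near the compact image are composed with the map. The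
  classical chain rule gives their gradients, and the Jacobian bounds transfer the errors back to
  \<open>C\<close>.\<close>

lemma strong_grad_compose:
  assumes U: "open U" and V: "open V" and J: "has_jacobian U \<Phi> A" and img: "\<Phi> ` U \<subseteq> V" and inj: "inj_on \<Phi> U"
    and c: "c > 0" "\<forall>x\<in>U. c \<le> \<bar>jac A x\<bar>"
    and f: "sqint_on V f" "\<And>i. sqint_on V (f' i)" "strong_grad V f f'"
  shows "strong_grad U (\<lambda>x. f (\<Phi> x)) (\<lambda>i x. \<Sum>j\<in>UNIV. A i j x * f' j (\<Phi> x))"
  unfolding strong_grad_def
proof (intro allI impI, elim conjE)
  fix C and e :: real assume C: "compact C" "C \<subseteq> U" "0 < e"
  define D where "D = \<Phi> ` C"
  have cont: "continuous_on U \<Phi>" by (rule has_jacobian_continuous[OF J])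
  have D: "compact D" "D \<subseteq> V"
    unfolding D_def using C img by (auto intro!: compact_continuous_image continuous_on_subset[OF cont])
  have Cs: "C \<in> sets lebesgue" and Ds: "\<Phi> ` C \<in> sets lebesgue" and Vs: "V \<in> sets lebesgue"
    using C(1) D(1) V by (auto simp: D_def intro: open_sets_lebesgue compact_sets_lebesgue)
  have injC: "inj_on \<Phi> C" using inj C(2) by (rule inj_on_subset)
  have cC: "\<forall>x\<in>C. c \<le> \<bar>jac A x\<bar>" using c(2) C(2) by auto
  note comp = sqint_compose[OF Cs Ds J C(2) injC c(1) cC, folded D_def]
  have cA: "continuous_on C (A i j)" for i j
    by (rule has_jacobian_continuous_entry[OF J C(2)])
  have mA: "A i j \<in> borel_measurable (lebesgue_on C)" for i j
    by (intro continuous_imp_measurable_on_sets_lebesgue[OF _ Cs] cA)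
  have "\<exists>M. M > 0 \<and> (\<forall>x\<in>C. \<bar>A i j x\<bar> \<le> M)" for i j
    by (rule continuous_on_compact_abs_bound[OF cA[of i j] C(1)]) blast
  then have "\<forall>p. \<exists>M. M > 0 \<and> (\<forall>x\<in>C. \<bar>A (fst p) (snd p) x\<bar> \<le> M)" by blast
  from choice[OF this] obtain N where N: "\<And>p. N p > 0" "\<And>p x. x \<in> C \<Longrightarrow> \<bar>A (fst p) (snd p) x\<bar> \<le> N p" by blast
  define M where "M = (\<Sum>p\<in>UNIV. N p)"
  have M: "M > 0" "\<And>i j x. x \<in> C \<Longrightarrow> \<bar>A i j x\<bar> \<le> M"
  proof -
    show "M > 0" unfolding M_def using N(1) by (intro sum_pos) auto
    fix i j x assume "x \<in> C"
    then have "\<bar>A i j x\<bar> \<le> N (i, j)" using N(2)[of x "(i, j)"] by simp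
    also have "\<dots> \<le> M" unfolding M_def using N(1) by (intro member_le_sum) (auto intro: less_imp_le)
    finally show "\<bar>A i j x\<bar> \<le> M" .
  qed
  \<comment> \<open>The first term controls the function, where composition costs 1/c. The second
    controls a gradient component, a sum of two products with entries bounded by
    \<open>M\<close>.\<close>
  define e' where "e' = min (c * e) (c * e / (4 * M\<^sup>2))"
  have e': "e' > 0" "e' / c \<le> e" "4 * (M\<^sup>2 * (e' / c)) \<le> e"
  proof -
    show "e' > 0" using C(3) M(1) c(1) by (simp add: e'_def)
    have "e' \<le> c * e" by (simp add: e'_def)
    then show "e' / c \<le> e" using c(1) by (simp add: field_simps)
    have "e' \<le> c * e / (4 * M\<^sup>2)" by (simp add: e'_def)
    then show "4 * (M\<^sup>2 * (e' / c)) \<le> e" using c(1) M(1) by (simp add: field_simps)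
  qed
  obtain W F F' where W: "open W" "D \<subseteq> W" "W \<subseteq> V" "C1_on W F F'"
    and err: "sqnorm_on D (\<lambda>x. F x - f x) \<le> e'" "\<And>i. sqnorm_on D (\<lambda>x. F' i x - f' i x) \<le> e'"
    by (rule strong_gradD[OF f(3) D e'(1)]) (rule that)
  have fD: "sqint_on D f" "sqint_on D (f' i)" for i
    using sqint_mono(1)[OF f(1) D(2) _ Vs] sqint_mono(1)[OF f(2) D(2) _ Vs] Ds by (auto simp: D_def)
  note FD = C1_on_sqint_compact[OF W(4) D(1) W(2)]
  define O' where "O' = U \<inter> \<Phi> -` W"
  have O': "open O'" "C \<subseteq> O'" "O' \<subseteq> U"
    unfolding O'_def using continuous_open_preimage[OF cont U W(1)] C(2) W(2) by (auto simp: D_def)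
  have C1: "C1_on O' (\<lambda>x. F (\<Phi> x)) (\<lambda>i x. \<Sum>j\<in>UNIV. A i j x * F' j (\<Phi> x))"
    unfolding C1_on_def
  proof (intro conjI ballI allI)
    fix x assume x: "x \<in> O'"
    have "has_grad (\<lambda>x. F (\<Phi> x)) (\<lambda>i. \<Sum>j\<in>UNIV. F' j (\<Phi> x) * A i j x) x"
      by (rule has_grad_compose_vec[of \<Phi> "\<lambda>i j. A i j x"])
         (use x J W(4) in \<open>auto simp: O'_def has_jacobian_def C1_on_def\<close>)
    then show "has_grad (\<lambda>x. F (\<Phi> x)) (\<lambda>i. \<Sum>j\<in>UNIV. A i j x * F' j (\<Phi> x)) x"
      by (simp add: mult.commute)
  next
    fix i
    show "continuous_on O' (\<lambda>x. \<Sum>j\<in>UNIV. A i j x * F' j (\<Phi> x))"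
    proof (intro continuous_on_sum continuous_on_mult)
      show "continuous_on O' (A i j)" for j by (rule has_jacobian_continuous_entry[OF J O'(3)])
      show "continuous_on O' (\<lambda>x. F' j (\<Phi> x))" for j
        by (rule continuous_on_compose2[of W "F' j"])
           (use W(4) cont O'(3) in \<open>auto simp: C1_on_def O'_def intro: continuous_on_subset\<close>)
    qed
  qed
  have cmp: "sqnorm_on C (\<lambda>x. H (\<Phi> x) - h (\<Phi> x)) \<le> e' / c" "sqint_on C (\<lambda>x. H (\<Phi> x) - h (\<Phi> x))"
    if "sqint_on D H" "sqint_on D h" "sqnorm_on D (\<lambda>x. H x - h x) \<le> e'" for H h
  proof -
    note * = comp[OF sqint_diff[OF that(1,2)]]
    show "sqint_on C (\<lambda>x. H (\<Phi> x) - h (\<Phi> x))" by (rule *(1))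
    have "sqnorm_on C (\<lambda>x. H (\<Phi> x) - h (\<Phi> x)) \<le> (1 / c) * sqnorm_on D (\<lambda>x. H x - h x)" by (rule *(2))
    also have "\<dots> \<le> (1 / c) * e'" using that(3) c(1) by (intro mult_left_mono) auto
    finally show "sqnorm_on C (\<lambda>x. H (\<Phi> x) - h (\<Phi> x)) \<le> e' / c" by simp
  qed
  have err1: "sqnorm_on C (\<lambda>x. F (\<Phi> x) - f (\<Phi> x)) \<le> e"
    using cmp(1)[OF FD(1) fD(1) err(1)] e'(2) by linarith
  have err2: "sqnorm_on C (\<lambda>x. (\<Sum>j\<in>UNIV. A i j x * F' j (\<Phi> x)) - (\<Sum>j\<in>UNIV. A i j x * f' j (\<Phi> x))) \<le> e" for i
  proof -
    have b: "sqint_on C (\<lambda>x. A i j x * (F' j (\<Phi> x) - f' j (\<Phi> x)))"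
      "sqnorm_on C (\<lambda>x. A i j x * (F' j (\<Phi> x) - f' j (\<Phi> x))) \<le> M\<^sup>2 * (e' / c)" for j
    proof -
      note * = sqint_mult_bounded[OF cmp(2)[OF FD(2) fD(2) err(2)] mA, where B=M]
      show "sqint_on C (\<lambda>x. A i j x * (F' j (\<Phi> x) - f' j (\<Phi> x)))" by (rule *(1)) (simp add: M(2))
      have "sqnorm_on C (\<lambda>x. A i j x * (F' j (\<Phi> x) - f' j (\<Phi> x))) \<le> M\<^sup>2 * sqnorm_on C (\<lambda>x. F' j (\<Phi> x) - f' j (\<Phi> x))"
        by (rule *(2)) (simp add: M(2))
      also have "\<dots> \<le> M\<^sup>2 * (e' / c)" by (intro mult_left_mono cmp(1)[OF FD(2) fD(2) err(2)]) simp
      finally show "sqnorm_on C (\<lambda>x. A i j x * (F' j (\<Phi> x) - f' j (\<Phi> x))) \<le> M\<^sup>2 * (e' / c)" .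
    qed
    have "sqnorm_on C (\<lambda>x. (\<Sum>j\<in>UNIV. A i j x * F' j (\<Phi> x)) - (\<Sum>j\<in>UNIV. A i j x * f' j (\<Phi> x)))
      = sqnorm_on C (\<lambda>x. A i 1 x * (F' 1 (\<Phi> x) - f' 1 (\<Phi> x)) + A i 2 x * (F' 2 (\<Phi> x) - f' 2 (\<Phi> x)))"
      by (simp add: sum_2 algebra_simps)
    also have "\<dots> \<le> 2 * sqnorm_on C (\<lambda>x. A i 1 x * (F' 1 (\<Phi> x) - f' 1 (\<Phi> x))) + 2 * sqnorm_on C (\<lambda>x. A i 2 x * (F' 2 (\<Phi> x) - f' 2 (\<Phi> x)))"
      by (intro sqnorm_add_le b)
    also have "\<dots> \<le> 2 * (M\<^sup>2 * (e' / c)) + 2 * (M\<^sup>2 * (e' / c))"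
      by (intro add_mono mult_left_mono b) auto
    finally show ?thesis using e'(3) by linarith
  qed
  show "\<exists>V F F'. open V \<and> C \<subseteq> V \<and> V \<subseteq> U \<and> C1_on V F F' \<and>
        sqnorm_on C (\<lambda>x. F x - f (\<Phi> x)) \<le> e \<and>
        (\<forall>i. sqnorm_on C (\<lambda>x. F' i x - (\<Sum>j\<in>UNIV. A i j x * f' j (\<Phi> x))) \<le> e)"
    by (rule exI[of _ O'], rule exI[of _ "\<lambda>x. F (\<Phi> x)"], rule exI[of _ "\<lambda>i x. \<Sum>j\<in>UNIV. A i j x * F' j (\<Phi> x)"])
       (intro conjI allI O' C1 err1 err2)
qed

section \<open>Functions with bounded derivatives\<close>

text \<open>The bound on all derivatives is an explicit argument, so that later lemmas can fix their
  constants before the set and the function.\<close>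

primrec CB :: "nat \<Rightarrow> plane set \<Rightarrow> real \<Rightarrow> (plane \<Rightarrow> real) \<Rightarrow> bool" where
  "CB 0 U M a \<longleftrightarrow> continuous_on U a \<and> (\<forall>x\<in>U. \<bar>a x\<bar> \<le> M)"
| "CB (Suc k) U M a \<longleftrightarrow> (\<forall>x\<in>U. \<bar>a x\<bar> \<le> M) \<and> (\<exists>a'. C1_on U a a' \<and> (\<forall>i. CB k U M (a' i)))"

lemma CB_bound: "CB k U M a \<Longrightarrow> x \<in> U \<Longrightarrow> \<bar>a x\<bar> \<le> M"
  by (cases k) auto

lemma CB_continuous: "CB k U M a \<Longrightarrow> continuous_on U a"
  by (cases k) (auto intro: C1_on_continuous)

lemma CB_Suc: "CB (Suc k) U M a \<Longrightarrow> CB k U M a"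
proof (induction k arbitrary: a)
  case 0 then show ?case using C1_on_continuous by auto
next
  case (Suc k)
  from Suc.prems obtain a' where a': "\<forall>x\<in>U. \<bar>a x\<bar> \<le> M" "C1_on U a a'" "\<forall>i. CB (Suc k) U M (a' i)"
    unfolding CB.simps(2)[of "Suc k"] by blast
  have "\<forall>i. CB k U M (a' i)" using a'(3) Suc.IH by blast
  then show ?case unfolding CB.simps(2)[of k] using a'(1,2) by blast
qed

lemma CB_mono_order: "CB k U M a \<Longrightarrow> j \<le> k \<Longrightarrow> CB j U M a"
  by (induction k) (auto simp del: CB.simps simp: le_Suc_eq dest: CB_Suc)

lemma CB_mono: "CB k U M a \<Longrightarrow> M \<le> N \<Longrightarrow> CB k U N a"
proof (induction k arbitrary: a)
  case 0 then show ?case by force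
next
  case (Suc k) then show ?case unfolding CB.simps by (meson order_trans)
qed

lemma CB_subset: "CB k U M a \<Longrightarrow> V \<subseteq> U \<Longrightarrow> CB k V M a"
proof (induction k arbitrary: a)
  case 0 then show ?case by (auto intro: continuous_on_subset)
next
  case (Suc k)
  from Suc.prems(1) obtain a' where "\<forall>x\<in>U. \<bar>a x\<bar> \<le> M" "C1_on U a a'" "\<forall>i. CB k U M (a' i)"
    unfolding CB.simps by blast
  then show ?case unfolding CB.simps using Suc.IH Suc.prems(2) C1_on_subset by blast
qed

lemma C1_on_add:
  assumes "C1_on U f f'" "C1_on U g g'"
  shows "C1_on U (\<lambda>x. f x + g x) (\<lambda>i x. f' i x + g' i x)"
  using assms unfolding C1_on_def by (auto intro!: has_grad_add continuous_intros)

lemma CB_add: "CB k U M a \<Longrightarrow> CB k U N b \<Longrightarrow> CB k U (M + N) (\<lambda>x. a x + b x)"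
proof (induction k arbitrary: a b)
  case 0
  then have "\<forall>x\<in>U. \<bar>a x + b x\<bar> \<le> M + N" by (fastforce intro: order_trans[OF abs_triangle_ineq] add_mono)
  with 0 show ?case by (auto intro: continuous_on_add)
next
  case (Suc k)
  from Suc.prems obtain a' b' where a: "C1_on U a a'" "\<And>i. CB k U M (a' i)" and b: "C1_on U b b'" "\<And>i. CB k U N (b' i)"
    unfolding CB.simps by blast
  have "\<forall>x\<in>U. \<bar>a x + b x\<bar> \<le> M + N"
    using CB_bound[OF Suc.prems(1)] CB_bound[OF Suc.prems(2)] by (fastforce intro: order_trans[OF abs_triangle_ineq] add_mono)
  moreover have "C1_on U (\<lambda>x. a x + b x) (\<lambda>i x. a' i x + b' i x)" by (rule C1_on_add[OF a(1) b(1)])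
  moreover have "\<forall>i. CB k U (M + N) (\<lambda>x. a' i x + b' i x)" using Suc.IH[OF a(2) b(2)] by blast
  ultimately show ?case unfolding CB.simps by (intro conjI exI[of _ "\<lambda>i x. a' i x + b' i x"])
qed

text \<open>Each application of the product rule gives two terms, whence the factor 2 per
  order.\<close>

lemma CB_mult:
  assumes "CB k U M a" "CB k U N b" "0 \<le> M" "0 \<le> N"
  shows "CB k U (2 ^ k * (M * N)) (\<lambda>x. a x * b x)"
  using assms(1,2)
proof (induction k arbitrary: a b)
  case 0
  then have "\<forall>x\<in>U. \<bar>a x * b x\<bar> \<le> M * N" by (auto simp: abs_mult assms intro!: mult_mono)
  with 0 show ?case by (auto intro: continuous_on_mult)
next
  case (Suc k)
  from Suc.prems obtain a' b' where a: "C1_on U a a'" "\<And>i. CB k U M (a' i)" and b: "C1_on U b b'" "\<And>i. CB k U N (b' i)"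
    unfolding CB.simps by blast
  have "\<bar>a x * b x\<bar> \<le> 2 ^ Suc k * (M * N)" if "x \<in> U" for x
  proof -
    have "\<bar>a x * b x\<bar> \<le> M * N" using CB_bound[OF Suc.prems(1) that] CB_bound[OF Suc.prems(2) that]
      by (auto simp: abs_mult assms intro!: mult_mono)
    also have "\<dots> \<le> 2 ^ Suc k * (M * N)"
      using mult_right_mono[OF one_le_power[of "2::real" "Suc k"], of "M * N"] assms(3,4) by simp
    finally show ?thesis .
  qed
  moreover have "C1_on U (\<lambda>x. a x * b x) (\<lambda>i x. a x * b' i x + a' i x * b x)" by (rule C1_on_mult[OF a(1) b(1)])
  moreover have "CB k U (2 ^ Suc k * (M * N)) (\<lambda>x. a x * b' i x + a' i x * b x)" for i
    using CB_add[OF Suc.IH[OF CB_Suc[OF Suc.prems(1)] b(2)[of i]] Suc.IH[OF a(2)[of i] CB_Suc[OF Suc.prems(2)]]] by (simp add: mult_ac)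
  ultimately show ?case unfolding CB.simps by (intro conjI exI[of _ "\<lambda>i x. a x * b' i x + a' i x * b x"]) auto
qed

text \<open>Here the Jacobian of \<open>R\<close> is itself a function of \<open>R\<close>, as for
  an inverse map. A derivative of \<open>b (R x)\<close> is a sum of products of functions of the
  same form, so the induction closes without any bound on derivatives of \<open>R\<close> as
  hypothesis.\<close>

lemma CB_compose_branch:
  assumes M: "M \<ge> 0"
  shows "\<exists>K\<ge>0. \<forall>U R B b. (\<forall>x\<in>U. R x \<in> V) \<and> has_jacobian U R (\<lambda>i j x. B i j (R x)) \<and>
     (\<forall>i j. CB (k - 1) V M (B i j)) \<and> CB k V M b \<longrightarrow> CB k U K (\<lambda>x. b (R x))"
proof (induction k)
  case 0
  show ?case
  proof (intro exI[of _ M] conjI allI impI M)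
    fix U R B b assume "(\<forall>x\<in>U. R x \<in> V) \<and> has_jacobian U R (\<lambda>i j x. B i j (R x)) \<and> (\<forall>i j. CB (0 - 1) V M (B i j)) \<and> CB 0 V M b"
    then have *: "\<And>x. x \<in> U \<Longrightarrow> R x \<in> V" "has_jacobian U R (\<lambda>i j x. B i j (R x))" "CB 0 V M b" by auto
    have "continuous_on U (\<lambda>x. b (R x))"
      by (rule continuous_on_compose2[OF CB_continuous[OF *(3)] has_jacobian_continuous[OF *(2)]]) (use *(1) in auto)
    then show "CB 0 U M (\<lambda>x. b (R x))" using * by simp
  qed
next
  case (Suc k)
  then obtain K where K1: "K \<ge> 0" and K2: "\<forall>U R B b. (\<forall>x\<in>U. R x \<in> V) \<and> has_jacobian U R (\<lambda>i j x. B i j (R x)) \<and>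
     (\<forall>i j. CB (k - 1) V M (B i j)) \<and> CB k V M b \<longrightarrow> CB k U K (\<lambda>x. b (R x))"
    by (elim exE conjE) (rule that)
  have K: "CB k U K (\<lambda>x. b (R x))" if "\<forall>x\<in>U. R x \<in> V" "has_jacobian U R (\<lambda>i j x. B i j (R x))"
     "\<forall>i j. CB (k - 1) V M (B i j)" "CB k V M b" for U R B b
    by (rule K2[rule_format, of U R B b], intro conjI that)
  define L where "L = M + 2 * (2 ^ k * (K * K))"
  have L: "L \<ge> 0" "M \<le> L" "2 ^ k * (K * K) + 2 ^ k * (K * K) \<le> L" using M K1 by (auto simp: L_def)
  show ?case
  proof (intro exI[of _ L] conjI allI impI L)
    fix U R B b assume "(\<forall>x\<in>U. R x \<in> V) \<and> has_jacobian U R (\<lambda>i j x. B i j (R x)) \<and> (\<forall>i j. CB (Suc k - 1) V M (B i j)) \<and> CB (Suc k) V M b"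
    then have *: "\<And>x. x \<in> U \<Longrightarrow> R x \<in> V" "has_jacobian U R (\<lambda>i j x. B i j (R x))" "\<And>i j. CB k V M (B i j)" "CB (Suc k) V M b" by auto
    obtain b' where b': "C1_on V b b'" "\<And>i. CB k V M (b' i)" using *(4) by auto
    have B1: "\<forall>i j. CB (k - 1) V M (B i j)" using CB_mono_order[OF *(3)] by simp
    have V: "\<forall>x\<in>U. R x \<in> V" using *(1) by blast
    have t: "CB k U (2 ^ k * (K * K)) (\<lambda>x. b' j (R x) * B i j (R x))" for i j
      by (rule CB_mult[OF K[OF V *(2) B1 b'(2)] K[OF V *(2) B1 *(3)] K1 K1])
    have s: "CB k U L (\<lambda>x. \<Sum>j\<in>UNIV. b' j (R x) * B i j (R x))" for i
      unfolding sum_2 by (rule CB_mono[OF CB_add[OF t t] L(3)])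
    have "has_grad (\<lambda>x. b (R x)) (\<lambda>i. \<Sum>j\<in>UNIV. b' j (R x) * B i j (R x)) x" if "x \<in> U" for x
      by (rule has_grad_compose_vec[of R "\<lambda>i j. B i j (R x)"])
         (use *(1,2) b'(1) that in \<open>auto simp: has_jacobian_def C1_on_def\<close>)
    then have "C1_on U (\<lambda>x. b (R x)) (\<lambda>i x. \<Sum>j\<in>UNIV. b' j (R x) * B i j (R x))"
      unfolding C1_on_def using CB_continuous[OF s] by blast
    moreover have "\<forall>x\<in>U. \<bar>b (R x)\<bar> \<le> L" using CB_bound[OF *(4)] *(1) L(2) by (meson order_trans)
    ultimately show "CB (Suc k) U L (\<lambda>x. b (R x))"
      unfolding CB.simps using s by (intro conjI exI[of _ "\<lambda>i x. \<Sum>j\<in>UNIV. b' j (R x) * B i j (R x)"]) auto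
  qed
qed

section \<open>Sobolev functions with quantitative bounds\<close>

text \<open>A quantitative form of membership in the Sobolev space of order \<open>k\<close>. It passes through products
  and changes of variables by induction on \<open>k\<close>, with constants that do not depend on \<open>U\<close>.\<close>

primrec HN :: "nat \<Rightarrow> plane set \<Rightarrow> real \<Rightarrow> (plane \<Rightarrow> real) \<Rightarrow> bool" where
  "HN 0 U B w \<longleftrightarrow> sqint_on U w \<and> sqnorm_on U w \<le> B"
| "HN (Suc k) U B w \<longleftrightarrow> sqint_on U w \<and> sqnorm_on U w \<le> B \<and>
     (\<exists>w'. strong_grad U w w' \<and> (\<forall>i. HN k U B (w' i)))"

lemma HN_sqint: "HN k U B w \<Longrightarrow> sqint_on U w"
  and HN_sqnorm: "HN k U B w \<Longrightarrow> sqnorm_on U w \<le> B"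
  by (cases k; auto)+

lemma HN_nonneg: "HN k U B w \<Longrightarrow> B \<ge> 0"
  using HN_sqnorm sqnorm_nonneg order_trans by blast

lemma HN_mono: "HN k U B w \<Longrightarrow> B \<le> C \<Longrightarrow> HN k U C w"
proof (induction k arbitrary: w)
  case (Suc k)
  from Suc.prems(1) obtain w' where "strong_grad U w w'" "\<forall>i. HN k U B (w' i)" unfolding HN.simps by blast
  then show ?case using Suc.IH Suc.prems HN_sqint[OF Suc.prems(1)] HN_sqnorm[OF Suc.prems(1)]
    unfolding HN.simps by (blast intro: order_trans)
qed (auto intro: order_trans)

lemma HN_Suc: "HN (Suc k) U B w \<Longrightarrow> HN k U B w"
proof (induction k arbitrary: w)
  case (Suc k)
  from Suc.prems(1) obtain w' where "strong_grad U w w'" "\<forall>i. HN (Suc k) U B (w' i)"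
    unfolding HN.simps(2)[of "Suc k"] by blast
  then show ?case using Suc.IH HN_sqint[OF Suc.prems(1)] HN_sqnorm[OF Suc.prems(1)]
    unfolding HN.simps(2)[of k] by blast
qed auto

lemma HN_add:
  assumes U: "open U"
  shows "HN k U B f \<Longrightarrow> HN k U C g \<Longrightarrow> HN k U (2 * B + 2 * C) (\<lambda>x. f x + g x)"
proof (induction k arbitrary: f g)
  case 0
  then show ?case using sqint_add[of _ f g] sqnorm_add_le[of _ f g] by fastforce
next
  case (Suc k)
  from Suc.prems obtain f' g' where f: "strong_grad U f f'" "\<And>i. HN k U B (f' i)" and g: "strong_grad U g g'" "\<And>i. HN k U C (g' i)"
    unfolding HN.simps by blast
  note s = HN_sqint[OF Suc.prems(1)] HN_sqint[OF Suc.prems(2)]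
  have "strong_grad U (\<lambda>x. f x + g x) (\<lambda>i x. f' i x + g' i x)"
    by (rule strong_grad_add[OF U s(1) HN_sqint[OF f(2)] f(1) s(2) HN_sqint[OF g(2)] g(1)])
  moreover have "sqnorm_on U (\<lambda>x. f x + g x) \<le> 2 * B + 2 * C"
    using sqnorm_add_le[OF s] HN_sqnorm[OF Suc.prems(1)] HN_sqnorm[OF Suc.prems(2)] by linarith
  ultimately show ?case
    using Suc.IH[OF f(2) g(2)] sqint_add[OF s] unfolding HN.simps by (intro conjI exI[of _ "\<lambda>i x. f' i x + g' i x"]) auto
qed

text \<open>Induction with the product rule: each gradient component is a sum of two products of
  lower order, and the constant depends on \<open>M\<close> and \<open>k\<close> only.\<close>

lemma HN_mult:
  assumes M: "M \<ge> 0"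
  shows "\<exists>K\<ge>0. \<forall>U a B w. open U \<and> CB k U M a \<and> HN k U B w \<longrightarrow> HN k U (K * B) (\<lambda>x. a x * w x)"
proof (induction k)
  case 0
  show ?case
  proof (intro exI[of _ "M\<^sup>2"] conjI allI impI)
    fix U a B w assume "open U \<and> CB 0 U M a \<and> HN 0 U B w"
    then have *: "open U" "CB 0 U M a" "HN 0 U B w" by auto
    have ma: "a \<in> borel_measurable (lebesgue_on U)"
      by (rule continuous_imp_measurable_on_sets_lebesgue[OF CB_continuous[OF *(2)] open_sets_lebesgue[OF *(1)]])
    note b = sqint_mult_bounded[OF HN_sqint[OF *(3)] ma, of M]
    have "M\<^sup>2 * sqnorm_on U w \<le> M\<^sup>2 * B" using *(3) by (intro mult_left_mono) auto
    then show "HN 0 U (M\<^sup>2 * B) (\<lambda>x. a x * w x)"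
      using b CB_bound[OF *(2)] by simp
  qed simp
next
  case (Suc k)
  then obtain K where K: "K \<ge> 0" "\<And>U a B w. open U \<Longrightarrow> CB k U M a \<Longrightarrow> HN k U B w \<Longrightarrow> HN k U (K * B) (\<lambda>x. a x * w x)" by blast
  show ?case
  proof (intro exI[of _ "M\<^sup>2 + 4 * K"] conjI allI impI)
    show "M\<^sup>2 + 4 * K \<ge> 0" using K(1) by simp
    fix U a B w assume "open U \<and> CB (Suc k) U M a \<and> HN (Suc k) U B w"
    then have *: "open U" "CB (Suc k) U M a" "HN (Suc k) U B w" by auto
    have B: "B \<ge> 0" by (rule HN_nonneg[OF *(3)])
    obtain a' where a': "C1_on U a a'" "\<And>i. CB k U M (a' i)" using *(2) by auto
    obtain w' where w': "strong_grad U w w'" "\<And>i. HN k U B (w' i)" using *(3) by auto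
    have ma: "a \<in> borel_measurable (lebesgue_on U)"
      by (rule continuous_imp_measurable_on_sets_lebesgue[OF CB_continuous[OF *(2)] open_sets_lebesgue[OF *(1)]])
    note b = sqint_mult_bounded[OF HN_sqint[OF *(3)] ma, of M]
    have "M\<^sup>2 * sqnorm_on U w \<le> M\<^sup>2 * B" using HN_sqnorm[OF *(3)] by (intro mult_left_mono) auto
    also have "\<dots> \<le> (M\<^sup>2 + 4 * K) * B" using B K(1) by (intro mult_right_mono) auto
    finally have "sqint_on U (\<lambda>x. a x * w x)" "sqnorm_on U (\<lambda>x. a x * w x) \<le> (M\<^sup>2 + 4 * K) * B"
      using b CB_bound[OF *(2)] by auto
    moreover have "strong_grad U (\<lambda>x. a x * w x) (\<lambda>i x. a x * w' i x + a' i x * w x)"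
      by (rule strong_grad_mult[OF *(1) a'(1) HN_sqint[OF *(3)] HN_sqint[OF w'(2)] w'(1)])
    moreover have "HN k U ((M\<^sup>2 + 4 * K) * B) (\<lambda>x. a x * w' i x + a' i x * w x)" for i
    proof (rule HN_mono[OF HN_add[OF *(1) K(2)[OF *(1) CB_Suc[OF *(2)] w'(2)] K(2)[OF *(1) a'(2) HN_Suc[OF *(3)]]]])
      show "2 * (K * B) + 2 * (K * B) \<le> (M\<^sup>2 + 4 * K) * B" using B by (simp add: algebra_simps)
    qed
    ultimately show "HN (Suc k) U ((M\<^sup>2 + 4 * K) * B) (\<lambda>x. a x * w x)"
      unfolding HN.simps by (intro conjI exI[of _ "\<lambda>i x. a x * w' i x + a' i x * w x"]) auto
  qed
qed

text \<open>By the chain rule, a gradient component of the composition is a sum of products of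
  Jacobian entries with compositions of lower order. Hence the entries need one derivative less than
  \<open>w\<close>, and the constant depends on \<open>M\<close>, \<open>c\<close> and
  \<open>k\<close> only.\<close>

lemma HN_compose:
  assumes M: "M \<ge> 0" and c: "c > 0"
  shows "\<exists>K\<ge>0. \<forall>U V \<Phi> A B w. open U \<and> open V \<and> has_jacobian U \<Phi> A \<and> \<Phi> ` U \<subseteq> V \<and> inj_on \<Phi> U \<and>
      (\<forall>x\<in>U. c \<le> \<bar>jac A x\<bar>) \<and> (\<forall>i j. CB (k - 1) U M (A i j)) \<and> HN k V B w \<longrightarrow> HN k U (K * B) (\<lambda>x. w (\<Phi> x))"
proof -
  have base: "sqint_on U (\<lambda>x. w (\<Phi> x)) \<and> sqnorm_on U (\<lambda>x. w (\<Phi> x)) \<le> (1 / c) * B"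
    if *: "open U" "open V" "has_jacobian U \<Phi> A" "\<Phi> ` U \<subseteq> V" "inj_on \<Phi> U" "\<forall>x\<in>U. c \<le> \<bar>jac A x\<bar>" "HN k V B w"
    for U V \<Phi> A B w k
  proof -
    note Us = open_sets_lebesgue[OF *(1)] and Vs = open_sets_lebesgue[OF *(2)]
    note ims = has_jacobian_image_sets[OF *(3) subset_refl Us]
    note w = sqint_mono[OF HN_sqint[OF *(7)] *(4) ims Vs]
    note s = sqint_compose[OF Us ims *(3) subset_refl *(5) c *(6) w(1)]
    have "(1 / c) * sqnorm_on (\<Phi> ` U) w \<le> (1 / c) * B"
      using w(2) HN_sqnorm[OF *(7)] c by (intro mult_left_mono) auto
    with s show ?thesis by simp
  qed
  show ?thesis
  proof (induction k)
    case 0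
    show ?case
      using base[where k=0] c by (intro exI[of _ "1 / c"] conjI allI impI) auto
  next
    case (Suc k)
    then obtain K where K1: "K \<ge> 0" and K2: "\<forall>U V \<Phi> A B w. open U \<and> open V \<and> has_jacobian U \<Phi> A \<and> \<Phi> ` U \<subseteq> V \<and> inj_on \<Phi> U \<and>
      (\<forall>x\<in>U. c \<le> \<bar>jac A x\<bar>) \<and> (\<forall>i j. CB (k - 1) U M (A i j)) \<and> HN k V B w \<longrightarrow> HN k U (K * B) (\<lambda>x. w (\<Phi> x))"
      by (elim exE conjE) (rule that)
    have K: "K \<ge> 0" "HN k U (K * B) (\<lambda>x. w (\<Phi> x))" if "open U" "open V" "has_jacobian U \<Phi> A" "\<Phi> ` U \<subseteq> V" "inj_on \<Phi> U"
      "\<forall>x\<in>U. c \<le> \<bar>jac A x\<bar>" "\<forall>i j. CB (k - 1) U M (A i j)" "HN k V B w" for U V \<Phi> A B w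
      by (rule K1) (rule K2[rule_format, of U V \<Phi> A B w], intro conjI that)
    obtain L where L: "L \<ge> 0" "\<And>U a B w. open U \<Longrightarrow> CB k U M a \<Longrightarrow> HN k U B w \<Longrightarrow> HN k U (L * B) (\<lambda>x. a x * w x)"
      using HN_mult[OF M, of k] by blast
    show ?case
    proof (intro exI[of _ "1 / c + 4 * (L * K)"] conjI allI impI)
      show "0 \<le> 1 / c + 4 * (L * K)" using c K1 L(1) by simp
      fix U V \<Phi> A B w
      assume "open U \<and> open V \<and> has_jacobian U \<Phi> A \<and> \<Phi> ` U \<subseteq> V \<and> inj_on \<Phi> U \<and>
        (\<forall>x\<in>U. c \<le> \<bar>jac A x\<bar>) \<and> (\<forall>i j. CB (Suc k - 1) U M (A i j)) \<and> HN (Suc k) V B w"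
      then have *: "open U" "open V" "has_jacobian U \<Phi> A" "\<Phi> ` U \<subseteq> V" "inj_on \<Phi> U" "\<forall>x\<in>U. c \<le> \<bar>jac A x\<bar>"
        and A: "\<And>i j. CB k U M (A i j)" and w: "HN (Suc k) V B w" by auto
      have B: "B \<ge> 0" by (rule HN_nonneg[OF w])
      obtain w' where w': "strong_grad V w w'" "\<And>i. HN k V B (w' i)" using w by auto
      have A1: "\<forall>i j. CB (k - 1) U M (A i j)" using CB_mono_order[OF A] by simp
      have g: "strong_grad U (\<lambda>x. w (\<Phi> x)) (\<lambda>i x. \<Sum>j\<in>UNIV. A i j x * w' j (\<Phi> x))"
        by (rule strong_grad_compose[OF *(1-5) c *(6) HN_sqint[OF w] HN_sqint[OF w'(2)] w'(1)])
      have t: "HN k U (L * (K * B)) (\<lambda>x. A i j x * w' j (\<Phi> x))" for i j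
        by (rule L(2)[OF *(1) A K(2)[OF * A1 w'(2)]])
      have h: "HN k U ((1 / c + 4 * (L * K)) * B) (\<lambda>x. \<Sum>j\<in>UNIV. A i j x * w' j (\<Phi> x))" for i
        unfolding sum_2
      proof (rule HN_mono[OF HN_add[OF *(1) t t]])
        have "0 \<le> (1/c) * B" using B c by simp
        then show "2 * (L * (K * B)) + 2 * (L * (K * B)) \<le> (1 / c + 4 * (L * K)) * B" by (simp add: algebra_simps)
      qed
      have "0 \<le> 4 * (L * K) * B" using B L(1) K1 by simp
      then have "(1 / c) * B \<le> (1 / c + 4 * (L * K)) * B" by (simp add: algebra_simps)
      with base[OF * w] g h show "HN (Suc k) U ((1 / c + 4 * (L * K)) * B) (\<lambda>x. w (\<Phi> x))"
        unfolding HN.simps by (intro conjI exI[of _ "\<lambda>i x. \<Sum>j\<in>UNIV. A i j x * w' j (\<Phi> x)"]) auto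
    qed
  qed
qed

section \<open>Weak derivatives and jets\<close>

lemma locally_integrable_times_test:
  assumes U: "open U" and d: "locally_integrable U d" and \<phi>: "test_function U \<phi>"
  shows "integrable (lebesgue_on U) (\<lambda>x. d x * \<phi> x)"
proof -
  obtain S where S: "smooth \<phi>" "compact S" "S \<subseteq> U" "\<And>x. x \<notin> S \<Longrightarrow> \<phi> x = 0"
    "\<And>x i. x \<notin> S \<Longrightarrow> partial_deriv i \<phi> x = 0"
    by (rule test_functionE[OF \<phi>]) (rule that)
  note Us = open_sets_lebesgue[OF U] and Ss = compact_sets_lebesgue[OF S(2)]
  have i: "integrable (lebesgue_on S) d" using d S(2,3) unfolding locally_integrable_def by simp
  obtain M where M: "M > 0" "\<And>x. x \<in> S \<Longrightarrow> \<bar>\<phi> x\<bar> \<le> M"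
    by (rule continuous_on_compact_abs_bound[OF smooth_continuous_on[OF S(1)] S(2)]) (rule that)
  have m: "\<phi> \<in> borel_measurable (lebesgue_on S)"
    by (rule continuous_imp_measurable_on_sets_lebesgue[OF smooth_continuous_on[OF S(1)] Ss])
  have "integrable (lebesgue_on S) (\<lambda>x. d x * \<phi> x)"
  proof (rule Bochner_Integration.integrable_bound)
    show "integrable (lebesgue_on S) (\<lambda>x. M * d x)" using i by simp
    show "(\<lambda>x. d x * \<phi> x) \<in> borel_measurable (lebesgue_on S)" using borel_measurable_integrable[OF i] m by auto
    show "AE x in lebesgue_on S. norm (d x * \<phi> x) \<le> norm (M * d x)"
      using M by (intro AE_I2) (auto simp: abs_mult mult.commute[of "\<bar>d _\<bar>"] intro!: mult_right_mono)
  qed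
  then show ?thesis using lebesgue_on_integral_support(2)[OF Us Ss S(3)] S(4) by simp
qed

lemma has_weak_deriv_test:
  assumes "has_weak_deriv U i j u v" "test_function U \<phi>"
  shows "(LINT x|lebesgue_on U. u x * multi_deriv i j \<phi> x) = (-1) ^ (i + j) * (LINT x|lebesgue_on U. v x * \<phi> x)"
  using assms unfolding has_weak_deriv_def by simp

lemma has_weak_deriv_unique:
  assumes U: "open U" and v: "has_weak_deriv U i j u v" and w: "has_weak_deriv U i j u w"
  shows "AE x in lebesgue_on U. v x = w x"
proof -
  have lv: "locally_integrable U v" and lw: "locally_integrable U w"
    using v w by (auto simp: has_weak_deriv_def)
  have "AE x in lebesgue_on U. v x - w x = 0"
  proof (rule fundamental_lemma[OF U])
    show "locally_integrable U (\<lambda>x. v x - w x)"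
      using lv lw unfolding locally_integrable_def by auto
    fix \<phi> assume t: "test_function U \<phi>"
    have "(-1) ^ (i + j) * (LINT x|lebesgue_on U. v x * \<phi> x) = (-1) ^ (i + j) * (LINT x|lebesgue_on U. w x * \<phi> x)"
      using has_weak_deriv_test[OF v t] has_weak_deriv_test[OF w t] by simp
    then have "(LINT x|lebesgue_on U. v x * \<phi> x) = (LINT x|lebesgue_on U. w x * \<phi> x)"
      by simp
    then show "(LINT x|lebesgue_on U. (v x - w x) * \<phi> x) = 0"
      using locally_integrable_times_test[OF U lv t] locally_integrable_times_test[OF U lw t] by (simp add: left_diff_distrib)
  qed
  then show ?thesis by eventually_elim simp
qed

lemma measurable_lebesgue_on_AE:
  fixes f g :: "plane \<Rightarrow> real"
  assumes "U \<in> sets lebesgue" "f \<in> borel_measurable (lebesgue_on U)" "AE x in lebesgue_on U. f x = g x"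
  shows "g \<in> borel_measurable (lebesgue_on U)"
proof -
  have "AE x in lebesgue. x \<in> U \<longrightarrow> f x = g x"
    using assms(1,3) by (simp add: AE_restrict_space_iff)
  then have "AE x in lebesgue. (if x \<in> U then f x else 0) = (if x \<in> U then g x else 0)"
    by eventually_elim auto
  from borel_measurable_AE[OF _ this] show ?thesis
    using borel_measurable_if[OF assms(1), of f] borel_measurable_if[OF assms(1), of g] assms(2) by simp
qed

text \<open>\<open>weak_deriv\<close> is an arbitrary choice among weak derivatives. Since these
  agree almost everywhere, any square integrable one computes its norm.\<close>

lemma weak_deriv_sqnorm:
  assumes U: "open U" and v: "has_weak_deriv U i j u v" "sqint_on U v"
  shows "sqnorm_on U (weak_deriv U i j u) = sqnorm_on U v"
proof -
  have w: "has_weak_deriv U i j u (weak_deriv U i j u)"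
    unfolding weak_deriv_def by (rule someI[of _ v]) (rule v(1))
  have ae: "AE x in lebesgue_on U. v x = weak_deriv U i j u x"
    by (rule has_weak_deriv_unique[OF U v(1) w])
  from sqint_AE_cong(2)[OF ae sqint_measurable[OF v(2)] measurable_lebesgue_on_AE[OF open_sets_lebesgue[OF U] sqint_measurable[OF v(2)] ae]]
  show ?thesis by simp
qed

lemma has_weak_deriv_0:
  assumes "open U" "sqint_on U u"
  shows "has_weak_deriv U 0 0 u u"
  using sqint_locally_integrable[OF assms] by (simp add: has_weak_deriv_def)

lemma test_function_smooth: "test_function U \<phi> \<Longrightarrow> smooth \<phi>"
  by (simp add: test_function_iff)

lemma minus_one_power_cancel: "(-1::real) ^ n * a = (-1) ^ Suc n * b \<Longrightarrow> a = - b"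
  by (cases "even n") auto

text \<open>A partial derivative of a test function is again a test function. Using it in the
  identity for order (i, j) gives the identity of the next order, and the signs differ by one factor
  -1.\<close>

lemma has_weak_deriv_weak_grad:
  assumes v: "has_weak_deriv U i j u v" and v1: "has_weak_deriv U (Suc i) j u v1" and v2: "has_weak_deriv U i (Suc j) u v2"
  shows "weak_grad U v (\<lambda>l. if l = 1 then v1 else v2)"
  unfolding weak_grad_def
proof (intro allI impI)
  fix \<phi> and l :: 2 assume t: "test_function U \<phi>"
  note a = has_weak_deriv_test[OF v test_function_partial_deriv[OF t]]
  show "(LINT x|lebesgue_on U. v x * partial_deriv l \<phi> x) = - (LINT x|lebesgue_on U. (if l = 1 then v1 else v2) x * \<phi> x)"
  proof (cases "l = 1")
    case True
    have "(-1) ^ (i + j) * (LINT x|lebesgue_on U. v x * partial_deriv 1 \<phi> x) = (-1) ^ (Suc i + j) * (LINT x|lebesgue_on U. v1 x * \<phi> x)"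
      using a[of 1] has_weak_deriv_test[OF v1 t] by (simp only: multi_deriv_partial_deriv_1[OF test_function_smooth[OF t]])
    then have "(LINT x|lebesgue_on U. v x * partial_deriv 1 \<phi> x) = - (LINT x|lebesgue_on U. v1 x * \<phi> x)"
      by (intro minus_one_power_cancel[of "i + j"]) (simp only: add_Suc)
    then show ?thesis using True by simp
  next
    case False
    then have l: "l = 2" using exhaust_2[of l] by auto
    have "(-1) ^ (i + j) * (LINT x|lebesgue_on U. v x * partial_deriv 2 \<phi> x) = (-1) ^ (i + Suc j) * (LINT x|lebesgue_on U. v2 x * \<phi> x)"
      using a[of 2] has_weak_deriv_test[OF v2 t] by (simp only: multi_deriv_partial_deriv_2)
    then have "(LINT x|lebesgue_on U. v x * partial_deriv 2 \<phi> x) = - (LINT x|lebesgue_on U. v2 x * \<phi> x)"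
      by (intro minus_one_power_cancel[of "i + j"]) (simp only: add_Suc_right)
    then show ?thesis using l by simp
  qed
qed

text \<open>The weak gradient takes one derivative off the test function. Direction 1 goes first
  because \<open>multi_deriv\<close> applies it outermost; direction 2 is then treated only when
  \<open>i = 0\<close>.\<close>

lemma HN_imp_has_weak_deriv:
  assumes U: "open U"
  shows "HN k U B w \<Longrightarrow> i + j \<le> k \<Longrightarrow> \<exists>v. has_weak_deriv U i j w v \<and> sqint_on U v \<and> sqnorm_on U v \<le> B"
proof (induction k arbitrary: w i j)
  case 0
  then show ?case using has_weak_deriv_0[OF U HN_sqint[OF 0(1)]] by auto
next
  case (Suc k)
  obtain w' where w': "strong_grad U w w'" "\<And>i. HN k U B (w' i)" using Suc.prems(1) by auto
  note sw = HN_sqint[OF Suc.prems(1)]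
  have weak: "weak_grad U w w'" by (rule strong_imp_weak_grad[OF U sw HN_sqint[OF w'(2)] w'(1)])
  show ?case
  proof (cases i)
    case (Suc i')
    obtain v where v: "has_weak_deriv U i' j (w' 1) v" "sqint_on U v" "sqnorm_on U v \<le> B"
      using Suc.IH[OF w'(2), of i' j 1] Suc.prems(2) Suc by auto
    have "has_weak_deriv U i j w v"
      unfolding has_weak_deriv_def
    proof (intro conjI allI impI sqint_locally_integrable[OF U] sw v)
      fix \<phi> assume t: "test_function U \<phi>"
      have "(LINT x|lebesgue_on U. w x * multi_deriv i j \<phi> x) = (LINT x|lebesgue_on U. w x * partial_deriv 1 (multi_deriv i' j \<phi>) x)"
        unfolding partial_deriv_multi_deriv_1 Suc ..
      also have "\<dots> = - (LINT x|lebesgue_on U. w' 1 x * multi_deriv i' j \<phi> x)"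
        using weak test_function_multi_deriv[OF t, of i' j] unfolding weak_grad_def by simp
      also have "\<dots> = (-1) ^ (i + j) * (LINT x|lebesgue_on U. v x * \<phi> x)"
        unfolding has_weak_deriv_test[OF v(1) t] Suc by simp
      finally show "(LINT x|lebesgue_on U. w x * multi_deriv i j \<phi> x) = (-1) ^ (i + j) * (LINT x|lebesgue_on U. v x * \<phi> x)" .
    qed
    then show ?thesis using v by blast
  next
    case 0
    show ?thesis
    proof (cases j)
      case 0
      then show ?thesis using \<open>i = 0\<close> has_weak_deriv_0[OF U sw] sw HN_sqnorm[OF Suc.prems(1)] by auto
    next
      case j: (Suc j')
      obtain v where v: "has_weak_deriv U 0 j' (w' 2) v" "sqint_on U v" "sqnorm_on U v \<le> B"
        using Suc.IH[OF w'(2), of 0 j' 2] Suc.prems(2) 0 j by auto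
      have "has_weak_deriv U i j w v"
        unfolding has_weak_deriv_def
      proof (intro conjI allI impI sqint_locally_integrable[OF U] sw v)
        fix \<phi> assume t: "test_function U \<phi>"
        have "(LINT x|lebesgue_on U. w x * multi_deriv i j \<phi> x) = (LINT x|lebesgue_on U. w x * partial_deriv 2 (multi_deriv 0 j' \<phi>) x)"
          unfolding partial_deriv_multi_deriv_2[OF test_function_smooth[OF t]] 0 j ..
        also have "\<dots> = - (LINT x|lebesgue_on U. w' 2 x * multi_deriv 0 j' \<phi> x)"
          using weak test_function_multi_deriv[OF t, of 0 j'] unfolding weak_grad_def by simp
        also have "\<dots> = (-1) ^ (i + j) * (LINT x|lebesgue_on U. v x * \<phi> x)"
          unfolding has_weak_deriv_test[OF v(1) t] 0 j by simp
        finally show "(LINT x|lebesgue_on U. w x * multi_deriv i j \<phi> x) = (-1) ^ (i + j) * (LINT x|lebesgue_on U. v x * \<phi> x)" .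
      qed
      then show ?thesis using v by blast
    qed
  qed
qed

lemma HN_imp_in_sobolev: "open U \<Longrightarrow> HN k U B w \<Longrightarrow> in_sobolev k U w"
  unfolding in_sobolev_def in_L2_iff_sqint
  using HN_sqint[of k U B w] HN_imp_has_weak_deriv[of U k B w] by blast

lemma HN_imp_sobolev_seminorm:
  assumes U: "open U" and w: "HN k U B w"
  shows "(sobolev_seminorm k U w)\<^sup>2 \<le> real (Suc k) * B"
proof -
  have "sqnorm_on U (weak_deriv U i (k - i) w) \<le> B" if "i \<le> k" for i
  proof -
    have le: "i + (k - i) \<le> k" using \<open>i \<le> k\<close> by simp
    obtain v where v: "has_weak_deriv U i (k - i) w v" "sqint_on U v" "sqnorm_on U v \<le> B"
      using HN_imp_has_weak_deriv[OF U w le] by (elim exE conjE) (rule that)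
    then show ?thesis using weak_deriv_sqnorm[OF U v(1,2)] by simp
  qed
  then have "(\<Sum>i\<le>k. sqnorm_on U (weak_deriv U i (k - i) w)) \<le> (\<Sum>i\<le>k. B)"
    by (intro sum_mono) auto
  then show ?thesis
    unfolding sobolev_seminorm_def by (subst real_sqrt_pow2) (auto intro: sum_nonneg)
qed

text \<open>\<open>HN\<close> nests gradients and does not identify mixed derivatives reached in
  different orders. A jet is one family indexed by multi-indices, as needed for correcting all
  derivatives by those of a single polynomial.\<close>

definition jet :: "nat \<Rightarrow> plane set \<Rightarrow> (nat \<Rightarrow> nat \<Rightarrow> plane \<Rightarrow> real) \<Rightarrow> bool" where
  "jet k U D \<longleftrightarrow> (\<forall>i j. i + j \<le> k \<longrightarrow> sqint_on U (D i j)) \<and>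
     (\<forall>i j. i + j < k \<longrightarrow> strong_grad U (D i j) (\<lambda>l. if l = 1 then D (Suc i) j else D i (Suc j)))"

lemma jet_sqint: "jet k U D \<Longrightarrow> i + j \<le> k \<Longrightarrow> sqint_on U (D i j)"
  and jet_strong_grad: "jet k U D \<Longrightarrow> i + j < k \<Longrightarrow> strong_grad U (D i j) (\<lambda>l. if l = 1 then D (Suc i) j else D i (Suc j))"
  by (simp_all add: jet_def)

lemma jet_subset:
  assumes "jet k U D" "open U" "open V" "V \<subseteq> U"
  shows "jet k V D"
  unfolding jet_def
  using sqint_mono(1)[OF jet_sqint[OF assms(1)] assms(4) open_sets_lebesgue[OF assms(3)] open_sets_lebesgue[OF assms(2)]]
    strong_grad_subset[OF jet_strong_grad[OF assms(1)] assms(3,4)] by simp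

lemma jet_imp_HN_derivs:
  assumes D: "jet k U D" and B: "\<And>i j. i + j \<le> k \<Longrightarrow> sqnorm_on U (D i j) \<le> B"
  shows "i + j + n = k \<Longrightarrow> HN n U B (D i j)"
proof (induction n arbitrary: i j)
  case 0 then show ?case using jet_sqint[OF D] B by simp
next
  case (Suc n)
  have "HN n U B (D (Suc i) j)" "HN n U B (D i (Suc j))" using Suc by auto
  then show ?case
    using jet_sqint[OF D, of i j] B[of i j] jet_strong_grad[OF D, of i j] Suc.prems
    unfolding HN.simps by (intro conjI exI[of _ "\<lambda>l. if l = 1 then D (Suc i) j else D i (Suc j)"]) auto
qed

lemma jet_imp_HN:
  assumes D: "jet k U D" and B: "\<And>i j. i + j \<le> k \<Longrightarrow> sqnorm_on U (D i j) \<le> B"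
  shows "HN k U B (D 0 0)"
  by (rule jet_imp_HN_derivs[OF D B]) auto

lemma jet_mono: "jet k U D \<Longrightarrow> n \<le> k \<Longrightarrow> jet n U D"
  by (simp add: jet_def)

lemma weak_derivs_imp_jet:
  assumes U: "open U" and D: "\<And>i j. i + j \<le> k \<Longrightarrow> has_weak_deriv U i j u (D i j)" "\<And>i j. i + j \<le> k \<Longrightarrow> sqint_on U (D i j)"
  shows "jet k U D"
  unfolding jet_def
proof (intro conjI allI impI D(2))
  fix i j :: nat assume ij: "i + j < k"
  have s: "sqint_on U (if l = 1 then D (Suc i) j else D i (Suc j))" for l :: 2
    using D(2)[of "Suc i" j] D(2)[of i "Suc j"] ij by simp
  show "strong_grad U (D i j) (\<lambda>l. if l = 1 then D (Suc i) j else D i (Suc j))"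
    by (rule weak_imp_strong_grad[OF U D(2) s has_weak_deriv_weak_grad[OF D(1) D(1) D(1)]]) (use ij in auto)
qed

lemma in_sobolev_derivs:
  assumes U: "open U" and u: "in_sobolev k U u"
  obtains D where "D 0 0 = u" "\<And>i j. i + j \<le> k \<Longrightarrow> has_weak_deriv U i j u (D i j)"
    "\<And>i j. i + j \<le> k \<Longrightarrow> sqint_on U (D i j)"
proof -
  have su: "sqint_on U u" using u by (simp add: in_sobolev_def in_L2_iff_sqint)
  have "\<forall>p. \<exists>v. fst p + snd p \<le> k \<longrightarrow> has_weak_deriv U (fst p) (snd p) u v \<and> sqint_on U v"
    using u by (simp add: in_sobolev_def in_L2_iff_sqint)
  from choice[OF this] obtain E where E0: "\<forall>p. fst p + snd p \<le> k \<longrightarrow> has_weak_deriv U (fst p) (snd p) u (E p) \<and> sqint_on U (E p)"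
    by (elim exE) (rule that)
  have E: "has_weak_deriv U (fst p) (snd p) u (E p) \<and> sqint_on U (E p)" if "fst p + snd p \<le> k" for p
    by (rule E0[rule_format, OF that])
  show ?thesis
  proof (rule that[of "\<lambda>i j. if i = 0 \<and> j = 0 then u else E (i, j)"])
    fix i j assume "i + j \<le> k"
    then show "has_weak_deriv U i j u (if i = 0 \<and> j = 0 then u else E (i, j))"
      "sqint_on U (if i = 0 \<and> j = 0 then u else E (i, j))"
      using E[of "(i, j)"] has_weak_deriv_0[OF U su] su by auto
  qed simp
qed

lemma sobolev_norm_derivs:
  assumes U: "open U" and D: "\<And>i j. i + j \<le> k \<Longrightarrow> has_weak_deriv U i j u (D i j)"
    "\<And>i j. i + j \<le> k \<Longrightarrow> sqint_on U (D i j)"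
  shows "(sobolev_norm k U u)\<^sup>2 = (\<Sum>n\<le>k. \<Sum>i\<le>n. sqnorm_on U (D i (n - i)))"
proof -
  have "(sobolev_seminorm n U u)\<^sup>2 = (\<Sum>i\<le>n. sqnorm_on U (D i (n - i)))" if "n \<le> k" for n
  proof -
    have "(\<Sum>i\<le>n. sqnorm_on U (weak_deriv U i (n - i) u)) = (\<Sum>i\<le>n. sqnorm_on U (D i (n - i)))"
      using that by (intro sum.cong refl weak_deriv_sqnorm[OF U D]) auto
    then show ?thesis
      unfolding sobolev_seminorm_def by (subst real_sqrt_pow2) (auto intro!: sum_nonneg)
  qed
  then show ?thesis
    unfolding sobolev_norm_def by (subst real_sqrt_pow2) (auto intro!: sum_nonneg sum.cong)
qed

text \<open>The passage goes through the weak derivatives, for which the order of differentiation is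
  irrelevant; their uniqueness carries the bound over to the chosen family.\<close>

lemma HN_imp_jet:
  assumes U: "open U" and w: "HN k U B w"
  obtains D where "D 0 0 = w" "jet k U D" "\<And>i j. i + j \<le> k \<Longrightarrow> sqnorm_on U (D i j) \<le> B"
proof -
  obtain D where D: "D 0 0 = w" "\<And>i j. i + j \<le> k \<Longrightarrow> has_weak_deriv U i j w (D i j)"
    "\<And>i j. i + j \<le> k \<Longrightarrow> sqint_on U (D i j)"
    by (rule in_sobolev_derivs[OF U HN_imp_in_sobolev[OF U w]]) (rule that)
  have "sqnorm_on U (D i j) \<le> B" if "i + j \<le> k" for i j
  proof -
    obtain v where v: "has_weak_deriv U i j w v" "sqint_on U v" "sqnorm_on U v \<le> B"
      using HN_imp_has_weak_deriv[OF U w \<open>i + j \<le> k\<close>] by (elim exE conjE) (rule that)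
    then show ?thesis using weak_deriv_sqnorm[OF U v(1,2)] weak_deriv_sqnorm[OF U D(2,3)[OF that]] by simp
  qed
  then show ?thesis using that[OF D(1) weak_derivs_imp_jet[OF U D(2,3)]] by simp
qed

lemma jet_add:
  assumes U: "open U" and D: "jet k U D" and E: "jet k U E"
  shows "jet k U (\<lambda>i j x. D i j x + E i j x)"
  unfolding jet_def
proof (intro conjI allI impI)
  fix i j :: nat
  show "sqint_on U (\<lambda>x. D i j x + E i j x)" if "i + j \<le> k"
    using sqint_add jet_sqint[OF D that] jet_sqint[OF E that] by blast
  assume ij: "i + j < k"
  have s: "sqint_on U (if l = 1 then D (Suc i) j else D i (Suc j))"
    "sqint_on U (if l = 1 then E (Suc i) j else E i (Suc j))" for l :: 2
    using jet_sqint[OF D] jet_sqint[OF E] ij by auto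
  have "strong_grad U (\<lambda>x. D i j x + E i j x) (\<lambda>l x. (if l = 1 then D (Suc i) j else D i (Suc j)) x + (if l = 1 then E (Suc i) j else E i (Suc j)) x)"
    by (rule strong_grad_add[OF U jet_sqint[OF D] s(1) jet_strong_grad[OF D ij] jet_sqint[OF E] s(2) jet_strong_grad[OF E ij]]) (use ij in auto)
  also have "(\<lambda>l x. (if l = 1 then D (Suc i) j else D i (Suc j)) x + (if l = 1 then E (Suc i) j else E i (Suc j)) x)
    = (\<lambda>l. if l = (1::2) then (\<lambda>x. D (Suc i) j x + E (Suc i) j x) else (\<lambda>x. D i (Suc j) x + E i (Suc j) x))"
    by (auto simp: fun_eq_iff)
  finally show "strong_grad U (\<lambda>x. D i j x + E i j x) (\<lambda>l. if l = 1 then (\<lambda>x. D (Suc i) j x + E (Suc i) j x) else (\<lambda>x. D i (Suc j) x + E i (Suc j) x))" .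
qed

lemma smooth_sqint:
  fixes p :: "plane \<Rightarrow> real"
  assumes "smooth p" "bounded U" "U \<in> sets lebesgue"
  shows "sqint_on U p"
proof -
  have "compact (closure U)" using assms(2) by simp
  then show ?thesis
    using sqint_mono(1)[OF sqint_continuous_compact[OF smooth_continuous_on[OF assms(1)]] closure_subset assms(3)] compact_sets_lebesgue
    by blast
qed

lemma smooth_jet:
  assumes p: "smooth p" and U: "open U" "bounded U"
  shows "jet k U (\<lambda>i j. multi_deriv i j p)"
  unfolding jet_def
proof (intro conjI allI impI)
  fix i j :: nat
  show "sqint_on U (multi_deriv i j p)"
    by (rule smooth_sqint[OF smooth_multi_deriv[OF p] U(2) open_sets_lebesgue[OF U(1)]])
  have "(\<lambda>l. partial_deriv l (multi_deriv i j p)) = (\<lambda>l. if l = 1 then multi_deriv (Suc i) j p else multi_deriv i (Suc j) p)"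
  proof
    fix l :: 2
    show "partial_deriv l (multi_deriv i j p) = (if l = 1 then multi_deriv (Suc i) j p else multi_deriv i (Suc j) p)"
      using partial_deriv_multi_deriv_1[of i j p] partial_deriv_multi_deriv_2[OF p, of i j] exhaust_2[of l] by auto
  qed
  with C1_on_imp_strong_grad[OF U(1) smooth_C1_on[OF smooth_multi_deriv[OF p, of i j]]]
  show "strong_grad U (multi_deriv i j p) (\<lambda>l. if l = 1 then multi_deriv (Suc i) j p else multi_deriv i (Suc j) p)"
    by simp
qed

section \<open>The Poincare inequality on convex sets\<close>

text \<open>Expand the square. This identity replaces the deviation from the mean by differences of
  point values, which can be estimated along segments.\<close>

lemma integral_square_difference:
  assumes M: "finite_measure M" and f: "sqint M f"
  shows "(LINT x|M. (LINT y|M. (f x - f y)\<^sup>2)) = 2 * (measure M (space M) * sqnorm M f - (LINT x|M. f x)\<^sup>2)"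
proof -
  interpret finite_measure M by fact
  define c a b where "c = measure M (space M)" and "a = (LINT x|M. f x)" and "b = sqnorm M f"
  note i = integral_square_le(1)[OF M f] sqint_integrable[OF f]
  have "(LINT y|M. (f x - f y)\<^sup>2) = c * (f x)\<^sup>2 - 2 * a * f x + b" for x
  proof -
    have "(LINT y|M. (f x - f y)\<^sup>2) = (LINT y|M. (f x)\<^sup>2 - 2 * f x * f y + (f y)\<^sup>2)"
      by (intro Bochner_Integration.integral_cong refl) (simp add: power2_diff)
    also have "\<dots> = c * (f x)\<^sup>2 - 2 * a * f x + b"
      using i by (simp add: a_def b_def c_def)
    finally show ?thesis .
  qed
  then have "(LINT x|M. (LINT y|M. (f x - f y)\<^sup>2)) = (LINT x|M. c * (f x)\<^sup>2 - 2 * a * f x + b)" by simp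
  also have "\<dots> = c * b - 2 * a * a + c * b"
    using i by (simp add: a_def b_def c_def)
  finally show ?thesis by (simp add: a_def b_def c_def power2_eq_square)
qed

lemma nn_integral_lebesgue_on_eq:
  fixes g :: "'a::euclidean_space \<Rightarrow> real"
  assumes "S \<in> sets borel" "(\<lambda>x. indicator S x * g x) \<in> borel_measurable borel"
  shows "(\<integral>\<^sup>+x. ennreal (g x) \<partial>lebesgue_on S) = (\<integral>\<^sup>+x. ennreal (indicator S x * g x) \<partial>lborel)"
proof -
  have "(\<integral>\<^sup>+x. ennreal (g x) \<partial>lebesgue_on S) = (\<integral>\<^sup>+x. ennreal (g x) * indicator S x \<partial>lebesgue)"
    using assms(1) by (subst nn_integral_restrict_space) auto
  also have "\<dots> = (\<integral>\<^sup>+x. ennreal (indicator S x * g x) \<partial>lebesgue)"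
    by (intro nn_integral_cong) (auto simp: indicator_def)
  also have "\<dots> = (\<integral>\<^sup>+x. ennreal (indicator S x * g x) \<partial>lborel)"
    using assms(2) by (simp add: nn_integral_completion)
  finally show ?thesis .
qed

text \<open>The fundamental theorem of calculus along the segment, and Cauchy-Schwarz on [0, 1]. The
  nonnegative integral on the right is ready for exchanging the order of integration.\<close>

lemma square_increment_le:
  assumes F: "C1_on V F F'" and seg: "closed_segment x y \<subseteq> V"
  shows "ennreal ((F y - F x)\<^sup>2) \<le> (\<integral>\<^sup>+t. indicator {0..1} t * ennreal ((norm (y - x))\<^sup>2 * (\<Sum>i\<in>UNIV. (F' i (x + t *\<^sub>R (y - x)))\<^sup>2)) \<partial>lborel)"
proof -
  define v where "v = y - x"
  define \<phi> where "\<phi> t = (\<Sum>i\<in>UNIV. F' i (x + t *\<^sub>R v) * v $ i)" for t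
  have inV: "x + t *\<^sub>R v \<in> V" if "t \<in> {0..1}" for t
    using seg that unfolding v_def closed_segment_def by (force simp: algebra_simps)
  have cF': "continuous_on {0..1} (\<lambda>t. F' i (x + t *\<^sub>R v))" for i
    by (rule continuous_on_compose2[of V "F' i"]) (use F inV in \<open>auto simp: C1_on_def intro!: continuous_intros\<close>)
  have c\<phi>: "continuous_on {0..1} \<phi>" unfolding \<phi>_def by (intro continuous_intros cF')
  have der: "((\<lambda>t. F (x + t *\<^sub>R v)) has_vector_derivative \<phi> t) (at t within {0..1})" if "t \<in> {0..1}" for t
  proof -
    have "((\<lambda>t. F (x + t *\<^sub>R v)) has_real_derivative \<phi> t) (at t)"
      unfolding \<phi>_def by (rule line_has_real_derivative) (use F inV[OF that] in \<open>simp add: C1_on_def\<close>)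
    then show ?thesis
      by (simp add: has_real_derivative_iff_has_vector_derivative[symmetric] has_field_derivative_at_within)
  qed
  have hi: "(\<phi> has_integral (F (x + 1 *\<^sub>R v) - F (x + 0 *\<^sub>R v))) {0..1}"
    by (rule fundamental_theorem_of_calculus[OF _ der]) auto
  have sq: "sqint (lebesgue_on {0..1}) \<phi>" by (rule sqint_continuous_compact[OF c\<phi>]) simp
  have fm: "finite_measure (lebesgue_on {0..1::real})" by (rule finite_measure_lebesgue_on) simp
  have "(LINT t|lebesgue_on {0..1}. \<phi> t) = integral {0..1} \<phi>"
    by (rule lebesgue_integral_eq_integral[OF integral_square_le(1)[OF fm sq]]) simp
  also have "\<dots> = F y - F x" using integral_unique[OF hi] by (simp add: v_def)
  finally have "(F y - F x)\<^sup>2 \<le> measure (lebesgue_on {0..1::real}) {0..1} * sqnorm (lebesgue_on {0..1}) \<phi>"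
    using integral_square_le(2)[OF fm sq] by simp
  also have "measure (lebesgue_on {0..1::real}) {0..1} = 1" by (simp add: measure_restrict_space)
  finally have "ennreal ((F y - F x)\<^sup>2) \<le> ennreal (sqnorm (lebesgue_on {0..1}) \<phi>)" by (simp add: ennreal_leI)
  also have "\<dots> = (\<integral>\<^sup>+t. ennreal ((\<phi> t)\<^sup>2) \<partial>lebesgue_on {0..1})"
    by (rule sqnorm_nn_integral[OF sq, symmetric])
  also have "\<dots> = (\<integral>\<^sup>+t. ennreal (indicator {0..1} t * (\<phi> t)\<^sup>2) \<partial>lborel)"
  proof (rule nn_integral_lebesgue_on_eq)
    have "(\<lambda>t. indicator {0..1} t *\<^sub>R (\<phi> t)\<^sup>2) \<in> borel_measurable borel"
      by (rule borel_measurable_continuous_on_indicator) (auto intro!: continuous_intros c\<phi>)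
    then show "(\<lambda>t. indicator {0..1} t * (\<phi> t)\<^sup>2) \<in> borel_measurable borel" by simp
  qed simp
  also have "\<dots> \<le> (\<integral>\<^sup>+t. indicator {0..1} t * ennreal ((norm v)\<^sup>2 * (\<Sum>i\<in>UNIV. (F' i (x + t *\<^sub>R v))\<^sup>2)) \<partial>lborel)"
  proof (rule nn_integral_mono)
    fix t :: real
    have "(\<phi> t)\<^sup>2 \<le> (\<Sum>i\<in>UNIV. (F' i (x + t *\<^sub>R v))\<^sup>2) * (\<Sum>i\<in>UNIV. (v $ i)\<^sup>2)"
      unfolding \<phi>_def by (rule Cauchy_Schwarz_ineq_sum)
    also have "(\<Sum>i\<in>UNIV. (v $ i)\<^sup>2) = (norm v)\<^sup>2"
      by (simp add: norm_vec_def L2_set_def sum_nonneg)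
    finally have "(\<phi> t)\<^sup>2 \<le> (norm v)\<^sup>2 * (\<Sum>i\<in>UNIV. (F' i (x + t *\<^sub>R v))\<^sup>2)" by (simp add: mult.commute)
    then show "ennreal (indicator {0..1} t * (\<phi> t)\<^sup>2) \<le> indicator {0..1} t * ennreal ((norm v)\<^sup>2 * (\<Sum>i\<in>UNIV. (F' i (x + t *\<^sub>R v))\<^sup>2))"
      by (auto simp: indicator_def intro: ennreal_leI)
  qed
  finally show ?thesis by (simp add: v_def)
qed

text \<open>Half of the double integral of (f x - f y)^2 over \<open>C\<close>; leaving it
  unnormalised avoids dividing by the area, which varies along an exhaustion.\<close>

definition variance_form :: "plane set \<Rightarrow> (plane \<Rightarrow> real) \<Rightarrow> real" where
  "variance_form C f = measure lebesgue C * sqnorm_on C f - (LINT x|lebesgue_on C. f x)\<^sup>2"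

text \<open>Substitute v = y - x, which ranges over a disc of radius \<open>2 * R\<close>. For fixed
  \<open>v\<close> and \<open>t\<close> the map from \<open>x\<close> to x + t v is a translation,
  so the integral of the squared gradient along the segments is bounded by its integral over
  \<open>C\<close>, uniformly in \<open>t\<close>.\<close>

lemma Poincare_C1:
  assumes C: "compact C" "convex C" "C \<subseteq> cball x\<^sub>0 R" and V: "C \<subseteq> V" and F: "C1_on V F F'" and R: "R > 0"
  shows "2 * variance_form C F \<le> (2 * R)\<^sup>2 * measure lebesgue (cball (0::plane) (2 * R)) * (\<Sum>i\<in>UNIV. sqnorm_on C (F' i))"
proof -
  let ?M = "lebesgue_on C"
  define d where "d = 2 * R"
  have Cs: "C \<in> sets lebesgue" and Cb: "C \<in> sets borel" using C(1) by (auto intro: compact_sets_lebesgue borel_compact)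
  have fm: "finite_measure ?M" by (rule finite_measure_lebesgue_on) (simp add: lmeasurable_compact C(1))
  have mC: "measure ?M (space ?M) = measure lebesgue C" using Cs by (simp add: measure_restrict_space)
  note sF = C1_on_sqint_compact[OF F C(1) V]
  \<comment> \<open>The squared gradient extended by 0: the integrals over \<open>x\<close> can then
    run over the whole plane and be translated.\<close>
  define G where "G x = indicator C x * (\<Sum>i\<in>UNIV. (F' i x)\<^sup>2)" for x
  have cF: "continuous_on C F" "continuous_on C (F' i)" for i
    using C1_on_continuous[OF F] F V by (auto simp: C1_on_def intro: continuous_on_subset)
  have ind: "(\<lambda>x. indicator C x * g x) \<in> borel_measurable borel" if "continuous_on C g" for g :: "plane \<Rightarrow> real"
    using borel_measurable_continuous_on_indicator[OF Cb that] by simp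
  have [measurable]: "G \<in> borel_measurable borel" unfolding G_def by (intro ind continuous_intros cF)
  have G0: "G x \<ge> 0" for x by (auto simp: G_def indicator_def intro!: sum_nonneg)
  define F0 where "F0 x = indicator C x * F x" for x
  have [measurable]: "F0 \<in> borel_measurable borel" unfolding F0_def by (intro ind cF)
  have [measurable]: "C \<in> sets borel" by fact
  have inner: "(\<integral>\<^sup>+y. ennreal ((F x - F y)\<^sup>2) \<partial>?M) = ennreal (LINT y|?M. (F x - F y)\<^sup>2)" for x
  proof (rule sqnorm_nn_integral)
    have "sqint ?M (\<lambda>y. F x)" using fm by (simp add: sqint_def finite_measure.integrable_const)
    then show "sqint ?M (\<lambda>y. F x - F y)" by (rule sqint_diff[OF _ sF(1)])
  qed
  have int2: "integrable ?M (\<lambda>x. LINT y|?M. (F x - F y)\<^sup>2)"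
  proof -
    have "(LINT y|?M. (F x - F y)\<^sup>2) = measure ?M (space ?M) * (F x)\<^sup>2 - 2 * (LINT y|?M. F y) * F x + sqnorm ?M F" for x
    proof -
      interpret finite_measure ?M by fact
      have "(LINT y|?M. (F x - F y)\<^sup>2) = (LINT y|?M. (F x)\<^sup>2 - 2 * F x * F y + (F y)\<^sup>2)"
        by (intro Bochner_Integration.integral_cong refl) (simp add: power2_diff)
      then show ?thesis using integral_square_le(1)[OF fm sF(1)] sqint_integrable[OF sF(1)] by simp
    qed
    then show ?thesis using integral_square_le(1)[OF fm sF(1)] sqint_integrable[OF sF(1)] fm
      by (simp add: finite_measure.integrable_const)
  qed
  have "ennreal (2 * variance_form C F) = ennreal (LINT x|?M. (LINT y|?M. (F x - F y)\<^sup>2))"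
    using integral_square_difference[OF fm sF(1)] mC by (simp add: variance_form_def)
  also have "\<dots> = (\<integral>\<^sup>+x. ennreal (LINT y|?M. (F x - F y)\<^sup>2) \<partial>?M)"
    by (rule nn_integral_eq_integral[symmetric, OF int2]) auto
  also have "\<dots> = (\<integral>\<^sup>+x. (\<integral>\<^sup>+y. ennreal ((F x - F y)\<^sup>2) \<partial>?M) \<partial>?M)"
    by (simp only: inner)
  also have "\<dots> \<le> (\<integral>\<^sup>+x. (\<integral>\<^sup>+y. (\<integral>\<^sup>+t. indicator {0..1} t * ennreal (d\<^sup>2 * G (x + t *\<^sub>R (y - x))) \<partial>lborel) \<partial>?M) \<partial>?M)"
  proof (rule nn_integral_mono, rule nn_integral_mono)
    fix x y assume "x \<in> space ?M" "y \<in> space ?M"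
    then have xy: "x \<in> C" "y \<in> C" by auto
    have seg: "closed_segment x y \<subseteq> C" using xy C(2) by (simp add: convex_contains_segment)
    have nd: "norm (y - x) \<le> d"
    proof -
      have "dist y x \<le> dist y x\<^sub>0 + dist x\<^sub>0 x" by (rule dist_triangle)
      also have "\<dots> \<le> R + R" using xy C(3) by (intro add_mono) (auto simp: dist_commute)
      finally show ?thesis by (simp add: dist_norm d_def)
    qed
    have "ennreal ((F x - F y)\<^sup>2) = ennreal ((F y - F x)\<^sup>2)" by (simp add: power2_commute)
    also have "\<dots> \<le> (\<integral>\<^sup>+t. indicator {0..1} t * ennreal ((norm (y - x))\<^sup>2 * (\<Sum>i\<in>UNIV. (F' i (x + t *\<^sub>R (y - x)))\<^sup>2)) \<partial>lborel)"
      by (rule square_increment_le[OF F order_trans[OF seg V]])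
    also have "\<dots> \<le> (\<integral>\<^sup>+t. indicator {0..1} t * ennreal (d\<^sup>2 * G (x + t *\<^sub>R (y - x))) \<partial>lborel)"
    proof (rule nn_integral_mono)
      fix t :: real
      show "indicator {0..1} t * ennreal ((norm (y - x))\<^sup>2 * (\<Sum>i\<in>UNIV. (F' i (x + t *\<^sub>R (y - x)))\<^sup>2))
        \<le> indicator {0..1} t * ennreal (d\<^sup>2 * G (x + t *\<^sub>R (y - x)))"
      proof (cases "t \<in> {0..1}")
        case True
        then have "x + t *\<^sub>R (y - x) \<in> C"
          using seg unfolding closed_segment_def by (force simp: algebra_simps)
        then have "G (x + t *\<^sub>R (y - x)) = (\<Sum>i\<in>UNIV. (F' i (x + t *\<^sub>R (y - x)))\<^sup>2)" by (simp add: G_def)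
        then show ?thesis
          using nd by (auto simp: indicator_def intro!: ennreal_leI mult_right_mono power_mono sum_nonneg)
      qed simp
    qed
    finally show "ennreal ((F x - F y)\<^sup>2) \<le> (\<integral>\<^sup>+t. indicator {0..1} t * ennreal (d\<^sup>2 * G (x + t *\<^sub>R (y - x))) \<partial>lborel)" .
  qed
  also have "\<dots> \<le> emeasure lborel (cball (0::plane) d) * (ennreal (d\<^sup>2) * (\<integral>\<^sup>+x. ennreal (G x) \<partial>lborel))"
  proof -
    have [measurable]: "cball (0::plane) d \<in> sets borel" by simp
    \<comment> \<open>Writing the inner integral as a function of the point and of the difference
      vector makes the substitution v = y - x a translation in \<open>y\<close>.\<close>
    define H where "H x v = (\<integral>\<^sup>+t. indicator {0..1} t * ennreal (d\<^sup>2 * G (x + t *\<^sub>R v)) \<partial>(lborel::real measure))" for x v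
    have [measurable]: "(\<lambda>(x, v). H x v) \<in> borel_measurable (borel \<Otimes>\<^sub>M borel)"
      unfolding H_def split_beta by measurable
    have mH: "(\<lambda>y. indicator C y * H x (y - x)) \<in> borel_measurable borel" for x by measurable
    have "(\<integral>\<^sup>+x. (\<integral>\<^sup>+y. H x (y - x) \<partial>?M) \<partial>?M) = (\<integral>\<^sup>+x. (\<integral>\<^sup>+y. indicator C y * H x (y - x) \<partial>lborel) \<partial>?M)"
    proof (rule nn_integral_cong)
      fix x
      have "(\<integral>\<^sup>+y. H x (y - x) \<partial>?M) = (\<integral>\<^sup>+y. indicator C y * H x (y - x) \<partial>lebesgue)"
        using Cs by (subst nn_integral_restrict_space) (auto simp: mult.commute)
      then show "(\<integral>\<^sup>+y. H x (y - x) \<partial>?M) = (\<integral>\<^sup>+y. indicator C y * H x (y - x) \<partial>lborel)"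
        using mH by (simp add: nn_integral_completion)
    qed
    also have "\<dots> = (\<integral>\<^sup>+x. indicator C x * (\<integral>\<^sup>+y. indicator C y * H x (y - x) \<partial>lborel) \<partial>lebesgue)"
      using Cs by (subst nn_integral_restrict_space) (auto simp: mult.commute)
    also have "\<dots> = (\<integral>\<^sup>+x. indicator C x * (\<integral>\<^sup>+y. indicator C y * H x (y - x) \<partial>lborel) \<partial>lborel)"
      by (rule nn_integral_completion)
    also have "\<dots> = (\<integral>\<^sup>+x. indicator C x * (\<integral>\<^sup>+v. indicator C (x + v) * H x v \<partial>lborel) \<partial>lborel)"
    proof (rule nn_integral_cong)
      fix x
      show "indicator C x * (\<integral>\<^sup>+y. indicator C y * H x (y - x) \<partial>lborel) = indicator C x * (\<integral>\<^sup>+v. indicator C (x + v) * H x v \<partial>lborel)"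
        using nn_integral_lborel_translate[OF mH[of x], of x] by simp
    qed
    also have "\<dots> \<le> (\<integral>\<^sup>+x. (\<integral>\<^sup>+v. indicator (cball 0 d) v * H x v \<partial>lborel) \<partial>lborel)"
    proof (rule nn_integral_mono)
      fix x
      show "indicator C x * (\<integral>\<^sup>+v. indicator C (x + v) * H x v \<partial>lborel) \<le> (\<integral>\<^sup>+v. indicator (cball 0 d) v * H x v \<partial>lborel)"
      proof (cases "x \<in> C")
        case True
        have "indicator C (x + v) * H x v \<le> indicator (cball 0 d) v * H x v" for v
        proof (cases "x + v \<in> C")
          case xv: True
          have "dist (x + v) x \<le> dist (x + v) x\<^sub>0 + dist x\<^sub>0 x" by (rule dist_triangle)
          also have "\<dots> \<le> R + R" using xv True C(3) by (intro add_mono) (auto simp: dist_commute)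
          finally have "v \<in> cball 0 d" by (simp add: dist_norm d_def)
          then show ?thesis using xv by simp
        qed simp
        then show ?thesis using True by (auto intro: nn_integral_mono)
      qed simp
    qed
    also have "\<dots> = (\<integral>\<^sup>+v. (\<integral>\<^sup>+x. indicator (cball 0 d) v * H x v \<partial>lborel) \<partial>lborel)"
      by (rule lborel_pair.Fubini') measurable
    also have "\<dots> = (\<integral>\<^sup>+v. indicator (cball (0::plane) d) v * (ennreal (d\<^sup>2) * (\<integral>\<^sup>+x. ennreal (G x) \<partial>lborel)) \<partial>lborel)"
    proof (rule nn_integral_cong)
      fix v :: plane
      have "(\<integral>\<^sup>+x. H x v \<partial>lborel) = (\<integral>\<^sup>+t. (\<integral>\<^sup>+x. indicator {0..1} t * ennreal (d\<^sup>2 * G (x + t *\<^sub>R v)) \<partial>lborel) \<partial>(lborel::real measure))"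
        unfolding H_def by (rule lborel_pair.Fubini') measurable
      also have "\<dots> = (\<integral>\<^sup>+t. indicator {0..1} t * (ennreal (d\<^sup>2) * (\<integral>\<^sup>+x. ennreal (G x) \<partial>lborel)) \<partial>(lborel::real measure))"
      proof (rule nn_integral_cong)
        fix t :: real
        have "(\<integral>\<^sup>+x. indicator {0..1} t * ennreal (d\<^sup>2 * G (x + t *\<^sub>R v)) \<partial>lborel)
          = indicator {0..1} t * (ennreal (d\<^sup>2) * (\<integral>\<^sup>+x. ennreal (G (t *\<^sub>R v + x)) \<partial>lborel))"
          by (simp add: ennreal_mult' nn_integral_cmult add.commute)
        also have "(\<integral>\<^sup>+x. ennreal (G (t *\<^sub>R v + x)) \<partial>lborel) = (\<integral>\<^sup>+x. ennreal (G x) \<partial>lborel)"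
          by (rule nn_integral_lborel_translate[of "\<lambda>x. ennreal (G x)"]) measurable
        finally show "(\<integral>\<^sup>+x. indicator {0..1} t * ennreal (d\<^sup>2 * G (x + t *\<^sub>R v)) \<partial>lborel)
          = indicator {0..1} t * (ennreal (d\<^sup>2) * (\<integral>\<^sup>+x. ennreal (G x) \<partial>lborel))" .
      qed
      also have "\<dots> = ennreal (d\<^sup>2) * (\<integral>\<^sup>+x. ennreal (G x) \<partial>lborel)"
        by (simp add: nn_integral_multc)
      finally show "(\<integral>\<^sup>+x. indicator (cball 0 d) v * H x v \<partial>lborel) = indicator (cball 0 d) v * (ennreal (d\<^sup>2) * (\<integral>\<^sup>+x. ennreal (G x) \<partial>lborel))"
        by (simp add: nn_integral_cmult)
    qed
    also have "\<dots> = emeasure lborel (cball (0::plane) d) * (ennreal (d\<^sup>2) * (\<integral>\<^sup>+x. ennreal (G x) \<partial>lborel))"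
      by (simp add: nn_integral_multc)
    finally show ?thesis unfolding H_def .
  qed
  also have "(\<integral>\<^sup>+x. ennreal (G x) \<partial>lborel) = ennreal (\<Sum>i\<in>UNIV. sqnorm ?M (F' i))"
  proof -
    have "(\<integral>\<^sup>+x. ennreal (G x) \<partial>lborel) = (\<integral>\<^sup>+x. ennreal (\<Sum>i\<in>UNIV. (F' i x)\<^sup>2) \<partial>?M)"
      unfolding G_def by (rule nn_integral_lebesgue_on_eq[OF Cb, symmetric]) (intro ind continuous_intros cF)
    also have "\<dots> = ennreal (LINT x|?M. (\<Sum>i\<in>UNIV. (F' i x)\<^sup>2))"
      using sF(2) by (intro nn_integral_eq_integral) (auto simp: sqint_def intro!: AE_I2 sum_nonneg)
    also have "(LINT x|?M. (\<Sum>i\<in>UNIV. (F' i x)\<^sup>2)) = (\<Sum>i\<in>UNIV. sqnorm ?M (F' i))"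
      using sF(2) by (intro Bochner_Integration.integral_sum) (auto simp: sqint_def)
    finally show ?thesis .
  qed
  also have "emeasure lborel (cball (0::plane) d) = ennreal (measure lebesgue (cball (0::plane) d))"
  proof -
    have "emeasure lborel (cball (0::plane) d) \<noteq> top"
      using emeasure_lborel_cball_finite[of "0::plane" d] by (auto simp: less_top)
    from emeasure_eq_ennreal_measure[OF this] show ?thesis by simp
  qed
  finally have "ennreal (2 * variance_form C F) \<le> ennreal (measure lebesgue (cball (0::plane) d) * (d\<^sup>2 * (\<Sum>i\<in>UNIV. sqnorm ?M (F' i))))"
    by (simp add: ennreal_mult'' sum_nonneg)
  then have "2 * variance_form C F \<le> measure lebesgue (cball (0::plane) d) * (d\<^sup>2 * (\<Sum>i\<in>UNIV. sqnorm ?M (F' i)))"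
    by (subst (asm) ennreal_le_iff) (auto intro!: mult_nonneg_nonneg sum_nonneg)
  then show ?thesis by (simp add: d_def mult_ac)
qed

lemma variance_form_nonneg:
  assumes "compact C" "sqint_on C f"
  shows "variance_form C f \<ge> 0"
proof -
  have Cs: "C \<in> sets lebesgue" using assms(1) by (rule compact_sets_lebesgue)
  have fm: "finite_measure (lebesgue_on C)" by (rule finite_measure_lebesgue_on) (simp add: lmeasurable_compact assms(1))
  show ?thesis using integral_square_le(2)[OF fm assms(2)] Cs by (simp add: variance_form_def measure_restrict_space)
qed

lemma variance_form_le: "variance_form C f \<le> measure lebesgue C * sqnorm_on C f"
  by (simp add: variance_form_def)

text \<open>The parallelogram law for a nonnegative quadratic form.\<close>

lemma variance_form_add_le:
  assumes C: "compact C" and f: "sqint_on C f" and g: "sqint_on C g"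
  shows "variance_form C (\<lambda>x. f x + g x) \<le> 2 * variance_form C f + 2 * variance_form C g"
proof -
  let ?M = "lebesgue_on C"
  have fm: "finite_measure ?M" by (rule finite_measure_lebesgue_on) (simp add: lmeasurable_compact C)
  note i = integral_square_le(1)[OF fm f] integral_square_le(1)[OF fm g]
    sqint_integrable[OF f] sqint_integrable[OF g] sqint_mult_integrable[OF f g]
  have 1: "sqnorm ?M (\<lambda>x. f x + g x) = sqnorm ?M f + sqnorm ?M g + 2 * (LINT x|?M. f x * g x)"
    using i by (simp add: power2_sum mult.assoc)
  have 2: "sqnorm ?M (\<lambda>x. f x - g x) = sqnorm ?M f + sqnorm ?M g - 2 * (LINT x|?M. f x * g x)"
    using i by (simp add: power2_diff mult.assoc)
  have 3: "(LINT x|?M. f x + g x) = (LINT x|?M. f x) + (LINT x|?M. g x)" "(LINT x|?M. f x - g x) = (LINT x|?M. f x) - (LINT x|?M. g x)"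
    using i by simp_all
  have "variance_form C (\<lambda>x. f x + g x) + variance_form C (\<lambda>x. f x - g x) = 2 * variance_form C f + 2 * variance_form C g"
    unfolding variance_form_def 1 2 3 by (simp only: power2_sum power2_diff) (simp add: algebra_simps)
  then show ?thesis using variance_form_nonneg[OF C sqint_diff[OF f g]] by linarith
qed

text \<open>Approximate by C1 functions near \<open>C\<close> and let the tolerance tend to 0; the
  variance form of the error is at most the area times its squared norm.\<close>

lemma Poincare_compact:
  assumes C: "compact C" "convex C" "C \<subseteq> cball x\<^sub>0 R" and U: "open U" "C \<subseteq> U" and R: "R > 0"
    and f: "sqint_on U f" "\<And>i. sqint_on U (f' i)" "strong_grad U f f'"
  shows "variance_form C f \<le> 2 * ((2 * R)\<^sup>2 * measure lebesgue (cball (0::plane) (2 * R))) * (\<Sum>i\<in>UNIV. sqnorm_on C (f' i))"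
proof -
  let ?M = "lebesgue_on C"
  define K where "K = (2 * R)\<^sup>2 * measure lebesgue (cball (0::plane) (2 * R))"
  have K: "K \<ge> 0" by (simp add: K_def)
  define S where "S = (\<Sum>i\<in>UNIV. sqnorm ?M (f' i))"
  note Us = open_sets_lebesgue[OF U(1)] and Cs = compact_sets_lebesgue[OF C(1)]
  note sf = sqint_mono(1)[OF f(1) U(2) Cs Us] sqint_mono(1)[OF f(2) U(2) Cs Us]
  have le: "variance_form C f - 2 * K * S \<le> e * (4 * K + 2 * measure lebesgue C)" if e: "e > 0" for e
  proof -
    obtain V F F' where V: "open V" "C \<subseteq> V" "V \<subseteq> U" "C1_on V F F'"
      and err: "sqnorm ?M (\<lambda>x. F x - f x) \<le> e" "\<And>i. sqnorm ?M (\<lambda>x. F' i x - f' i x) \<le> e"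
      by (rule strong_gradD[OF f(3) C(1) U(2) e]) (rule that)
    note sF = C1_on_sqint_compact[OF V(4) C(1) V(2)]
    have b: "sqnorm ?M (F' i) \<le> 2 * sqnorm ?M (f' i) + 2 * e" for i
    proof -
      have "sqnorm ?M (\<lambda>x. f' i x + (F' i x - f' i x)) \<le> 2 * sqnorm ?M (f' i) + 2 * sqnorm ?M (\<lambda>x. F' i x - f' i x)"
        by (intro sqnorm_add_le sf sqint_diff sF)
      then show ?thesis using err(2)[of i] by simp
    qed
    have "variance_form C (\<lambda>x. F x + (f x - F x)) \<le> 2 * variance_form C F + 2 * variance_form C (\<lambda>x. f x - F x)"
      by (rule variance_form_add_le[OF C(1) sF(1) sqint_diff[OF sf(1) sF(1)]])
    moreover have "2 * variance_form C F \<le> K * (2 * S + 4 * e)"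
    proof -
      have "2 * variance_form C F \<le> K * (\<Sum>i\<in>UNIV. sqnorm ?M (F' i))"
        unfolding K_def by (rule Poincare_C1[OF C V(2,4) R])
      also have "\<dots> \<le> K * (\<Sum>i\<in>UNIV. 2 * sqnorm ?M (f' i) + 2 * e)"
        by (intro mult_left_mono sum_mono b K)
      also have "\<dots> = K * (2 * S + 4 * e)" by (simp add: S_def sum.distrib sum_distrib_left)
      finally show ?thesis .
    qed
    moreover have "variance_form C (\<lambda>x. f x - F x) \<le> measure lebesgue C * e"
    proof -
      have "variance_form C (\<lambda>x. f x - F x) \<le> measure lebesgue C * sqnorm ?M (\<lambda>x. f x - F x)" by (rule variance_form_le)
      also have "\<dots> \<le> measure lebesgue C * e" using err(1) by (intro mult_left_mono) (auto simp: power2_commute)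
      finally show ?thesis .
    qed
    ultimately show ?thesis by (simp add: algebra_simps)
  qed
  have "variance_form C f - 2 * K * S \<le> 0"
  proof (rule ccontr)
    assume "\<not> ?thesis"
    then have "variance_form C f - 2 * K * S = 0"
      using K by (intro nonneg_le_all_mult_imp_zero[OF le]) auto
    with \<open>\<not> ?thesis\<close> show False by simp
  qed
  then show ?thesis by (simp add: K_def S_def)
qed

text \<open>Strong gradients are approximated on compact subsets only, so an open convex set is
  exhausted by copies of its closure shrunk towards an interior point.\<close>

lemma convex_compact_exhaustion:
  fixes U :: "plane set"
  assumes U: "open U" "convex U" "bounded U" "x\<^sub>0 \<in> U"
  obtains C where "\<And>n. compact (C n)" "\<And>n. convex (C n)" "\<And>n. C n \<subseteq> U"
    "\<And>x. x \<in> U \<Longrightarrow> \<forall>\<^sub>F n in sequentially. x \<in> C (n::nat)"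
proof -
  \<comment> \<open>The 2 in the denominator keeps the factor strictly between 0 and 1 already for
    \<open>n = 0\<close>.\<close>
  define s where "s n = 1 - 1 / (real n + 2)" for n :: nat
  have s: "0 < s n" "s n < 1" for n by (auto simp: s_def field_simps)
  define C where "C n = (\<lambda>y. x\<^sub>0 + s n *\<^sub>R (y - x\<^sub>0)) ` closure U" for n
  have cl: "compact (closure U)" using U(3) by simp
  show ?thesis
  proof (rule that[of C])
    show "compact (C n)" for n
      unfolding C_def by (intro compact_continuous_image cl continuous_intros)
    show "convex (C n)" for n
    proof -
      have "C n = (\<lambda>z. (x\<^sub>0 - s n *\<^sub>R x\<^sub>0) + z) ` ((\<lambda>y. s n *\<^sub>R y) ` closure U)"
        unfolding C_def image_image by (auto simp: algebra_simps)
      then show ?thesis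
        using convex_closure[OF U(2)] by (simp only: convex_translation convex_scaling)
    qed
    show "C n \<subseteq> U" for n
    proof
      fix z assume "z \<in> C n"
      then obtain y where y: "y \<in> closure U" "z = x\<^sub>0 + s n *\<^sub>R (y - x\<^sub>0)" by (auto simp: C_def)
      have "y - (1 - s n) *\<^sub>R (y - x\<^sub>0) \<in> interior U"
        using s[of n] by (intro mem_interior_closure_convex_shrink U y) (auto simp: interior_open U)
      moreover have "y - (1 - s n) *\<^sub>R (y - x\<^sub>0) = z" unfolding y(2) by (simp add: algebra_simps)
      ultimately show "z \<in> U" using U(1) by (simp add: interior_open)
    qed
    fix x assume x: "x \<in> U"
    have "(\<lambda>n. 1 / (real n + 2)) \<longlonglongrightarrow> 0"
      using LIMSEQ_ignore_initial_segment[OF lim_1_over_n[where 'a=real], of 2] by (simp add: add.commute)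
    then have "s \<longlonglongrightarrow> 1 - 0" unfolding s_def by (intro tendsto_intros)
    then have "(\<lambda>n. x\<^sub>0 + (1 / s n) *\<^sub>R (x - x\<^sub>0)) \<longlonglongrightarrow> x\<^sub>0 + (1 / 1) *\<^sub>R (x - x\<^sub>0)"
      by (intro tendsto_intros) auto
    then have "\<forall>\<^sub>F n in sequentially. x\<^sub>0 + (1 / s n) *\<^sub>R (x - x\<^sub>0) \<in> U"
      using U(1) x by (auto elim: topological_tendstoD)
    then show "\<forall>\<^sub>F n in sequentially. x \<in> C n"
    proof eventually_elim
      case (elim n)
      have "x = x\<^sub>0 + s n *\<^sub>R ((x\<^sub>0 + (1 / s n) *\<^sub>R (x - x\<^sub>0)) - x\<^sub>0)" using s(1)[of n] by simp
      then show ?case unfolding C_def using elim closure_subset by blast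
    qed
  qed
qed

lemma integral_exhaustion:
  fixes g :: "plane \<Rightarrow> real"
  assumes U: "U \<in> sets lebesgue" and C: "\<And>n. C n \<in> sets lebesgue" "\<And>n. C n \<subseteq> U"
    and ev: "\<And>x. x \<in> U \<Longrightarrow> \<forall>\<^sub>F n in sequentially. x \<in> C (n::nat)"
    and g: "integrable (lebesgue_on U) g"
  shows "(\<lambda>n. LINT x|lebesgue_on (C n). g x) \<longlonglongrightarrow> (LINT x|lebesgue_on U. g x)"
proof -
  define h where "h x = (if x \<in> U then g x else 0)" for x
  have h: "integrable lebesgue h"
    unfolding h_def by (rule Lebesgue_Measure.integrable_restrict_UNIV[OF U, THEN iffD2, OF g])
  have eq: "(LINT x|lebesgue_on (C n). g x) = (LINT x|lebesgue. indicator (C n) x * h x)" for n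
  proof -
    have "(LINT x|lebesgue_on (C n). g x) = (LINT x|lebesgue. (if x \<in> C n then g x else 0))"
      by (rule Lebesgue_Measure.integral_restrict_UNIV[OF C(1), symmetric])
    also have "\<dots> = (LINT x|lebesgue. indicator (C n) x * h x)"
      using C(2) by (intro Bochner_Integration.integral_cong) (auto simp: h_def indicator_def)
    finally show ?thesis .
  qed
  have "(\<lambda>n. LINT x|lebesgue. indicator (C n) x * h x) \<longlonglongrightarrow> (LINT x|lebesgue. h x)"
  proof (rule integral_dominated_convergence[where w="\<lambda>x. \<bar>h x\<bar>"])
    show "(\<lambda>x. indicator (C n) x * h x) \<in> borel_measurable lebesgue" for n
      using C(1) borel_measurable_integrable[OF h] by (intro borel_measurable_times borel_measurable_indicator) auto
    show "AE x in lebesgue. (\<lambda>n. indicator (C n) x * h x) \<longlonglongrightarrow> h x"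
    proof (rule AE_I2)
      fix x
      show "(\<lambda>n. indicator (C n) x * h x) \<longlonglongrightarrow> h x"
      proof (cases "x \<in> U")
        case True
        have "\<forall>\<^sub>F n in sequentially. indicator (C n) x * h x = h x"
          using ev[OF True] by eventually_elim simp
        then show ?thesis by (rule tendsto_eventually)
      qed (simp add: h_def)
    qed
    show "AE x in lebesgue. norm (indicator (C n) x * h x) \<le> \<bar>h x\<bar>" for n
      by (rule AE_I2) (auto simp: indicator_def)
  qed (use h in auto)
  moreover have "(LINT x|lebesgue. h x) = (LINT x|lebesgue_on U. g x)"
    unfolding h_def by (rule Lebesgue_Measure.integral_restrict_UNIV[OF U])
  ultimately show ?thesis unfolding eq by simp
qed

text \<open>Pass to the limit along the exhaustion. With mean 0 the variance form is the area of
  \<open>U\<close> times the squared norm, and the inscribed ball bounds the area from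
  below.\<close>

theorem Poincare_convex:
  assumes U: "open U" "convex U" and r: "r > 0" "ball x\<^sub>0 r \<subseteq> U" and \<sigma>: "\<sigma> > 0" "U \<subseteq> cball x\<^sub>0 (\<sigma> * r)"
    and f: "sqint_on U f" "\<And>i. sqint_on U (f' i)" "strong_grad U f f'"
    and mean: "(LINT x|lebesgue_on U. f x) = 0"
  shows "sqnorm_on U f \<le> 32 * \<sigma> ^ 4 * r\<^sup>2 * (\<Sum>i\<in>UNIV. sqnorm_on U (f' i))"
proof -
  note Us = open_sets_lebesgue[OF U(1)]
  have bU: "bounded U" using \<sigma>(2) bounded_cball bounded_subset by blast
  have x0: "x\<^sub>0 \<in> U" using r by auto
  have fmU: "finite_measure (lebesgue_on U)"
    by (rule finite_measure_lebesgue_on) (simp add: bounded_set_imp_lmeasurable bU Us)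
  obtain C where C: "\<And>n. compact (C n)" "\<And>n. convex (C n)" "\<And>n. C n \<subseteq> U"
    "\<And>x. x \<in> U \<Longrightarrow> \<forall>\<^sub>F n in sequentially. x \<in> C (n::nat)"
    by (rule convex_compact_exhaustion[OF U bU x0]) (rule that)
  define R where "R = \<sigma> * r"
  have R: "R > 0" using \<sigma> r by (simp add: R_def)
  define K where "K = 2 * ((2 * R)\<^sup>2 * measure lebesgue (cball (0::plane) (2 * R)))"
  have le: "variance_form (C n) f \<le> K * (\<Sum>i\<in>UNIV. sqnorm_on (C n) (f' i))" for n
    unfolding K_def by (rule Poincare_compact[OF C(1,2) _ U(1) C(3) R f]) (use C(3)[of n] \<sigma>(2) in \<open>auto simp: R_def\<close>)
  note lim = integral_exhaustion[OF Us compact_sets_lebesgue[OF C(1)] C(3) C(4)]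
  have m: "(LINT x|lebesgue_on S. (1::real)) = measure lebesgue S" if "S \<in> sets lebesgue" for S :: "plane set"
    using that by (simp add: measure_restrict_space)
  have "(\<lambda>n. LINT x|lebesgue_on (C n). (1::real)) \<longlonglongrightarrow> (LINT x|lebesgue_on U. (1::real))"
    by (rule lim) (auto intro: finite_measure.integrable_const[OF fmU])
  then have lm: "(\<lambda>n. measure lebesgue (C n)) \<longlonglongrightarrow> measure lebesgue U"
    by (simp only: m[OF Us] m[OF compact_sets_lebesgue[OF C(1)]])
  have "(\<lambda>n. variance_form (C n) f) \<longlonglongrightarrow> variance_form U f"
    unfolding variance_form_def
    by (intro tendsto_intros lm lim integral_square_le(1)[OF fmU f(1)] sqint_integrable[OF f(1)])
  moreover have "(\<lambda>n. K * (\<Sum>i\<in>UNIV. sqnorm_on (C n) (f' i))) \<longlonglongrightarrow> K * (\<Sum>i\<in>UNIV. sqnorm_on U (f' i))"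
    by (intro tendsto_intros lim sqint_integrable[OF f(2)])
  ultimately have "variance_form U f \<le> K * (\<Sum>i\<in>UNIV. sqnorm_on U (f' i))"
    by (rule LIMSEQ_le) (use le in blast)
  then have 1: "measure lebesgue U * sqnorm_on U f \<le> K * (\<Sum>i\<in>UNIV. sqnorm_on U (f' i))"
    by (simp add: variance_form_def mean)
  define v where "v = unit_ball_vol (real DIM(plane))"
  have v: "v > 0" by (simp add: v_def)
  have mb: "measure lebesgue (ball x\<^sub>0 r) = v * r\<^sup>2"
    using content_ball[of r x\<^sub>0] r(1) by (simp add: v_def)
  have mcb: "measure lebesgue (cball (0::plane) (2 * R)) = v * (2 * R)\<^sup>2"
    using content_cball[of "2 * R" "0::plane"] R by (simp add: v_def)
  have "measure lebesgue (ball x\<^sub>0 r) \<le> measure lebesgue U"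
    by (rule measure_mono_fmeasurable[OF r(2)]) (auto simp: bounded_set_imp_lmeasurable bU Us)
  then have "v * r\<^sup>2 * sqnorm_on U f \<le> measure lebesgue U * sqnorm_on U f"
    unfolding mb by (rule mult_right_mono) simp
  also note 1
  \<comment> \<open>The origin of 32: with R = \<sigma> r, twice the squared diameter (2R)^2 times
    the disc area v (2R)^2 is 32 \<sigma>^4 r^4 v, to be compared with the area v r^2 of the
    inscribed ball.\<close>
  also have "K = v * r\<^sup>2 * (32 * \<sigma> ^ 4 * r\<^sup>2)"
    unfolding K_def mcb by (simp add: R_def power2_eq_square power4_eq_xxxx algebra_simps)
  finally have "v * r\<^sup>2 * sqnorm_on U f \<le> v * r\<^sup>2 * (32 * \<sigma> ^ 4 * r\<^sup>2 * (\<Sum>i\<in>UNIV. sqnorm_on U (f' i)))"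
    by (simp add: mult.assoc)
  then show ?thesis
    by (rule mult_left_le_imp_le) (use v r in simp)
qed

section \<open>Polynomials\<close>

definition monom2 :: "nat \<times> nat \<Rightarrow> plane \<Rightarrow> real" where
  "monom2 t z = (z$1) ^ fst t * (z$2) ^ snd t"

definition indices :: "nat \<Rightarrow> (nat \<times> nat) set" where
  "indices m = {t. fst t + snd t \<le> m}"

lemma indices_Sigma: "indices m = Sigma {..m} (\<lambda>i. {..m - i})"
  by (auto simp: indices_def)

lemma finite_indices [simp]: "finite (indices m)"
  by (simp add: indices_Sigma)

lemma polys_iff: "p \<in> polys m \<longleftrightarrow> (\<exists>c. p = (\<lambda>z. \<Sum>t\<in>indices m. c t * monom2 t z))"
proof -
  have eq: "(\<lambda>z. \<Sum>i\<le>m. \<Sum>j\<le>m - i. c i j * (z$1) ^ i * (z$2) ^ j) = (\<lambda>z. \<Sum>t\<in>indices m. c (fst t) (snd t) * monom2 t z)"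
    for c :: "nat \<Rightarrow> nat \<Rightarrow> real"
    by (subst sum.Sigma) (auto simp: indices_Sigma monom2_def split_beta mult.assoc)
  show ?thesis
  proof
    assume "p \<in> polys m"
    then obtain c where "p = (\<lambda>z. \<Sum>i\<le>m. \<Sum>j\<le>m - i. c i j * (z$1) ^ i * (z$2) ^ j)"
      unfolding polys_def by blast
    then show "\<exists>c. p = (\<lambda>z. \<Sum>t\<in>indices m. c t * monom2 t z)"
      unfolding eq by (intro exI[of _ "\<lambda>t. c (fst t) (snd t)"])
  next
    assume "\<exists>c. p = (\<lambda>z. \<Sum>t\<in>indices m. c t * monom2 t z)"
    then obtain c where "p = (\<lambda>z. \<Sum>t\<in>indices m. c t * monom2 t z)" by blast
    then have "p = (\<lambda>z. \<Sum>i\<le>m. \<Sum>j\<le>m - i. c (i, j) * (z$1) ^ i * (z$2) ^ j)"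
      unfolding eq by simp
    then show "p \<in> polys m"
      unfolding polys_def by (intro CollectI exI[of _ "\<lambda>i j. c (i, j)"])
  qed
qed

lemma polysI: "(\<lambda>z. \<Sum>t\<in>indices m. c t * monom2 t z) \<in> polys m"
  using polys_iff by blast

lemma polysE:
  assumes "p \<in> polys m" obtains c where "p = (\<lambda>z. \<Sum>t\<in>indices m. c t * monom2 t z)"
  using assms polys_iff by blast

lemma smooth_monom2: "smooth (monom2 t)"
  unfolding monom2_def by (intro smooth_mult smooth_power smooth_coord)

lemma polys_smooth: "p \<in> polys m \<Longrightarrow> smooth p"
  by (erule polysE) (auto intro!: smooth_sum smooth_mult smooth_monom2)

lemma polys_add: "p \<in> polys m \<Longrightarrow> q \<in> polys m \<Longrightarrow> (\<lambda>z. p z + q z) \<in> polys m"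
proof (elim polysE)
  fix c d assume "p = (\<lambda>z. \<Sum>t\<in>indices m. c t * monom2 t z)" "q = (\<lambda>z. \<Sum>t\<in>indices m. d t * monom2 t z)"
  then have "(\<lambda>z. p z + q z) = (\<lambda>z. \<Sum>t\<in>indices m. (c t + d t) * monom2 t z)"
    by (simp add: sum.distrib distrib_right)
  then show ?thesis by (simp only: polysI)
qed

lemma polys_cmult: "p \<in> polys m \<Longrightarrow> (\<lambda>z. a * p z) \<in> polys m"
proof (elim polysE)
  fix c assume "p = (\<lambda>z. \<Sum>t\<in>indices m. c t * monom2 t z)"
  then have "(\<lambda>z. a * p z) = (\<lambda>z. \<Sum>t\<in>indices m. (a * c t) * monom2 t z)"
    by (simp add: sum_distrib_left mult.assoc)
  then show ?thesis by (simp only: polysI)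
qed

lemma polys_diff: "p \<in> polys m \<Longrightarrow> q \<in> polys m \<Longrightarrow> (\<lambda>z. p z - q z) \<in> polys m"
  using polys_add[of p m "\<lambda>z. (-1) * q z"] polys_cmult[of q m "-1"] by simp

lemma polys_monom2: "fst t + snd t \<le> m \<Longrightarrow> monom2 t \<in> polys m"
proof -
  assume "fst t + snd t \<le> m"
  then have tm: "t \<in> indices m" by (simp add: indices_def)
  have "monom2 t = (\<lambda>z. \<Sum>s\<in>indices m. (if s = t then 1 else 0) * monom2 s z)"
  proof
    fix z
    have "(\<Sum>s\<in>indices m. (if s = t then 1 else 0) * monom2 s z) = (\<Sum>s\<in>indices m. if s = t then monom2 s z else 0)"
      by (intro sum.cong) auto
    then show "monom2 t z = (\<Sum>s\<in>indices m. (if s = t then 1 else 0) * monom2 s z)"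
      using tm by simp
  qed
  then show ?thesis by (simp only: polysI)
qed

lemma polys_zero: "(\<lambda>z. 0) \<in> polys m"
  using polysI[of "\<lambda>_. 0" m] by simp

lemma polys_sum: "(\<And>i. i \<in> I \<Longrightarrow> f i \<in> polys m) \<Longrightarrow> (\<lambda>z. \<Sum>i\<in>I. f i z) \<in> polys m"
  by (induction I rule: infinite_finite_induct) (auto intro: polys_zero polys_add)

lemma polys_mult_coord:
  assumes "p \<in> polys m"
  shows "(\<lambda>z. z $ k * p z) \<in> polys (Suc m)"
proof -
  obtain c where c: "p = (\<lambda>z. \<Sum>t\<in>indices m. c t * monom2 t z)" by (rule polysE[OF assms])
  have m: "(\<lambda>z. z $ k * monom2 t z) \<in> polys (Suc m)" if "t \<in> indices m" for t
  proof (cases "k = 1")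
    case True
    then have "(\<lambda>z. z $ k * monom2 t z) = monom2 (Suc (fst t), snd t)" by (auto simp: monom2_def)
    then show ?thesis using that by (simp only:) (rule polys_monom2, simp add: indices_def)
  next
    case False
    then have "k = 2" using exhaust_2[of k] by auto
    then have "(\<lambda>z. z $ k * monom2 t z) = monom2 (fst t, Suc (snd t))" by (auto simp: monom2_def)
    then show ?thesis using that by (simp only:) (rule polys_monom2, simp add: indices_def)
  qed
  have "(\<lambda>z. z $ k * p z) = (\<lambda>z. \<Sum>t\<in>indices m. c t * (z $ k * monom2 t z))"
    unfolding c by (auto simp: sum_distrib_left algebra_simps)
  then show ?thesis by (simp only:) (intro polys_sum polys_cmult m)
qed

lemma polys_Suc:
  assumes "p \<in> polys m"
  shows "p \<in> polys (Suc m)"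
proof -
  obtain c where c: "p = (\<lambda>z. \<Sum>t\<in>indices m. c t * monom2 t z)" by (rule polysE[OF assms])
  show ?thesis unfolding c by (intro polys_sum polys_cmult polys_monom2) (auto simp: indices_def)
qed

lemma polys_mono: "p \<in> polys m \<Longrightarrow> m \<le> n \<Longrightarrow> p \<in> polys n"
  by (induction n) (auto simp: le_Suc_eq intro: polys_Suc)

lemma polys_mult_linear: "p \<in> polys m \<Longrightarrow> (\<lambda>z. (a + s * z $ k) * p z) \<in> polys (Suc m)"
  using polys_add[OF polys_Suc[OF polys_cmult[of p m a]] polys_cmult[OF polys_mult_coord[of p m k], of s]]
  by (simp add: algebra_simps)

lemma polys_affine:
  assumes "p \<in> polys m"
  shows "(\<lambda>z. p (a + s *\<^sub>R z)) \<in> polys m"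
proof -
  obtain c where c: "p = (\<lambda>z. \<Sum>t\<in>indices m. c t * monom2 t z)" by (rule polysE[OF assms])
  have "(\<lambda>z. monom2 (i, j) (a + s *\<^sub>R z)) \<in> polys (i + j)" for i j
  proof (induction i)
    case 0
    show ?case
    proof (induction j)
      case 0 show ?case using polys_monom2[of "(0, 0)" 0] by (simp add: monom2_def[abs_def])
    next
      case (Suc j)
      then show ?case using polys_mult_linear[of "\<lambda>z. monom2 (0, j) (a + s *\<^sub>R z)" j "a $ 2" s 2] by (simp add: monom2_def)
    qed
  next
    case (Suc i)
    then show ?case using polys_mult_linear[of "\<lambda>z. monom2 (i, j) (a + s *\<^sub>R z)" "i + j" "a $ 1" s 1] by (simp add: monom2_def mult.assoc)
  qed
  then have "(\<lambda>z. monom2 t (a + s *\<^sub>R z)) \<in> polys m" if "t \<in> indices m" for t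
    using that polys_mono[of _ "fst t + snd t" m] by (metis (mono_tags) indices_def mem_Collect_eq prod.collapse)
  then show ?thesis unfolding c by (intro polys_sum polys_cmult)
qed

text \<open>The falling factorial n (n-1) ... (n-i+1), with real factors so that it vanishes for
  \<open>i > n\<close>.\<close>

definition falling :: "nat \<Rightarrow> nat \<Rightarrow> real" where
  "falling n i = (\<Prod>l<i. real n - real l)"

lemma falling_Suc: "falling n (Suc i) = falling n i * (real n - real i)"
  by (simp add: falling_def)

lemma falling_eq_0: "i > n \<Longrightarrow> falling n i = 0"
  by (auto simp: falling_def)

lemma falling_self: "falling n n > 0"
  unfolding falling_def by (rule prod_pos) auto

lemma has_grad_monom2:
  "has_grad (monom2 t) (\<lambda>l. if l = 1 then real (fst t) * monom2 (fst t - 1, snd t) z else real (snd t) * monom2 (fst t, snd t - 1) z) z"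
proof -
  have c: "has_grad (\<lambda>z. (z $ k) ^ n) (\<lambda>i. (real n * (z $ k) ^ (n - 1)) * (if i = k then 1 else 0)) z" for k :: 2 and n
    by (rule has_grad_compose_real[OF has_grad_coord]) (auto intro!: derivative_eq_intros)
  from has_grad_mult[OF c[of 1 "fst t"] c[of 2 "snd t"]]
  have "has_grad (monom2 t) (\<lambda>i. (z $ 1) ^ fst t * ((real (snd t) * (z $ 2) ^ (snd t - 1)) * (if i = 2 then 1 else 0))
      + (real (fst t) * (z $ 1) ^ (fst t - 1)) * (if i = 1 then 1 else 0) * (z $ 2) ^ snd t) z"
    by (simp add: monom2_def[abs_def])
  moreover have "(z $ 1) ^ fst t * ((real (snd t) * (z $ 2) ^ (snd t - 1)) * (if i = 2 then 1 else 0))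
      + (real (fst t) * (z $ 1) ^ (fst t - 1)) * (if i = 1 then 1 else 0) * (z $ 2) ^ snd t
      = (if i = 1 then real (fst t) * monom2 (fst t - 1, snd t) z else real (snd t) * monom2 (fst t, snd t - 1) z)" for i :: 2
    using exhaust_2[of i] by (auto simp: monom2_def)
  ultimately show ?thesis by (simp only:)
qed

lemma partial_deriv_cmult:
  assumes "smooth f"
  shows "partial_deriv l (\<lambda>z. c * f z) = (\<lambda>z. c * partial_deriv l f z)"
  by (rule ext, rule partial_deriv_eq)
     (use has_grad_mult[OF has_grad_const smooth_has_grad[OF assms], of c] in simp)

lemma partial_deriv_add:
  assumes "smooth f" "smooth g"
  shows "partial_deriv l (\<lambda>z. f z + g z) = (\<lambda>z. partial_deriv l f z + partial_deriv l g z)"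
  by (rule ext, rule partial_deriv_eq[OF has_grad_add[OF smooth_has_grad[OF assms(1)] smooth_has_grad[OF assms(2)]]])

lemma iterated_cmult: "smooth f \<Longrightarrow> (partial_deriv l ^^ n) (\<lambda>z. c * f z) = (\<lambda>z. c * (partial_deriv l ^^ n) f z)"
  by (induction n) (auto simp: partial_deriv_cmult smooth_iterated)

lemma iterated_add: "smooth f \<Longrightarrow> smooth g \<Longrightarrow> (partial_deriv l ^^ n) (\<lambda>z. f z + g z) = (\<lambda>z. (partial_deriv l ^^ n) f z + (partial_deriv l ^^ n) g z)"
  by (induction n) (auto simp: partial_deriv_add smooth_iterated)

lemma multi_deriv_cmult: "smooth f \<Longrightarrow> multi_deriv i j (\<lambda>z. c * f z) = (\<lambda>z. c * multi_deriv i j f z)"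
  by (simp add: multi_deriv_def iterated_cmult smooth_iterated)

lemma multi_deriv_add: "smooth f \<Longrightarrow> smooth g \<Longrightarrow> multi_deriv i j (\<lambda>z. f z + g z) = (\<lambda>z. multi_deriv i j f z + multi_deriv i j g z)"
  by (simp add: multi_deriv_def iterated_add smooth_iterated)

lemma multi_deriv_zero: "multi_deriv i j (\<lambda>z. 0) = (\<lambda>z. 0)"
  using multi_deriv_cmult[of "\<lambda>z. 0" i j 0] by simp

lemma multi_deriv_sum:
  "finite T \<Longrightarrow> (\<And>t. t \<in> T \<Longrightarrow> smooth (f t)) \<Longrightarrow> multi_deriv i j (\<lambda>z. \<Sum>t\<in>T. c t * f t z) = (\<lambda>z. \<Sum>t\<in>T. c t * multi_deriv i j (f t) z)"
proof (induction T rule: finite_induct)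
  case (insert s T)
  have "smooth (\<lambda>z. \<Sum>t\<in>T. c t * f t z)" using insert by (intro smooth_sum smooth_mult smooth_const) auto
  moreover have "smooth (\<lambda>z. c s * f s z)" using insert by (intro smooth_mult smooth_const) auto
  ultimately have "multi_deriv i j (\<lambda>z. c s * f s z + (\<Sum>t\<in>T. c t * f t z)) = (\<lambda>z. multi_deriv i j (\<lambda>z. c s * f s z) z + multi_deriv i j (\<lambda>z. \<Sum>t\<in>T. c t * f t z) z)"
    by (intro multi_deriv_add)
  then show ?case using insert by (simp add: multi_deriv_cmult)
qed (simp add: multi_deriv_zero)

text \<open>Exponents are truncated at 0; the falling factorials vanish exactly where truncation
  occurs.\<close>

lemma multi_deriv_monom2:
  "multi_deriv i j (monom2 t) = (\<lambda>z. (falling (fst t) i * falling (snd t) j) * monom2 (fst t - i, snd t - j) z)"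
proof -
  have p: "partial_deriv l (monom2 s) = (\<lambda>z. if l = 1 then real (fst s) * monom2 (fst s - 1, snd s) z else real (snd s) * monom2 (fst s, snd s - 1) z)" for l s
    by (rule ext, rule partial_deriv_eq[OF has_grad_monom2])
  have 2: "(partial_deriv 2 ^^ j) (monom2 t) = (\<lambda>z. falling (snd t) j * monom2 (fst t, snd t - j) z)" for j t
  proof (induction j)
    case 0 show ?case by (simp add: falling_def)
  next
    case (Suc j)
    have "partial_deriv 2 (\<lambda>z. falling (snd t) j * monom2 (fst t, snd t - j) z) = (\<lambda>z. falling (snd t) j * (real (snd t - j) * monom2 (fst t, snd t - j - 1) z))"
      unfolding partial_deriv_cmult[OF smooth_monom2] p by simp
    also have "\<dots> = (\<lambda>z. falling (snd t) (Suc j) * monom2 (fst t, snd t - Suc j) z)"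
      by (cases "j \<le> snd t") (auto simp: falling_Suc falling_eq_0 of_nat_diff)
    finally show ?case using Suc by simp
  qed
  have 1: "(partial_deriv 1 ^^ i) (monom2 s) = (\<lambda>z. falling (fst s) i * monom2 (fst s - i, snd s) z)" for i s
  proof (induction i)
    case 0 show ?case by (simp add: falling_def)
  next
    case (Suc i)
    have "partial_deriv 1 (\<lambda>z. falling (fst s) i * monom2 (fst s - i, snd s) z) = (\<lambda>z. falling (fst s) i * (real (fst s - i) * monom2 (fst s - i - 1, snd s) z))"
      unfolding partial_deriv_cmult[OF smooth_monom2] p by simp
    also have "\<dots> = (\<lambda>z. falling (fst s) (Suc i) * monom2 (fst s - Suc i, snd s) z)"
      by (cases "i \<le> fst s") (auto simp: falling_Suc falling_eq_0 of_nat_diff)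
    finally show ?case using Suc by simp
  qed
  show ?thesis
    unfolding multi_deriv_def 2 iterated_cmult[OF smooth_monom2] 1 by (simp add: mult_ac)
qed

text \<open>Triangularity: among monomials of total degree at most \<open>i + j\<close>, the
  derivative of order (i, j) detects only the one with these exponents.\<close>

lemma multi_deriv_monom2_eq_0:
  assumes "fst t + snd t \<le> i + j" "t \<noteq> (i, j)"
  shows "multi_deriv i j (monom2 t) = (\<lambda>z. 0)"
proof -
  have "i > fst t \<or> j > snd t" using assms by (cases t) auto
  then show ?thesis unfolding multi_deriv_monom2 by (auto simp: falling_eq_0)
qed

lemma multi_deriv_monom2_self: "multi_deriv i j (monom2 (i, j)) = (\<lambda>z. falling i i * falling j j)"
  unfolding multi_deriv_monom2 by (simp add: monom2_def)

lemma multi_deriv_poly: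
  "multi_deriv i j (\<lambda>z. \<Sum>t\<in>indices m. c t * monom2 t z) = (\<lambda>z. \<Sum>t\<in>indices m. c t * multi_deriv i j (monom2 t) z)"
  by (rule multi_deriv_sum) (auto intro: smooth_monom2)

lemma multi_deriv_polys_eq_0:
  assumes "p \<in> polys m" "m < i + j"
  shows "multi_deriv i j p = (\<lambda>z. 0)"
proof -
  obtain c where c: "p = (\<lambda>z. \<Sum>t\<in>indices m. c t * monom2 t z)" by (rule polysE[OF assms(1)])
  have "multi_deriv i j (monom2 t) = (\<lambda>z. 0)" if "t \<in> indices m" for t
    using that assms(2) by (intro multi_deriv_monom2_eq_0) (auto simp: indices_def)
  then show ?thesis unfolding c multi_deriv_poly by simp
qed

section \<open>The Bramble-Hilbert lemma on convex sets\<close>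

text \<open>Means are corrected from the highest order downwards. A homogeneous polynomial of degree
  \<open>r\<close> has constant derivatives of order \<open>r\<close> and vanishing ones of higher
  order, so it fixes order \<open>r\<close> without disturbing what was already corrected.\<close>

lemma mean_correction:
  assumes U: "open U" "bounded U" "U \<noteq> {}" and D: "\<And>i j. i + j \<le> m \<Longrightarrow> sqint_on U (D i j)"
  shows "n \<le> Suc m \<Longrightarrow> \<exists>p\<in>polys m. \<forall>i j. Suc m - n \<le> i + j \<and> i + j \<le> m \<longrightarrow> (LINT x|lebesgue_on U. D i j x + multi_deriv i j p x) = 0"
proof (induction n)
  case 0
  show ?case by (rule bexI[OF _ polys_zero]) auto
next
  case (Suc n)
  define r where "r = m - n"
  have Us: "U \<in> sets lebesgue" by (rule open_sets_lebesgue[OF U(1)])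
  have lm: "U \<in> lmeasurable" by (simp add: bounded_set_imp_lmeasurable U Us)
  have fm: "finite_measure (lebesgue_on U)" by (rule finite_measure_lebesgue_on[OF lm])
  have mpos: "measure lebesgue U > 0"
  proof -
    have "\<not> negligible U" using open_not_negligible[OF U(1,3)] .
    then have "measure lebesgue U \<noteq> 0" using lm by (simp add: negligible_iff_measure)
    then show ?thesis by (simp add: less_le)
  qed
  obtain p where p: "p \<in> polys m" "\<And>i j. Suc m - n \<le> i + j \<Longrightarrow> i + j \<le> m \<Longrightarrow> (LINT x|lebesgue_on U. D i j x + multi_deriv i j p x) = 0"
  proof -
    have "n \<le> Suc m" using Suc.prems by simp
    from Suc.IH[OF this] show thesis by (elim bexE) (rule that, assumption, simp)
  qed
  define X where "X i j = (LINT x|lebesgue_on U. D i j x + multi_deriv i j p x)" for i j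
  \<comment> \<open>The derivative of order (i, j) of the corresponding monomial is the constant i!
    j!, whose integral over \<open>U\<close> is i! j! times the area; dividing by it cancels the
    mean \<open>X i j\<close>.\<close>
  define c where "c t = (if fst t + snd t = r then - X (fst t) (snd t) / (measure lebesgue U * (falling (fst t) (fst t) * falling (snd t) (snd t))) else 0)" for t
  define q where "q = (\<lambda>z. \<Sum>t\<in>indices m. c t * monom2 t z)"
  have q: "q \<in> polys m" unfolding q_def by (rule polysI)
  have dq: "multi_deriv i j q = (\<lambda>z. c (i, j) * (falling i i * falling j j))" if "r \<le> i + j" "i + j \<le> m" for i j
  proof -
    have "c t * multi_deriv i j (monom2 t) z = (if t = (i, j) then c (i, j) * (falling i i * falling j j) else 0)" for t z
    proof (cases "t = (i, j)")
      case True then show ?thesis by (simp add: multi_deriv_monom2_self)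
    next
      case False
      show ?thesis
      proof (cases "fst t + snd t = r")
        case True then show ?thesis using multi_deriv_monom2_eq_0[of t i j] False that by simp
      next
        case F2: False then show ?thesis using False by (simp add: c_def)
      qed
    qed
    then have "multi_deriv i j q = (\<lambda>z. \<Sum>t\<in>indices m. if t = (i, j) then c (i, j) * (falling i i * falling j j) else 0)"
      unfolding q_def multi_deriv_poly by simp
    also have "\<dots> = (\<lambda>z. c (i, j) * (falling i i * falling j j))"
    proof -
      have "(i, j) \<in> indices m" using that by (simp add: indices_def)
      then show ?thesis by simp
    qed
    finally show ?thesis .
  qed
  show ?case
  proof (intro bexI[of _ "\<lambda>z. p z + q z"] allI impI polys_add p q)
    fix i j assume ij: "Suc m - Suc n \<le> i + j \<and> i + j \<le> m"
    then have ij': "r \<le> i + j" "i + j \<le> m" by (auto simp: r_def)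
    have sp: "sqint_on U (multi_deriv i j p)"
      by (rule smooth_sqint[OF smooth_multi_deriv[OF polys_smooth[OF p(1)]] U(2) Us])
    have i1: "integrable (lebesgue_on U) (\<lambda>x. D i j x + multi_deriv i j p x)"
      by (rule integral_square_le(1)[OF fm sqint_add[OF D[OF ij'(2)] sp]])
    have "(LINT x|lebesgue_on U. D i j x + multi_deriv i j (\<lambda>z. p z + q z) x) = (LINT x|lebesgue_on U. (D i j x + multi_deriv i j p x) + c (i, j) * (falling i i * falling j j))"
      unfolding multi_deriv_add[OF polys_smooth[OF p(1)] polys_smooth[OF q]] dq[OF ij'] by (simp add: add.assoc)
    also have "\<dots> = X i j + measure lebesgue U * (c (i, j) * (falling i i * falling j j))"
      using i1 fm Us by (simp add: X_def finite_measure.integrable_const measure_restrict_space)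
    also have "\<dots> = 0"
    proof (cases "i + j = r")
      case True
      then show ?thesis using mpos falling_self[of i] falling_self[of j] by (simp add: c_def)
    next
      case False
      then have "Suc m - n \<le> i + j" using ij' by (auto simp: r_def)
      then show ?thesis using p(2)[OF _ ij'(2)] False by (simp add: X_def c_def)
    qed
    finally show "(LINT x|lebesgue_on U. D i j x + multi_deriv i j (\<lambda>z. p z + q z) x) = 0" .
  qed
qed

text \<open>After the correction all derivatives up to order \<open>m\<close> have mean 0, so
  Poincare's inequality bounds each by those of one order more, down to order m + 1. The constant 64
  is 32 times the two partial derivatives.\<close>

theorem Bramble_Hilbert:
  assumes U: "open U" "convex U" and r: "r > 0" "ball x\<^sub>0 r \<subseteq> U" and \<sigma>: "\<sigma> > 0" "U \<subseteq> cball x\<^sub>0 (\<sigma> * r)"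
    and w: "HN (Suc m) U B w"
  obtains p E where "p \<in> polys m" "jet (Suc m) U E" "E 0 0 = (\<lambda>x. w x + p x)"
    "\<And>i j n. i + j + n = Suc m \<Longrightarrow> sqnorm_on U (E i j) \<le> (64 * \<sigma> ^ 4 * r\<^sup>2) ^ n * B"
proof -
  have bU: "bounded U" using \<sigma>(2) bounded_cball bounded_subset by blast
  have ne: "U \<noteq> {}" using r by auto
  obtain D where D: "D 0 0 = w" "jet (Suc m) U D" "\<And>i j. i + j \<le> Suc m \<Longrightarrow> sqnorm_on U (D i j) \<le> B"
    by (rule HN_imp_jet[OF U(1) w]) (rule that)
  obtain p where p: "p \<in> polys m" "\<And>i j. i + j \<le> m \<Longrightarrow> (LINT x|lebesgue_on U. D i j x + multi_deriv i j p x) = 0"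
    using mean_correction[OF U(1) bU ne, where m=m and n="Suc m" and D=D] jet_sqint[OF D(2)] by auto
  define E where "E i j x = D i j x + multi_deriv i j p x" for i j x
  have jE: "jet (Suc m) U E"
    using jet_add[OF U(1) D(2) smooth_jet[OF polys_smooth[OF p(1)] U(1) bU]] by (simp add: E_def[abs_def])
  have le: "sqnorm_on U (E i j) \<le> (64 * \<sigma> ^ 4 * r\<^sup>2) ^ n * B" if "i + j + n = Suc m" for i j n
    using that
  proof (induction n arbitrary: i j)
    case 0
    \<comment> \<open>At order m + 1 the polynomial of degree at most \<open>m\<close> leaves no
      trace, so the bound for \<open>w\<close> itself applies.\<close>
    then have "E i j = D i j" using multi_deriv_polys_eq_0[OF p(1), of i j] by (auto simp: E_def fun_eq_iff)
    then show ?case using D(3)[of i j] 0 by simp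
  next
    case (Suc n)
    define f' where "f' = (\<lambda>l::2. if l = 1 then E (Suc i) j else E i (Suc j))"
    have b: "sqnorm_on U (f' l) \<le> (64 * \<sigma> ^ 4 * r\<^sup>2) ^ n * B" for l
      using Suc by (simp add: f'_def)
    have s: "sqint_on U (f' l)" for l using jet_sqint[OF jE] Suc.prems by (simp add: f'_def)
    have "sqnorm_on U (E i j) \<le> 32 * \<sigma> ^ 4 * r\<^sup>2 * (\<Sum>l\<in>UNIV. sqnorm_on U (f' l))"
    proof (rule Poincare_convex[OF U r \<sigma> _ s])
      show "sqint_on U (E i j)" using jet_sqint[OF jE] Suc.prems by simp
      show "strong_grad U (E i j) f'" unfolding f'_def using jet_strong_grad[OF jE] Suc.prems by simp
      show "(LINT x|lebesgue_on U. E i j x) = 0" using p(2)[of i j] Suc.prems by (simp add: E_def)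
    qed
    also have "\<dots> \<le> 32 * \<sigma> ^ 4 * r\<^sup>2 * (\<Sum>l\<in>(UNIV::2 set). (64 * \<sigma> ^ 4 * r\<^sup>2) ^ n * B)"
      by (intro mult_left_mono sum_mono b) simp
    also have "\<dots> = (64 * \<sigma> ^ 4 * r\<^sup>2) ^ Suc n * B" by simp
    finally show ?case .
  qed
  show ?thesis by (rule that[OF p(1) jE _ le]) (auto simp: E_def D(1))
qed

section \<open>Orthogonal projections and inverse inequalities\<close>

text \<open>One Gram-Schmidt step per element; \<open>f\<close> is arbitrary in the induction
  because the new \<open>b a\<close> is projected as well. Linear dependence is allowed.\<close>

lemma orthogonal_projection_exists:
  assumes "finite S" "\<And>s. s \<in> S \<Longrightarrow> sqint M (b s)"
  shows "sqint M f \<Longrightarrow> \<exists>c. \<forall>s\<in>S. (LINT x|M. (f x - (\<Sum>t\<in>S. c t * b t x)) * b s x) = 0"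
  using assms
proof (induction S arbitrary: f rule: finite_induct)
  case (insert a S)
  have sb: "\<And>s. s \<in> S \<Longrightarrow> sqint M (b s)" "sqint M (b a)" using insert by auto
  obtain c where c: "\<forall>s\<in>S. (LINT x|M. (f x - (\<Sum>t\<in>S. c t * b t x)) * b s x) = 0"
    using insert.IH[OF insert.prems(1) sb(1)] by auto
  obtain d where d: "\<forall>s\<in>S. (LINT x|M. (b a x - (\<Sum>t\<in>S. d t * b t x)) * b s x) = 0"
    using insert.IH[OF sb(2) sb(1)] by auto
  define g where "g x = f x - (\<Sum>t\<in>S. c t * b t x)" for x
  define e where "e x = b a x - (\<Sum>t\<in>S. d t * b t x)" for x
  have ss: "sqint M (\<lambda>x. \<Sum>t\<in>S. k t * b t x)" for k by (intro sqint_sum sqint_cmult sb)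
  have sg: "sqint M g" unfolding g_def by (intro sqint_diff ss insert.prems)
  have se: "sqint M e" unfolding e_def by (intro sqint_diff ss sb)
  have gb: "(LINT x|M. g x * b s x) = 0" and eb: "(LINT x|M. e x * b s x) = 0" if "s \<in> S" for s
    using c d that by (auto simp: g_def e_def)
  \<comment> \<open>If the new direction \<open>e\<close> has norm 0, any coefficient works:
    Cauchy-Schwarz makes everything orthogonal to \<open>e\<close>.\<close>
  define \<beta> where "\<beta> = (if sqnorm M e = 0 then 0 else (LINT x|M. g x * e x) / sqnorm M e)"
  define h where "h x = g x - \<beta> * e x" for x
  have sh: "sqint M h" unfolding h_def by (intro sqint_diff sqint_cmult sg se)
  have lin: "(LINT x|M. h x * k x) = (LINT x|M. g x * k x) - \<beta> * (LINT x|M. e x * k x)" if "sqint M k" for k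
    using sqint_mult_integrable[OF sg that] sqint_mult_integrable[OF se that] by (simp add: h_def left_diff_distrib mult.assoc)
  have hb: "(LINT x|M. h x * b s x) = 0" if "s \<in> S" for s
    using lin[OF sb(1)[OF that]] gb[OF that] eb[OF that] by simp
  have he: "(LINT x|M. h x * e x) = 0"
  proof (cases "sqnorm M e = 0")
    case True
    have "(LINT x|M. h x * e x)\<^sup>2 \<le> sqnorm M h * sqnorm M e" by (rule sqint_Cauchy_Schwarz[OF sh se])
    then show ?thesis using True by simp
  next
    case False
    then show ?thesis using lin[OF se] by (simp add: \<beta>_def power2_eq_square)
  qed
  have ba: "(LINT x|M. h x * b a x) = 0"
  proof -
    have "(LINT x|M. h x * b a x) = (LINT x|M. h x * e x + (\<Sum>t\<in>S. d t * (h x * b t x)))"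
      by (simp add: e_def algebra_simps sum_distrib_left)
    also have "\<dots> = (LINT x|M. h x * e x) + (LINT x|M. (\<Sum>t\<in>S. d t * (h x * b t x)))"
      by (intro Bochner_Integration.integral_add sqint_mult_integrable sh se Bochner_Integration.integrable_sum integrable_mult_right sb)
    also have "(LINT x|M. (\<Sum>t\<in>S. d t * (h x * b t x))) = (\<Sum>t\<in>S. d t * (LINT x|M. h x * b t x))"
      using sqint_mult_integrable[OF sh sb(1)] by (subst Bochner_Integration.integral_sum) auto
    finally show ?thesis using he hb by simp
  qed
  define c' where "c' t = (if t = a then \<beta> else c t - \<beta> * d t)" for t
  have "(\<Sum>t\<in>insert a S. c' t * b t x) = \<beta> * b a x + (\<Sum>t\<in>S. (c t - \<beta> * d t) * b t x)" for x
  proof -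
    have "(\<Sum>t\<in>S. c' t * b t x) = (\<Sum>t\<in>S. (c t - \<beta> * d t) * b t x)"
      using insert.hyps(2) by (intro sum.cong) (auto simp: c'_def)
    then show ?thesis using insert.hyps by (simp add: c'_def)
  qed
  then have "f x - (\<Sum>t\<in>insert a S. c' t * b t x) = h x" for x
    by (simp add: h_def g_def e_def algebra_simps sum_subtractf sum_distrib_left)
  then show ?case using ba hb by (intro exI[of _ c']) auto
qed simp

lemma HN_cmult:
  assumes U: "open U"
  shows "HN k U B w \<Longrightarrow> HN k U (c\<^sup>2 * B) (\<lambda>x. c * w x)"
proof (induction k arbitrary: w)
  case 0
  then show ?case using sqint_cmult[of "lebesgue_on U" w c] by (auto simp: power_mult_distrib mult_left_mono)
next
  case (Suc k)
  obtain w' where w': "strong_grad U w w'" "\<And>i. HN k U B (w' i)" using Suc.prems by auto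
  note s = HN_sqint[OF Suc.prems]
  have "C1_on U (\<lambda>x. c) (\<lambda>i x. 0)" by (simp add: C1_on_def)
  from strong_grad_mult[OF U this s HN_sqint[OF w'(2)] w'(1)]
  have "strong_grad U (\<lambda>x. c * w x) (\<lambda>i x. c * w' i x)" by simp
  moreover have "sqnorm_on U (\<lambda>x. c * w x) \<le> c\<^sup>2 * B"
    unfolding sqnorm_cmult by (rule mult_left_mono[OF HN_sqnorm[OF Suc.prems]]) simp
  ultimately show ?case
    using sqint_cmult[OF s] Suc.IH[OF w'(2)] unfolding HN.simps by (intro conjI exI[of _ "\<lambda>i x. c * w' i x"]) auto
qed

lemma continuous_sqnorm_zero:
  fixes f :: "plane \<Rightarrow> real"
  assumes U: "open U" and f: "continuous_on U f" "sqint_on U f" and z: "sqnorm_on U f = 0"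
  shows "\<forall>x\<in>U. f x = 0"
proof
  fix x assume x: "x \<in> U"
  note Us = open_sets_lebesgue[OF U]
  have "AE x in lebesgue_on U. (f x)\<^sup>2 = 0"
    using integral_nonneg_eq_0_iff_AE[OF sqint_integrable[OF f(2)]] z by simp
  then have ae: "AE x in lebesgue. x \<in> U \<longrightarrow> f x = 0"
    using Us by (simp add: AE_restrict_space_iff)
  show "f x = 0"
  proof (rule ccontr)
    assume "f x \<noteq> 0"
    define V where "V = U \<inter> f -` (- {0})"
    have "open V" unfolding V_def by (rule continuous_open_preimage[OF f(1) U]) auto
    moreover have "x \<in> V" using x \<open>f x \<noteq> 0\<close> by (simp add: V_def)
    ultimately have "\<not> negligible V" using open_not_negligible by blast
    moreover have "AE x in lebesgue. x \<notin> V" using ae by eventually_elim (auto simp: V_def)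
    ultimately show False
      using \<open>open V\<close> by (simp add: negligible_iff_null_sets AE_iff_null_sets open_sets_lebesgue)
  qed
qed

text \<open>Downward induction on the degree of \<open>t\<close>: in the derivative of that order,
  lower terms vanish by triangularity and higher coefficients are already 0.\<close>

lemma poly_coeff_eq_0:
  assumes U: "open U" "x \<in> U" and z: "\<And>y. y \<in> U \<Longrightarrow> (\<Sum>t\<in>indices m. c t * monom2 t y) = 0" and t: "t \<in> indices m"
  shows "c t = 0"
proof -
  define p where "p = (\<lambda>z. \<Sum>t\<in>indices m. c t * monom2 t z)"
  have sp: "smooth p" unfolding p_def by (intro smooth_sum smooth_mult smooth_const smooth_monom2)
  have zero_pd: "\<forall>y\<in>U. partial_deriv l f y = 0" if f: "\<forall>y\<in>U. f y = 0" for f l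
  proof
    fix y assume y: "y \<in> U"
    have "has_grad f (\<lambda>i. 0) y"
      by (rule has_derivative_transform_within_open[where f="\<lambda>x. 0" and s=U])
         (rule has_grad_const, rule U, rule y, use f in simp)
    from partial_deriv_eq[OF this] show "partial_deriv l f y = 0" .
  qed
  have zero_it: "\<forall>y\<in>U. (partial_deriv l ^^ n) f y = 0" if f: "\<forall>y\<in>U. f y = 0" for f l n
    by (induction n) (use f zero_pd in auto)
  have zd: "\<forall>y\<in>U. multi_deriv i j p y = 0" for i j
    unfolding multi_deriv_def by (intro zero_it) (use z in \<open>simp add: p_def\<close>)
  show ?thesis using t
  proof (induction "m - (fst t + snd t)" arbitrary: t rule: less_induct)
    case (less t)
    obtain i j where ij: "t = (i, j)" by (cases t)
    have "0 = multi_deriv i j p x" using zd U(2) by simp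
    also have "\<dots> = (\<Sum>s\<in>indices m. c s * multi_deriv i j (monom2 s) x)" unfolding p_def multi_deriv_poly ..
    also have "\<dots> = (\<Sum>s\<in>indices m. if s = t then c t * (falling i i * falling j j) else 0)"
    proof (rule sum.cong[OF refl])
      fix s assume s: "s \<in> indices m"
      show "c s * multi_deriv i j (monom2 s) x = (if s = t then c t * (falling i i * falling j j) else 0)"
      proof (cases "s = t")
        case True then show ?thesis by (simp add: ij multi_deriv_monom2_self)
      next
        case False
        show ?thesis
        proof (cases "fst s + snd s \<le> i + j")
          case True
          then show ?thesis using multi_deriv_monom2_eq_0[OF True] False by (simp add: ij)
        next
          case F2: False
          then have "m - (fst s + snd s) < m - (fst t + snd t)" using s by (simp add: ij indices_def)
          from less.hyps[OF this s] show ?thesis using False by simp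
        qed
      qed
    qed
    also have "\<dots> = c t * (falling i i * falling j j)" using less.prems by simp
    finally show ?case using falling_self[of i] falling_self[of j] by simp
  qed
qed

text \<open>Let \<open>e\<close> be the part of the monomial \<open>t\<close> orthogonal to the
  other monomials. The inner product of a polynomial with \<open>e\<close> is its coefficient at
  \<open>t\<close> times the squared norm of \<open>e\<close>, which is positive because the
  monomials are independent on an open set; Cauchy-Schwarz does the rest.\<close>

lemma poly_coeff_bound:
  assumes U: "open U" "bounded U" "U \<noteq> {}"
  obtains K where "K \<ge> 0" "\<And>c t. t \<in> indices m \<Longrightarrow> (c t)\<^sup>2 \<le> K * sqnorm_on U (\<lambda>z. \<Sum>t\<in>indices m. c t * monom2 t z)"
proof -
  let ?M = "lebesgue_on U"
  have sm: "sqint ?M (monom2 t)" for t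
    by (rule smooth_sqint[OF smooth_monom2 U(2) open_sets_lebesgue[OF U(1)]])
  have ex: "\<exists>k\<ge>0. \<forall>c. (c t)\<^sup>2 \<le> k * sqnorm ?M (\<lambda>z. \<Sum>t\<in>indices m. c t * monom2 t z)" if t: "t \<in> indices m" for t
  proof -
    define S where "S = indices m - {t}"
    have S: "finite S" "t \<notin> S" "indices m = insert t S" using t by (auto simp: S_def)
    obtain d where d: "\<forall>s\<in>S. (LINT x|?M. (monom2 t x - (\<Sum>s\<in>S. d s * monom2 s x)) * monom2 s x) = 0"
      using orthogonal_projection_exists[OF S(1), of ?M monom2 "monom2 t"] sm by auto
    define e where "e x = monom2 t x - (\<Sum>s\<in>S. d s * monom2 s x)" for x
    have se: "sqint ?M e" unfolding e_def by (intro sqint_diff sqint_sum sqint_cmult sm)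
    have eS: "(LINT x|?M. e x * monom2 s x) = 0" if "s \<in> S" for s using d that by (simp add: e_def)
    have lin: "(LINT x|?M. e x * (\<Sum>s\<in>S. k s * monom2 s x)) = 0" for k
    proof -
      have "(LINT x|?M. e x * (\<Sum>s\<in>S. k s * monom2 s x)) = (LINT x|?M. (\<Sum>s\<in>S. k s * (e x * monom2 s x)))"
        by (simp add: sum_distrib_left mult_ac)
      also have "\<dots> = (\<Sum>s\<in>S. k s * (LINT x|?M. e x * monom2 s x))"
        using sqint_mult_integrable[OF se sm] by (subst Bochner_Integration.integral_sum) auto
      finally show ?thesis using eS by simp
    qed
    have pos: "sqnorm ?M e > 0"
    proof (rule ccontr)
      assume "\<not> sqnorm ?M e > 0"
      then have z: "sqnorm ?M e = 0" using sqnorm_nonneg[of ?M e] by linarith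
      have "continuous_on U e" unfolding e_def
        by (intro continuous_intros smooth_continuous_on smooth_monom2)
      then have "\<forall>x\<in>U. e x = 0" using continuous_sqnorm_zero[OF U(1) _ se z] by blast
      moreover have "(\<Sum>s\<in>indices m. (if s = t then 1 else - d s) * monom2 s x) = e x" for x
      proof -
        have "(\<Sum>s\<in>S. (if s = t then 1 else - d s) * monom2 s x) = (\<Sum>s\<in>S. - (d s * monom2 s x))"
          using S(2) by (intro sum.cong) auto
        then show ?thesis unfolding S(3) using S(1,2) by (simp add: e_def sum_negf)
      qed
      moreover obtain x where "x \<in> U" using U(3) by blast
      ultimately have "(if t = t then 1 else - d t) = 0"
        using poly_coeff_eq_0[OF U(1) \<open>x \<in> U\<close> _ t, of "\<lambda>s. if s = t then 1 else - d s"] by simp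
      then show False by simp
    qed
    show ?thesis
    proof (intro exI[of _ "1 / sqnorm ?M e"] conjI allI)
      show "0 \<le> 1 / sqnorm ?M e" using pos by simp
      fix c
      define q where "q z = (\<Sum>t\<in>indices m. c t * monom2 t z)" for z
      have sq: "sqint ?M q" unfolding q_def by (intro sqint_sum sqint_cmult sm)
      have qe: "e x * q x = c t * (e x * e x) + e x * (\<Sum>s\<in>S. (c s + c t * d s) * monom2 s x)" for x
      proof -
        have "q x = c t * monom2 t x + (\<Sum>s\<in>S. c s * monom2 s x)" unfolding q_def S(3) using S(1,2) by simp
        also have "\<dots> = c t * e x + (\<Sum>s\<in>S. (c s + c t * d s) * monom2 s x)"
          by (simp add: e_def distrib_right sum.distrib right_diff_distrib sum_distrib_left mult.assoc)
        finally show ?thesis by (simp add: algebra_simps)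
      qed
      have ss: "sqint ?M (\<lambda>x. \<Sum>s\<in>S. (c s + c t * d s) * monom2 s x)" by (intro sqint_sum sqint_cmult sm)
      have "(LINT x|?M. e x * q x) = c t * (LINT x|?M. e x * e x) + (LINT x|?M. e x * (\<Sum>s\<in>S. (c s + c t * d s) * monom2 s x))"
        unfolding qe using sqint_mult_integrable[OF se se] sqint_mult_integrable[OF se ss] by simp
      then have "(LINT x|?M. e x * q x) = c t * sqnorm ?M e" unfolding lin by (simp add: power2_eq_square)
      then have "(c t * sqnorm ?M e)\<^sup>2 \<le> sqnorm ?M e * sqnorm ?M q"
        using sqint_Cauchy_Schwarz[OF se sq] by simp
      then have "sqnorm ?M e * ((c t)\<^sup>2 * sqnorm ?M e) \<le> sqnorm ?M e * sqnorm ?M q"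
        by (simp add: power_mult_distrib power2_eq_square[of "sqnorm ?M e"] mult_ac)
      then have "(c t)\<^sup>2 * sqnorm ?M e \<le> sqnorm ?M q" using pos by (simp add: mult_le_cancel_left_pos)
      then show "(c t)\<^sup>2 \<le> 1 / sqnorm ?M e * sqnorm ?M (\<lambda>z. \<Sum>t\<in>indices m. c t * monom2 t z)"
        using pos by (simp add: field_simps q_def)
    qed
  qed
  then have "\<forall>t. \<exists>k. t \<in> indices m \<longrightarrow> k \<ge> 0 \<and> (\<forall>c. (c t)\<^sup>2 \<le> k * sqnorm ?M (\<lambda>z. \<Sum>t\<in>indices m. c t * monom2 t z))"
    by blast
  from choice[OF this] obtain k where k: "\<forall>t. t \<in> indices m \<longrightarrow> k t \<ge> 0 \<and> (\<forall>c. (c t)\<^sup>2 \<le> k t * sqnorm ?M (\<lambda>z. \<Sum>t\<in>indices m. c t * monom2 t z))"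
    by (elim exE) (rule that)
  show ?thesis
  proof (rule that[of "\<Sum>t\<in>indices m. k t"])
    show "(\<Sum>t\<in>indices m. k t) \<ge> 0" using k by (intro sum_nonneg) auto
    fix c t assume t: "t \<in> indices m"
    have "(c t)\<^sup>2 \<le> k t * sqnorm ?M (\<lambda>z. \<Sum>t\<in>indices m. c t * monom2 t z)" using k t by blast
    also have "\<dots> \<le> (\<Sum>t\<in>indices m. k t) * sqnorm ?M (\<lambda>z. \<Sum>t\<in>indices m. c t * monom2 t z)"
      using k t by (intro mult_right_mono member_le_sum) auto
    finally show "(c t)\<^sup>2 \<le> (\<Sum>t\<in>indices m. k t) * sqnorm ?M (\<lambda>z. \<Sum>t\<in>indices m. c t * monom2 t z)" .
  qed
qed

lemma iterated_affine:
  assumes "smooth f"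
  shows "(partial_deriv l ^^ n) (\<lambda>z. f (a + s *\<^sub>R z)) = (\<lambda>z. s ^ n * (partial_deriv l ^^ n) f (a + s *\<^sub>R z))"
proof (induction n)
  case (Suc n)
  have sm: "smooth ((partial_deriv l ^^ n) f)" by (rule smooth_iterated[OF assms])
  have "partial_deriv l (\<lambda>z. s ^ n * (partial_deriv l ^^ n) f (a + s *\<^sub>R z)) = (\<lambda>z. s ^ n * (s * partial_deriv l ((partial_deriv l ^^ n) f) (a + s *\<^sub>R z)))"
    unfolding partial_deriv_cmult[OF smooth_affine[OF sm]] partial_deriv_affine[OF smooth_of_class[OF sm]] ..
  then show ?case using Suc by (simp add: mult_ac)
qed simp

lemma multi_deriv_affine:
  assumes "smooth f"
  shows "multi_deriv i j (\<lambda>z. f (a + s *\<^sub>R z)) = (\<lambda>z. s ^ (i + j) * multi_deriv i j f (a + s *\<^sub>R z))"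
  unfolding multi_deriv_def iterated_affine[OF assms] iterated_cmult[OF smooth_affine[OF smooth_iterated[OF assms]]]
    iterated_affine[OF smooth_iterated[OF assms]]
  by (simp add: power_add mult_ac)

lemma sum_square_le_card:
  fixes a :: "'a \<Rightarrow> real"
  shows "(\<Sum>i\<in>I. a i)\<^sup>2 \<le> real (card I) * (\<Sum>i\<in>I. (a i)\<^sup>2)"
  using Cauchy_Schwarz_ineq_sum[of "\<lambda>_. 1" a I] by simp

text \<open>After scaling, \<open>U\<close> lies between the unit ball and the ball of radius
  \<sigma>. Coefficients are bounded by the norm on the small ball and derivatives by the
  coefficients on the large one, so no constant depends on \<open>U\<close>.\<close>

lemma inverse_inequality:
  assumes \<sigma>: "\<sigma> > 0"
  obtains K where "K \<ge> 0"
    "\<And>q U x\<^sub>0 r i j. \<lbrakk>q \<in> polys m; open U; r > 0; ball x\<^sub>0 r \<subseteq> U; U \<subseteq> cball x\<^sub>0 (\<sigma> * r); i + j \<le> Suc m\<rbrakk>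
      \<Longrightarrow> r ^ (2 * (i + j)) * sqnorm_on U (multi_deriv i j q) \<le> K * sqnorm_on U q"
proof -
  let ?B = "ball (0::plane) 1"
  obtain k where k: "k \<ge> 0" "\<And>c t. t \<in> indices m \<Longrightarrow> (c t)\<^sup>2 \<le> k * sqnorm (lebesgue_on ?B) (\<lambda>z. \<Sum>t\<in>indices m. c t * monom2 t z)"
    by (rule poly_coeff_bound[of ?B m]) (auto intro: that)
  have "\<exists>M. M > 0 \<and> (\<forall>z\<in>cball 0 \<sigma>. \<bar>multi_deriv i j (monom2 t) z\<bar> \<le> M)" for i j t
    by (rule continuous_on_compact_abs_bound[OF smooth_continuous_on[OF smooth_multi_deriv[OF smooth_monom2]] compact_cball]) blast
  then have "\<forall>p. \<exists>M. M > 0 \<and> (\<forall>z\<in>cball 0 \<sigma>. \<bar>multi_deriv (fst (fst p)) (snd (fst p)) (monom2 (snd p)) z\<bar> \<le> M)" by blast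
  from choice[OF this] obtain N where N: "\<forall>p. N p > 0 \<and> (\<forall>z\<in>cball 0 \<sigma>. \<bar>multi_deriv (fst (fst p)) (snd (fst p)) (monom2 (snd p)) z\<bar> \<le> N p)"
    by (elim exE) (rule that)
  define M where "M = (\<Sum>p\<in>indices (Suc m) \<times> indices m. N p)"
  have Mb: "\<bar>multi_deriv i j (monom2 t) z\<bar> \<le> M" if "i + j \<le> Suc m" "t \<in> indices m" "z \<in> cball 0 \<sigma>" for i j t z
  proof -
    have "\<bar>multi_deriv i j (monom2 t) z\<bar> \<le> N ((i, j), t)" using spec[OF N, of "((i, j), t)"] that(3) by simp
    also have "\<dots> \<le> M" unfolding M_def
    proof (rule member_le_sum)
      show "((i, j), t) \<in> indices (Suc m) \<times> indices m" using that(1,2) by (simp add: indices_def)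
      show "0 \<le> N p" for p using spec[OF N, of p] by (simp add: less_imp_le)
      show "finite (indices (Suc m) \<times> indices m)" by simp
    qed
    finally show ?thesis .
  qed
  have M0: "M \<ge> 0" unfolding M_def by (intro sum_nonneg less_imp_le) (use N in blast)
  define v where "v = unit_ball_vol (real DIM(plane))"
  have v: "v > 0" by (simp add: v_def)
  define n where "n = real (card (indices m))"
  \<comment> \<open>One \<open>n\<close> comes from Cauchy-Schwarz for the sum over monomials, the
    other counts its terms; \<open>k\<close> bounds the squared coefficients, \<open>M\<close> the
    derivatives of monomials, and \<open>v * \<sigma>\<^sup>2\<close> is the area of the large
    ball.\<close>
  define K where "K = v * \<sigma>\<^sup>2 * (n * (n * (k * M\<^sup>2)))"
  have K: "K \<ge> 0" unfolding K_def n_def using v k(1) by simp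
  show ?thesis
  proof (rule that[OF K])
    fix q and U :: "plane set" and x\<^sub>0 and r :: real and i j :: nat
    assume q: "q \<in> polys m" and U: "open U" and r: "r > 0" "ball x\<^sub>0 r \<subseteq> U" and Us: "U \<subseteq> cball x\<^sub>0 (\<sigma> * r)" and ij: "i + j \<le> Suc m"
    have bU: "bounded U" using Us bounded_cball bounded_subset by blast
    note Um = open_sets_lebesgue[OF U]
    have lU: "U \<in> lmeasurable" by (simp add: bounded_set_imp_lmeasurable bU Um)
    note sq = smooth_sqint[OF polys_smooth[OF q] bU Um]
    define q' where "q' z = q (x\<^sub>0 + r *\<^sub>R z)" for z
    have q': "q' \<in> polys m" unfolding q'_def by (rule polys_affine[OF q])
    obtain c where c: "q' = (\<lambda>z. \<Sum>t\<in>indices m. c t * monom2 t z)" by (rule polysE[OF q'])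
    have J: "has_jacobian UNIV (\<lambda>z. x\<^sub>0 + r *\<^sub>R z) (\<lambda>i j x. if i = j then r else 0)"
      unfolding has_jacobian_def
    proof (intro conjI ballI allI)
      fix z :: plane and j :: 2
      have "has_grad (\<lambda>z. z $ j) (\<lambda>i. if i = j then 1 else 0) (x\<^sub>0 + r *\<^sub>R z)" by (rule has_grad_coord)
      from has_grad_affine[OF this] show "has_grad (\<lambda>x. (x\<^sub>0 + r *\<^sub>R x) $ j) (\<lambda>i. if i = j then r else 0) z"
        by (simp add: if_distrib cong: if_cong)
    qed simp
    have img: "(\<lambda>z. x\<^sub>0 + r *\<^sub>R z) ` ?B = ball x\<^sub>0 r"
    proof -
      have "y \<in> (\<lambda>z. x\<^sub>0 + r *\<^sub>R z) ` ?B" if "dist x\<^sub>0 y < r" for y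
        by (rule image_eqI[of _ _ "(1 / r) *\<^sub>R (y - x\<^sub>0)"])
           (use that r(1) in \<open>auto simp: dist_norm norm_minus_commute\<close>)
      moreover have "dist x\<^sub>0 (x\<^sub>0 + r *\<^sub>R z) < r" if "norm z < 1" for z
        using that r(1) by (simp add: dist_norm)
      ultimately show ?thesis by auto
    qed
    have sb: "sqint_on (ball x\<^sub>0 r) q" "sqnorm_on (ball x\<^sub>0 r) q \<le> sqnorm_on U q"
      using sqint_mono[OF sq r(2) _ Um] by (auto intro: open_sets_lebesgue)
    have "sqnorm (lebesgue_on ?B) q' \<le> (1 / r\<^sup>2) * sqnorm_on (ball x\<^sub>0 r) q"
      unfolding q'_def img[symmetric]
      by (rule sqint_compose(2)[OF _ _ J])
         (use r(1) sb(1) in \<open>auto simp: jac_def power2_eq_square inj_on_def img intro: open_sets_lebesgue\<close>)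
    also have "\<dots> \<le> (1 / r\<^sup>2) * sqnorm_on U q" by (rule mult_left_mono[OF sb(2)]) simp
    finally have nq: "sqnorm (lebesgue_on ?B) q' \<le> (1 / r\<^sup>2) * sqnorm_on U q" .
    define Z where "Z = n * (n * (k * M\<^sup>2)) * sqnorm (lebesgue_on ?B) q'"
    have pw: "(r ^ (i + j) * multi_deriv i j q x)\<^sup>2 \<le> Z" if x: "x \<in> U" for x
    proof -
      define z where "z = (1 / r) *\<^sub>R (x - x\<^sub>0)"
      have xz: "x = x\<^sub>0 + r *\<^sub>R z" using r(1) by (simp add: z_def)
      have zs: "z \<in> cball 0 \<sigma>"
      proof -
        have "dist x\<^sub>0 x \<le> \<sigma> * r" using x Us by auto
        then show ?thesis using r(1) by (simp add: z_def dist_norm norm_minus_commute divide_le_eq)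
      qed
      have "r ^ (i + j) * multi_deriv i j q x = multi_deriv i j q' z"
        unfolding q'_def multi_deriv_affine[OF polys_smooth[OF q]] xz ..
      also have "\<dots> = (\<Sum>t\<in>indices m. c t * multi_deriv i j (monom2 t) z)" unfolding c multi_deriv_poly ..
      finally have h1: "(r ^ (i + j) * multi_deriv i j q x)\<^sup>2 \<le> n * (\<Sum>t\<in>indices m. (c t * multi_deriv i j (monom2 t) z)\<^sup>2)"
        unfolding n_def using sum_square_le_card by metis
      have "(\<Sum>t\<in>indices m. (c t * multi_deriv i j (monom2 t) z)\<^sup>2) \<le> (\<Sum>t\<in>indices m. k * sqnorm (lebesgue_on ?B) q' * M\<^sup>2)"
      proof (rule sum_mono)
        fix t assume t: "t \<in> indices m"
        have "(c t)\<^sup>2 \<le> k * sqnorm (lebesgue_on ?B) q'" unfolding c by (rule k(2)[OF t])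
        moreover have "(multi_deriv i j (monom2 t) z)\<^sup>2 \<le> M\<^sup>2"
          using Mb[OF ij t zs] M0 by (simp add: power2_le_iff_abs_le)
        ultimately show "(c t * multi_deriv i j (monom2 t) z)\<^sup>2 \<le> k * sqnorm (lebesgue_on ?B) q' * M\<^sup>2"
          unfolding power_mult_distrib using k(1) by (intro mult_mono) auto
      qed
      also have "\<dots> = n * (k * sqnorm (lebesgue_on ?B) q' * M\<^sup>2)" by (simp add: n_def)
      finally have h2: "(\<Sum>t\<in>indices m. (c t * multi_deriv i j (monom2 t) z)\<^sup>2) \<le> n * (k * sqnorm (lebesgue_on ?B) q' * M\<^sup>2)" .
      have "n \<ge> 0" by (simp add: n_def)
      from order_trans[OF h1 mult_left_mono[OF h2 this]] show ?thesis by (simp add: Z_def mult_ac)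
    qed
    have Z0: "Z \<ge> 0" unfolding Z_def n_def using k(1) by simp
    have sd: "sqint_on U (\<lambda>x. r ^ (i + j) * multi_deriv i j q x)"
      by (rule sqint_cmult[OF smooth_sqint[OF smooth_multi_deriv[OF polys_smooth[OF q]] bU Um]])
    have "r ^ (2 * (i + j)) * sqnorm_on U (multi_deriv i j q) = sqnorm_on U (\<lambda>x. r ^ (i + j) * multi_deriv i j q x)"
      unfolding sqnorm_cmult by (simp only: power_even_eq)
    also have "\<dots> \<le> (LINT x|lebesgue_on U. Z)"
      by (rule integral_mono[OF sqint_integrable[OF sd]])
         (use pw in \<open>auto intro: finite_measure.integrable_const[OF finite_measure_lebesgue_on[OF lU]]\<close>)
    also have "\<dots> = Z * measure lebesgue U" using Um by (simp add: measure_restrict_space)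
    also have "\<dots> \<le> Z * (v * (\<sigma> * r)\<^sup>2)"
    proof (rule mult_left_mono[OF _ Z0])
      have "measure lebesgue U \<le> measure lebesgue (cball x\<^sub>0 (\<sigma> * r))"
        by (rule measure_mono_fmeasurable[OF Us Um]) simp
      also have "\<dots> = v * (\<sigma> * r)\<^sup>2" using content_cball[of "\<sigma> * r" x\<^sub>0] \<sigma> r(1) by (simp add: v_def)
      finally show "measure lebesgue U \<le> v * (\<sigma> * r)\<^sup>2" .
    qed
    also have "\<dots> = (v * \<sigma>\<^sup>2 * (n * (n * (k * M\<^sup>2)))) * (r\<^sup>2 * sqnorm (lebesgue_on ?B) q')"
      by (simp add: Z_def power_mult_distrib mult_ac)
    also have "\<dots> \<le> K * sqnorm_on U q"
      unfolding K_def[symmetric] by (rule mult_left_mono[OF _ K]) (use nq r(1) in \<open>simp add: field_simps\<close>)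
    finally show "r ^ (2 * (i + j)) * sqnorm_on U (multi_deriv i j q) \<le> K * sqnorm_on U q" .
  qed
qed

text \<open>The boundary of a convex set is negligible. This reconciles the projection, defined on
  the closed set, with Sobolev spaces, defined on open ones.\<close>

lemma integral_interior_convex:
  fixes g :: "plane \<Rightarrow> real"
  assumes D: "convex D" "compact D" and g: "g \<in> borel_measurable (lebesgue_on (interior D))"
  shows "(LINT x|lebesgue_on D. g x) = (LINT x|lebesgue_on (interior D). g x)"
proof -
  have Ds: "D \<in> sets lebesgue" and Is: "interior D \<in> sets lebesgue"
    using D(2) by (auto intro: compact_sets_lebesgue open_sets_lebesgue)
  have "negligible (D - interior D)"
    by (rule negligible_subset[OF negligible_convex_frontier[OF D(1)]])
       (use closure_subset in \<open>auto simp: frontier_def\<close>)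
  then have "AE x in lebesgue. x \<notin> D - interior D"
    by (intro AE_not_in) (simp add: negligible_iff_null_sets)
  then have ae: "AE x in lebesgue. (if x \<in> interior D then g x else 0) = (if x \<in> D then g x else 0)"
    by eventually_elim (use interior_subset in auto)
  have m: "(\<lambda>x. if x \<in> interior D then g x else 0) \<in> borel_measurable lebesgue"
    using borel_measurable_if[OF Is, of g] g by simp
  note m' = borel_measurable_AE[OF m ae]
  show ?thesis
    using integral_cong_AE[OF m m' ae] Lebesgue_Measure.integral_restrict_UNIV[OF Ds, of g]
      Lebesgue_Measure.integral_restrict_UNIV[OF Is, of g] by simp
qed

text \<open>Gives the definite description its meaning: existence by Gram-Schmidt, uniqueness
  because a polynomial of norm 0 on a nonempty open set has only zero coefficients.\<close>

lemma L2_projection_characterization: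
  assumes D: "convex D" "compact D" "interior D \<noteq> {}" and w: "sqint_on (interior D) w"
  shows "L2_projection m D w \<in> polys m"
    and "\<And>p. p \<in> polys m \<Longrightarrow> (LINT x|lebesgue_on (interior D). (w x - L2_projection m D w x) * p x) = 0"
proof -
  let ?U = "interior D"
  let ?M = "lebesgue_on ?U"
  have U: "open ?U" "bounded ?U" using D(2) by (auto intro: bounded_subset[OF compact_imp_bounded interior_subset])
  note Us = open_sets_lebesgue[OF U(1)]
  have sp: "sqint ?M p" if "p \<in> polys m" for p by (rule smooth_sqint[OF polys_smooth[OF that] U(2) Us])
  have eqD: "(LINT x|lebesgue_on D. (w x - q x) * p x) = (LINT x|?M. (w x - q x) * p x)" if "q \<in> polys m" "p \<in> polys m" for p q
    by (rule integral_interior_convex[OF D(1,2)])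
       (rule borel_measurable_integrable[OF sqint_mult_integrable[OF sqint_diff[OF w sp[OF that(1)]] sp[OF that(2)]]])
  have sm: "sqint ?M (monom2 t)" for t by (rule smooth_sqint[OF smooth_monom2 U(2) Us])
  obtain c where c: "\<forall>s\<in>indices m. (LINT x|?M. (w x - (\<Sum>t\<in>indices m. c t * monom2 t x)) * monom2 s x) = 0"
    using orthogonal_projection_exists[of "indices m" ?M monom2 w] sm w by auto
  define q where "q = (\<lambda>x. \<Sum>t\<in>indices m. c t * monom2 t x)"
  have q: "q \<in> polys m" unfolding q_def by (rule polysI)
  have orth: "(LINT x|?M. (w x - q x) * p x) = 0" if p: "p \<in> polys m" for p
  proof -
    obtain d where d: "p = (\<lambda>z. \<Sum>t\<in>indices m. d t * monom2 t z)" by (rule polysE[OF p])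
    have "(LINT x|?M. (w x - q x) * p x) = (LINT x|?M. (\<Sum>s\<in>indices m. d s * ((w x - q x) * monom2 s x)))"
      unfolding d by (simp add: sum_distrib_left mult_ac)
    also have "\<dots> = (\<Sum>s\<in>indices m. d s * (LINT x|?M. (w x - q x) * monom2 s x))"
      using sqint_mult_integrable[OF sqint_diff[OF w sp[OF q]] sm] by (subst Bochner_Integration.integral_sum) auto
    also have "\<dots> = 0" using c by (simp add: q_def)
    finally show ?thesis .
  qed
  let ?P = "\<lambda>q. q \<in> polys m \<and> (\<forall>p\<in>polys m. (LINT x|lebesgue_on D. (w x - q x) * p x) = 0)"
  have Pq: "?P q" using q orth eqD[OF q] by simp
  have uniq: "q' = q" if "?P q'" for q'
  proof -
    have q': "q' \<in> polys m" using that by simp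
    define d where "d = (\<lambda>x. q x - q' x)"
    have d: "d \<in> polys m" unfolding d_def by (rule polys_diff[OF q q'])
    have o: "(LINT x|?M. (w x - q' x) * d x) = 0" using that d eqD[OF q' d] by simp
    have "sqnorm ?M d = (LINT x|?M. (w x - q' x) * d x - (w x - q x) * d x)"
      by (rule Bochner_Integration.integral_cong) (auto simp: d_def power2_eq_square algebra_simps)
    also have "\<dots> = (LINT x|?M. (w x - q' x) * d x) - (LINT x|?M. (w x - q x) * d x)"
      by (intro Bochner_Integration.integral_diff sqint_mult_integrable sqint_diff w sp q q' d)
    finally have "sqnorm ?M d = 0" using o orth[OF d] by simp
    then have zero: "\<forall>x\<in>?U. d x = 0"
      by (rule continuous_sqnorm_zero[OF U(1) smooth_continuous_on[OF polys_smooth[OF d]] sp[OF d]])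
    obtain e where e: "d = (\<lambda>z. \<Sum>t\<in>indices m. e t * monom2 t z)" by (rule polysE[OF d])
    obtain x where x: "x \<in> ?U" using D(3) by blast
    have "e t = 0" if "t \<in> indices m" for t
      by (rule poly_coeff_eq_0[OF U(1) x _ that, of e]) (use zero in \<open>simp add: e\<close>)
    then have "d = (\<lambda>x. 0)" unfolding e by simp
    then show ?thesis unfolding d_def by (metis eq_iff_diff_eq_0 ext)
  qed
  have P: "L2_projection m D w = q"
    unfolding L2_projection_def by (rule the_equality[of ?P, OF Pq uniq])
  show "L2_projection m D w \<in> polys m" unfolding P by (rule q)
  show "(LINT x|?M. (w x - L2_projection m D w x) * p x) = 0" if "p \<in> polys m" for p
    unfolding P by (rule orth[OF that])
qed

text \<open>With \<open>q\<close> the projection and \<open>p\<close> from Bramble-Hilbert, q - w =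
  (q + p) - (w + p). The second term is small in all derivatives. The first is a polynomial, at most
  as large as w + p in L2 by orthogonality, and the inverse inequality passes this to its
  derivatives.\<close>

theorem L2_projection_estimate:
  fixes \<sigma> :: real
  assumes \<sigma>: "\<sigma> > 0"
  obtains K where "K \<ge> 0"
    "\<And>D x\<^sub>0 r w B k. \<lbrakk>convex D; compact D; 0 < r; r \<le> 1; ball x\<^sub>0 r \<subseteq> D; D \<subseteq> cball x\<^sub>0 (\<sigma> * r);
        HN (Suc m) (interior D) B w; k \<le> Suc m\<rbrakk>
      \<Longrightarrow> HN k (interior D) (K * r ^ (2 * (Suc m - k)) * B) (\<lambda>x. L2_projection m D w x - w x)"
proof -
  obtain K0 where K0: "K0 \<ge> 0" and inv: "\<And>q U x\<^sub>0 r i j. \<lbrakk>q \<in> polys m; open U; r > 0; ball x\<^sub>0 r \<subseteq> U; U \<subseteq> cball x\<^sub>0 (\<sigma> * r); i + j \<le> Suc m\<rbrakk>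
      \<Longrightarrow> r ^ (2 * (i + j)) * sqnorm_on U (multi_deriv i j q) \<le> K0 * sqnorm_on U q"
    by (rule inverse_inequality[OF \<sigma>, of m]) (rule that)
  define A where "A = 64 * \<sigma> ^ 4"
  \<comment> \<open>Bounds \<open>A ^ n\<close> for all \<open>n \<le> Suc m\<close>, whether or not
    \<open>A\<close> exceeds 1.\<close>
  define A1 where "A1 = (1 + A) ^ Suc m"
  have A: "A \<ge> 0" "A1 \<ge> 0" by (auto simp: A_def A1_def)
  show ?thesis
  proof (rule that[of "2 * (K0 * A1) + 2 * A1"])
    show "0 \<le> 2 * (K0 * A1) + 2 * A1" using K0 A by simp
    fix D x\<^sub>0 r w B k
    assume D: "convex D" "compact D" and r: "0 < r" "r \<le> 1" and bD: "ball x\<^sub>0 r \<subseteq> D" and Dc: "D \<subseteq> cball x\<^sub>0 (\<sigma> * r)"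
      and w: "HN (Suc m) (interior D) B w" and k: "k \<le> Suc m"
    let ?U = "interior D"
    let ?M = "lebesgue_on ?U"
    have U: "open ?U" "convex ?U" using D(1) by (auto intro: convex_interior)
    have bU: "ball x\<^sub>0 r \<subseteq> ?U" by (rule interior_maximal[OF bD]) simp
    have Uc: "?U \<subseteq> cball x\<^sub>0 (\<sigma> * r)" using Dc interior_subset by blast
    have bdU: "bounded ?U" using Uc bounded_cball bounded_subset by blast
    have ne: "?U \<noteq> {}" using bU r(1) by auto
    note Us = open_sets_lebesgue[OF U(1)]
    have B: "B \<ge> 0" by (rule HN_nonneg[OF w])
    note sw = HN_sqint[OF w]
    define q where "q = L2_projection m D w"
    have q: "q \<in> polys m" and orth: "\<And>p. p \<in> polys m \<Longrightarrow> (LINT x|?M. (w x - q x) * p x) = 0"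
      using L2_projection_characterization[OF D ne sw, where m=m] by (auto simp: q_def)
    obtain p E where p: "p \<in> polys m" and E: "jet (Suc m) ?U E" "E 0 0 = (\<lambda>x. w x + p x)"
      and Eb: "\<And>i j n. i + j + n = Suc m \<Longrightarrow> sqnorm ?M (E i j) \<le> (64 * \<sigma> ^ 4 * r\<^sup>2) ^ n * B"
      by (rule Bramble_Hilbert[OF U r(1) bU \<sigma> Uc w]) (rule that)
    have sp: "sqint ?M f" if "f \<in> polys m" for f by (rule smooth_sqint[OF polys_smooth[OF that] bdU Us])
    define R where "R = r ^ (2 * (Suc m - k))"
    have R: "R \<ge> 0" using r(1) by (simp add: R_def)
    \<comment> \<open>Since \<open>r \<le> 1\<close>, the smallest power of \<open>r\<close>
      decides; it occurs for derivatives of order \<open>k\<close>.\<close>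
    have scale: "(A * r\<^sup>2) ^ n \<le> A1 * R" if "i + j + n = Suc m" "i + j \<le> k" for i j n
    proof -
      have "A ^ n \<le> (1 + A) ^ n" using A by (intro power_mono) auto
      also have "\<dots> \<le> A1" unfolding A1_def using A that(1) by (intro power_increasing) auto
      finally have 1: "A ^ n \<le> A1" .
      have "(r\<^sup>2) ^ n = r ^ (2 * n)" by (simp add: power_mult)
      also have "\<dots> \<le> R" unfolding R_def using r that k by (intro power_decreasing) auto
      finally show ?thesis unfolding power_mult_distrib using 1 A by (intro mult_mono) auto
    qed
    have HE: "HN k ?U (A1 * R * B) (E 0 0)"
    proof (rule jet_imp_HN[OF jet_mono[OF E(1) k]])
      fix i j assume ij: "i + j \<le> k"
      have eq: "i + j + (Suc m - (i + j)) = Suc m" using ij k by simp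
      have "sqnorm ?M (E i j) \<le> (A * r\<^sup>2) ^ (Suc m - (i + j)) * B" using Eb[OF eq] by (simp add: A_def)
      also have "\<dots> \<le> A1 * R * B" by (rule mult_right_mono[OF scale[OF eq ij] B])
      finally show "sqnorm ?M (E i j) \<le> A1 * R * B" .
    qed
    define s where "s = (\<lambda>x. q x + p x)"
    have s: "s \<in> polys m" unfolding s_def by (rule polys_add[OF q p])
    \<comment> \<open>Pythagoras: w + p is the sum of w - q and \<open>s\<close>, which are
      orthogonal because \<open>s\<close> is a polynomial of degree at most
      \<open>m\<close>.\<close>
    have "sqnorm ?M s \<le> sqnorm ?M (E 0 0)"
    proof -
      note i = sqint_mult_integrable[OF sqint_diff[OF sw sp[OF q]] sp[OF s]]
        sqint_integrable[OF sqint_diff[OF sw sp[OF q]]] sqint_integrable[OF sp[OF s]]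
      have "sqnorm ?M (E 0 0) = (LINT x|?M. (w x - q x)\<^sup>2 + 2 * ((w x - q x) * s x) + (s x)\<^sup>2)"
        unfolding E(2) by (rule Bochner_Integration.integral_cong) (auto simp: s_def power2_eq_square algebra_simps)
      also have "\<dots> = sqnorm ?M (\<lambda>x. w x - q x) + 2 * (LINT x|?M. (w x - q x) * s x) + sqnorm ?M s"
        using i by simp
      finally show ?thesis using orth[OF s] by simp
    qed
    also have "\<dots> \<le> (A * r\<^sup>2) ^ Suc m * B" using Eb[of 0 0 "Suc m"] by (simp add: A_def)
    finally have sn: "sqnorm ?M s \<le> (A * r\<^sup>2) ^ Suc m * B" .
    have Hs: "HN k ?U (K0 * (A1 * R * B)) s"
    proof -
      have "HN k ?U (K0 * (A1 * R * B)) (multi_deriv 0 0 s)"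
      proof (rule jet_imp_HN[OF smooth_jet[OF polys_smooth[OF s] U(1) bdU]])
        fix i j assume ij: "i + j \<le> k"
        define n where "n = Suc m - (i + j)"
        have eq: "i + j + n = Suc m" using ij k by (simp add: n_def)
        have "r ^ (2 * (i + j)) * sqnorm ?M (multi_deriv i j s) \<le> K0 * sqnorm ?M s"
          using ij k by (intro inv[OF s U(1) r(1) bU Uc]) auto
        also have "\<dots> \<le> K0 * ((A * r\<^sup>2) ^ Suc m * B)" by (rule mult_left_mono[OF sn K0])
        \<comment> \<open>The inverse inequality costs the factor \<open>r ^ (2 * (i + j))\<close>,
          which is split off from the power of order m + 1 and cancelled; \<open>2 * n\<close>
          powers of \<open>r\<close> remain.\<close>
        also have "(A * r\<^sup>2) ^ Suc m = A ^ Suc m * (r ^ (2 * (i + j)) * r ^ (2 * n))"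
          unfolding eq[symmetric] by (simp add: power_mult_distrib power_add power_mult)
        also have "K0 * (A ^ Suc m * (r ^ (2 * (i + j)) * r ^ (2 * n)) * B) = r ^ (2 * (i + j)) * (K0 * (A ^ Suc m * r ^ (2 * n) * B))"
          by (simp add: mult_ac)
        finally have "sqnorm ?M (multi_deriv i j s) \<le> K0 * (A ^ Suc m * r ^ (2 * n) * B)"
          using r(1) by simp
        also have "\<dots> \<le> K0 * (A1 * R * B)"
        proof (intro mult_left_mono mult_right_mono mult_mono K0 B)
          show "A ^ Suc m \<le> A1" unfolding A1_def using A by (intro power_mono) auto
          show "r ^ (2 * n) \<le> R" unfolding R_def n_def using r ij k by (intro power_decreasing) auto
        qed (use A r in auto)
        finally show "sqnorm ?M (multi_deriv i j s) \<le> K0 * (A1 * R * B)" .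
      qed
      then show ?thesis by simp
    qed
    have "HN k ?U (2 * (K0 * (A1 * R * B)) + 2 * ((-1)\<^sup>2 * (A1 * R * B))) (\<lambda>x. s x + (-1) * E 0 0 x)"
      by (rule HN_add[OF U(1) Hs HN_cmult[OF U(1) HE]])
    moreover have "(\<lambda>x. s x + (-1) * E 0 0 x) = (\<lambda>x. q x - w x)" by (auto simp: s_def E(2))
    ultimately show "HN k ?U ((2 * (K0 * A1) + 2 * A1) * r ^ (2 * (Suc m - k)) * B) (\<lambda>x. L2_projection m D w x - w x)"
      by (simp add: q_def R_def algebra_simps)
  qed
qed

section \<open>Regularity of the Frenet transformation\<close>

text \<open>The qualitative form of \<open>CB\<close>, for the fixed strip around a curve, where the
  size of the bound is irrelevant and sums, products and quotients should compose freely.\<close>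

definition CBx :: "nat \<Rightarrow> plane set \<Rightarrow> (plane \<Rightarrow> real) \<Rightarrow> bool" where
  "CBx k U a \<longleftrightarrow> (\<exists>M\<ge>0. CB k U M a)"

lemma CBxI: "CB k U M a \<Longrightarrow> CBx k U a"
  unfolding CBx_def by (rule exI[of _ "max M 0"]) (auto intro: CB_mono)

lemma CBx_add: "CBx k U a \<Longrightarrow> CBx k U b \<Longrightarrow> CBx k U (\<lambda>x. a x + b x)"
  unfolding CBx_def[of k U a] CBx_def[of k U b] by (elim exE conjE) (rule CBxI, rule CB_add)

lemma CBx_mult: "CBx k U a \<Longrightarrow> CBx k U b \<Longrightarrow> CBx k U (\<lambda>x. a x * b x)"
  unfolding CBx_def[of k U a] CBx_def[of k U b] by (elim exE conjE) (rule CBxI, rule CB_mult)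

lemma CBx_const: "CBx k U (\<lambda>x. c)"
proof -
  have "CB k U M (\<lambda>x. c)" if "\<bar>c\<bar> \<le> M" for M c using that
  proof (induction k arbitrary: c)
    case (Suc k)
    have "C1_on U (\<lambda>x. c) (\<lambda>i x. 0)" by (simp add: C1_on_def)
    moreover have "CB k U M (\<lambda>x. 0)" using Suc by simp
    ultimately show ?case using Suc.prems unfolding CB.simps by (intro conjI ballI exI[of _ "\<lambda>i x. 0"]) auto
  qed simp
  then show ?thesis using CBxI by blast
qed

lemma CBx_cmult: "CBx k U a \<Longrightarrow> CBx k U (\<lambda>x. c * a x)"
  by (intro CBx_mult CBx_const)

lemma CBx_diff: "CBx k U a \<Longrightarrow> CBx k U b \<Longrightarrow> CBx k U (\<lambda>x. a x - b x)"
  using CBx_add[OF _ CBx_cmult[of k U b "-1"]] by simp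

lemma CBx_Suc: "CBx (Suc k) U a \<Longrightarrow> CBx k U a"
  unfolding CBx_def[of "Suc k"] by (elim exE conjE) (rule CBxI, rule CB_Suc)

lemma CBx_SucE:
  assumes "CBx (Suc k) U a"
  obtains a' where "C1_on U a a'" "\<And>i. CBx k U (a' i)"
proof -
  obtain M where M: "M \<ge> 0" "CB (Suc k) U M a" using assms unfolding CBx_def by (elim exE conjE) (rule that)
  then obtain a' where a': "C1_on U a a'" "\<forall>i. CB k U M (a' i)" unfolding CB.simps by (elim exE conjE) (rule that)
  show ?thesis by (rule that[OF a'(1)]) (rule CBxI, rule spec[OF a'(2)])
qed

lemma CBx_SucI:
  assumes "CBx 0 U a" "C1_on U a a'" "\<And>i. CBx k U (a' i)"
  shows "CBx (Suc k) U a"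
proof -
  obtain M where M: "\<forall>x\<in>U. \<bar>a x\<bar> \<le> M" using assms(1) unfolding CBx_def by auto
  have "\<forall>i. \<exists>N\<ge>0. CB k U N (a' i)" using assms(3) by (simp add: CBx_def)
  from choice[OF this] obtain N where "\<forall>i. N i \<ge> 0 \<and> CB k U (N i) (a' i)" by (elim exE) (rule that)
  then have N: "N i \<ge> 0" "CB k U (N i) (a' i)" for i by simp_all
  define L where "L = max M (N 1 + N 2)"
  have "CB k U L (a' i)" for i
    by (rule CB_mono[OF N(2)]) (use N(1)[of 1] N(1)[of 2] exhaust_2[of i] in \<open>auto simp: L_def\<close>)
  then have "CB (Suc k) U L a" unfolding CB.simps using M assms(2) by (force simp: L_def)
  then show ?thesis by (rule CBxI)
qed

lemma CBx_power: "CBx k U a \<Longrightarrow> CBx k U (\<lambda>x. a x ^ n)"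
  by (induction n) (auto intro: CBx_const CBx_mult)

text \<open>The gradient of the reciprocal is a polynomial in the reciprocal and the gradient of
  \<open>a\<close>, so the induction needs the reciprocal only at the preceding order.\<close>

lemma CBx_inverse:
  assumes "CBx k U a" "c > 0" "\<forall>x\<in>U. c \<le> \<bar>a x\<bar>"
  shows "CBx k U (\<lambda>x. inverse (a x))"
proof -
  have nz: "a x \<noteq> 0" if "x \<in> U" for x using assms(2,3) that by fastforce
  have b: "\<bar>inverse (a x)\<bar> \<le> inverse c" if "x \<in> U" for x
    using assms(2,3) that by (auto simp: abs_inverse intro!: le_imp_inverse_le)
  have base: "CBx 0 U (\<lambda>x. inverse (a x))" if "continuous_on U a"
    by (rule CBxI[of _ _ "inverse c"]) (use that b nz in \<open>auto intro: continuous_on_inverse\<close>)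
  show ?thesis using assms(1)
  proof (induction k)
    case 0
    then show ?case using base by (auto simp: CBx_def)
  next
    case (Suc k)
    obtain a' where a': "C1_on U a a'" "\<And>i. CBx k U (a' i)" by (rule CBx_SucE[OF Suc.prems]) (rule that)
    note IH = Suc.IH[OF CBx_Suc[OF Suc.prems]]
    have t: "CBx k U (\<lambda>x. - 1 * ((inverse (a x)) ^ 2 * a' i x))" for i
      by (intro CBx_cmult CBx_mult CBx_power IH a')
    have "has_grad (\<lambda>x. inverse (a x)) (\<lambda>i. - 1 * ((inverse (a x)) ^ 2 * a' i x)) x" if "x \<in> U" for x
    proof -
      have "(inverse has_real_derivative - ((inverse (a x)) ^ 2)) (at (a x))"
        using DERIV_inverse[OF nz[OF that]] by (simp add: power2_eq_square)
      from has_grad_compose_real[where f=a and \<phi>=inverse and a="\<lambda>i. a' i x", OF _ this] show ?thesis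
        using a'(1) that by (simp add: C1_on_def)
    qed
    moreover have "continuous_on U (\<lambda>x. - 1 * ((inverse (a x)) ^ 2 * a' i x))" for i
      using t[of i] unfolding CBx_def by (auto intro: CB_continuous)
    ultimately have "C1_on U (\<lambda>x. inverse (a x)) (\<lambda>i x. - 1 * ((inverse (a x)) ^ 2 * a' i x))"
      by (simp add: C1_on_def)
    then show ?case by (rule CBx_SucI[OF base[OF C1_on_continuous[OF a'(1)]] _ t])
  qed
qed

lemma CBx_inverse_sqrt:
  assumes "CBx k U a" "c > 0" "\<forall>x\<in>U. c \<le> a x"
  shows "CBx k U (\<lambda>x. inverse (sqrt (a x)))"
proof -
  have pos: "a x > 0" if "x \<in> U" for x using assms(2,3) that by fastforce
  have b: "\<bar>inverse (sqrt (a x))\<bar> \<le> inverse (sqrt c)" if "x \<in> U" for x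
    using assms(2,3) that pos[OF that] by (auto intro!: le_imp_inverse_le)
  have base: "CBx 0 U (\<lambda>x. inverse (sqrt (a x)))" if "continuous_on U a"
  proof (rule CBxI[of _ _ "inverse (sqrt c)"])
    have "continuous_on U (\<lambda>x. inverse (sqrt (a x)))"
      using pos by (intro continuous_intros that) force
    then show "CB 0 U (inverse (sqrt c)) (\<lambda>x. inverse (sqrt (a x)))" using b by simp
  qed
  show ?thesis using assms(1)
  proof (induction k)
    case 0
    then show ?case using base by (auto simp: CBx_def)
  next
    case (Suc k)
    obtain a' where a': "C1_on U a a'" "\<And>i. CBx k U (a' i)" by (rule CBx_SucE[OF Suc.prems]) (rule that)
    note IH = Suc.IH[OF CBx_Suc[OF Suc.prems]]
    have t: "CBx k U (\<lambda>x. (- 1/2) * ((inverse (sqrt (a x))) ^ 3 * a' i x))" for i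
      by (intro CBx_cmult CBx_mult CBx_power IH a')
    have "has_grad (\<lambda>x. inverse (sqrt (a x))) (\<lambda>i. (- 1/2) * ((inverse (sqrt (a x))) ^ 3 * a' i x)) x" if "x \<in> U" for x
    proof -
      have "((\<lambda>s. inverse (sqrt s)) has_real_derivative - ((inverse (sqrt (a x)) / 2) * (inverse (sqrt (a x)))\<^sup>2)) (at (a x))"
        using pos[OF that] by (auto intro!: derivative_eq_intros simp: power2_eq_square)
      from has_grad_compose_real[where f=a and \<phi>="\<lambda>s. inverse (sqrt s)" and a="\<lambda>i. a' i x", OF _ this] show ?thesis
        using a'(1) that by (simp add: C1_on_def power2_eq_square power3_eq_cube mult.assoc)
    qed
    moreover have "continuous_on U (\<lambda>x. (- 1/2) * ((inverse (sqrt (a x))) ^ 3 * a' i x))" for i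
      using t[of i] unfolding CBx_def by (auto intro: CB_continuous)
    ultimately have "C1_on U (\<lambda>x. inverse (sqrt (a x))) (\<lambda>i x. (- 1/2) * ((inverse (sqrt (a x))) ^ 3 * a' i x))"
      by (simp add: C1_on_def)
    then show ?case by (rule CBx_SucI[OF base[OF C1_on_continuous[OF a'(1)]] _ t])
  qed
qed

lemma CBx_coord_bounded:
  assumes "\<forall>z\<in>U. \<bar>z $ l\<bar> \<le> M"
  shows "CBx k U (\<lambda>z. z $ l)"
proof -
  have 0: "CBx 0 U (\<lambda>z. z $ l)"
    by (rule CBxI[of _ _ M]) (use assms in \<open>auto intro: continuous_intros\<close>)
  show ?thesis
  proof (cases k)
    case (Suc n)
    have "C1_on U (\<lambda>z. z $ l) (\<lambda>i x. if i = l then 1 else 0)"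
      unfolding C1_on_def using has_grad_coord[of l] by auto
    from CBx_SucI[OF 0 this CBx_const] show ?thesis using Suc by simp
  qed (use 0 in simp)
qed

lemma CBx_of_parameter:
  assumes "\<And>l t. l < k \<Longrightarrow> (\<gamma> l has_real_derivative \<gamma> (Suc l) t) (at t)" "continuous_on UNIV (\<gamma> k)"
    and "\<And>l t. l \<le> k \<Longrightarrow> \<bar>\<gamma> l t\<bar> \<le> M"
  shows "CBx k U (\<lambda>z. \<gamma> 0 (z $ 2))"
  using assms
proof (induction k arbitrary: \<gamma>)
  case 0
  have "continuous_on U (\<lambda>z::plane. \<gamma> 0 (z $ 2))"
    by (rule continuous_on_compose2[OF 0(2)]) (auto intro: continuous_intros)
  then show ?case using 0(3) by (intro CBxI[of _ _ M]) simp
next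
  case (Suc k)
  have IH: "CBx k U (\<lambda>z. \<gamma> (Suc 0) (z $ 2))"
    using Suc.IH[of "\<lambda>l. \<gamma> (Suc l)"] Suc.prems by simp
  have d: "(\<gamma> 0 has_real_derivative \<gamma> (Suc 0) t) (at t)" for t using Suc.prems(1) by simp
  have c0: "continuous_on UNIV (\<gamma> 0)" by (rule DERIV_continuous_on) (rule has_field_derivative_at_within[OF d])
  have "continuous_on U (\<lambda>z::plane. \<gamma> 0 (z $ 2))"
    by (rule continuous_on_compose2[OF c0]) (auto intro: continuous_intros)
  then have 0: "CBx 0 U (\<lambda>z. \<gamma> 0 (z $ 2))" using Suc.prems(3) by (intro CBxI[of _ _ M]) simp
  have t: "CBx k U (\<lambda>z. (if i = 2 then 1 else 0) * \<gamma> (Suc 0) (z $ 2))" for i :: 2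
    by (intro CBx_cmult IH)
  have "has_grad (\<lambda>z. \<gamma> 0 (z $ 2)) (\<lambda>i. (if i = 2 then 1 else 0) * \<gamma> (Suc 0) (z $ 2)) z" for z :: plane
    using has_grad_compose_real[OF has_grad_coord[of 2 z] d] by (simp add: mult.commute)
  moreover have "continuous_on U (\<lambda>z. (if i = 2 then 1 else 0) * \<gamma> (Suc 0) (z $ 2))" for i :: 2
    using t[of i] unfolding CBx_def by (auto intro: CB_continuous)
  ultimately have "C1_on U (\<lambda>z. \<gamma> 0 (z $ 2)) (\<lambda>i z. (if i = 2 then 1 else 0) * \<gamma> (Suc 0) (z $ 2))"
    by (simp add: C1_on_def)
  then show ?case by (rule CBx_SucI[OF 0 _ t])
qed

section \<open>Periodic functions and closed curves\<close>

lemma periodic_int: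
  fixes f :: "real \<Rightarrow> 'a"
  assumes "\<And>t. f (t + L) = f t"
  shows "f (t + of_int n * L) = f t"
proof -
  have nat: "f (t + real n * L) = f t" for n t
  proof (induction n)
    case (Suc n)
    have "f (t + real (Suc n) * L) = f ((t + real n * L) + L)" by (simp add: algebra_simps)
    then show ?case using assms Suc by simp
  qed simp
  show ?thesis
  proof (cases "n \<ge> 0")
    case True
    then show ?thesis using nat[of t "nat n"] by simp
  next
    case False
    then show ?thesis using nat[of "t + of_int n * L" "nat (- n)"] by (simp add: algebra_simps)
  qed
qed

lemma periodic_reduce:
  fixes t L s :: real
  assumes "L > 0"
  obtains n :: int where "s \<le> t + of_int n * L" "t + of_int n * L < s + L"
proof (rule that[of "- \<lfloor>(t - s) / L\<rfloor>"])
  have "of_int \<lfloor>(t - s) / L\<rfloor> * L \<le> t - s" by (rule floor_divide_lower[OF assms])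
  then show "s \<le> t + of_int (- \<lfloor>(t - s) / L\<rfloor>) * L" by simp
  have "t - s < (of_int \<lfloor>(t - s) / L\<rfloor> + 1) * L" by (rule floor_divide_upper[OF assms])
  then show "t + of_int (- \<lfloor>(t - s) / L\<rfloor>) * L < s + L" by (simp add: algebra_simps)
qed

text \<open>The strip of Frenet coordinates is unbounded along the curve, so bounds have to hold on
  the whole line; periodicity reduces them to one compact period.\<close>

lemma periodic_bounded:
  fixes f :: "real \<Rightarrow> real"
  assumes "continuous_on UNIV f" "\<And>t. f (t + L) = f t" "L > 0"
  obtains M where "M > 0" "\<And>t. \<bar>f t\<bar> \<le> M"
proof -
  obtain M where M: "M > 0" "\<And>t. t \<in> {0..L} \<Longrightarrow> \<bar>f t\<bar> \<le> M"
    by (rule continuous_on_compact_abs_bound[OF continuous_on_subset[OF assms(1) subset_UNIV] compact_Icc]) (rule that)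
  have "\<bar>f t\<bar> \<le> M" for t
  proof -
    obtain n where n: "0 \<le> t + of_int n * L" "t + of_int n * L < 0 + L" by (rule periodic_reduce[OF assms(3)])
    then have "\<bar>f (t + of_int n * L)\<bar> \<le> M" using M(2) by simp
    then show ?thesis using periodic_int[where f=f and L=L, OF assms(2)] by simp
  qed
  with M(1) show ?thesis by (rule that)
qed

abbreviation period :: "curve \<Rightarrow> real" where
  "period \<Gamma> \<equiv> xi_e \<Gamma> - xi_s \<Gamma>"

abbreviation xi_shift :: "curve \<Rightarrow> int \<Rightarrow> plane" where
  "xi_shift \<Gamma> n \<equiv> (of_int n * period \<Gamma>) *\<^sub>R axis 2 1"

lemma vderiv_works: "f differentiable (at t) \<Longrightarrow> (f has_vector_derivative vderiv f t) (at t)"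
  unfolding vderiv_def by (rule vector_derivative_works[THEN iffD1])

lemma vderiv_periodic:
  assumes "\<And>t. f (t + L) = f t" "\<And>t. f differentiable (at t)"
  shows "vderiv f (t + L) = vderiv f t"
proof -
  have d: "(f has_vector_derivative vderiv f (t + L)) (at (t + L))"
    by (rule vderiv_works[OF assms(2)])
  have "((f \<circ> (\<lambda>t. t + L)) has_vector_derivative 1 *\<^sub>R vderiv f (t + L)) (at t)"
    by (rule vector_diff_chain_at[where f="\<lambda>t. t + L" and g=f, OF _ d]) (auto intro!: derivative_eq_intros)
  moreover have "f \<circ> (\<lambda>t. t + L) = f" using assms(1) by auto
  ultimately show ?thesis
    using vector_derivative_at[of f "vderiv f (t + L)" t] by (simp add: vderiv_def)
qed

text \<open>The total smoothness n + k is split: \<open>n\<close> derivatives are taken, and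
  \<open>k\<close> remain as bounded derivatives of the result.\<close>

lemma curve_parameter_CBx:
  assumes \<Gamma>: "regular_closed_curve \<Gamma>" "curve_class (n + k) \<Gamma>"
  shows "CBx k U (\<lambda>z. (vderiv ^^ n) (par \<Gamma>) (z $ 2) $ c)"
    and "\<And>t. (vderiv ^^ n) (par \<Gamma>) (t + period \<Gamma>) = (vderiv ^^ n) (par \<Gamma>) t"
    and "continuous_on UNIV ((vderiv ^^ n) (par \<Gamma>))"
proof -
  let ?g = "\<lambda>l. (vderiv ^^ l) (par \<Gamma>)"
  have L: "period \<Gamma> > 0" using \<Gamma>(1) by (simp add: regular_closed_curve_def)
  have diff: "?g l differentiable (at t)" if "l < n + k" for l t using \<Gamma>(2) that by (simp add: curve_class_def)
  have cont: "continuous_on UNIV (?g l)" if "l \<le> n + k" for l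
  proof (cases "l = n + k")
    case True then show ?thesis using \<Gamma>(2) by (simp add: curve_class_def)
  next
    case False
    then show ?thesis using diff[of l] that
      by (intro continuous_at_imp_continuous_on ballI differentiable_imp_continuous_within) auto
  qed
  have per: "l \<le> n + k \<Longrightarrow> ?g l (t + period \<Gamma>) = ?g l t" for l t
  proof (induction l arbitrary: t)
    case 0 then show ?case using \<Gamma>(1) by (simp add: regular_closed_curve_def)
  next
    case (Suc l)
    then show ?case using vderiv_periodic[of "?g l" "period \<Gamma>" t] diff[of l] by simp
  qed
  show "\<And>t. ?g n (t + period \<Gamma>) = ?g n t" using per by simp
  show "continuous_on UNIV (?g n)" using cont by simp
  define \<gamma> where "\<gamma> l t = ?g (n + l) t $ c" for l t
  have d: "(\<gamma> l has_real_derivative \<gamma> (Suc l) t) (at t)" if "l < k" for l t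
  proof -
    have "(?g (n + l) has_vector_derivative ?g (n + Suc l) t) (at t)"
      using vderiv_works[OF diff[of "n + l" t]] that by simp
    then have "((\<lambda>t. ?g (n + l) t $ c) has_vector_derivative ?g (n + Suc l) t $ c) (at t)"
      by (rule bounded_linear.has_vector_derivative[OF bounded_linear_vec_nth])
    then show ?thesis unfolding \<gamma>_def has_real_derivative_iff_has_vector_derivative .
  qed
  have cg: "continuous_on UNIV (\<gamma> l)" if "l \<le> k" for l
    unfolding \<gamma>_def using cont[of "n + l"] that by (intro continuous_intros) simp
  have "\<forall>l. \<exists>M. l \<le> k \<longrightarrow> (\<forall>t. \<bar>\<gamma> l t\<bar> \<le> M)"
  proof
    fix l
    show "\<exists>M. l \<le> k \<longrightarrow> (\<forall>t. \<bar>\<gamma> l t\<bar> \<le> M)"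
    proof (cases "l \<le> k")
      case True
      have "\<gamma> l (t + period \<Gamma>) = \<gamma> l t" for t using per[of "n + l" t] True by (simp add: \<gamma>_def)
      from periodic_bounded[OF cg[OF True] this L] show ?thesis by blast
    qed simp
  qed
  from choice[OF this] obtain N where N: "\<And>l t. l \<le> k \<Longrightarrow> \<bar>\<gamma> l t\<bar> \<le> N l" by blast
  have "\<bar>\<gamma> l t\<bar> \<le> (\<Sum>l\<le>k. N l)" if "l \<le> k" for l t
  proof -
    have "\<bar>\<gamma> l t\<bar> \<le> N l" by (rule N[OF that])
    also have "\<dots> \<le> (\<Sum>l\<le>k. N l)"
      by (rule member_le_sum) (use that N in \<open>auto intro: order_trans[OF abs_ge_zero]\<close>)
    finally show ?thesis .
  qed
  from CBx_of_parameter[OF d cg[OF order_refl] this, of U]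
  show "CBx k U (\<lambda>z. ?g n (z $ 2) $ c)" by (simp add: \<gamma>_def)
qed

section \<open>The Frenet map on an infinite strip\<close>

definition strip :: "real \<Rightarrow> plane set" where
  "strip \<epsilon> = {z. \<bar>z $ 1\<bar> < \<epsilon>}"

lemma strip_open [simp]: "open (strip \<epsilon>)"
proof -
  have "strip \<epsilon> = {z. - \<epsilon> < z $ 1} \<inter> {z. z $ 1 < \<epsilon>}" by (auto simp: strip_def)
  then show ?thesis by (simp add: open_Int open_halfspace_component_lt_cart open_halfspace_component_gt_cart)
qed

lemma strip_convex: "convex (strip \<epsilon>)"
proof -
  have "strip \<epsilon> = {z. - \<epsilon> < z $ 1} \<inter> {z. z $ 1 < \<epsilon>}" by (auto simp: strip_def)
  moreover have "convex {z::plane. - \<epsilon> < z $ 1}" "convex {z::plane. z $ 1 < \<epsilon>}"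
    using convex_halfspace_gt[of "- \<epsilon>" "axis 1 1 :: plane"] convex_halfspace_lt[of "axis 1 1 :: plane" \<epsilon>]
    by (simp_all add: inner_axis inner_commute)
  ultimately show ?thesis by (simp add: convex_Int)
qed

lemma Q_mult: "(Q *v v) $ 1 = v $ 2" "(Q *v v) $ 2 = - v $ 1"
  by (simp_all add: Q_def matrix_vector_mult_def sum_2 vector_2)

text \<open>The speed is written as the root of a sum of squares, so that the rule for inverse
  square roots applies.\<close>

lemma frenet_nth:
  "frenet \<Gamma> z $ 1 = par \<Gamma> (z$2) $ 1 + z$1 * (inverse (sqrt ((vderiv (par \<Gamma>) (z$2) $ 1)\<^sup>2 + (vderiv (par \<Gamma>) (z$2) $ 2)\<^sup>2)) * vderiv (par \<Gamma>) (z$2) $ 2)"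
  "frenet \<Gamma> z $ 2 = par \<Gamma> (z$2) $ 2 - z$1 * (inverse (sqrt ((vderiv (par \<Gamma>) (z$2) $ 1)\<^sup>2 + (vderiv (par \<Gamma>) (z$2) $ 2)\<^sup>2)) * vderiv (par \<Gamma>) (z$2) $ 1)"
  by (simp_all add: frenet_def normal_vec_def Q_mult tangent_def norm_vec_def L2_set_def sum_2)

text \<open>The unit normal is the only nonpolynomial ingredient. It is controlled because the speed
  of a regular periodic curve is bounded away from 0, and it costs one derivative.\<close>

lemma frenet_CBx:
  assumes \<Gamma>: "regular_closed_curve \<Gamma>" "curve_class (Suc k) \<Gamma>"
  shows "CBx k (strip \<epsilon>) (\<lambda>z. frenet \<Gamma> z $ j)"
proof -
  have L: "period \<Gamma> > 0" using \<Gamma>(1) by (simp add: regular_closed_curve_def)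
  let ?g = "vderiv (par \<Gamma>)"
  have g: "CBx k (strip \<epsilon>) (\<lambda>z. ?g (z $ 2) $ c)" for c
    using curve_parameter_CBx(1)[OF \<Gamma>(1), of 1 k] \<Gamma>(2) by simp
  have cg: "continuous_on UNIV ?g" and pg: "\<And>t. ?g (t + period \<Gamma>) = ?g t"
    using curve_parameter_CBx(2,3)[OF \<Gamma>(1), of 1 k] \<Gamma>(2) by simp_all
  have p: "CBx k (strip \<epsilon>) (\<lambda>z. par \<Gamma> (z $ 2) $ c)" for c
    using CBx_Suc[OF curve_parameter_CBx(1)[OF \<Gamma>(1), of 0 "Suc k"]] \<Gamma>(2) by simp
  \<comment> \<open>The squared speed; its minimum over one period is positive and bounds it from
    below on the whole line.\<close>
  define s where "s t = (?g t $ 1)\<^sup>2 + (?g t $ 2)\<^sup>2" for t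
  have "continuous_on {0..period \<Gamma>} s" unfolding s_def
    by (intro continuous_intros) (use cg continuous_on_subset in auto)
  then obtain t0 where t0: "t0 \<in> {0..period \<Gamma>}" "\<And>t. t \<in> {0..period \<Gamma>} \<Longrightarrow> s t0 \<le> s t"
    using continuous_attains_inf[of "{0..period \<Gamma>}" s] L by auto
  have nz: "?g t \<noteq> 0" for t using \<Gamma>(1) by (simp add: regular_closed_curve_def)
  have s0: "s t0 > 0"
  proof -
    have "?g t0 $ 1 \<noteq> 0 \<or> ?g t0 $ 2 \<noteq> 0" using nz[of t0] by (auto simp: vec_eq_iff forall_2)
    then show ?thesis by (auto simp: s_def add_pos_nonneg add_nonneg_pos)
  qed
  have s_ge: "s t0 \<le> s t" for t
  proof -
    obtain n where n: "0 \<le> t + of_int n * period \<Gamma>" "t + of_int n * period \<Gamma> < 0 + period \<Gamma>" by (rule periodic_reduce[OF L])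
    have "s (t + of_int n * period \<Gamma>) = s t" by (rule periodic_int) (simp add: s_def pg)
    then show ?thesis using t0(2)[of "t + of_int n * period \<Gamma>"] n by simp
  qed
  have cs: "CBx k (strip \<epsilon>) (\<lambda>z. (?g (z $ 2) $ 1)\<^sup>2 + (?g (z $ 2) $ 2)\<^sup>2)"
    by (intro CBx_add CBx_power g)
  have r: "CBx k (strip \<epsilon>) (\<lambda>z. inverse (sqrt ((?g (z $ 2) $ 1)\<^sup>2 + (?g (z $ 2) $ 2)\<^sup>2)))"
    by (rule CBx_inverse_sqrt[OF cs s0]) (use s_ge in \<open>auto simp: s_def\<close>)
  have e: "CBx k (strip \<epsilon>) (\<lambda>z. z $ 1)"
    by (rule CBx_coord_bounded[of _ _ \<epsilon>]) (auto simp: strip_def)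
  have "j = 1 \<or> j = 2" using exhaust_2 by auto
  then show ?thesis
    unfolding frenet_nth[abs_def]
    by (elim disjE) (simp_all only: frenet_nth, auto intro!: CBx_add CBx_diff CBx_mult p e r g)
qed

lemma frenet_periodic:
  assumes "regular_closed_curve \<Gamma>"
  shows "frenet \<Gamma> (z + xi_shift \<Gamma> n) = frenet \<Gamma> z"
proof -
  have c2: "curve_class (1 + 1) \<Gamma>" using assms by (simp add: regular_closed_curve_def numeral_2_eq_2)
  have p: "par \<Gamma> (t + of_int n * period \<Gamma>) = par \<Gamma> t" for t
    by (rule periodic_int) (use assms in \<open>simp add: regular_closed_curve_def\<close>)
  have g: "vderiv (par \<Gamma>) (t + of_int n * period \<Gamma>) = vderiv (par \<Gamma>) t" for t
    by (rule periodic_int) (use curve_parameter_CBx(2)[OF assms c2] in simp)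
  show ?thesis
    by (simp add: frenet_def normal_vec_def tangent_def p g axis_def)
qed

lemma CB_jacobian_exists:
  assumes "\<And>j. CBx (Suc m) S (\<lambda>z. \<Phi> z $ j)"
  obtains A M where "has_jacobian S \<Phi> A" "M > 0" "\<And>i j. CB m S M (A i j)"
proof -
  have "\<forall>j. \<exists>a'. C1_on S (\<lambda>z. \<Phi> z $ j) a' \<and> (\<forall>i. CBx m S (a' i))"
  proof
    fix j
    show "\<exists>a'. C1_on S (\<lambda>z. \<Phi> z $ j) a' \<and> (\<forall>i. CBx m S (a' i))"
      by (rule CBx_SucE[OF assms[of j]]) blast
  qed
  from choice[OF this] obtain F where F: "\<And>j. C1_on S (\<lambda>z. \<Phi> z $ j) (F j)" "\<And>j i. CBx m S (F j i)" by blast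
  have "\<forall>p. \<exists>M\<ge>0. CB m S M (F (fst p) (snd p))" using F(2) by (simp add: CBx_def)
  from choice[OF this] obtain N where N: "\<And>p. N p \<ge> 0" "\<And>p. CB m S (N p) (F (fst p) (snd p))" by blast
  define M where "M = (\<Sum>p\<in>UNIV. N p) + 1"
  have "CB m S M (F j i)" for i j
  proof (rule CB_mono)
    show "CB m S (N (j, i)) (F j i)" using N(2)[of "(j, i)"] by simp
    have "N (j, i) \<le> (\<Sum>p\<in>UNIV. N p)" by (rule member_le_sum) (use N(1) in auto)
    then show "N (j, i) \<le> M" by (simp add: M_def)
  qed
  moreover have "M > 0" unfolding M_def using N(1) by (simp add: add_nonneg_pos sum_nonneg)
  moreover have "has_jacobian S \<Phi> (\<lambda>i j. F j i)"
    using F(1) by (auto simp: has_jacobian_def C1_on_def)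
  ultimately show ?thesis using that[of "\<lambda>i j. F j i" M] by blast
qed

text \<open>Adjugate over determinant. For a 2 by 2 matrix the formula has the same shape for the
  transpose, so the index order of \<open>has_jacobian\<close> is respected.\<close>

definition inverse_entry :: "(2 \<Rightarrow> 2 \<Rightarrow> plane \<Rightarrow> real) \<Rightarrow> 2 \<Rightarrow> 2 \<Rightarrow> plane \<Rightarrow> real" where
  "inverse_entry A i j z = inverse (jac A z) * (if i = j then (if i = 1 then A 2 2 z else A 1 1 z) else - A i j z)"

lemma jac_inverse_entry:
  assumes "jac A z \<noteq> 0"
  shows "inverse_entry A 1 1 z * inverse_entry A 2 2 z - inverse_entry A 1 2 z * inverse_entry A 2 1 z = inverse (jac A z)"
proof -
  have "inverse_entry A 1 1 z * inverse_entry A 2 2 z - inverse_entry A 1 2 z * inverse_entry A 2 1 z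
     = inverse (jac A z) * inverse (jac A z) * jac A z"
    by (simp add: inverse_entry_def jac_def algebra_simps)
  then show ?thesis using assms by simp
qed

text \<open>A continuous right inverse is differentiable wherever the derivative of the map at its
  value is invertible. Its Jacobian then has the form of a function of \<open>R x\<close> that the
  composition bound expects.\<close>

lemma branch_has_jacobian:
  assumes A: "has_jacobian S \<Phi> A" and S: "open S" and nz: "\<And>z. z \<in> S \<Longrightarrow> jac A z \<noteq> 0"
    and U: "open U" and R: "continuous_on U R" "\<And>x. x \<in> U \<Longrightarrow> R x \<in> S" "\<And>x. x \<in> U \<Longrightarrow> \<Phi> (R x) = x"
  shows "has_jacobian U R (\<lambda>i j x. inverse_entry A i j (R x))"
proof -
  have der: "(R has_derivative (\<lambda>h. \<chi> j. \<Sum>i\<in>UNIV. inverse_entry A i j (R x) * h $ i)) (at x)" if x: "x \<in> U" for x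
  proof (rule has_derivative_inverse_basic[where f=\<Phi> and T=U])
    show "(\<Phi> has_derivative (\<lambda>h. \<chi> j. \<Sum>i\<in>UNIV. A i j (R x) * h $ i)) (at (R x))"
      by (rule has_jacobian_has_derivative[OF A R(2)[OF x]])
    have "linear (\<lambda>h. \<chi> j. \<Sum>i\<in>UNIV. inverse_entry A i j (R x) * (h::plane) $ i)"
      by (rule linearI) (simp_all add: vec_eq_iff sum.distrib algebra_simps sum_distrib_left)
    then show "bounded_linear (\<lambda>h. \<chi> j. \<Sum>i\<in>UNIV. inverse_entry A i j (R x) * (h::plane) $ i)"
      by (simp add: linear_linear)
    have n: "jac A (R x) \<noteq> 0" by (rule nz[OF R(2)[OF x]])
    show "(\<lambda>h. \<chi> j. \<Sum>i\<in>UNIV. inverse_entry A i j (R x) * h $ i) \<circ> (\<lambda>h. \<chi> j. \<Sum>i\<in>UNIV. A i j (R x) * h $ i) = id"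
    proof
      fix h :: plane
      have 1: "inverse (jac A (R x)) * (jac A (R x) * h $ l) = h $ l" for l using n by simp
      have "((\<lambda>h. \<chi> j. \<Sum>i\<in>UNIV. inverse_entry A i j (R x) * h $ i) \<circ> (\<lambda>h. \<chi> j. \<Sum>i\<in>UNIV. A i j (R x) * h $ i)) h $ l
        = inverse (jac A (R x)) * (jac A (R x) * h $ l)" for l
        using exhaust_2[of l] by (auto simp: sum_2 inverse_entry_def jac_def algebra_simps)
      then show "((\<lambda>h. \<chi> j. \<Sum>i\<in>UNIV. inverse_entry A i j (R x) * h $ i) \<circ> (\<lambda>h. \<chi> j. \<Sum>i\<in>UNIV. A i j (R x) * h $ i)) h = id h"
        by (simp add: vec_eq_iff 1)
    qed
    show "continuous (at x) R" using R(1) U x by (simp add: continuous_on_eq_continuous_at)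
  qed (use U x R(3) in auto)
  have cA: "continuous_on S (A i j)" for i j using A by (simp add: has_jacobian_def)
  have cE: "continuous_on S (inverse_entry A i j)" for i j
  proof -
    have cj: "continuous_on S (\<lambda>z. inverse (jac A z))"
      using nz unfolding jac_def by (intro continuous_intros cA) (auto simp: jac_def)
    show ?thesis unfolding inverse_entry_def[abs_def]
      by (cases "i = j"; cases "i = 1") (auto intro!: continuous_intros cj cA)
  qed
  show ?thesis
    unfolding has_jacobian_def
  proof (intro conjI ballI allI)
    fix x j assume "x \<in> U"
    from der[OF this] show "has_grad (\<lambda>x. R x $ j) (\<lambda>i. inverse_entry A i j (R x)) x"
      by (subst (asm) has_derivative_componentwise_within) (auto simp: Basis_vec_def inner_axis)
  next
    fix i j
    show "continuous_on U (\<lambda>x. inverse_entry A i j (R x))"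
      by (rule continuous_on_compose2[OF cE R(1)]) (use R(2) in auto)
  qed
qed

section \<open>The inverse Frenet transformation\<close>

lemma shift_eq_zero:
  fixes L x y :: real
  assumes L: "L > 0" and "y = x + of_int n * L" "\<bar>y - x\<bar> < L"
  shows "n = 0"
proof -
  have "\<bar>of_int n :: real\<bar> * L < 1 * L" using assms by (simp add: abs_mult)
  then have "\<bar>of_int n :: real\<bar> < 1" by (rule mult_right_less_imp_less) (use L in simp)
  then show ?thesis by linarith
qed

lemma norm_plane_le: "norm (x::plane) \<le> \<bar>x $ 1\<bar> + \<bar>x $ 2\<bar>"
  using norm_le_l1_cart[of x] by (simp add: sum_2)

lemma mean_value_grad:
  assumes S: "convex S" "x \<in> S" "y \<in> S" and f: "C1_on S f f'"
  obtains w where "w \<in> S" "dist x w \<le> dist x y" "f y - f x = (\<Sum>i\<in>UNIV. f' i w * (y - x) $ i)"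
proof -
  have seg: "x + s *\<^sub>R (y - x) \<in> S" if "0 \<le> s" "s \<le> 1" for s
    using convexD_alt[OF S that] by (simp add: algebra_simps)
  have "\<exists>s. 0 < s \<and> s < 1 \<and> f (x + 1 *\<^sub>R (y - x)) - f (x + 0 *\<^sub>R (y - x))
      = (1 - 0) * (\<Sum>i\<in>UNIV. f' i (x + s *\<^sub>R (y - x)) * (y - x) $ i)"
  proof (rule MVT2)
    fix s :: real assume "0 \<le> s" "s \<le> 1"
    then have "has_grad f (\<lambda>i. f' i (x + s *\<^sub>R (y - x))) (x + s *\<^sub>R (y - x))"
      using f seg unfolding C1_on_def by auto
    then show "DERIV (\<lambda>s. f (x + s *\<^sub>R (y - x))) s :> (\<Sum>i\<in>UNIV. f' i (x + s *\<^sub>R (y - x)) * (y - x) $ i)"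
      by (rule line_has_real_derivative)
  qed simp
  then obtain s where s: "0 < s" "s < 1" "f y - f x = (\<Sum>i\<in>UNIV. f' i (x + s *\<^sub>R (y - x)) * (y - x) $ i)"
    by auto
  show ?thesis
  proof (rule that)
    show "x + s *\<^sub>R (y - x) \<in> S" using seg s by simp
    show "dist x (x + s *\<^sub>R (y - x)) \<le> dist x y"
      using s mult_right_mono[of s 1 "norm (y - x)"] by (simp add: dist_norm norm_minus_commute)
  qed (rule s(3))
qed

lemma C1_on_Lipschitz:
  assumes S: "convex S" "x \<in> S" "y \<in> S" and f: "C1_on S f f'" and M: "\<And>i z. z \<in> S \<Longrightarrow> \<bar>f' i z\<bar> \<le> M"
  shows "\<bar>f y - f x\<bar> \<le> 2 * M * dist x y"
proof -
  obtain w where w: "w \<in> S" "f y - f x = (\<Sum>i\<in>UNIV. f' i w * (y - x) $ i)"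
    by (rule mean_value_grad[OF S f]) (rule that)
  have "\<bar>f' i w * (y - x) $ i\<bar> \<le> M * dist x y" for i
    unfolding abs_mult dist_norm norm_minus_commute[of x y] using M[OF w(1)] component_le_norm_cart[of "y - x" i]
    by (intro mult_mono) (auto intro: order_trans[OF abs_ge_zero])
  from this[of 1] this[of 2] show ?thesis
    unfolding w(2) sum_2 using abs_triangle_ineq[of "f' 1 w * (y - x) $ 1" "f' 2 w * (y - x) $ 2"] by simp
qed

text \<open>Cramer's rule. The two equations may come from different intermediate points, so the
  matrix need not be the Jacobian at any one point.\<close>

lemma two_by_two_bound:
  fixes p q r s v w a b M c :: real
  assumes "a = p * v + q * w" "b = r * v + s * w" "\<bar>p * s - q * r\<bar> \<ge> c" "c > 0"
    and "\<bar>p\<bar> \<le> M" "\<bar>q\<bar> \<le> M" "\<bar>r\<bar> \<le> M" "\<bar>s\<bar> \<le> M"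
  shows "\<bar>v\<bar> + \<bar>w\<bar> \<le> 2 * M / c * (\<bar>a\<bar> + \<bar>b\<bar>)"
proof -
  have v: "(p * s - q * r) * v = s * a - q * b" and w: "(p * s - q * r) * w = p * b - r * a"
    unfolding assms by (simp_all add: algebra_simps)
  have "c * \<bar>v\<bar> \<le> \<bar>p * s - q * r\<bar> * \<bar>v\<bar>" using assms by (intro mult_right_mono) auto
  also have "\<dots> \<le> \<bar>s\<bar> * \<bar>a\<bar> + \<bar>q\<bar> * \<bar>b\<bar>"
    using arg_cong[OF v, of abs] abs_triangle_ineq4[of "s * a" "q * b"] by (simp add: abs_mult)
  also have "\<dots> \<le> M * \<bar>a\<bar> + M * \<bar>b\<bar>" using assms by (intro add_mono mult_right_mono) auto
  finally have 1: "c * \<bar>v\<bar> \<le> M * (\<bar>a\<bar> + \<bar>b\<bar>)" by (simp add: algebra_simps)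
  have "c * \<bar>w\<bar> \<le> \<bar>p * s - q * r\<bar> * \<bar>w\<bar>" using assms by (intro mult_right_mono) auto
  also have "\<dots> \<le> \<bar>p\<bar> * \<bar>b\<bar> + \<bar>r\<bar> * \<bar>a\<bar>"
    using arg_cong[OF w, of abs] abs_triangle_ineq4[of "p * b" "r * a"] by (simp add: abs_mult)
  also have "\<dots> \<le> M * \<bar>b\<bar> + M * \<bar>a\<bar>" using assms by (intro add_mono mult_right_mono) auto
  finally have "c * \<bar>w\<bar> \<le> M * (\<bar>a\<bar> + \<bar>b\<bar>)" by (simp add: algebra_simps)
  with 1 have "c * (\<bar>v\<bar> + \<bar>w\<bar>) \<le> 2 * M * (\<bar>a\<bar> + \<bar>b\<bar>)" by (simp add: algebra_simps)
  then show ?thesis using assms(4) by (simp add: field_simps)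
qed

text \<open>The mean value theorem for each component gives a linear system whose rows are gradients
  at two points near \<open>z\<close>; its determinant stays close to the Jacobian at
  \<open>z\<close>.\<close>

lemma local_inverse_Lipschitz:
  assumes S: "convex S" and A: "has_jacobian S \<Phi> A" and M: "M > 0" "\<And>i j. CB 1 S M (A i j)"
    and c: "c > 0" "\<And>z. z \<in> S \<Longrightarrow> c \<le> \<bar>jac A z\<bar>"
    and z: "z \<in> S" "z' \<in> S" "dist z z' \<le> c / (16 * M\<^sup>2)"
  shows "dist z z' \<le> 8 * M / c * dist (\<Phi> z) (\<Phi> z')"
proof -
  have C: "C1_on S (\<lambda>x. \<Phi> x $ j) (\<lambda>i. A i j)" for j
    using A unfolding has_jacobian_def C1_on_def by simp
  have b: "\<bar>A i j x\<bar> \<le> M" if "x \<in> S" for i j x using CB_bound[OF M(2) that] .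
  have lip: "\<bar>A i j y - A i j x\<bar> \<le> 2 * M * dist x y" if "x \<in> S" "y \<in> S" for i j x y
  proof -
    from M(2)[of i j] obtain a' where a': "C1_on S (A i j) a'" "\<And>i. CB 0 S M (a' i)" by auto
    show ?thesis by (rule C1_on_Lipschitz[OF S that a'(1)]) (use CB_bound[OF a'(2)] in auto)
  qed
  obtain u where u: "u \<in> S" "dist z u \<le> dist z z'" "\<Phi> z' $ 1 - \<Phi> z $ 1 = (\<Sum>i\<in>UNIV. A i 1 u * (z' - z) $ i)"
    by (rule mean_value_grad[OF S z(1,2) C[of 1]]) (rule that)
  obtain v where v: "v \<in> S" "dist z v \<le> dist z z'" "\<Phi> z' $ 2 - \<Phi> z $ 2 = (\<Sum>i\<in>UNIV. A i 2 v * (z' - z) $ i)"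
    by (rule mean_value_grad[OF S z(1,2) C[of 2]]) (rule that)
  \<comment> \<open>Within distance c / (16 M^2) an entry moves by at most c / (8 M), a product of
    two entries by c / 4, and the determinant by c / 2, which leaves at least c / 2 of it.\<close>
  have l: "\<bar>A i j x - A i j z\<bar> \<le> c / (8 * M)" if x: "x \<in> S" "dist z x \<le> dist z z'" for i j x
  proof -
    have "\<bar>A i j x - A i j z\<bar> \<le> 2 * M * (c / (16 * M\<^sup>2))"
      using lip[OF z(1) x(1), of i j] mult_left_mono[of "dist z x" "c / (16 * M\<^sup>2)" "2 * M"] x(2) z(3) M(1) by linarith
    also have "\<dots> = c / (8 * M)" using M(1) by (simp add: power2_eq_square)
    finally show ?thesis .
  qed
  have prod: "\<bar>A i j u * A k l v - A i j z * A k l z\<bar> \<le> c / 4" for i j k l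
  proof -
    have "A i j u * A k l v - A i j z * A k l z = A i j u * (A k l v - A k l z) + A k l z * (A i j u - A i j z)"
      by (simp add: algebra_simps)
    then have "\<bar>A i j u * A k l v - A i j z * A k l z\<bar> \<le> \<bar>A i j u\<bar> * \<bar>A k l v - A k l z\<bar> + \<bar>A k l z\<bar> * \<bar>A i j u - A i j z\<bar>"
      unfolding abs_mult[symmetric] by linarith
    also have "\<dots> \<le> M * (c / (8 * M)) + M * (c / (8 * M))"
      by (intro add_mono mult_mono b l u v z) (use M in auto)
    also have "\<dots> = c / 4" using M by (simp add: field_simps)
    finally show ?thesis .
  qed
  have "c \<le> \<bar>jac A z\<bar>" by (rule c(2)[OF z(1)])
  then have d: "c / 2 \<le> \<bar>A 1 1 u * A 2 2 v - A 2 1 u * A 1 2 v\<bar>"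
    using prod[of 1 1 2 2] prod[of 2 1 1 2] unfolding jac_def by (simp add: abs_if mult.commute split: if_splits)
  have "\<bar>(z' - z) $ 1\<bar> + \<bar>(z' - z) $ 2\<bar> \<le> 2 * M / (c / 2) * (\<bar>\<Phi> z' $ 1 - \<Phi> z $ 1\<bar> + \<bar>\<Phi> z' $ 2 - \<Phi> z $ 2\<bar>)"
    by (rule two_by_two_bound[OF _ _ d]) (use u v b c in \<open>simp_all add: sum_2\<close>)
  also have "\<dots> \<le> 2 * M / (c / 2) * (2 * dist (\<Phi> z) (\<Phi> z'))"
    using component_le_norm_cart[of "\<Phi> z' - \<Phi> z" 1] component_le_norm_cart[of "\<Phi> z' - \<Phi> z" 2] M c
    by (intro mult_left_mono) (simp_all add: dist_norm norm_minus_commute)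
  finally have "\<bar>(z' - z) $ 1\<bar> + \<bar>(z' - z) $ 2\<bar> \<le> 8 * M / c * dist (\<Phi> z) (\<Phi> z')" by simp
  then show ?thesis using norm_plane_le[of "z' - z"] by (simp only: dist_norm norm_minus_commute[of z z'])
qed

section \<open>The Frenet chart and its inverse modulo the period\<close>

locale frenet_chart =
  fixes \<Gamma> :: curve and \<epsilon> :: real and m :: nat and A :: "2 \<Rightarrow> 2 \<Rightarrow> plane \<Rightarrow> real" and M c C :: real
  assumes curve: "regular_closed_curve \<Gamma>" and regular: "frenet_regular \<Gamma> \<epsilon>" and eps: "\<epsilon> > 0" and m: "m \<ge> 1"
    and jacobian: "has_jacobian (strip \<epsilon>) (frenet \<Gamma>) A" and M: "M > 0"
    and CB_entry: "CB m (strip \<epsilon>) M (A i j)"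
    and c: "c > 0" and jac_ge: "z \<in> strip \<epsilon> \<Longrightarrow> c \<le> \<bar>jac A z\<bar>" and jac_le: "z \<in> strip \<epsilon> \<Longrightarrow> \<bar>jac A z\<bar> \<le> C"

text \<open>Class m + 2 gives Frenet components with m + 1 bounded derivatives and hence Jacobian
  entries with \<open>m\<close>. The bounds on the determinant are read off from the assumed bounds
  on the Frechet derivative.\<close>

lemma frenet_chart_exists:
  assumes \<Gamma>: "regular_closed_curve \<Gamma>" "curve_class (m + 2) \<Gamma>" "frenet_regular \<Gamma> \<epsilon>" and "\<epsilon> > 0" "m \<ge> 1"
  obtains A M c C where "frenet_chart \<Gamma> \<epsilon> m A M c C"
proof -
  have cl: "curve_class (Suc (Suc m)) \<Gamma>" using \<Gamma>(2) by simp
  obtain A M where A: "has_jacobian (strip \<epsilon>) (frenet \<Gamma>) A" "M > 0" "\<And>i j. CB m (strip \<epsilon>) M (A i j)"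
    by (rule CB_jacobian_exists[OF frenet_CBx[OF \<Gamma>(1) cl]]) (rule that)
  obtain c C where c: "c > 0" "\<And>z. \<bar>z$1\<bar> \<le> \<epsilon> \<Longrightarrow> bounded_diffeo_at c C (frenet \<Gamma>) z"
    using \<Gamma>(3) unfolding frenet_regular_def by (elim conjE exE) (rule that, auto)
  have det: "det (matrix (frechet_derivative (frenet \<Gamma>) (at z))) = jac A z" if z: "z \<in> strip \<epsilon>" for z
    using frechet_derivative_at[OF has_jacobian_has_derivative[OF A(1) z]] det_jacobian[of A z] by metis
  have b: "c \<le> \<bar>jac A z\<bar> \<and> \<bar>jac A z\<bar> \<le> C" if z: "z \<in> strip \<epsilon>" for z
    using c(2)[of z] z unfolding bounded_diffeo_at_def det[OF z] strip_def by simp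
  show ?thesis
    by (rule that[of A M c C], unfold_locales) (use assms A c(1) b in auto)
qed

context frenet_chart
begin

lemma period_pos: "period \<Gamma> > 0"
  using curve unfolding regular_closed_curve_def by simp

lemma entry_bound: "z \<in> strip \<epsilon> \<Longrightarrow> \<bar>A i j z\<bar> \<le> M"
  by (rule CB_bound[OF CB_entry])

lemma frenet_shift: "frenet \<Gamma> (z + xi_shift \<Gamma> n) = frenet \<Gamma> z"
  by (rule frenet_periodic[OF curve])

text \<open>Both points are shifted into one half-open period, where the Frenet map is injective by
  hypothesis.\<close>

lemma frenet_eq_imp_shift:
  assumes z: "\<bar>z $ 1\<bar> \<le> \<epsilon>" "\<bar>z' $ 1\<bar> \<le> \<epsilon>" and eq: "frenet \<Gamma> z = frenet \<Gamma> z'"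
  obtains n :: int where "z' = z + xi_shift \<Gamma> n"
proof -
  obtain k :: int where k: "xi_s \<Gamma> \<le> z $ 2 + of_int k * period \<Gamma>" "z $ 2 + of_int k * period \<Gamma> < xi_s \<Gamma> + period \<Gamma>"
    by (rule periodic_reduce[OF period_pos])
  obtain l :: int where l: "xi_s \<Gamma> \<le> z' $ 2 + of_int l * period \<Gamma>" "z' $ 2 + of_int l * period \<Gamma> < xi_s \<Gamma> + period \<Gamma>"
    by (rule periodic_reduce[OF period_pos])
  have inj: "inj_on (frenet \<Gamma>) {z. \<bar>z$1\<bar> \<le> \<epsilon> \<and> z$2 \<in> {xi_s \<Gamma>..<xi_e \<Gamma>}}"
    using regular unfolding frenet_regular_def bij_betw_def by simp
  have "z + xi_shift \<Gamma> k = z' + xi_shift \<Gamma> l"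
    by (rule inj_onD[OF inj]) (use z k l eq frenet_shift in \<open>simp_all add: axis_def\<close>)
  then have "z' = z + xi_shift \<Gamma> (k - l)" by (simp add: algebra_simps)
  then show ?thesis by (rule that)
qed

lemma frenet_Lipschitz:
  assumes z: "z \<in> strip \<epsilon>" "z' \<in> strip \<epsilon>"
  shows "dist (frenet \<Gamma> z) (frenet \<Gamma> z') \<le> 4 * M * dist z z'"
proof -
  have "\<bar>frenet \<Gamma> z' $ j - frenet \<Gamma> z $ j\<bar> \<le> 2 * M * dist z z'" for j
    by (rule C1_on_Lipschitz[OF strip_convex z, where f'="\<lambda>i. A i j"])
      (use jacobian entry_bound in \<open>auto simp: has_jacobian_def C1_on_def\<close>)
  from this[of 1] this[of 2] show ?thesis
    using norm_plane_le[of "frenet \<Gamma> z' - frenet \<Gamma> z"] by (simp add: dist_norm norm_minus_commute)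
qed

lemma frenet_continuous: "continuous_on (strip \<epsilon>) (frenet \<Gamma>)"
  by (rule has_jacobian_continuous[OF jacobian])

text \<open>Compactness: on pairs from a closed one-period rectangle that stay \<rho>-apart modulo
  the period, the distance of the images has a positive minimum. The factor 1/2 on \<epsilon> puts
  the closed rectangle inside the open strip.\<close>

lemma frenet_close_imp_shift_close:
  assumes \<rho>: "\<rho> > 0"
  obtains \<delta> where "\<delta> > 0" "\<And>z z'. \<bar>z $ 1\<bar> \<le> \<epsilon> / 2 \<Longrightarrow> \<bar>z' $ 1\<bar> \<le> \<epsilon> / 2 \<Longrightarrow> dist (frenet \<Gamma> z) (frenet \<Gamma> z') < \<delta>
    \<Longrightarrow> \<exists>n::int. dist z (z' + xi_shift \<Gamma> n) < \<rho>"
proof -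
  define B :: "plane set" where "B = cbox (vector [-(\<epsilon> / 2), xi_s \<Gamma>]) (vector [\<epsilon> / 2, xi_e \<Gamma>])"
  have B: "z \<in> B \<longleftrightarrow> \<bar>z $ 1\<bar> \<le> \<epsilon> / 2 \<and> xi_s \<Gamma> \<le> z $ 2 \<and> z $ 2 \<le> xi_e \<Gamma>" for z
    unfolding B_def mem_cbox_2 by auto
  have Bs: "B \<subseteq> strip \<epsilon>" using eps by (auto simp: B strip_def)
  \<comment> \<open>Two points of one closed period have second coordinates at most a period apart,
    so equal images can arise only from the shifts -1, 0 and 1.\<close>
  define F where "F = (B \<times> B) \<inter> (\<Inter>n\<in>{-1, 0, 1 :: int}. {p. \<rho> \<le> dist (fst p) (snd p + xi_shift \<Gamma> n)})"
  have cl: "closed {p. \<rho> \<le> dist (fst p) (snd p + xi_shift \<Gamma> n)}" for n :: int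
    by (intro closed_Collect_le continuous_intros)
  have F: "compact F"
    unfolding F_def by (intro compact_Int_closed compact_Times closed_INT ballI cl) (auto simp: B_def)
  have cont: "continuous_on F (\<lambda>p. dist (frenet \<Gamma> (fst p)) (frenet \<Gamma> (snd p)))"
    by (intro continuous_intros continuous_on_compose2[OF frenet_continuous]) (use Bs in \<open>auto simp: F_def\<close>)
  have pos: "dist (frenet \<Gamma> (fst p)) (frenet \<Gamma> (snd p)) > 0" if p: "p \<in> F" for p
  proof (rule ccontr)
    assume "\<not> ?thesis"
    then have eq: "frenet \<Gamma> (snd p) = frenet \<Gamma> (fst p)" by simp
    have mem: "fst p \<in> B" "snd p \<in> B" using p by (auto simp: F_def)
    obtain n where n: "fst p = snd p + xi_shift \<Gamma> n"
      by (rule frenet_eq_imp_shift[OF _ _ eq]) (use mem eps in \<open>auto simp: B\<close>)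
    have "fst p $ 2 = snd p $ 2 + of_int n * period \<Gamma>" by (subst n) (simp add: axis_def)
    then have "\<bar>of_int n * period \<Gamma>\<bar> \<le> period \<Gamma>" using mem unfolding B by auto
    then have "\<bar>of_int n :: real\<bar> \<le> 1" using period_pos by (simp add: abs_mult)
    then have "n \<in> {-1, 0, 1}" by auto
    then have "\<rho> \<le> dist (fst p) (snd p + xi_shift \<Gamma> n)" using p unfolding F_def by blast
    then show False using \<rho> n by simp
  qed
  obtain \<delta> where \<delta>: "\<delta> > 0" "\<And>p. p \<in> F \<Longrightarrow> \<delta> \<le> dist (frenet \<Gamma> (fst p)) (frenet \<Gamma> (snd p))"
  proof (cases "F = {}")
    case True
    then show ?thesis using that[of 1] by simp
  next
    case False
    from continuous_attains_inf[OF F False cont] show ?thesis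
      using pos by (elim bexE) (rule that, auto)
  qed
  show ?thesis
  proof (rule that[OF \<delta>(1)])
    fix z z' :: plane assume z: "\<bar>z $ 1\<bar> \<le> \<epsilon> / 2" "\<bar>z' $ 1\<bar> \<le> \<epsilon> / 2" and d: "dist (frenet \<Gamma> z) (frenet \<Gamma> z') < \<delta>"
    obtain k :: int where k: "xi_s \<Gamma> \<le> z $ 2 + of_int k * period \<Gamma>" "z $ 2 + of_int k * period \<Gamma> < xi_s \<Gamma> + period \<Gamma>"
      by (rule periodic_reduce[OF period_pos])
    obtain l :: int where l: "xi_s \<Gamma> \<le> z' $ 2 + of_int l * period \<Gamma>" "z' $ 2 + of_int l * period \<Gamma> < xi_s \<Gamma> + period \<Gamma>"
      by (rule periodic_reduce[OF period_pos])
    define p where "p = (z + xi_shift \<Gamma> k, z' + xi_shift \<Gamma> l)"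
    have "p \<notin> F" using \<delta>(2)[of p] d unfolding p_def fst_conv snd_conv frenet_shift by auto
    moreover have "p \<in> B \<times> B" using z k l by (simp add: p_def B axis_def)
    ultimately have "\<exists>n\<in>{-1, 0, 1 :: int}. \<not> \<rho> \<le> dist (fst p) (snd p + xi_shift \<Gamma> n)"
      unfolding F_def by blast
    then obtain n :: int where n: "dist (fst p) (snd p + xi_shift \<Gamma> n) < \<rho>"
      unfolding not_le by (elim bexE) (rule that)
    have "dist z (z' + xi_shift \<Gamma> (l + n - k)) = dist (fst p) (snd p + xi_shift \<Gamma> n)"
      by (simp add: p_def dist_norm algebra_simps)
    then show "\<exists>n::int. dist z (z' + xi_shift \<Gamma> n) < \<rho>" using n by (intro exI[of _ "l + n - k"]) simp
  qed
qed

lemma frenet_inverse_Lipschitz: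
  obtains \<delta> where "\<delta> > 0" "\<And>z z'. \<bar>z $ 1\<bar> \<le> \<epsilon> / 2 \<Longrightarrow> \<bar>z' $ 1\<bar> \<le> \<epsilon> / 2 \<Longrightarrow> dist (frenet \<Gamma> z) (frenet \<Gamma> z') < \<delta>
    \<Longrightarrow> \<exists>n::int. dist z (z' + xi_shift \<Gamma> n) < period \<Gamma> / 4 \<and>
          dist z (z' + xi_shift \<Gamma> n) \<le> 8 * M / c * dist (frenet \<Gamma> z) (frenet \<Gamma> z')"
proof -
  \<comment> \<open>The first bound is the range of the local inverse estimate; a quarter of the
    period separates the possible shifts.\<close>
  have \<rho>: "min (c / (16 * M\<^sup>2)) (period \<Gamma> / 4) > 0" using c M period_pos by simp
  obtain \<delta> where \<delta>: "\<delta> > 0" "\<And>z z'. \<bar>z $ 1\<bar> \<le> \<epsilon> / 2 \<Longrightarrow> \<bar>z' $ 1\<bar> \<le> \<epsilon> / 2 \<Longrightarrow> dist (frenet \<Gamma> z) (frenet \<Gamma> z') < \<delta>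
    \<Longrightarrow> \<exists>n::int. dist z (z' + xi_shift \<Gamma> n) < min (c / (16 * M\<^sup>2)) (period \<Gamma> / 4)"
    by (rule frenet_close_imp_shift_close[OF \<rho>]) (rule that)
  show ?thesis
  proof (rule that[OF \<delta>(1)])
    fix z z' :: plane assume z: "\<bar>z $ 1\<bar> \<le> \<epsilon> / 2" "\<bar>z' $ 1\<bar> \<le> \<epsilon> / 2" and d: "dist (frenet \<Gamma> z) (frenet \<Gamma> z') < \<delta>"
    obtain n :: int where n: "dist z (z' + xi_shift \<Gamma> n) < min (c / (16 * M\<^sup>2)) (period \<Gamma> / 4)"
      using \<delta>(2)[OF z d] by (rule exE)
    have "dist z (z' + xi_shift \<Gamma> n) \<le> 8 * M / c * dist (frenet \<Gamma> z) (frenet \<Gamma> (z' + xi_shift \<Gamma> n))"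
    proof (rule local_inverse_Lipschitz[OF strip_convex jacobian M _ c jac_ge])
      show "CB 1 (strip \<epsilon>) M (A i j)" for i j by (rule CB_mono_order[OF CB_entry m])
      show "z \<in> strip \<epsilon>" "z' + xi_shift \<Gamma> n \<in> strip \<epsilon>"
        using z eps by (simp_all add: strip_def axis_def)
    qed (use n in auto)
    then show "\<exists>n::int. dist z (z' + xi_shift \<Gamma> n) < period \<Gamma> / 4 \<and>
          dist z (z' + xi_shift \<Gamma> n) \<le> 8 * M / c * dist (frenet \<Gamma> z) (frenet \<Gamma> z')"
      using n unfolding frenet_shift by (intro exI[of _ n]) simp
  qed
qed

text \<open>Named so that one \<delta>, fixed for the curve, can be a parameter in the setting of a
  single element.\<close>

definition close_inverse :: "real \<Rightarrow> bool" where
  "close_inverse \<delta> \<longleftrightarrow> \<delta> > 0 \<and> (\<forall>z z'. \<bar>z $ 1\<bar> \<le> \<epsilon> / 2 \<and> \<bar>z' $ 1\<bar> \<le> \<epsilon> / 2 \<and> dist (frenet \<Gamma> z) (frenet \<Gamma> z') < \<delta> \<longrightarrow>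
    (\<exists>n::int. dist z (z' + xi_shift \<Gamma> n) < period \<Gamma> / 4 \<and>
          dist z (z' + xi_shift \<Gamma> n) \<le> 8 * M / c * dist (frenet \<Gamma> z) (frenet \<Gamma> z')))"

lemma close_inverse_exists: obtains \<delta> where "close_inverse \<delta>"
  by (rule frenet_inverse_Lipschitz) (rule that, auto simp: close_inverse_def)

lemma branch_Lipschitz:
  assumes \<delta>: "close_inverse \<delta>" and K: "connected K" "continuous_on K R"
    and R: "\<And>x. x \<in> K \<Longrightarrow> \<bar>R x $ 1\<bar> \<le> \<epsilon> / 2" "\<And>x. x \<in> K \<Longrightarrow> frenet \<Gamma> (R x) = x"
    and close: "\<And>x y. x \<in> K \<Longrightarrow> y \<in> K \<Longrightarrow> dist x y < \<delta>" and x: "x \<in> K" "y \<in> K"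
  shows "dist (R x) (R y) \<le> 8 * M / c * dist x y" "dist (R x) (R y) < period \<Gamma> / 4"
proof -
  have ex: "\<exists>n::int. dist (R y) (R x + xi_shift \<Gamma> n) < period \<Gamma> / 4 \<and>
          dist (R y) (R x + xi_shift \<Gamma> n) \<le> 8 * M / c * dist x y" if y: "y \<in> K" for y
    using \<delta> R(1)[OF x(1)] R(1)[OF y] close[OF y x(1)] unfolding close_inverse_def
    by (elim conjE allE[of _ "R y"] allE[of _ "R x"]) (simp add: R(2)[OF x(1)] R(2)[OF y] dist_commute[of y x])
  then have "\<forall>y\<in>K. \<exists>n::int. dist (R y) (R x + xi_shift \<Gamma> n) < period \<Gamma> / 4 \<and>
          dist (R y) (R x + xi_shift \<Gamma> n) \<le> 8 * M / c * dist x y" by (rule ballI)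
  from bchoice[OF this] obtain n :: "plane \<Rightarrow> int" where n': "\<forall>y\<in>K. dist (R y) (R x + xi_shift \<Gamma> (n y)) < period \<Gamma> / 4 \<and>
          dist (R y) (R x + xi_shift \<Gamma> (n y)) \<le> 8 * M / c * dist x y"
    by (elim exE) (rule that)
  note n = conjunct1[OF bspec[OF n']] conjunct2[OF bspec[OF n']]
  \<comment> \<open>The displacement along the curve from \<open>x\<close>, in periods;
    \<open>n y\<close> is the integer near it.\<close>
  define g where "g = (\<lambda>y. (R y $ 2 - R x $ 2) / period \<Gamma>)"
  have g: "\<bar>g y - of_int (n y)\<bar> < 1 / 4" if "y \<in> K" for y
  proof -
    have "\<bar>R y $ 2 - (R x $ 2 + of_int (n y) * period \<Gamma>)\<bar> < period \<Gamma> / 4"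
      using n(1)[OF that] component_le_norm_cart[of "R y - (R x + xi_shift \<Gamma> (n y))" 2]
      by (simp add: dist_norm axis_def)
    moreover have "R y $ 2 - (R x $ 2 + of_int (n y) * period \<Gamma>) = (g y - of_int (n y)) * period \<Gamma>"
      unfolding g_def using period_pos by (simp add: field_simps)
    ultimately have "\<bar>g y - of_int (n y)\<bar> * period \<Gamma> < 1 / 4 * period \<Gamma>" using period_pos by (simp add: abs_mult)
    then show ?thesis by (rule mult_right_less_imp_less) (use period_pos in simp)
  qed
  have cg: "connected (g ` K)"
    unfolding g_def by (intro connected_continuous_image K continuous_intros) (use period_pos in auto)
  \<comment> \<open>The connected set \<open>g ` K\<close> contains 0 and stays within 1/4 of the integers.\<close>
  have small: "\<bar>g y\<bar> < 1 / 2" if y: "y \<in> K" for y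
  proof (rule ccontr)
    assume "\<not> ?thesis"
    then have "1 / 2 \<le> \<bar>g y\<bar>" by simp
    moreover have g0: "0 \<in> g ` K" using x(1) by (intro image_eqI[of _ _ x]) (simp_all add: g_def)
    moreover have gy: "g y \<in> g ` K" using y by simp
    ultimately have "1 / 2 \<in> g ` K \<or> - (1 / 2) \<in> g ` K"
      using connectedD_interval[OF cg g0 gy, of "1 / 2"] connectedD_interval[OF cg gy g0, of "- (1 / 2)"] by linarith
    then obtain w where w: "w \<in> K" "g w = 1 / 2 \<or> g w = - (1 / 2)" by auto
    have "(-1 :: real) / 4 < g w - of_int (n w)" "g w - of_int (n w) < 1 / 4"
      using g[OF w(1)] unfolding abs_less_iff by simp_all
    then have "0 < real_of_int (n w) \<and> real_of_int (n w) < 1 \<or> -1 < real_of_int (n w) \<and> real_of_int (n w) < 0"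
      using w(2) by (elim disjE) simp_all
    then have "0 < n w \<and> n w < 1 \<or> -1 < n w \<and> n w < 0" by linarith
    then show False by presburger
  qed
  have "n y = 0" using g[OF x(2)] small[OF x(2)] by linarith
  then show "dist (R x) (R y) \<le> 8 * M / c * dist x y" "dist (R x) (R y) < period \<Gamma> / 4"
    using n[OF x(2)] by (simp_all add: dist_commute)
qed

end

section \<open>Half rectangles and curved elements\<close>

definition fict_rect :: "real \<Rightarrow> real \<Rightarrow> real \<Rightarrow> real \<Rightarrow> plane set" where
  "fict_rect d a b s = {z. \<bar>z$1\<bar> \<le> d \<and> z$2 \<in> {a..b} \<and> 0 \<le> s * z$1}"

lemma fict_rect_cbox:
  assumes "s \<in> {1, -1}" "d \<ge> 0"
  shows "fict_rect d a b s = cbox (vector [min 0 (s * d), a]) (vector [max 0 (s * d), b])"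
  using assms by (auto simp: fict_rect_def mem_cbox_2)

lemma fict_rect_compact_convex:
  assumes "s \<in> {1, -1}" "d \<ge> 0"
  shows "compact (fict_rect d a b s)" "convex (fict_rect d a b s)"
  unfolding fict_rect_cbox[OF assms] by (simp_all add: convex_box)

lemma ball_subset_fict_rect:
  assumes s: "s \<in> {1, -1}" and r: "r \<le> d / 2" "r \<le> (b - a) / 2"
  shows "ball (vector [s * d / 2, (a + b) / 2]) r \<subseteq> fict_rect d a b s"
proof
  fix z :: plane assume "z \<in> ball (vector [s * d / 2, (a + b) / 2]) r"
  then have z: "norm (z - vector [s * d / 2, (a + b) / 2]) < r" by (simp add: dist_norm norm_minus_commute)
  have "\<bar>z $ 1 - s * d / 2\<bar> < d / 2" "\<bar>z $ 2 - (a + b) / 2\<bar> < (b - a) / 2"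
    using component_le_norm_cart[of "z - vector [s * d / 2, (a + b) / 2]" 1]
      component_le_norm_cart[of "z - vector [s * d / 2, (a + b) / 2]" 2] z r by simp_all
  then show "z \<in> fict_rect d a b s" unfolding fict_rect_def mem_Collect_eq atLeastAtMost_iff abs_less_iff using s by (auto simp: field_simps)
qed

lemma fict_rect_subset_cball:
  assumes s: "s \<in> {1, -1}" and t: "b - a \<le> 2 * t * d"
  shows "fict_rect d a b s \<subseteq> cball (vector [s * d / 2, (a + b) / 2]) ((1 + t) * d)"
proof
  fix z :: plane assume "z \<in> fict_rect d a b s"
  then have z: "\<bar>z$1\<bar> \<le> d" "a \<le> z $ 2" "z $ 2 \<le> b" "0 \<le> s * z$1" by (simp_all add: fict_rect_def)
  have "\<bar>z $ 1 - s * d / 2\<bar> \<le> d" using z(1,4) s by (auto simp: abs_if split: if_splits)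
  moreover have "\<bar>z $ 2 - (a + b) / 2\<bar> \<le> t * d" using z t by (simp add: abs_if field_simps)
  ultimately show "z \<in> cball (vector [s * d / 2, (a + b) / 2]) ((1 + t) * d)"
    using norm_plane_le[of "z - vector [s * d / 2, (a + b) / 2]"] by (simp add: dist_norm norm_minus_commute algebra_simps)
qed

text \<open>The hypotheses on an element \<open>K\<close> of diameter \<open>d\<close> with inverse Frenet branch \<open>R\<close> are those
  that a small curved triangle of a shape-regular mesh satisfies. The number \<open>\<theta>\<close> measures shape regularity.\<close>

locale curved_element = frenet_chart +
  fixes \<delta> \<theta> d a b s :: real and K :: "plane set" and R :: "plane \<Rightarrow> plane" and x\<^sub>0 :: plane
  assumes close: "close_inverse \<delta>" and K: "compact K" "connected K" and d: "d = diameter K" "0 < d" "d < \<delta>" "d \<le> \<epsilon> / 2"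
    and branch: "frenet_branch \<Gamma> \<epsilon> K R" and s: "s \<in> {1, -1}"
    and a: "a = (INF x\<in>K. R x $ 2)" and b: "b = (SUP x\<in>K. R x $ 2)"
    and K_fict: "K \<subseteq> frenet \<Gamma> ` fict_rect d a b s"
    and \<theta>: "0 < \<theta>" "\<theta> * d < 4 * M * period \<Gamma>" and ball_K: "ball x\<^sub>0 (\<theta> * d) \<subseteq> K"
begin

abbreviation H :: "plane set" where "H \<equiv> fict_rect d a b s"

lemma R_continuous: "continuous_on K R" and frenet_R: "x \<in> K \<Longrightarrow> frenet \<Gamma> (R x) = x"
  using branch by (auto simp: frenet_branch_def)

lemma x0: "x\<^sub>0 \<in> K"
  using ball_K d(2) \<theta>(1) by (intro subsetD[OF ball_K]) simp

lemma R_bounds: assumes "x \<in> K" shows "a \<le> R x $ 2" "R x $ 2 \<le> b"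
proof -
  have "compact ((\<lambda>x. R x $ 2) ` K)" by (intro compact_continuous_image continuous_intros R_continuous K)
  then have bd: "bounded ((\<lambda>x. R x $ 2) ` K)" by (rule compact_imp_bounded)
  show "a \<le> R x $ 2" unfolding a by (rule cINF_lower[OF bounded_imp_bdd_below[OF bd] assms])
  show "R x $ 2 \<le> b" unfolding b by (rule cSUP_upper[OF assms bounded_imp_bdd_above[OF bd]])
qed

text \<open>That \<open>K\<close> lies in the image of the rectangle says only that some preimage of
  \<open>x\<close> does. It differs from \<open>R x\<close> by whole periods, so the normal
  coordinates agree, and the other coordinate of \<open>R x\<close> is between its extrema on
  \<open>K\<close>.\<close>

lemma R_in_H: assumes x: "x \<in> K" shows "R x \<in> H"
proof -
  obtain z where z: "z \<in> H" "frenet \<Gamma> z = x" using K_fict x by (metis imageE subsetD)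
  have b1: "\<bar>z $ 1\<bar> \<le> \<epsilon>" using z(1) d eps by (simp add: fict_rect_def)
  have b2: "\<bar>R x $ 1\<bar> \<le> \<epsilon>" using branch x by (simp add: frenet_branch_def)
  have "frenet \<Gamma> z = frenet \<Gamma> (R x)" by (simp add: z(2) frenet_R[OF x])
  then obtain n where "R x = z + xi_shift \<Gamma> n"
    by (rule frenet_eq_imp_shift[OF b1 b2]) (rule that)
  then have "R x $ 1 = z $ 1" by (simp add: axis_def)
  then show ?thesis using z(1) R_bounds[OF x] by (simp add: fict_rect_def)
qed

lemma H_strip: "H \<subseteq> strip \<epsilon>"
  using d eps by (auto simp: fict_rect_def strip_def)

lemma R_bound1: "x \<in> K \<Longrightarrow> \<bar>R x $ 1\<bar> \<le> \<epsilon> / 2"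
  using R_in_H[of x] d by (simp add: fict_rect_def)

lemma dist_K: "x \<in> K \<Longrightarrow> y \<in> K \<Longrightarrow> dist x y \<le> d"
  unfolding d using diameter_bounded_bound[OF compact_imp_bounded[OF K(1)]] .

lemma R_Lipschitz:
  assumes "x \<in> K" "y \<in> K"
  shows "dist (R x) (R y) \<le> 8 * M / c * dist x y" "dist (R x) (R y) < period \<Gamma> / 4"
proof -
  have "dist x y < \<delta>" if "x \<in> K" "y \<in> K" for x y using dist_K[OF that] d by simp
  from branch_Lipschitz[OF close K(2) R_continuous R_bound1 frenet_R this assms]
  show "dist (R x) (R y) \<le> 8 * M / c * dist x y" "dist (R x) (R y) < period \<Gamma> / 4" by simp_all
qed

lemma width_le: "b - a \<le> period \<Gamma> / 4" "b - a \<le> 8 * M / c * d"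
proof -
  have "b - a \<le> t" if t: "\<And>x y. x \<in> K \<Longrightarrow> y \<in> K \<Longrightarrow> R y $ 2 - R x $ 2 \<le> t" for t
  proof -
    have ne: "K \<noteq> {}" using x0 by auto
    have "b \<le> t + R x $ 2" if x: "x \<in> K" for x unfolding b by (rule cSUP_least[OF ne]) (use t[OF x] in \<open>simp add: algebra_simps\<close>)
    then have "b - t \<le> a" unfolding a by (intro cINF_greatest[OF ne]) (simp add: algebra_simps)
    then show ?thesis by simp
  qed
  moreover have "R y $ 2 - R x $ 2 \<le> period \<Gamma> / 4" "R y $ 2 - R x $ 2 \<le> 8 * M / c * d" if xy: "x \<in> K" "y \<in> K" for x y
  proof -
    have 1: "R y $ 2 - R x $ 2 \<le> dist (R x) (R y)"
      using component_le_norm_cart[of "R y - R x" 2] by (simp add: dist_norm norm_minus_commute)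
    then show "R y $ 2 - R x $ 2 \<le> period \<Gamma> / 4" using R_Lipschitz[OF xy] by simp
    show "R y $ 2 - R x $ 2 \<le> 8 * M / c * d"
      using 1 R_Lipschitz(1)[OF xy] mult_left_mono[OF dist_K[OF xy], of "8 * M / c"] M c by simp
  qed
  ultimately show "b - a \<le> period \<Gamma> / 4" "b - a \<le> 8 * M / c * d" by blast+
qed

text \<open>Moving from \<open>R x\<^sub>0\<close> in the tangential direction stays in \<open>K\<close> up to a distance proportional to \<open>d\<close>.\<close>

lemma width_ge: "\<theta> / (8 * M) * d \<le> b - a"
proof -
  \<comment> \<open>Half the step that the Lipschitz constant \<open>4 * M\<close> permits inside
    the ball of radius \<theta> d; the assumed bound on \<theta> d makes it less than half a
    period.\<close>
  define t where "t = \<theta> / (8 * M) * d"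
  have t: "0 < t" "t < period \<Gamma> / 2" "4 * M * t < \<theta> * d"
    unfolding t_def using \<theta> d M by (simp_all add: field_simps)
  define z where "z = R x\<^sub>0 + t *\<^sub>R axis 2 1"
  have z: "z $ 1 = R x\<^sub>0 $ 1" "z $ 2 = R x\<^sub>0 $ 2 + t" by (simp_all add: z_def axis_def)
  have st: "R x\<^sub>0 \<in> strip \<epsilon>" using R_in_H[OF x0] H_strip by (rule subsetD[rotated])
  have zst: "z \<in> strip \<epsilon>" using st z by (simp add: strip_def)
  have "dist (R x\<^sub>0) z = t" using t by (simp add: z_def dist_norm norm_axis_1)
  then have "dist x\<^sub>0 (frenet \<Gamma> z) < \<theta> * d"
    using frenet_Lipschitz[OF st zst] t unfolding frenet_R[OF x0] by simp
  then have y: "frenet \<Gamma> z \<in> K" using ball_K by auto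
  have bz: "\<bar>z $ 1\<bar> \<le> \<epsilon>" "\<bar>R (frenet \<Gamma> z) $ 1\<bar> \<le> \<epsilon>" using R_bound1[OF y] zst eps by (simp_all add: strip_def)
  obtain n where n: "R (frenet \<Gamma> z) = z + xi_shift \<Gamma> n"
    by (rule frenet_eq_imp_shift[OF bz frenet_R[OF y, symmetric]]) (rule that)
  have R2: "R (frenet \<Gamma> z) $ 2 = R x\<^sub>0 $ 2 + t + of_int n * period \<Gamma>" using n z by (simp add: axis_def)
  have "\<bar>R (frenet \<Gamma> z) $ 2 - R x\<^sub>0 $ 2\<bar> < period \<Gamma> / 4"
    using R_Lipschitz(2)[OF y x0] component_le_norm_cart[of "R (frenet \<Gamma> z) - R x\<^sub>0" 2] by (simp add: dist_norm)
  then have "\<bar>R (frenet \<Gamma> z) $ 2 - (R x\<^sub>0 $ 2 + t)\<bar> < period \<Gamma>"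
    using t unfolding abs_less_iff by simp
  from shift_eq_zero[OF period_pos R2 this] have "n = 0" .
  then have "R (frenet \<Gamma> z) $ 2 - R x\<^sub>0 $ 2 = t" using R2 by simp
  then show ?thesis using R_bounds[OF y] R_bounds[OF x0] t_def by linarith
qed

lemma inj_frenet_H: "inj_on (frenet \<Gamma>) H"
proof (rule inj_onI)
  fix z z' assume z: "z \<in> H" "z' \<in> H" and eq: "frenet \<Gamma> z = frenet \<Gamma> z'"
  have bz: "\<bar>z $ 1\<bar> \<le> \<epsilon>" "\<bar>z' $ 1\<bar> \<le> \<epsilon>" using z d eps by (simp_all add: fict_rect_def)
  obtain n where n: "z' = z + xi_shift \<Gamma> n" by (rule frenet_eq_imp_shift[OF bz eq])
  have zb: "a \<le> z $ 2" "z $ 2 \<le> b" "a \<le> z' $ 2" "z' $ 2 \<le> b" using z by (simp_all add: fict_rect_def)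
  have z2: "z' $ 2 = z $ 2 + of_int n * period \<Gamma>" by (subst n) (simp add: axis_def)
  have "\<bar>z' $ 2 - z $ 2\<bar> < period \<Gamma>" using zb width_le(1) period_pos unfolding abs_less_iff by simp
  from shift_eq_zero[OF period_pos z2 this] have "n = 0" .
  then show "z = z'" using n by simp
qed

lemma H_compact_convex: "compact H" "convex H"
  using fict_rect_compact_convex[OF s] d by auto

text \<open>Invariance of domain: the map is continuous and injective, the latter because the
  rectangle is shorter than a period.\<close>

lemma open_image_H: "open (frenet \<Gamma> ` interior H)"
  by (intro invariance_of_domain continuous_on_subset[OF frenet_continuous] inj_on_subset[OF inj_frenet_H])
    (use interior_subset[of H] H_strip in auto)

lemma inj_R: "inj_on R K"
  by (rule inj_on_inverseI[where g="frenet \<Gamma>"]) (rule frenet_R)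

text \<open>The estimate on the rectangle holds on its interior only. Invariance of domain shows
  that the branch does not send interior points of \<open>K\<close> to its boundary.\<close>

lemma R_interior: "R ` interior K \<subseteq> interior H"
proof (rule interior_maximal)
  show "R ` interior K \<subseteq> H" using R_in_H interior_subset[of K] by auto
  show "open (R ` interior K)"
    by (intro invariance_of_domain continuous_on_subset[OF R_continuous] inj_on_subset[OF inj_R] interior_subset open_interior)
qed

text \<open>The two bounds on \<gamma> are for the half side d/2 in the normal direction and for the
  half side in the other one, which \<open>width_ge\<close> bounds below.\<close>

lemma ball_H:
  assumes "0 < \<gamma>" "\<gamma> \<le> 1 / 2" "\<gamma> \<le> \<theta> / (16 * M)"
  shows "ball (vector [s * d / 2, (a + b) / 2]) (\<gamma> * d) \<subseteq> H"
proof (rule ball_subset_fict_rect[OF s])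
  show "\<gamma> * d \<le> d / 2" using mult_right_mono[OF assms(2), of d] d by simp
  have "\<gamma> * d \<le> \<theta> / (16 * M) * d" using assms(3) d by (intro mult_right_mono) auto
  also have "\<theta> / (16 * M) * d = (\<theta> / (8 * M) * d) / 2" by simp
  also have "\<dots> \<le> (b - a) / 2" using width_ge by (rule divide_right_mono) simp
  finally show "\<gamma> * d \<le> (b - a) / 2" .
qed

lemma H_cball: "H \<subseteq> cball (vector [s * d / 2, (a + b) / 2]) ((1 + 8 * M / c) * d)"
proof (rule fict_rect_subset_cball[OF s])
  have "0 \<le> 8 * M / c * d" using d M c by simp
  then show "b - a \<le> 2 * (8 * M / c) * d" using width_le(2) by linarith
qed

lemma fict_dist:
  assumes "x \<in> frenet \<Gamma> ` H" "y \<in> frenet \<Gamma> ` H"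
  shows "dist x y \<le> 8 * M * (1 + 8 * M / c) * d"
proof -
  obtain z z' where z: "z \<in> H" "x = frenet \<Gamma> z" and z': "z' \<in> H" "y = frenet \<Gamma> z'" using assms by (elim imageE) (rule that)
  have "dist z z' \<le> 2 * ((1 + 8 * M / c) * d)"
    using dist_triangle3[of z z' "vector [s * d / 2, (a + b) / 2]"] subsetD[OF H_cball z(1)] subsetD[OF H_cball z'(1)] by simp
  then have "4 * M * dist z z' \<le> 4 * M * (2 * ((1 + 8 * M / c) * d))" using M by (intro mult_left_mono) auto
  moreover have "4 * M * (2 * (t * d)) = 8 * M * t * d" for t by simp
  ultimately show ?thesis
    using frenet_Lipschitz[OF subsetD[OF H_strip z(1)] subsetD[OF H_strip z'(1)]] unfolding z(2) z'(2) by (metis order_trans)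
qed

end

section \<open>Error estimates on elements\<close>

lemma strong_grad_cong:
  assumes "strong_grad U f f'" "\<And>x. x \<in> U \<Longrightarrow> f x = g x"
  shows "strong_grad U g f'"
  unfolding strong_grad_def
proof (intro allI impI)
  fix D :: "plane set" and e :: real assume *: "compact D \<and> D \<subseteq> U \<and> 0 < e"
  obtain V F F' where V: "open V" "D \<subseteq> V" "V \<subseteq> U" "C1_on V F F'" "sqnorm_on D (\<lambda>x. F x - f x) \<le> e"
    "\<forall>i. sqnorm_on D (\<lambda>x. F' i x - f' i x) \<le> e"
    using assms(1)[unfolded strong_grad_def, rule_format, OF *] by (elim exE conjE) (rule that)
  have "sqnorm_on D (\<lambda>x. F x - g x) = sqnorm_on D (\<lambda>x. F x - f x)"
    by (rule sqint_cong) (use * assms(2) in auto)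
  then show "\<exists>V F F'. open V \<and> D \<subseteq> V \<and> V \<subseteq> U \<and> C1_on V F F' \<and> sqnorm_on D (\<lambda>x. F x - g x) \<le> e \<and>
      (\<forall>i. sqnorm_on D (\<lambda>x. F' i x - f' i x) \<le> e)"
    using V by (intro exI[of _ V] exI[of _ F] exI[of _ F'] conjI) simp_all
qed

lemma HN_cong:
  assumes w: "HN k U B w" and eq: "\<And>x. x \<in> U \<Longrightarrow> w x = w' x"
  shows "HN k U B w'"
proof -
  have *: "sqint_on U w = sqint_on U w'" "sqnorm_on U w = sqnorm_on U w'"
    by (rule sqint_cong, use eq in simp)+
  show ?thesis
  proof (cases k)
    case 0
    then show ?thesis using w * by simp
  next
    case (Suc n)
    then obtain g where g: "strong_grad U w g" "\<forall>i. HN n U B (g i)" using w by auto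
    have "strong_grad U w' g" by (rule strong_grad_cong[OF g(1) eq])
    then have "\<exists>g. strong_grad U w' g \<and> (\<forall>i. HN n U B (g i))" using g(2) by (intro exI[of _ g] conjI)
    then show ?thesis using w * unfolding Suc HN.simps by simp
  qed
qed

lemma finite_choice_bound:
  fixes P :: "nat \<Rightarrow> real \<Rightarrow> bool"
  assumes ex: "\<And>k. \<exists>C\<ge>0. P k C" and mono: "\<And>k C D. P k C \<Longrightarrow> C \<le> D \<Longrightarrow> P k D"
  obtains C where "C \<ge> 0" "\<And>k. k \<le> n \<Longrightarrow> P k C"
proof -
  from choice[of "\<lambda>k C. 0 \<le> C \<and> P k C"] ex obtain c where c: "\<And>k. 0 \<le> c k \<and> P k (c k)" by auto
  show ?thesis
  proof (rule that[of "\<Sum>k\<le>n. c k"])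
    show "0 \<le> (\<Sum>k\<le>n. c k)" using c by (simp add: sum_nonneg)
    fix k assume "k \<le> n"
    then have "c k \<le> (\<Sum>k\<le>n. c k)" using c by (intro member_le_sum) auto
    then show "P k (\<Sum>k\<le>n. c k)" using mono c by auto
  qed
qed

context frenet_chart
begin

lemma inverse_entry_bound:
  obtains N where "N \<ge> 0" "\<And>i j. CB m (strip \<epsilon>) N (inverse_entry A i j)"
proof -
  have A: "CBx m (strip \<epsilon>) (A i j)" for i j using CBxI[OF CB_entry] .
  have "CBx m (strip \<epsilon>) (\<lambda>z. jac A z)"
    unfolding jac_def by (intro CBx_diff CBx_mult A)
  then have inv: "CBx m (strip \<epsilon>) (\<lambda>z. inverse (jac A z))"
    by (rule CBx_inverse[OF _ c]) (use jac_ge in auto)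
  have "CBx m (strip \<epsilon>) (inverse_entry A i j)" for i j
  proof -
    have "CBx m (strip \<epsilon>) (\<lambda>z. if i = j then (if i = 1 then A 2 2 z else A 1 1 z) else - A i j z)"
      using A[of 2 2] A[of 1 1] CBx_cmult[OF A[of i j], of "-1"] by (cases "i = j"; cases "i = 1") simp_all
    from CBx_mult[OF inv this] show ?thesis unfolding inverse_entry_def[abs_def] .
  qed
  then have "\<forall>p. \<exists>N. 0 \<le> N \<and> CB m (strip \<epsilon>) N (inverse_entry A (fst p) (snd p))"
    unfolding CBx_def by auto
  from choice[OF this] obtain f where f': "\<forall>p. 0 \<le> f p \<and> CB m (strip \<epsilon>) (f p) (inverse_entry A (fst p) (snd p))"
    by (elim exE) (rule that)
  note f = conjunct1[OF spec[OF f']] conjunct2[OF spec[OF f']]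
  show ?thesis
  proof (rule that[of "\<Sum>p\<in>UNIV. f p"])
    show "0 \<le> (\<Sum>p\<in>UNIV. f p)" using f by (simp add: sum_nonneg)
    fix i j :: 2
    have "f (i, j) \<le> (\<Sum>p\<in>UNIV. f p)" using f by (intro member_le_sum) auto
    then show "CB m (strip \<epsilon>) (\<Sum>p\<in>UNIV. f p) (inverse_entry A i j)" using f(2)[of "(i, j)"] by (auto intro: CB_mono)
  qed
qed

text \<open>The conclusion of the composition lemma as a property of the constant \<open>K\<close>,
  so that one constant can be chosen for all orders. The inverse map has Jacobian at least
  \<open>inverse C\<close> because the Frenet map has Jacobian at most \<open>C\<close>.\<close>

definition pullback_bound :: "real \<Rightarrow> nat \<Rightarrow> real \<Rightarrow> bool" where
  "pullback_bound N k K \<longleftrightarrow> (\<forall>U V \<Phi> A B w. open U \<and> open V \<and> has_jacobian U \<Phi> A \<and> \<Phi> ` U \<subseteq> V \<and> inj_on \<Phi> U \<and>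
      (\<forall>x\<in>U. inverse C \<le> \<bar>jac A x\<bar>) \<and> (\<forall>i j. CB (k - 1) U N (A i j)) \<and> HN k V B w \<longrightarrow> HN k U (K * B) (\<lambda>x. w (\<Phi> x)))"

text \<open>Three constants multiply: \<open>K1\<close> for pulling \<open>u\<close> back to the
  rectangle, \<open>K2\<close> for the projection there, and \<open>K4\<close> for pulling the error
  back by the branch. Each is fixed before the element.\<close>

lemma curved_estimate:
  assumes \<theta>: "\<theta> > 0"
  obtains C' where "C' \<ge> 0" "\<And>\<delta> d a b s K R x\<^sub>0 u N k. curved_element \<Gamma> \<epsilon> m A M c C \<delta> \<theta> d a b s K R x\<^sub>0 \<Longrightarrow> d \<le> 1 \<Longrightarrow>
     HN (Suc m) (frenet \<Gamma> ` interior (fict_rect d a b s)) N u \<Longrightarrow> k \<le> Suc m \<Longrightarrow>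
     HN k (interior K) (C' * d ^ (2 * (Suc m - k)) * N) (\<lambda>x. L2_projection m (fict_rect d a b s) (u \<circ> frenet \<Gamma>) (R x) - u x)"
proof -
  define \<gamma> where "\<gamma> = min (1 / 2) (\<theta> / (16 * M))"
  have \<gamma>: "0 < \<gamma>" "\<gamma> \<le> 1 / 2" "\<gamma> \<le> \<theta> / (16 * M)" using \<theta> M by (auto simp: \<gamma>_def)
  \<comment> \<open>Ratio of the circumscribed radius (1 + 8 M / c) d to the inscribed radius
    \<gamma> d of the rectangle.\<close>
  define \<sigma> where "\<sigma> = (1 + 8 * M / c) / \<gamma>"
  have "0 < 1 + 8 * M / c" using M c by (intro add_pos_pos divide_pos_pos) auto
  then have \<sigma>: "\<sigma> > 0" unfolding \<sigma>_def using \<gamma> by simp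
  \<comment> \<open>Any point of the strip shows that \<open>C\<close> is positive, as it bounds a
    modulus that is at least \<open>c\<close>.\<close>
  have "(0::plane) \<in> strip \<epsilon>" using eps by (simp add: strip_def)
  then have C: "C > 0" using jac_ge jac_le c by fastforce
  have M0: "M \<ge> 0" using M by simp
  from HN_compose[OF M0 c, where k="Suc m"] obtain K1 where K1: "K1 \<ge> 0"
    "\<forall>U V \<Phi> A B w. open U \<and> open V \<and> has_jacobian U \<Phi> A \<and> \<Phi> ` U \<subseteq> V \<and> inj_on \<Phi> U \<and>
      (\<forall>x\<in>U. c \<le> \<bar>jac A x\<bar>) \<and> (\<forall>i j. CB (Suc m - 1) U M (A i j)) \<and> HN (Suc m) V B w \<longrightarrow> HN (Suc m) U (K1 * B) (\<lambda>x. w (\<Phi> x))"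
    by (elim exE conjE) (rule that)
  obtain K2 where K2: "K2 \<ge> 0"
    "\<And>D x\<^sub>0 r w B k. \<lbrakk>convex D; compact D; 0 < r; r \<le> 1; ball x\<^sub>0 r \<subseteq> D; D \<subseteq> cball x\<^sub>0 (\<sigma> * r);
        HN (Suc m) (interior D) B w; k \<le> Suc m\<rbrakk>
      \<Longrightarrow> HN k (interior D) (K2 * r ^ (2 * (Suc m - k)) * B) (\<lambda>x. L2_projection m D w x - w x)"
    by (rule L2_projection_estimate[OF \<sigma>, where m=m]) (rule that)
  obtain N\<^sub>0 where N0: "N\<^sub>0 \<ge> 0" "\<And>i j. CB m (strip \<epsilon>) N\<^sub>0 (inverse_entry A i j)" by (rule inverse_entry_bound) (rule that)
  \<comment> \<open>Applied with the inverse Jacobian entries in both roles, as the Jacobian of the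
    branch and as the function composed with it. So \<open>K3\<close> bounds the derivatives of the
    Jacobian of every branch.\<close>
  from CB_compose_branch[OF N0(1), where k=m and V="strip \<epsilon>"] obtain K3 where K3: "K3 \<ge> 0"
    "\<forall>U R B b. (\<forall>x\<in>U. R x \<in> strip \<epsilon>) \<and> has_jacobian U R (\<lambda>i j x. B i j (R x)) \<and>
     (\<forall>i j. CB (m - 1) (strip \<epsilon>) N\<^sub>0 (B i j)) \<and> CB m (strip \<epsilon>) N\<^sub>0 b \<longrightarrow> CB m U K3 (\<lambda>x. b (R x))"
    by (elim exE conjE) (rule that)
  have ex: "\<exists>K\<ge>0. pullback_bound K3 k K" for k
    unfolding pullback_bound_def by (rule HN_compose[OF K3(1)]) (use C in simp)
  have mono: "pullback_bound K3 k D" if p: "pullback_bound K3 k K" and KD: "K \<le> D" for k K D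
    unfolding pullback_bound_def
  proof (intro allI impI)
    fix U V \<Phi> A B and w :: "plane \<Rightarrow> real"
    assume *: "open U \<and> open V \<and> has_jacobian U \<Phi> A \<and> \<Phi> ` U \<subseteq> V \<and> inj_on \<Phi> U \<and>
      (\<forall>x\<in>U. inverse C \<le> \<bar>jac A x\<bar>) \<and> (\<forall>i j. CB (k - 1) U K3 (A i j)) \<and> HN k V B w"
    have "HN k U (K * B) (\<lambda>x. w (\<Phi> x))" by (rule p[unfolded pullback_bound_def, rule_format, OF *])
    moreover have "B \<ge> 0" using * HN_nonneg by (elim conjE)
    ultimately show "HN k U (D * B) (\<lambda>x. w (\<Phi> x))" using KD by (auto intro: HN_mono mult_right_mono)
  qed
  obtain K4 where K4: "K4 \<ge> 0" "\<And>k. k \<le> Suc m \<Longrightarrow> pullback_bound K3 k K4"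
    by (rule finite_choice_bound[where P="pullback_bound K3" and n="Suc m", OF ex]) (erule (1) mono, rule that)
  show ?thesis
  proof (rule that[of "K4 * K2 * K1"])
    show "0 \<le> K4 * K2 * K1" using K4 K2 K1 by simp
    fix \<delta> d a b s K R x\<^sub>0 u N k
    assume ce: "curved_element \<Gamma> \<epsilon> m A M c C \<delta> \<theta> d a b s K R x\<^sub>0" and d1: "d \<le> 1"
      and u: "HN (Suc m) (frenet \<Gamma> ` interior (fict_rect d a b s)) N u" and k: "k \<le> Suc m"
    interpret curved_element \<Gamma> \<epsilon> m A M c C \<delta> \<theta> d a b s K R x\<^sub>0 by (rule ce)
    have iH: "interior H \<subseteq> strip \<epsilon>" using interior_subset[of H] H_strip by (rule order_trans)
    have J: "has_jacobian (interior H) (frenet \<Gamma>) A"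
      using jacobian iH unfolding has_jacobian_def by (auto intro: continuous_on_subset[OF _ iH])
    have N: "N \<ge> 0" by (rule HN_nonneg[OF u])
    have "HN (Suc m) (interior H) (K1 * N) (\<lambda>x. u (frenet \<Gamma> x))"
    proof (rule K1(2)[rule_format, of "interior H" "frenet \<Gamma> ` interior H" "frenet \<Gamma>" A N u], intro conjI ballI allI)
      show "inj_on (frenet \<Gamma>) (interior H)" by (rule inj_on_subset[OF inj_frenet_H interior_subset])
      show "c \<le> \<bar>jac A x\<bar>" if "x \<in> interior H" for x using jac_ge that iH by auto
      show "CB (Suc m - 1) (interior H) M (A i j)" for i j using CB_subset[OF CB_entry iH] by simp
    qed (use J open_image_H u in auto)
    then have w: "HN (Suc m) (interior H) (K1 * N) (u \<circ> frenet \<Gamma>)" by (simp add: o_def)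
    have \<gamma>d: "0 < \<gamma> * d" "\<gamma> * d \<le> 1"
      using \<gamma> d d1 mult_le_one[of \<gamma> d] by simp_all
    have cb: "H \<subseteq> cball (vector [s * d / 2, (a + b) / 2]) (\<sigma> * (\<gamma> * d))"
    proof -
      have eq: "\<sigma> * (\<gamma> * d) = (1 + 8 * M / c) * d" unfolding \<sigma>_def using \<gamma>(1) by simp
      show ?thesis unfolding eq by (rule H_cball)
    qed
    note e = K2(2)[OF H_compact_convex(2,1) \<gamma>d ball_H[OF \<gamma>] cb w k]
    have iK: "interior K \<subseteq> K" by (rule interior_subset)
    have Rs: "R x \<in> strip \<epsilon>" if "x \<in> interior K" for x using that iK R_in_H H_strip by auto
    have JR: "has_jacobian (interior K) R (\<lambda>i j x. inverse_entry A i j (R x))"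
    proof (rule branch_has_jacobian[OF jacobian strip_open])
      show "jac A z \<noteq> 0" if "z \<in> strip \<epsilon>" for z using jac_ge[OF that] c by auto
      show "continuous_on (interior K) R" by (rule continuous_on_subset[OF R_continuous iK])
      show "frenet \<Gamma> (R x) = x" if "x \<in> interior K" for x using frenet_R that iK by auto
    qed (use Rs in auto)
    have CR: "CB m (interior K) K3 (\<lambda>x. inverse_entry A i j (R x))" for i j
      by (rule K3(2)[rule_format, of "interior K" R "inverse_entry A" "inverse_entry A i j"], intro conjI ballI allI)
        (use Rs JR N0(2) CB_mono_order[OF N0(2), of "m - 1"] in auto)
    define r where "r = K2 * (\<gamma> * d) ^ (2 * (Suc m - k)) * (K1 * N)"
    have "HN k (interior K) (K4 * r) (\<lambda>x. L2_projection m H (u \<circ> frenet \<Gamma>) (R x) - (u \<circ> frenet \<Gamma>) (R x))"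
    proof (rule K4(2)[OF k, unfolded pullback_bound_def, rule_format, of "interior K" "interior H" R "\<lambda>i j x. inverse_entry A i j (R x)" r
          "\<lambda>x. L2_projection m H (u \<circ> frenet \<Gamma>) x - (u \<circ> frenet \<Gamma>) x"], intro conjI ballI allI)
      show "inj_on R (interior K)" by (rule inj_on_subset[OF inj_R iK])
      show "inverse C \<le> \<bar>jac (\<lambda>i j x. inverse_entry A i j (R x)) x\<bar>" if x: "x \<in> interior K" for x
      proof -
        have j: "c \<le> \<bar>jac A (R x)\<bar>" "\<bar>jac A (R x)\<bar> \<le> C" using jac_ge jac_le Rs[OF x] by auto
        then have "jac A (R x) \<noteq> 0" using c by auto
        then have "jac (\<lambda>i j x. inverse_entry A i j (R x)) x = inverse (jac A (R x))"
          unfolding jac_def[of "\<lambda>i j x. inverse_entry A i j (R x)"] by (rule jac_inverse_entry)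
        then show ?thesis using j c by (simp add: le_imp_inverse_le)
      qed
      show "CB (k - 1) (interior K) K3 (\<lambda>x. inverse_entry A i j (R x))" for i j
        by (rule CB_mono_order[OF CR]) (use k in simp)
    qed (use JR R_interior e in \<open>auto simp: r_def\<close>)
    then have "HN k (interior K) (K4 * r) (\<lambda>x. L2_projection m H (u \<circ> frenet \<Gamma>) (R x) - u x)"
      by (rule HN_cong) (use frenet_R iK in auto)
    moreover have "K4 * r \<le> K4 * K2 * K1 * d ^ (2 * (Suc m - k)) * N"
    proof -
      have "(\<gamma> * d) ^ (2 * (Suc m - k)) \<le> d ^ (2 * (Suc m - k))"
        by (intro power_mono) (use \<gamma> d mult_right_mono[of \<gamma> 1 d] in auto)
      then have "(K4 * K2 * K1 * N) * (\<gamma> * d) ^ (2 * (Suc m - k)) \<le> (K4 * K2 * K1 * N) * d ^ (2 * (Suc m - k))"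
        using K4 K2 K1 N by (intro mult_left_mono) auto
      then show ?thesis unfolding r_def by (simp only: mult_ac)
    qed
    ultimately show "HN k (interior K) (K4 * K2 * K1 * d ^ (2 * (Suc m - k)) * N)
        (\<lambda>x. L2_projection m H (u \<circ> frenet \<Gamma>) (R x) - u x)" by (rule HN_mono)
  qed
qed

end

text \<open>The common interface of straight and curved elements: the error of \<open>P\<close> on
  \<open>K\<close> is controlled by \<open>u\<close> on an open patch \<open>W\<close>. The distance
  condition is what the overlap count needs.\<close>

definition local_estimate :: "nat \<Rightarrow> real \<Rightarrow> plane set \<Rightarrow> plane set \<Rightarrow> ((plane \<Rightarrow> real) \<Rightarrow> plane \<Rightarrow> real) \<Rightarrow> bool" where
  "local_estimate m B K W P \<longleftrightarrow> open W \<and> (\<forall>x\<in>W. \<forall>y\<in>K. dist x y \<le> B * diameter K) \<and>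
     (\<forall>u N k. HN (Suc m) W N u \<and> k \<le> Suc m \<longrightarrow>
        HN k (interior K) (B * diameter K ^ (2 * (Suc m - k)) * N) (\<lambda>x. P u x - u x))"

lemma local_estimate_mono:
  assumes "local_estimate m B K W P" "B \<le> B'" "0 \<le> diameter K"
  shows "local_estimate m B' K W P"
  unfolding local_estimate_def
proof (intro conjI ballI allI impI)
  show "open W" using assms(1) by (simp add: local_estimate_def)
  have "B * diameter K \<le> B' * diameter K" using assms(2,3) by (rule mult_right_mono)
  then show "dist x y \<le> B' * diameter K" if "x \<in> W" "y \<in> K" for x y
    using assms(1) that unfolding local_estimate_def by (auto intro: order_trans)
  fix u N k assume *: "HN (Suc m) W N u \<and> k \<le> Suc m"
  have "HN k (interior K) (B * diameter K ^ (2 * (Suc m - k)) * N) (\<lambda>x. P u x - u x)"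
    using assms(1) * unfolding local_estimate_def by (elim conjE allE[of _ u] allE[of _ N] allE[of _ k] impE) auto
  moreover have "N \<ge> 0" using * by (auto dest: HN_nonneg)
  moreover from this have "B * diameter K ^ (2 * (Suc m - k)) * N \<le> B' * diameter K ^ (2 * (Suc m - k)) * N"
    using assms(2,3) by (intro mult_right_mono) simp_all
  ultimately show "HN k (interior K) (B' * diameter K ^ (2 * (Suc m - k)) * N) (\<lambda>x. P u x - u x)"
    by (elim HN_mono)
qed

lemma straight_local_estimate:
  assumes \<theta>: "0 < \<theta>" "\<theta> \<le> 1"
  obtains B where "B \<ge> 0" "\<And>K x\<^sub>0. convex K \<Longrightarrow> compact K \<Longrightarrow> 0 < diameter K \<Longrightarrow> diameter K \<le> 1 \<Longrightarrow> ball x\<^sub>0 (\<theta> * diameter K) \<subseteq> K \<Longrightarrow>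
     local_estimate m B K (interior K) (L2_projection m K)"
proof -
  have \<sigma>: "1 / \<theta> > 0" using \<theta> by simp
  obtain B where B: "B \<ge> 0"
    "\<And>D x\<^sub>0 r w B' k. \<lbrakk>convex D; compact D; 0 < r; r \<le> 1; ball x\<^sub>0 r \<subseteq> D; D \<subseteq> cball x\<^sub>0 (1 / \<theta> * r);
        HN (Suc m) (interior D) B' w; k \<le> Suc m\<rbrakk>
      \<Longrightarrow> HN k (interior D) (B * r ^ (2 * (Suc m - k)) * B') (\<lambda>x. L2_projection m D w x - w x)"
    by (rule L2_projection_estimate[OF \<sigma>, where m=m]) (rule that)
  show ?thesis
  \<comment> \<open>The added 1 serves the distance condition, since points of \<open>K\<close> are
    up to one diameter apart.\<close>
  proof (rule that[of "B + 1"])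
    show "0 \<le> B + 1" using B(1) by simp
    fix K :: "plane set" and x\<^sub>0
    assume K: "convex K" "compact K" "0 < diameter K" "diameter K \<le> 1" and ball: "ball x\<^sub>0 (\<theta> * diameter K) \<subseteq> K"
    define d where "d = diameter K"
    have dK: "dist x y \<le> d" if "x \<in> K" "y \<in> K" for x y
      unfolding d_def by (rule diameter_bounded_bound[OF compact_imp_bounded[OF K(2)] that])
    have x0: "x\<^sub>0 \<in> K" using K(3) \<theta> by (intro subsetD[OF ball]) simp
    have r: "0 < \<theta> * d" "\<theta> * d \<le> 1" using K(3,4) \<theta> mult_le_one[of \<theta> d] by (simp_all add: d_def)
    have cb: "K \<subseteq> cball x\<^sub>0 (1 / \<theta> * (\<theta> * d))" using dK[OF x0] \<theta> by auto
    show "local_estimate m (B + 1) K (interior K) (L2_projection m K)"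
      unfolding local_estimate_def d_def[symmetric]
    proof (intro conjI ballI allI impI)
      fix x y assume "x \<in> interior K" "y \<in> K"
      then have "dist x y \<le> d" using dK interior_subset[of K] by auto
      also have "\<dots> \<le> (B + 1) * d" using B(1) K(3) by (simp add: algebra_simps d_def)
      finally show "dist x y \<le> (B + 1) * d" .
    next
      fix u N k assume *: "HN (Suc m) (interior K) N u \<and> k \<le> Suc m"
      have N: "N \<ge> 0" using * by (auto dest: HN_nonneg)
      have "(\<theta> * d) ^ (2 * (Suc m - k)) \<le> d ^ (2 * (Suc m - k))"
        using K(3) \<theta> mult_right_mono[of \<theta> 1 d] by (intro power_mono) (auto simp: d_def)
      then have "B * (\<theta> * d) ^ (2 * (Suc m - k)) * N \<le> (B + 1) * d ^ (2 * (Suc m - k)) * N"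
        using B(1) N K(3) \<theta> by (intro mult_right_mono mult_mono) (auto simp: d_def)
      from HN_mono[OF B(2)[OF K(1,2) r ball[folded d_def] cb conjunct1[OF *] conjunct2[OF *]] this]
      show "HN k (interior K) ((B + 1) * d ^ (2 * (Suc m - k)) * N) (\<lambda>x. L2_projection m K u x - u x)" .
    qed simp
  qed
qed

text \<open>Hides the constants of the Frenet chart, so that the boundary and the interface can be
  treated through one predicate.\<close>

definition curved_estimate_below :: "nat \<Rightarrow> real \<Rightarrow> real \<Rightarrow> curve \<Rightarrow> real \<Rightarrow> real \<Rightarrow> bool" where
  "curved_estimate_below m \<epsilon> \<theta> \<Gamma> h\<^sub>0 B \<longleftrightarrow> (\<forall>K R s x\<^sub>0 D. compact K \<and> connected K \<and> 0 < diameter K \<and> diameter K \<le> h\<^sub>0 \<and>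
     frenet_branch \<Gamma> \<epsilon> K R \<and> s \<in> {1, -1} \<and> D = fict_rect (diameter K) (INF x\<in>K. R x $ 2) (SUP x\<in>K. R x $ 2) s \<and>
     K \<subseteq> frenet \<Gamma> ` D \<and> ball x\<^sub>0 (\<theta> * diameter K) \<subseteq> K \<longrightarrow>
     local_estimate m B K (frenet \<Gamma> ` interior D) (\<lambda>u x. L2_projection m D (u \<circ> frenet \<Gamma>) (R x)))"

lemma curved_local_estimate:
  assumes \<Gamma>: "regular_closed_curve \<Gamma>" "curve_class (m + 2) \<Gamma>" "frenet_regular \<Gamma> \<epsilon>" and \<epsilon>: "\<epsilon> > 0" and m: "m \<ge> 1" and \<theta>: "0 < \<theta>"
  obtains h\<^sub>0 B where "h\<^sub>0 > 0" "B \<ge> 0" "curved_estimate_below m \<epsilon> \<theta> \<Gamma> h\<^sub>0 B"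
proof -
  obtain A M c C where ch: "frenet_chart \<Gamma> \<epsilon> m A M c C" by (rule frenet_chart_exists[OF \<Gamma> \<epsilon> m]) (rule that)
  interpret frenet_chart \<Gamma> \<epsilon> m A M c C by (rule ch)
  obtain \<delta> where \<delta>: "close_inverse \<delta>" by (rule close_inverse_exists) (rule that)
  have \<delta>0: "\<delta> > 0" using \<delta> by (simp add: close_inverse_def)
  obtain C' where C': "C' \<ge> 0" "\<And>\<delta> d a b s K R x\<^sub>0 u N k. curved_element \<Gamma> \<epsilon> m A M c C \<delta> \<theta> d a b s K R x\<^sub>0 \<Longrightarrow> d \<le> 1 \<Longrightarrow>
     HN (Suc m) (frenet \<Gamma> ` interior (fict_rect d a b s)) N u \<Longrightarrow> k \<le> Suc m \<Longrightarrow>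
     HN k (interior K) (C' * d ^ (2 * (Suc m - k)) * N) (\<lambda>x. L2_projection m (fict_rect d a b s) (u \<circ> frenet \<Gamma>) (R x) - u x)"
    by (rule curved_estimate[OF \<theta>]) (rule that)
  \<comment> \<open>The bounds serve, in order: diameters at most 1, the strict bound by \<delta>,
    the half strip, and \<theta> d < 4 M times the period.\<close>
  define h\<^sub>0 where "h\<^sub>0 = min (min 1 (\<delta> / 2)) (min (\<epsilon> / 2) (2 * M * period \<Gamma> / \<theta>))"
  have h0: "h\<^sub>0 > 0" unfolding h\<^sub>0_def using \<delta>0 \<epsilon> M period_pos \<theta> by simp
  define B where "B = C' + 8 * M * (1 + 8 * M / c)"
  have B: "C' \<le> B" "8 * M * (1 + 8 * M / c) \<le> B" "0 \<le> B" unfolding B_def using C'(1) M c by simp_all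
  show ?thesis
  proof (rule that[OF h0 B(3)], unfold curved_estimate_below_def, intro allI impI, elim conjE)
    fix K R s x\<^sub>0 D
    assume K: "compact K" "connected K" "0 < diameter K" "diameter K \<le> h\<^sub>0" and R: "frenet_branch \<Gamma> \<epsilon> K R" and s: "s \<in> {1, -1}"
      and D: "D = fict_rect (diameter K) (INF x\<in>K. R x $ 2) (SUP x\<in>K. R x $ 2) s"
      and KD: "K \<subseteq> frenet \<Gamma> ` D" and ball: "ball x\<^sub>0 (\<theta> * diameter K) \<subseteq> K"
    define d where "d = diameter K"
    have dd: "0 < d" "d \<le> 1" "d < \<delta>" "d \<le> \<epsilon> / 2" "d \<le> 2 * M * period \<Gamma> / \<theta>"
      using K(3,4) \<delta>0 unfolding h\<^sub>0_def d_def by auto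
    have "\<theta> * d \<le> 2 * M * period \<Gamma>" using dd(5) \<theta> by (simp add: field_simps)
    moreover have "0 < M * period \<Gamma>" using M period_pos by simp
    ultimately have \<theta>d: "\<theta> * d < 4 * M * period \<Gamma>" by simp
    define a b where "a = (INF x\<in>K. R x $ 2)" and "b = (SUP x\<in>K. R x $ 2)"
    have DD: "D = fict_rect d a b s" unfolding D d_def a_def b_def ..
    have ce: "curved_element \<Gamma> \<epsilon> m A M c C \<delta> \<theta> d a b s K R x\<^sub>0"
      by (unfold_locales) (use \<delta> K R s KD ball dd \<theta> \<theta>d in \<open>auto simp: a_def b_def DD d_def[symmetric]\<close>)
    interpret curved_element \<Gamma> \<epsilon> m A M c C \<delta> \<theta> d a b s K R x\<^sub>0 by (rule ce)
    show "local_estimate m B K (frenet \<Gamma> ` interior D) (\<lambda>u x. L2_projection m D (u \<circ> frenet \<Gamma>) (R x))"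
      unfolding local_estimate_def DD d_def[symmetric]
    proof (intro conjI ballI allI impI)
      show "open (frenet \<Gamma> ` interior H)" by (rule open_image_H)
      fix x y assume xy: "x \<in> frenet \<Gamma> ` interior H" "y \<in> K"
      have "dist x y \<le> 8 * M * (1 + 8 * M / c) * d"
        by (rule fict_dist) (use xy interior_subset[of H] K_fict in auto)
      also have "\<dots> \<le> B * d" using B(2) d by (intro mult_right_mono) auto
      finally show "dist x y \<le> B * d" .
    next
      fix u N k assume *: "HN (Suc m) (frenet \<Gamma> ` interior H) N u \<and> k \<le> Suc m"
      have "C' * d ^ (2 * (Suc m - k)) * N \<le> B * d ^ (2 * (Suc m - k)) * N"
        using B d * by (intro mult_right_mono) (auto dest: HN_nonneg)
      from HN_mono[OF C'(2)[OF ce dd(2) conjunct1[OF *] conjunct2[OF *]] this]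
      show "HN k (interior K) (B * d ^ (2 * (Suc m - k)) * N) (\<lambda>x. L2_projection m H (u \<circ> frenet \<Gamma>) (R x) - u x)" .
    qed
  qed
qed

section \<open>The interior of the closure of the domain\<close>

context frenet_chart
begin

text \<open>The map is injective on sets of diameter less than a period, so invariance of domain
  applies locally.\<close>

lemma frenet_image_open:
  assumes S: "open S" "S \<subseteq> strip \<epsilon>"
  shows "open (frenet \<Gamma> ` S)"
proof (subst open_subopen, intro ballI)
  fix x assume "x \<in> frenet \<Gamma> ` S"
  then obtain z where z: "z \<in> S" "x = frenet \<Gamma> z" by (rule imageE)
  define U where "U = S \<inter> ball z (period \<Gamma> / 2)"
  have U: "U \<subseteq> strip \<epsilon>" "z \<in> U" "open U" using z S period_pos by (auto simp: U_def)
  have "inj_on (frenet \<Gamma>) U"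
  proof (rule inj_onI)
    fix v w assume vw: "v \<in> U" "w \<in> U" "frenet \<Gamma> v = frenet \<Gamma> w"
    have bd: "\<bar>v $ 1\<bar> \<le> \<epsilon>" "\<bar>w $ 1\<bar> \<le> \<epsilon>" using vw U by (auto simp: strip_def)
    obtain n where n: "w = v + xi_shift \<Gamma> n"
      by (rule frenet_eq_imp_shift[OF bd vw(3)]) (rule that)
    have "dist v w < period \<Gamma>" using vw(1,2) dist_triangle_half_r[of z v "period \<Gamma>" w] by (simp add: U_def)
    then have "\<bar>w $ 2 - v $ 2\<bar> < period \<Gamma>"
      using component_le_norm_cart[of "w - v" 2] by (simp add: dist_norm norm_minus_commute)
    moreover have "w $ 2 = v $ 2 + of_int n * period \<Gamma>" by (subst n) (simp add: axis_def)
    ultimately have "n = 0" using shift_eq_zero[OF period_pos] by blast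
    then show "v = w" using n by simp
  qed
  then have "open (frenet \<Gamma> ` U)"
    by (intro invariance_of_domain continuous_on_subset[OF frenet_continuous] U)
  then show "\<exists>T. open T \<and> x \<in> T \<and> T \<subseteq> frenet \<Gamma> ` S"
    using z U by (intro exI[of _ "frenet \<Gamma> ` U"]) (auto simp: U_def)
qed

lemma par_eq_frenet: "par \<Gamma> t = frenet \<Gamma> (vector [0, t])"
  by (simp add: frenet_def)

lemma par_reduce: "par \<Gamma> t \<in> trace_of \<Gamma>"
proof -
  obtain n where n: "xi_s \<Gamma> \<le> t + of_int n * period \<Gamma>" "t + of_int n * period \<Gamma> < xi_s \<Gamma> + period \<Gamma>"
    by (rule periodic_reduce[OF period_pos])
  have "par \<Gamma> t = par \<Gamma> (t + of_int n * period \<Gamma>)"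
    using frenet_shift[of "vector [0, t]" n] by (simp add: frenet_def axis_def)
  then show ?thesis unfolding trace_of_def using n by (intro image_eqI[of _ _ "t + of_int n * period \<Gamma>"]) auto
qed

text \<open>If an open piece of the curve were interior to the closure, both sides of the whole curve would
  lie in \<open>W\<close>, and the closure of \<open>W\<close> would be a bounded open and closed set.\<close>

lemma interior_closure_eq:
  assumes W: "open W" "bounded W" "W \<noteq> {}" "frontier W = trace_of \<Gamma>"
  shows "interior (closure W) = W"
proof (rule ccontr)
  assume ne: "interior (closure W) \<noteq> W"
  have cl: "closure W = W \<union> trace_of \<Gamma>" using closure_Un_frontier[of W] W(4) by simp
  have "W \<subseteq> interior (closure W)" using W(1) closure_subset by (intro interior_maximal)
  with ne obtain x where x: "x \<in> interior (closure W)" "x \<notin> W" by auto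
  then have "x \<in> trace_of \<Gamma>" using interior_subset[of "closure W"] cl by auto
  then obtain t where t: "x = par \<Gamma> t" unfolding trace_of_def by auto
  \<comment> \<open>The image of a one-sided strip is connected and avoids the curve, which is the
    frontier of \<open>W\<close>. It meets \<open>W\<close> on the normal through \<open>x\<close>,
    close to \<open>x\<close>, so it lies in \<open>W\<close> entirely.\<close>
  have side: "frenet \<Gamma> ` {z. 0 < \<sigma> * z $ 1 \<and> \<bar>z $ 1\<bar> < \<epsilon>} \<subseteq> W" if \<sigma>: "\<sigma> = 1 \<or> \<sigma> = -1" for \<sigma> :: real
  proof -
    define S :: "plane set" where "S = {z. 0 < \<sigma> * z $ 1 \<and> \<bar>z $ 1\<bar> < \<epsilon>}"
    have "convex S"
    proof -
      have "S = {z. axis 1 \<sigma> \<bullet> z > 0} \<inter> strip \<epsilon>" by (auto simp: S_def strip_def inner_axis_axis inner_axis' )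
      then show ?thesis using strip_convex by (simp add: convex_Int convex_halfspace_gt)
    qed
    then have conn: "connected (frenet \<Gamma> ` S)"
      by (intro connected_continuous_image continuous_on_subset[OF frenet_continuous] convex_connected) (auto simp: S_def strip_def)
    have disj: "frenet \<Gamma> ` S \<inter> trace_of \<Gamma> = {}"
    proof (rule ccontr)
      assume "\<not> ?thesis"
      then obtain z t where z: "z \<in> S" "frenet \<Gamma> z = par \<Gamma> t" unfolding trace_of_def by auto
      have bd: "\<bar>z $ 1\<bar> \<le> \<epsilon>" "\<bar>(vector [0, t] :: plane) $ 1\<bar> \<le> \<epsilon>" using z(1) eps by (simp_all add: S_def)
      obtain n where n: "vector [0, t] = z + xi_shift \<Gamma> n"
        by (rule frenet_eq_imp_shift[OF bd z(2)[unfolded par_eq_frenet]]) (rule that)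
      have "(vector [0, t] :: plane) $ 1 = z $ 1" unfolding n by (simp add: axis_def)
      then show False using z(1) by (simp add: S_def)
    qed
    define f where "f = (\<lambda>\<eta>. par \<Gamma> t + (\<sigma> * \<eta>) *\<^sub>R normal_vec \<Gamma> t)"
    have f: "f \<eta> = frenet \<Gamma> (vector [\<sigma> * \<eta>, t])" for \<eta> by (simp add: f_def frenet_def)
    have "isCont f 0" unfolding f_def by (intro continuous_intros)
    moreover have "f 0 = x" by (simp add: f_def t)
    ultimately have "\<forall>\<^sub>F \<eta> in at 0. f \<eta> \<in> interior (closure W)"
      using x(1) by (auto simp: isCont_def intro: topological_tendstoD)
    then obtain e where e: "e > 0" "\<And>\<eta>. \<eta> \<noteq> 0 \<Longrightarrow> dist \<eta> 0 < e \<Longrightarrow> f \<eta> \<in> interior (closure W)"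
      unfolding eventually_at by auto
    define \<eta> where "\<eta> = min (e / 2) (\<epsilon> / 2)"
    have \<eta>: "0 < \<eta>" "\<eta> < e" "\<eta> < \<epsilon>" using e eps by (auto simp: \<eta>_def)
    have "f \<eta> \<in> frenet \<Gamma> ` S" unfolding f by (rule imageI) (use \<eta> \<sigma> in \<open>auto simp: S_def\<close>)
    moreover have "f \<eta> \<in> W \<union> trace_of \<Gamma>" using e(2)[of \<eta>] \<eta> interior_subset[of "closure W"] cl by auto
    ultimately have "frenet \<Gamma> ` S \<inter> W \<noteq> {}" using disj by auto
    then have "frenet \<Gamma> ` S - W = {}"
      using connected_Int_frontier[OF conn, of W] disj W(4) by auto
    then show ?thesis unfolding S_def by auto
  qed
  have N: "frenet \<Gamma> ` strip \<epsilon> \<subseteq> W \<union> trace_of \<Gamma>"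
  proof
    fix y assume "y \<in> frenet \<Gamma> ` strip \<epsilon>"
    then obtain z where z: "z \<in> strip \<epsilon>" "y = frenet \<Gamma> z" by (rule imageE)
    consider "z $ 1 = 0" | "0 < z $ 1" | "z $ 1 < 0" by linarith
    then show "y \<in> W \<union> trace_of \<Gamma>"
    proof cases
      case 1
      then show ?thesis using z par_reduce[of "z $ 2"] by (simp add: frenet_def)
    next
      case 2
      then show ?thesis using z subsetD[OF side[of 1], of y] by (auto simp: strip_def)
    next
      case 3
      then show ?thesis using z subsetD[OF side[of "-1"], of y] by (auto simp: strip_def)
    qed
  qed
  have "trace_of \<Gamma> \<subseteq> frenet \<Gamma> ` strip \<epsilon>"
    unfolding trace_of_def par_eq_frenet using eps by (auto simp: strip_def)
  then have "closure W = W \<union> frenet \<Gamma> ` strip \<epsilon>" using N cl by auto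
  moreover have "open (W \<union> frenet \<Gamma> ` strip \<epsilon>)" by (intro open_Un W(1) frenet_image_open strip_open order_refl)
  ultimately have "open (closure W)" by simp
  \<comment> \<open>The closure of \<open>W\<close> is open and closed and nonempty, hence the whole
    plane, contrary to boundedness.\<close>
  with closed_closure[of W] have "closure W = {} \<or> closure W = UNIV" unfolding clopen[symmetric] by (rule conjI)
  then have "closure W = UNIV" using W(3) by simp
  then show False using bounded_closure[OF W(2)] not_bounded_UNIV[where 'a=plane] by simp
qed

end

text \<open>The arc and the two segments form a connected compact set, and adding its inside, the
  bounded components of the complement, keeps it connected and closed.\<close>

lemma curved_triangle_connected:
  assumes \<Gamma>: "regular_closed_curve \<Gamma>" and K: "curved_triangle \<Gamma> T E K"
  shows "compact K" "connected K"
proof -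
  obtain a b c \<alpha> \<beta> A S where *: "\<alpha> < \<beta>" "par \<Gamma> \<alpha> = a" "par \<Gamma> \<beta> = b" "A = par \<Gamma> ` {\<alpha>..\<beta>}"
     "S = A \<union> closed_segment b c \<union> closed_segment c a" "K = S \<union> inside S"
    using K unfolding curved_triangle_def by (elim exE conjE) (rule that)
  have "curve_class (0 + 2) \<Gamma>" using \<Gamma> unfolding regular_closed_curve_def add_0 by (elim conjE)
  then have cont: "continuous_on UNIV (par \<Gamma>)" using curve_parameter_CBx(3)[OF \<Gamma>, of 0 2] by simp
  have A: "compact A" "connected A" unfolding *(4)
    by (intro compact_continuous_image connected_continuous_image continuous_on_subset[OF cont]; simp)+
  have "a \<in> A" "b \<in> A" using * by (auto simp: *(4))
  then have "connected S" unfolding *(5)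
    by (intro connected_Un A connected_segment) auto
  moreover have S: "compact S" unfolding *(5) using A by (intro compact_Un) auto
  ultimately show "connected K" unfolding *(6) by (intro connected_with_inside compact_imp_closed)
  have "closed K" unfolding *(6) union_with_inside by (intro closed_Compl open_outside compact_imp_closed S)
  moreover have "bounded K" unfolding *(6) using S bounded_inside compact_imp_bounded by auto
  ultimately show "compact K" by (simp add: compact_eq_bounded_closed)
qed

section \<open>Finite overlap and summation over the mesh\<close>

lemma overlap_count:
  fixes F :: "plane set set"
  assumes F: "finite F" "\<And>K K'. K \<in> F \<Longrightarrow> K' \<in> F \<Longrightarrow> K \<noteq> K' \<Longrightarrow> interior K \<inter> interior K' = {}"
    and \<rho>: "\<rho> > 0" and D: "D \<ge> 0"
    and ball: "\<And>K. K \<in> F \<Longrightarrow> \<exists>z. ball z \<rho> \<subseteq> K" and near: "\<And>K y. K \<in> F \<Longrightarrow> y \<in> K \<Longrightarrow> dist x y \<le> D"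
  shows "real (card F) \<le> (D / \<rho>)\<^sup>2"
proof -
  have "\<forall>K\<in>F. \<exists>z. ball z \<rho> \<subseteq> K" using ball by (rule ballI)
  from bchoice[OF this] obtain z where z: "\<forall>K\<in>F. ball (z K) \<rho> \<subseteq> K" by (elim exE) (rule that)
  define \<omega> where "\<omega> = measure lborel (ball (0::plane) 1)"
  have \<omega>: "\<omega> > 0" unfolding \<omega>_def by (rule content_ball_pos) simp
  have ms: "measure lebesgue (ball y r) = r\<^sup>2 * \<omega>" "measure lebesgue (cball y r) = r\<^sup>2 * \<omega>" if "r \<ge> 0" for y :: plane and r
    using content_ball_conv_unit_ball[OF that, of y] content_cball_conv_ball[of y r] by (simp_all add: \<omega>_def)
  have sub: "ball (z K) \<rho> \<subseteq> interior K" if "K \<in> F" for K using z that by (intro interior_maximal) auto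
  have "real (card F) * (\<rho>\<^sup>2 * \<omega>) = (\<Sum>K\<in>F. measure lebesgue (ball (z K) \<rho>))" using ms \<rho> by simp
  also have "\<dots> = measure lebesgue (\<Union>K\<in>F. ball (z K) \<rho>)"
  proof (rule measure_UNION'[symmetric])
    show "pairwise (\<lambda>K K'. disjnt (ball (z K) \<rho>) (ball (z K') \<rho>)) F"
      unfolding pairwise_def disjnt_def
    proof (intro ballI impI)
      fix K K' assume "K \<in> F" "K' \<in> F" "K \<noteq> K'"
      with F(2) sub show "ball (z K) \<rho> \<inter> ball (z K') \<rho> = {}" by blast
    qed
  qed (use F in auto)
  also have "\<dots> \<le> measure lebesgue (cball x D)"
  proof (rule measure_mono_fmeasurable)
    show "(\<Union>K\<in>F. ball (z K) \<rho>) \<subseteq> cball x D"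
    proof
      fix y assume "y \<in> (\<Union>K\<in>F. ball (z K) \<rho>)"
      then obtain K where K: "K \<in> F" "y \<in> ball (z K) \<rho>" by (rule UN_E)
      have "y \<in> K" using K(2) bspec[OF z K(1)] by (rule subsetD[rotated])
      then show "y \<in> cball x D" using near[OF K(1)] by simp
    qed
  qed (use F in auto)
  also have "\<dots> = D\<^sup>2 * \<omega>" using ms D by simp
  finally have "real (card F) * \<rho>\<^sup>2 \<le> D\<^sup>2" using \<omega> by simp
  then show ?thesis using \<rho> by (simp add: power_divide field_simps)
qed

text \<open>After exchanging sum and integral, the integrand at \<open>x\<close> is the squared
  value times the number of patches that contain \<open>x\<close>.\<close>

lemma sum_sqnorm_overlap:
  fixes f :: "plane \<Rightarrow> real"
  assumes F: "finite F" and U: "U \<in> sets lebesgue" and W: "\<And>K. K \<in> F \<Longrightarrow> W K \<in> sets lebesgue" "\<And>K. K \<in> F \<Longrightarrow> W K \<subseteq> U"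
    and N: "\<And>x. x \<in> U \<Longrightarrow> real (card {K\<in>F. x \<in> W K}) \<le> N" and f: "sqint_on U f"
  shows "(\<Sum>K\<in>F. sqnorm_on (W K) f) \<le> N * sqnorm_on U f"
proof -
  define g where "g = (\<lambda>S x. (if x \<in> S then f x else 0)\<^sup>2)"
  have i: "integrable lebesgue (g S)" "sqnorm_on S f = (LINT x|lebesgue. g S x)" if S: "S \<in> sets lebesgue" "S \<subseteq> U" for S
    using sqint_mono(1)[OF f S(2,1) U] sqint_lebesgue_on_iff[OF S(1), of f] unfolding g_def by (auto dest: sqint_integrable)
  have "(\<Sum>K\<in>F. sqnorm_on (W K) f) = (\<Sum>K\<in>F. LINT x|lebesgue. g (W K) x)"
    by (rule sum.cong[OF refl]) (rule i(2)[OF W])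
  also have "\<dots> = (LINT x|lebesgue. (\<Sum>K\<in>F. g (W K) x))"
    by (rule Bochner_Integration.integral_sum[symmetric]) (rule i(1)[OF W])
  also have "\<dots> \<le> (LINT x|lebesgue. N * g U x)"
  proof (rule integral_mono)
    show "integrable lebesgue (\<lambda>x. \<Sum>K\<in>F. g (W K) x)" by (intro Bochner_Integration.integrable_sum i(1) W)
    show "integrable lebesgue (\<lambda>x. N * g U x)" by (intro integrable_mult_right i(1) U order_refl)
    fix x
    have "(\<Sum>K\<in>F. g (W K) x) = (\<Sum>K\<in>{K\<in>F. x \<in> W K}. (f x)\<^sup>2)"
      unfolding sum.inter_filter[OF F] g_def by (intro sum.cong) auto
    also have "\<dots> = real (card {K\<in>F. x \<in> W K}) * (f x)\<^sup>2" by simp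
    also have "\<dots> \<le> N * g U x"
    proof (cases "x \<in> U")
      case True
      then show ?thesis using N[OF True] by (simp add: g_def mult_right_mono)
    next
      case False
      then have "{K\<in>F. x \<in> W K} = {}" using W(2) by auto
      then show ?thesis using False by (simp only: g_def) simp
    qed
    finally show "(\<Sum>K\<in>F. g (W K) x) \<le> N * g U x" .
  qed
  also have "\<dots> = N * sqnorm_on U f" using i(2)[OF U order_refl] by simp
  finally show ?thesis .
qed

text \<open>An element with empty interior contains no ball, and its \<open>inradius\<close> is then
  a supremum of the empty set, about which nothing is known. Such elements are disposed of by this
  lemma.\<close>

lemma HN_empty: "HN k {} 0 w"
proof (induction k arbitrary: w)
  case 0
  then show ?case
    using sqint_cong[of "lebesgue_on {}" w "\<lambda>x. 0"] by simp
next
  case (Suc k)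
  have "sqnorm_on {} v = 0" for v :: "plane \<Rightarrow> real"
    using sqint_cong(2)[of "lebesgue_on {}" v "\<lambda>x. 0"] by simp
  then have "strong_grad {} w (\<lambda>i x. 0)"
    unfolding strong_grad_def by (intro allI impI exI[of _ "{}"]) (auto simp: C1_on_def)
  then show ?case
    using sqint_cong[of "lebesgue_on {}" w "\<lambda>x. 0"] Suc by auto
qed

text \<open>The supremum of the radii need not be attained, hence the factor 2. If all radii were at
  most the claimed one, the supremum would be too, and the diameter would be at most half of itself.
  The modulus of \<open>Csh\<close> covers constants of either sign.\<close>

lemma inradius_ball:
  assumes K: "bounded K" "interior K \<noteq> {}" and d: "diameter K \<le> Csh * inradius K" "0 < diameter K"
  obtains z where "ball z (1 / (2 * (\<bar>Csh\<bar> + 1)) * diameter K) \<subseteq> K"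
proof -
  define X where "X = {r. 0 < r \<and> (\<exists>x. ball x r \<subseteq> K)}"
  define t where "t = 1 / (2 * (\<bar>Csh\<bar> + 1)) * diameter K"
  have "\<exists>r\<in>X. t \<le> r"
  proof (rule ccontr)
    assume "\<not> ?thesis"
    then have le: "r \<le> t" if "r \<in> X" for r using that by force
    obtain x r where r: "r > 0" "ball x r \<subseteq> K" using K(2) mem_interior by blast
    then have rX: "r \<in> X" by (auto simp: X_def)
    have "r \<le> Sup X" by (rule cSup_upper[OF rX]) (rule bdd_aboveI[of _ t], rule le)
    then have pos: "0 < Sup X" using r by simp
    have "Sup X \<le> t" using rX le by (intro cSup_least) auto
    have "diameter K \<le> Csh * Sup X" using d(1) by (simp add: inradius_def X_def)
    also have "\<dots> \<le> (\<bar>Csh\<bar> + 1) * t" using pos \<open>Sup X \<le> t\<close> by (intro mult_mono) auto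
    also have "\<dots> = diameter K / 2" unfolding t_def by (simp add: field_simps)
    finally show False using d(2) by simp
  qed
  then obtain r x where "t \<le> r" "ball x r \<subseteq> K" unfolding X_def by auto
  then have "ball x t \<subseteq> K" using subset_ball[of t r x] by auto
  then show ?thesis using that unfolding t_def by blast
qed

text \<open>Each local bound involves the derivatives of \<open>u\<close> on the patch. Since these
  are restrictions of derivatives fixed once on \<open>U\<close>, the local bounds can be summed
  with the overlap count.\<close>

lemma broken_estimate:
  assumes U: "open U" and u: "in_sobolev (Suc m) U u" and k: "k \<le> Suc m"
    and E: "finite E" "\<And>K K'. K \<in> E \<Longrightarrow> K' \<in> E \<Longrightarrow> K \<noteq> K' \<Longrightarrow> interior K \<inter> interior K' = {}"
    and c: "B \<ge> 0" "\<theta> > 0" "q > 0" "h > 0"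
    and est: "\<And>K. K \<in> E \<Longrightarrow> interior K \<noteq> {} \<Longrightarrow> local_estimate m B K (W K) (P K)"
    and WU: "\<And>K. K \<in> E \<Longrightarrow> interior K \<noteq> {} \<Longrightarrow> W K \<subseteq> U"
    and d: "\<And>K. K \<in> E \<Longrightarrow> interior K \<noteq> {} \<Longrightarrow> h \<le> q * diameter K" "\<And>K. K \<in> E \<Longrightarrow> interior K \<noteq> {} \<Longrightarrow> diameter K \<le> h"
    and ball: "\<And>K. K \<in> E \<Longrightarrow> interior K \<noteq> {} \<Longrightarrow> \<exists>z. ball z (\<theta> * diameter K) \<subseteq> K"
    and v: "\<And>K x. K \<in> E \<Longrightarrow> x \<in> interior K \<Longrightarrow> v x = P K u x - u x"
  shows "\<And>K. K \<in> E \<Longrightarrow> in_sobolev k (interior K) v"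
    and "(\<Sum>K\<in>E. (sobolev_seminorm k (interior K) v)\<^sup>2)
      \<le> real (Suc k) * (B * h ^ (2 * (Suc m - k))) * ((B * q / \<theta>)\<^sup>2 * (sobolev_norm (Suc m) U u)\<^sup>2)"
proof -
  obtain D where D: "D 0 0 = u" "\<And>i j. i + j \<le> Suc m \<Longrightarrow> has_weak_deriv U i j u (D i j)"
    "\<And>i j. i + j \<le> Suc m \<Longrightarrow> sqint_on U (D i j)"
    by (rule in_sobolev_derivs[OF U u]) (rule that)
  have J: "jet (Suc m) U D" by (rule weak_derivs_imp_jet[OF U D(2,3)])
  define F where "F = {K\<in>E. interior K \<noteq> {}}"
  \<comment> \<open>All derivatives up to order m + 1 on the patch: it bounds each single one, as
    \<open>HN\<close> requires, and over \<open>U\<close> the same sum is the squared Sobolev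
    norm.\<close>
  define N where "N = (\<lambda>K. \<Sum>n\<le>Suc m. \<Sum>i\<le>n. sqnorm_on (W K) (D i (n - i)))"
  have W: "open (W K)" "W K \<subseteq> U" if "K \<in> F" for K
    using est[of K] WU[of K] that by (auto simp: local_estimate_def F_def)
  have dpos: "0 < diameter K" if "K \<in> F" for K
    using d(1)[of K] that c by (auto simp: F_def) (metis less_le_trans zero_less_mult_pos)
  have HNu: "HN (Suc m) (W K) (N K) u" if K: "K \<in> F" for K
  proof -
    have "sqnorm_on (W K) (D i j) \<le> N K" if ij: "i + j \<le> Suc m" for i j
    proof -
      have "sqnorm_on (W K) (D i j) \<le> (\<Sum>l\<le>i + j. sqnorm_on (W K) (D l (i + j - l)))"
        using member_le_sum[of i "{..i + j}" "\<lambda>l. sqnorm_on (W K) (D l (i + j - l))"] by simp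
      also have "\<dots> \<le> N K" unfolding N_def
        using ij by (intro member_le_sum[of "i + j" "{..Suc m}" "\<lambda>n. \<Sum>l\<le>n. sqnorm_on (W K) (D l (n - l))"]) (auto intro!: sum_nonneg)
      finally show ?thesis .
    qed
    from jet_imp_HN[OF jet_subset[OF J U W[OF K]] this] show ?thesis unfolding D(1) .
  qed
  have HNv: "HN k (interior K) (B * h ^ (2 * (Suc m - k)) * (if interior K = {} then 0 else N K)) v" if K: "K \<in> E" for K
  proof (cases "interior K = {}")
    case True
    then show ?thesis using HN_empty by simp
  next
    case False
    then have KF: "K \<in> F" using K by (simp add: F_def)
    have "HN k (interior K) (B * diameter K ^ (2 * (Suc m - k)) * N K) (\<lambda>x. P K u x - u x)"
      using est[OF K False] HNu[OF KF] k unfolding local_estimate_def by (elim conjE allE impE) (intro conjI)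
    moreover have "B * diameter K ^ (2 * (Suc m - k)) * N K \<le> B * h ^ (2 * (Suc m - k)) * N K"
      using c d(2)[OF K False] dpos[OF KF] HN_nonneg[OF HNu[OF KF]]
      by (intro mult_right_mono mult_left_mono power_mono) auto
    ultimately have "HN k (interior K) (B * h ^ (2 * (Suc m - k)) * N K) (\<lambda>x. P K u x - u x)" by (rule HN_mono)
    then have "HN k (interior K) (B * h ^ (2 * (Suc m - k)) * N K) v" by (rule HN_cong) (rule v[OF K, symmetric])
    then show ?thesis using False by simp
  qed
  show "in_sobolev k (interior K) v" if "K \<in> E" for K
    by (rule HN_imp_in_sobolev[OF open_interior HNv[OF that]])
  have card: "real (card {K\<in>F. x \<in> W K}) \<le> (B * q / \<theta>)\<^sup>2" for x
  proof -
    \<comment> \<open>Elements whose patch contains \<open>x\<close> lie within distance B h of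
      \<open>x\<close>, and each contains a ball of radius \<theta> h / q by
      quasi-uniformity.\<close>
    have "real (card {K\<in>F. x \<in> W K}) \<le> (B * h / (\<theta> * h / q))\<^sup>2"
    proof (rule overlap_count)
      show "finite {K\<in>F. x \<in> W K}" using E(1) by (simp add: F_def)
      show "interior K \<inter> interior K' = {}" if "K \<in> {K\<in>F. x \<in> W K}" "K' \<in> {K\<in>F. x \<in> W K}" "K \<noteq> K'" for K K'
        using E(2)[of K K'] that by (simp add: F_def)
      show "\<exists>z. ball z (\<theta> * h / q) \<subseteq> K" if "K \<in> {K\<in>F. x \<in> W K}" for K
      proof -
        have K: "K \<in> E" "interior K \<noteq> {}" using that by (auto simp: F_def)
        from ball[OF K] obtain z where z: "ball z (\<theta> * diameter K) \<subseteq> K" by (rule exE)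
        have "\<theta> * h / q \<le> \<theta> * diameter K" using d(1)[OF K] c by (simp add: field_simps)
        from subset_ball[OF this, of z] z have "ball z (\<theta> * h / q) \<subseteq> K" by (rule order_trans)
        then show ?thesis by (rule exI)
      qed
      show "dist x y \<le> B * h" if K: "K \<in> {K\<in>F. x \<in> W K}" and y: "y \<in> K" for K y
      proof -
        have K': "K \<in> E" "interior K \<noteq> {}" "x \<in> W K" using K by (auto simp: F_def)
        have "dist x y \<le> B * diameter K" using est[OF K'(1,2)] K'(3) y unfolding local_estimate_def by simp
        also have "\<dots> \<le> B * h" using d(2)[OF K'(1,2)] c by (intro mult_left_mono)
        finally show ?thesis .
      qed
    qed (use c in auto)
    also have "B * h / (\<theta> * h / q) = B * q / \<theta>" using c by (simp add: field_simps)
    finally show ?thesis .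
  qed
  have "(\<Sum>K\<in>E. (sobolev_seminorm k (interior K) v)\<^sup>2)
      \<le> (\<Sum>K\<in>E. real (Suc k) * (B * h ^ (2 * (Suc m - k)) * (if interior K = {} then 0 else N K)))"
    by (rule sum_mono) (rule HN_imp_sobolev_seminorm[OF open_interior HNv])
  also have "\<dots> = real (Suc k) * (B * h ^ (2 * (Suc m - k))) * (\<Sum>K\<in>E. if interior K = {} then 0 else N K)"
    by (simp only: sum_distrib_left mult.assoc)
  also have "(\<Sum>K\<in>E. if interior K = {} then 0 else N K) = (\<Sum>K\<in>F. N K)"
    unfolding F_def sum.inter_filter[OF E(1)] by (rule sum.cong) auto
  also have "(\<Sum>K\<in>F. N K) = (\<Sum>n\<le>Suc m. \<Sum>i\<le>n. \<Sum>K\<in>F. sqnorm_on (W K) (D i (n - i)))"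
    unfolding N_def by (subst sum.swap) (intro sum.cong[OF refl] sum.swap)
  also have "\<dots> \<le> (\<Sum>n\<le>Suc m. \<Sum>i\<le>n. (B * q / \<theta>)\<^sup>2 * sqnorm_on U (D i (n - i)))"
  proof (intro sum_mono sum_sqnorm_overlap)
    show "finite F" using E(1) by (simp add: F_def)
    show "W K \<in> sets lebesgue" if "K \<in> F" for K using W[OF that] by simp
    show "sqint_on U (D i (n - i))" if "n \<in> {..Suc m}" "i \<in> {..n}" for n i using D(3)[of i "n - i"] that by simp
  qed (use W card U in auto)
  also have "\<dots> = (B * q / \<theta>)\<^sup>2 * (sobolev_norm (Suc m) U u)\<^sup>2"
  proof -
    have "(sobolev_norm (Suc m) U u)\<^sup>2 = (\<Sum>n\<le>Suc m. \<Sum>i\<le>n. sqnorm_on U (D i (n - i)))"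
      by (rule sobolev_norm_derivs[OF U]) (use D(2,3) in auto)
    then show ?thesis by (simp only: sum_distrib_left)
  qed
  finally show "(\<Sum>K\<in>E. (sobolev_seminorm k (interior K) v)\<^sup>2)
      \<le> real (Suc k) * (B * h ^ (2 * (Suc m - k))) * ((B * q / \<theta>)\<^sup>2 * (sobolev_norm (Suc m) U u)\<^sup>2)"
    using c by (simp add: mult_left_mono)
qed

lemma Pi_h_eq_Pi_elem:
  assumes "\<forall>K\<in>elements M. \<forall>K'\<in>elements M. K \<noteq> K' \<longrightarrow> interior K \<inter> interior K' = {}"
    and K: "K \<in> elements M" "x \<in> interior K"
  shows "Pi_h m M u x = Pi_elem m M K u x"
proof -
  have "(THE K. K \<in> elements M \<and> x \<in> interior K) = K"
    using assms by (intro the_equality) auto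
  then show ?thesis unfolding Pi_h_def using K by auto
qed

section \<open>Assembly of the global estimate\<close>

theorem theorem3p1:
  fixes G :: geometry and m :: nat and \<epsilon> Csh Cqu :: real
  assumes "m \<ge> 1"
    and "admissible_geometry G"
    and "curve_class (m + 2) (bdry G)"
    and "curve_class (m + 2) (iface G)"
    and "0 < \<epsilon>" and "\<epsilon> \<le> eps0 G"
  shows "\<exists>h_star>0. \<forall>h0 H T. h0 \<le> h_star \<and> quasi_uniform_family G \<epsilon> Csh Cqu h0 H T \<longrightarrow>
    (\<exists>C. \<forall>h\<in>H. \<forall>k\<le>m + 1. \<forall>u. in_sobolev (m + 1) (Omega G) u \<longrightarrow>
       (\<forall>K\<in>elements (T h). in_sobolev k (interior K) (\<lambda>x. Pi_h m (T h) u x - u x)) \<and>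
       broken_seminorm k (T h) (\<lambda>x. Pi_h m (T h) u x - u x)
         \<le> C * h ^ (m + 1 - k) * sobolev_norm (m + 1) (Omega G) u)"
proof -
  have Om: "open (Omega G)" "bounded (Omega G)" "Omega G \<noteq> {}" "frontier (Omega G) = trace_of (bdry G)"
    and sub: "Omega_minus G \<subseteq> Omega G" "Omega_plus G \<subseteq> Omega G"
    and curves: "regular_closed_curve (bdry G)" "regular_closed_curve (iface G)"
      "frenet_regular (bdry G) \<epsilon>" "frenet_regular (iface G) \<epsilon>"
    using assms(2,5,6) unfolding admissible_geometry_def by auto
  have int: "interior (closure (Omega G)) = Omega G"
    by (rule frenet_chart_exists[OF curves(1) assms(3) curves(3) assms(5,1)]) (rule frenet_chart.interior_closure_eq[OF _ Om])
  \<comment> \<open>The ratio of a contained ball's radius to the diameter that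
    \<open>inradius_ball\<close> provides.\<close>
  define \<theta> where "\<theta> = 1 / (2 * (\<bar>Csh\<bar> + 1))"
  have \<theta>: "0 < \<theta>" "\<theta> \<le> 1" unfolding \<theta>_def using abs_ge_zero[of Csh] by (simp_all add: divide_le_eq_1_pos add_nonneg_pos del: abs_ge_zero)
  obtain Bs where Bs: "Bs \<ge> 0" "\<And>K x\<^sub>0. convex K \<Longrightarrow> compact K \<Longrightarrow> 0 < diameter K \<Longrightarrow> diameter K \<le> 1 \<Longrightarrow> ball x\<^sub>0 (\<theta> * diameter K) \<subseteq> K \<Longrightarrow>
     local_estimate m Bs K (interior K) (L2_projection m K)"
    by (rule straight_local_estimate[OF \<theta>, where m=m]) (rule that)
  obtain hb Bb where b: "hb > 0" "Bb \<ge> 0" "curved_estimate_below m \<epsilon> \<theta> (bdry G) hb Bb"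
    by (rule curved_local_estimate[OF curves(1) assms(3) curves(3) assms(5,1) \<theta>(1)]) (rule that)
  obtain hi Bi where i: "hi > 0" "Bi \<ge> 0" "curved_estimate_below m \<epsilon> \<theta> (iface G) hi Bi"
    by (rule curved_local_estimate[OF curves(2) assms(4) curves(4) assms(5,1) \<theta>(1)]) (rule that)
  \<comment> \<open>It depends on the two curves, \<open>m\<close>, \<epsilon> and
    \<open>Csh\<close> only, so it precedes the mesh family.\<close>
  define h_star where "h_star = min 1 (min hb hi)"
  have hs: "0 < h_star" "h_star \<le> 1" "h_star \<le> hb" "h_star \<le> hi" using b i by (auto simp: h_star_def)
  define B where "B = Bs + Bb + Bi"
  have B: "B \<ge> 0" "Bs \<le> B" "Bb \<le> B" "Bi \<le> B" using Bs(1) b i by (auto simp: B_def)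
  define q where "q = \<bar>Cqu\<bar> + 1"
  have q: "q > 0" "Cqu \<le> q" by (auto simp: q_def)
  \<comment> \<open>The root of the constant in the summed estimate, with m + 2 in place of k + 1,
    so that one constant serves all orders \<open>k\<close>.\<close>
  define C where "C = sqrt (real (m + 2) * B) * (B * q / \<theta>)"
  have C0: "C \<ge> 0" using B q \<theta> by (simp add: C_def)
  show ?thesis
  proof (rule exI[of _ h_star], rule conjI[OF hs(1)], intro allI impI, rule exI[of _ C], intro ballI allI impI)
    fix h0 H T h k u
    assume fam: "h0 \<le> h_star \<and> quasi_uniform_family G \<epsilon> Csh Cqu h0 H T" and h: "h \<in> H" and k: "k \<le> m + 1"
      and u: "in_sobolev (m + 1) (Omega G) u"
    define M where "M = T h"
    have hpos: "0 < h" "h \<le> h_star" and mesh: "fitted_mesh G \<epsilon> M" "mesh_size M = h"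
      and shape: "\<And>K. K \<in> elements M \<Longrightarrow> diameter K \<le> Csh * inradius K"
      and quasi: "\<And>K. K \<in> elements M \<Longrightarrow> h \<le> Cqu * diameter K"
      using fam h unfolding quasi_uniform_family_def M_def by auto
    have fin: "finite (tris M)" and simp2: "\<And>K. K \<in> tris M \<Longrightarrow> 2 simplex K"
      and bij: "bij_betw (base_tri M) (curved M) (tris M - straight M)"
      and cover: "\<Union>(elements M) = closure (Omega G)"
      and disj: "\<forall>K\<in>elements M. \<forall>K'\<in>elements M. K \<noteq> K' \<longrightarrow> interior K \<inter> interior K' = {}"
      using mesh(1) unfolding fitted_mesh_def triangulation_def by (elim conjE, simp_all)+
    have curved: "assoc M K \<in> {bdry G, iface G}" "\<exists>E\<in>des M. curved_triangle (assoc M K) (base_tri M K) E K"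
      "frenet_branch (assoc M K) \<epsilon> K (branch M K)" "side M K \<in> {1, -1}" "K \<subseteq> half_fict M K"
      "\<exists>D\<in>{Omega_minus G, Omega_plus G}. half_fict M K \<subseteq> closure D" if "K \<in> curved M" for K
      using mesh(1) that unfolding fitted_mesh_def by (elim conjE, simp_all)+
    have "finite (curved M)" using bij_betw_finite[OF bij] fin by simp
    then have finE: "finite (elements M)" using fin by (simp add: elements_def straight_def)
    have dle: "diameter K \<le> h" if "K \<in> elements M" for K
      using mesh(2) finE that unfolding mesh_size_def by (auto intro: Max_ge)
    have compact: "compact K" if K: "K \<in> elements M" for K
    proof (cases "K \<in> curved M")
      case True
      from curved(2)[OF True] obtain E where E: "curved_triangle (assoc M K) (base_tri M K) E K" by (rule bexE)
      have "regular_closed_curve (assoc M K)" using curved(1)[OF True] curves by auto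
      from curved_triangle_connected(1)[OF this E] show ?thesis .
    next
      case False
      then have "K \<in> tris M" using K by (auto simp: elements_def straight_def)
      then show ?thesis by (intro compact_simplex[OF simp2])
    qed
    have dpos: "0 < diameter K" "h \<le> q * diameter K" if K: "K \<in> elements M" for K
    proof -
      have nn: "0 \<le> diameter K" by (rule diameter_ge_0[OF compact_imp_bounded[OF compact[OF K]]])
      show "h \<le> q * diameter K" using quasi[OF K] mult_right_mono[OF q(2) nn] by simp
      then have "0 < q * diameter K" using hpos by simp
      then show "0 < diameter K" using q by (simp add: zero_less_mult_iff)
    qed
    have ball: "\<exists>z. ball z (\<theta> * diameter K) \<subseteq> K" if K: "K \<in> elements M" "interior K \<noteq> {}" for K
      unfolding \<theta>_def
      by (rule inradius_ball[OF compact_imp_bounded[OF compact[OF K(1)]] K(2) shape[OF K(1)] dpos(1)[OF K(1)]]) (rule exI)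
    define W where "W = (\<lambda>K. if K \<in> curved M then frenet (assoc M K) ` interior (half_rect M K) else interior K)"
    have rect: "half_rect M K = fict_rect (diameter K) (INF x\<in>K. branch M K x $ 2) (SUP x\<in>K. branch M K x $ 2) (side M K)" for K
      by (simp add: half_rect_def fict_rect_def xi_min_def xi_max_def)
    have est: "local_estimate m B K (W K) (Pi_elem m M K)" if K: "K \<in> elements M" "interior K \<noteq> {}" for K
    proof -
      from ball[OF K] obtain z where z: "ball z (\<theta> * diameter K) \<subseteq> K" by (rule exE)
      show ?thesis
      proof (cases "K \<in> curved M")
        case True
        have P: "Pi_elem m M K = (\<lambda>u x. L2_projection m (half_rect M K) (u \<circ> frenet (assoc M K)) (branch M K x))"
          using True by (simp add: Pi_elem_def fun_eq_iff)
        from curved(2)[OF True] obtain E where E: "curved_triangle (assoc M K) (base_tri M K) E K" by (rule bexE)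
        have reg: "regular_closed_curve (assoc M K)" using curved(1)[OF True] curves by auto
        have loc: "local_estimate m B' K (W K) (Pi_elem m M K)" if "curved_estimate_below m \<epsilon> \<theta> (assoc M K) h' B'" "h_star \<le> h'" for h' B'
          using that(1)[unfolded curved_estimate_below_def, rule_format, of K "branch M K" "side M K" "half_rect M K" z] that(2) True
            compact[OF K(1)] curved_triangle_connected(2)[OF reg E] dpos[OF K(1)] dle[OF K(1)] hpos curved(3,4,5)[OF True] z
          unfolding P W_def half_fict_def by (simp add: rect[symmetric])
        consider "assoc M K = bdry G" | "assoc M K = iface G" using curved(1)[OF True] by auto
        then show ?thesis
        proof cases
          case 1
          show ?thesis
            by (rule local_estimate_mono[OF loc[of hb Bb] B(3) less_imp_le[OF dpos(1)[OF K(1)]]]) (use 1 b hs in auto)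
        next
          case 2
          show ?thesis
            by (rule local_estimate_mono[OF loc[of hi Bi] B(4) less_imp_le[OF dpos(1)[OF K(1)]]]) (use 2 i hs in auto)
        qed
      next
        case False
        then have "K \<in> tris M" using K by (auto simp: elements_def straight_def)
        then have "convex K" by (intro convex_simplex[OF simp2])
        from Bs(2)[OF this compact[OF K(1)] dpos(1)[OF K(1)] _ z] have "local_estimate m Bs K (interior K) (L2_projection m K)"
          using dle[OF K(1)] hpos hs by simp
        moreover have "Pi_elem m M K = L2_projection m K" using False by (simp add: Pi_elem_def fun_eq_iff)
        ultimately show ?thesis
          using local_estimate_mono[OF _ B(2) less_imp_le[OF dpos(1)[OF K(1)]]] False by (simp add: W_def)
      qed
    qed
    have WU: "W K \<subseteq> Omega G" if K: "K \<in> elements M" "interior K \<noteq> {}" for K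
    proof -
      have "W K \<subseteq> closure (Omega G)"
      proof (cases "K \<in> curved M")
        case True
        have "W K \<subseteq> half_fict M K" using True interior_subset by (auto simp: W_def half_fict_def)
        also from curved(6)[OF True] have "half_fict M K \<subseteq> closure (Omega G)"
          using closure_mono[OF sub(1)] closure_mono[OF sub(2)] by auto
        finally show ?thesis .
      next
        case False
        then show ?thesis using interior_subset[of K] cover K(1) by (auto simp: W_def)
      qed
      \<comment> \<open>The patch is open and contained in the closure of the domain, hence in the
        interior of that closure, which is the domain by \<open>int\<close>.\<close>
      then show ?thesis using est[OF K] interior_maximal[of "W K" "closure (Omega G)"] unfolding int local_estimate_def by simp
    qed
    have k': "k \<le> Suc m" and u': "in_sobolev (Suc m) (Omega G) u" using k u by simp_all
    define v where "v = (\<lambda>x. Pi_h m M u x - u x)"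
    have v: "v x = Pi_elem m M K u x - u x" if "K \<in> elements M" "x \<in> interior K" for K x
      using Pi_h_eq_Pi_elem[OF disj that] by (simp add: v_def)
    have disj': "interior K \<inter> interior K' = {}" if "K \<in> elements M" "K' \<in> elements M" "K \<noteq> K'" for K K'
      using disj that by auto
    have sob: "in_sobolev k (interior K) v" if "K \<in> elements M" for K
      by (rule broken_estimate(1)[OF Om(1) u' k' finE disj' B(1) \<theta>(1) q(1) hpos(1) est WU dpos(2) dle ball v that])
    have "(\<Sum>K\<in>elements M. (sobolev_seminorm k (interior K) v)\<^sup>2)
      \<le> real (Suc k) * (B * h ^ (2 * (Suc m - k))) * ((B * q / \<theta>)\<^sup>2 * (sobolev_norm (Suc m) (Omega G) u)\<^sup>2)"
      by (rule broken_estimate(2)[OF Om(1) u' k' finE disj' B(1) \<theta>(1) q(1) hpos(1) est WU dpos(2) dle ball v])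
    also have "\<dots> \<le> real (m + 2) * (B * h ^ (2 * (Suc m - k))) * ((B * q / \<theta>)\<^sup>2 * (sobolev_norm (Suc m) (Omega G) u)\<^sup>2)"
      using k B(1) hpos by (intro mult_right_mono) auto
    also have "\<dots> = (C * h ^ (Suc m - k) * sobolev_norm (Suc m) (Omega G) u)\<^sup>2"
    proof -
      have "(sqrt (real (m + 2) * B))\<^sup>2 = real (m + 2) * B" using B(1) by simp
      then have "C\<^sup>2 = real (m + 2) * B * (B * q / \<theta>)\<^sup>2" unfolding C_def by (simp only: power_mult_distrib)
      then show ?thesis by (simp only: power_mult_distrib power_even_eq mult_ac)
    qed
    finally have "broken_seminorm k M v \<le> sqrt ((C * h ^ (Suc m - k) * sobolev_norm (Suc m) (Omega G) u)\<^sup>2)"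
      unfolding broken_seminorm_def by (rule real_sqrt_le_mono)
    moreover have "0 \<le> sobolev_norm (Suc m) (Omega G) u" by (simp add: sobolev_norm_def sum_nonneg)
    ultimately have "broken_seminorm k M v \<le> C * h ^ (Suc m - k) * sobolev_norm (Suc m) (Omega G) u"
      using C0 hpos by simp
    then show "(\<forall>K\<in>elements (T h). in_sobolev k (interior K) (\<lambda>x. Pi_h m (T h) u x - u x)) \<and>
       broken_seminorm k (T h) (\<lambda>x. Pi_h m (T h) u x - u x) \<le> C * h ^ (m + 1 - k) * sobolev_norm (m + 1) (Omega G) u"
      using sob by (simp add: v_def M_def)
  qed
qed

end
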